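(* In the setting described in the context, if the zeroth order term $J$ of the quantum moment map $\boldsymbol J'$ is a moment map satisfying the generating and the complete intersection hypothesis, then the opposite of the BRST cohomology algebra $\mathrm H^\bullet\mathscr A((\nu))$ is isomorphic to $\operatorname{Ext}^\bullet_{\mathcal C^\infty(M)((\nu))}(\mathcal B,\mathcal B)$ with the composition product, where $\mathcal B$ is the left $\mathcal C^\infty(M)((\nu))$-module obtained by dividing out of $\mathcal C^\infty(M)((\nu))$ the left ideal generated by $\boldsymbol J'_1,\dots,\boldsymbol J'_\ell$.
   Context: $\mathbb K=\mathbb R$ or $\mathbb C$; $((\nu))$ denotes formal Laurent series. $M$ is a symplectic manifold with a Hamiltonian action of a compact connected Lie group $G$ with Lie algebra $\mathfrak g$ and moment map $J:M\to\mathfrak g^*$; $e_1,\dots,e_\ell$ a basis of $\mathfrak g$, structure constants $f_{ab}^c$, $J_a=\langle J,e_a\rangle$, $\{J_a,J_b\}=\sum_cf_{ab}^cJ_c$. With $Z=J^{-1}(0)$: the generating hypothesis says that $J_1,\dots,J_\ell$ generate the ideal of smooth functions vanishing on $Z$; the complete intersection hypothesis says that the Koszul complex $\mathcal C^\infty(M)\otimes\wedge^\bullet\mathfrak g$ with $\mathcal C^\infty(M)$-linear superderivation $e_a\mapsto J_a$ has vanishing homology in positive degrees. $\star$ is a star product on $M$ (associative $\mathbb K[[\nu]]$-bilinear product $f\star g=fg+\sum_{i\ge1}\nu^i\mu_i(f,g)$ with unit $1$, bidifferential $\mu_i$, $\mu_1(f,g)-\mu_1(g,f)=\{f,g\}$);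 $\mathcal C^\infty(M)((\nu))$ is regarded as the associative algebra with product $\star$. $\boldsymbol J=J+O(\nu):\mathfrak g\to\mathcal C^\infty(M)[[\nu]]$ is a quantum moment map: linear with $[\boldsymbol J(X),\boldsymbol J(Y)]_\star=\nu\boldsymbol J([X,Y])$. Put $\boldsymbol J'_a=\boldsymbol J_a+\frac\nu2\sum_bf_{ab}^b$, which is again a quantum moment map. BRST algebra: $\mathscr A=\mathcal C^\infty(M)\otimes\wedge(\mathfrak g^*\oplus\mathfrak g)$, generated over $\mathcal C^\infty(M)$ by ghosts $\xi^a$ (degree $1$, dual basis of $\mathfrak g^*$) and antighosts $\xi_a$ (degree $-1$, basis of $\mathfrak g$), with product on $\mathscr A((\nu))$ given by $(fv)*(gw)=(f\star g)(v\cdot w)$, $v\cdot w=\mu\big(\exp(-2\nu\sum_a\frac{\partial}{\partial\xi_a}\otimes\frac{\partial}{\partial\xi^a})(v\otimes w)\big)$, $\mu$ the supercommutative product, $\otimes$ graded, left derivatives. With $\boldsymbol\theta=-\frac14\sum f_{ab}^c\xi^a\xi^b\xi_c+\sum_a\boldsymbol J'_a\xi^a$, the differential is $\boldsymbol D=\frac1\nu[\boldsymbol\theta,\cdot]_*$ (graded commutator); $\mathrm H^\bullet\mathscr A((\nu))$ is the cohomology algebra of the differential graded algebra $(\mathscr A((\nu)),*,\boldsymbol D)$. The opposite of a graded algebra has product $a\cdot_{\mathrm{opp}}b=(-1)^{|a||b|}b\cdot a$. *)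

theory Defs
  imports
    "HOL-Analysis.Analysis"
    "HOL-Algebra.AbelCoset"
    "HOL-Algebra.Group_Action"
    "HOL-Algebra.Ideal"
    "HOL-Algebra.Module"
    "HOL-Computational_Algebra.Formal_Laurent_Series"
    "HOL-Library.Function_Algebras"
begin

section \<open>Smooth manifolds\<close>

text \<open>
  Functions carry the pointwise operations of Function_Algebras throughout.
\<close>

text \<open>\<open>C^k\<close> maps on an open subset of a finite-dimensional normed space.\<close>

primrec Ck_on :: "nat \<Rightarrow> 'e::real_normed_vector set \<Rightarrow> ('e \<Rightarrow> 'b::real_normed_vector) \<Rightarrow> bool" where
  "Ck_on 0 S f = continuous_on S f"
| "Ck_on (Suc k) S f =
     ((\<forall>x\<in>S. f differentiable (at x)) \<and>
      (\<forall>v. Ck_on k S (\<lambda>x. frechet_derivative f (at x) v)))"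

definition smooth_on :: "'e::real_normed_vector set \<Rightarrow> ('e \<Rightarrow> 'b::real_normed_vector) \<Rightarrow> bool" where
  "smooth_on S f \<longleftrightarrow> (\<forall>k. Ck_on k S f)"

type_synonym ('m, 'e) atlas = "('m set \<times> ('m \<Rightarrow> 'e)) set"

text \<open>
  The manifold is the whole type \<open>'m\<close>; the class constraints are the Hausdorff property and
  second countability. The model space \<open>'e\<close> is an arbitrary finite-dimensional real vector space
  rather than a \<open>euclidean_space\<close>, because the latter class excludes dimension 0.
\<close>

definition smooth_manifold ::
  "('m::{second_countable_topology,t2_space}, 'e::real_normed_vector) atlas \<Rightarrow> bool" where
  "smooth_manifold \<A> \<longleftrightarrow>
     (\<exists>B. finite B \<and> span B = (UNIV :: 'e set)) \<and>
     (\<Union>(fst ` \<A>) = UNIV) \<and>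
     (\<forall>(U, \<phi>)\<in>\<A>. open U \<and> open (\<phi> ` U) \<and> homeomorphism U (\<phi> ` U) \<phi> (inv_into U \<phi>)) \<and>
     (\<forall>(U, \<phi>)\<in>\<A>. \<forall>(V, \<psi>)\<in>\<A>. smooth_on (\<phi> ` (U \<inter> V)) (\<psi> \<circ> inv_into U \<phi>))"

definition Cinf ::
  "('m, 'e::real_normed_vector) atlas \<Rightarrow> ('m \<Rightarrow> 'b::real_normed_vector) set" where
  "Cinf \<A> = {f. \<forall>(U, \<phi>)\<in>\<A>. smooth_on (\<phi> ` U) (f \<circ> inv_into U \<phi>)}"

definition smooth_map ::
  "('m::topological_space, 'e::real_normed_vector) atlas \<Rightarrow>
   ('n::topological_space, 'f::real_normed_vector) atlas \<Rightarrow> ('m \<Rightarrow> 'n) \<Rightarrow> bool" where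
  "smooth_map \<A> \<B> F \<longleftrightarrow> continuous_on UNIV F \<and>
     (\<forall>(U, \<phi>)\<in>\<A>. \<forall>(V, \<psi>)\<in>\<B>.
        smooth_on (\<phi> ` (U \<inter> F -` V)) (\<psi> \<circ> F \<circ> inv_into U \<phi>))"

definition prod_atlas :: "('m, 'e) atlas \<Rightarrow> ('n, 'f) atlas \<Rightarrow> ('m \<times> 'n, 'e \<times> 'f) atlas" where
  "prod_atlas \<A> \<B> = {(U \<times> V, map_prod \<phi> \<psi>) |U \<phi> V \<psi>. (U, \<phi>) \<in> \<A> \<and> (V, \<psi>) \<in> \<B>}"

text \<open>
  Tangent vectors at a point are the derivations of the real smooth functions at that point, and
  vector fields are the derivations of the algebra of real smooth functions. They are
  totalised by the value 0 on nonsmooth arguments.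
\<close>

type_synonym 'm tangent = "('m \<Rightarrow> real) \<Rightarrow> real"
type_synonym 'm vfield = "('m \<Rightarrow> real) \<Rightarrow> ('m \<Rightarrow> real)"

definition tangent_space :: "('m, 'e::real_normed_vector) atlas \<Rightarrow> 'm \<Rightarrow> 'm tangent set" where
  "tangent_space \<A> p = {v.
     (\<forall>f. f \<notin> Cinf \<A> \<longrightarrow> v f = 0) \<and>
     (\<forall>f\<in>Cinf \<A>. \<forall>g\<in>Cinf \<A>. \<forall>r s. v (\<lambda>x. r * f x + s * g x) = r * v f + s * v g) \<and>
     (\<forall>f\<in>Cinf \<A>. \<forall>g\<in>Cinf \<A>. v (f * g) = v f * g p + f p * v g)}"

definition vector_fields :: "('m, 'e::real_normed_vector) atlas \<Rightarrow> 'm vfield set" where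
  "vector_fields \<A> = {X.
     (\<forall>f. f \<notin> Cinf \<A> \<longrightarrow> X f = 0) \<and>
     (\<forall>f\<in>Cinf \<A>. X f \<in> Cinf \<A>) \<and>
     (\<forall>f\<in>Cinf \<A>. \<forall>g\<in>Cinf \<A>. \<forall>r s.
        X (\<lambda>x. r * f x + s * g x) = (\<lambda>x. r * X f x + s * X g x)) \<and>
     (\<forall>f\<in>Cinf \<A>. \<forall>g\<in>Cinf \<A>. X (f * g) = X f * g + f * X g)}"

definition vf_at :: "'m vfield \<Rightarrow> 'm \<Rightarrow> 'm tangent" where
  "vf_at X p = (\<lambda>f. X f p)"

definition vf_bracket :: "'m vfield \<Rightarrow> 'm vfield \<Rightarrow> 'm vfield" where
  "vf_bracket X Y = (\<lambda>f. X (Y f) - Y (X f))"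

definition vf_scale :: "real \<Rightarrow> 'm vfield \<Rightarrow> 'm vfield" where
  "vf_scale r X = (\<lambda>f x. r * X f x)"


section \<open>Symplectic manifolds\<close>

definition two_form :: "('m \<Rightarrow> 'm tangent \<Rightarrow> 'm tangent \<Rightarrow> real) \<Rightarrow> 'm vfield \<Rightarrow> 'm vfield \<Rightarrow> 'm \<Rightarrow> real" where
  "two_form \<omega> X Y = (\<lambda>p. \<omega> p (vf_at X p) (vf_at Y p))"

definition symplectic_form ::
  "('m, 'e::real_normed_vector) atlas \<Rightarrow> ('m \<Rightarrow> 'm tangent \<Rightarrow> 'm tangent \<Rightarrow> real) \<Rightarrow> bool" where
  "symplectic_form \<A> \<omega> \<longleftrightarrow>
     (\<forall>p. \<forall>u\<in>tangent_space \<A> p. \<forall>v\<in>tangent_space \<A> p. \<forall>w\<in>tangent_space \<A> p. \<forall>r s.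
        \<omega> p (\<lambda>f. r * u f + s * v f) w = r * \<omega> p u w + s * \<omega> p v w) \<and>
     (\<forall>p. \<forall>u\<in>tangent_space \<A> p. \<forall>v\<in>tangent_space \<A> p. \<omega> p u v = - \<omega> p v u) \<and>
     (\<forall>p. \<forall>u\<in>tangent_space \<A> p. (\<forall>v\<in>tangent_space \<A> p. \<omega> p u v = 0) \<longrightarrow> u = 0) \<and>
     (\<forall>X\<in>vector_fields \<A>. \<forall>Y\<in>vector_fields \<A>. two_form \<omega> X Y \<in> Cinf \<A>) \<and>
     (\<forall>X\<in>vector_fields \<A>. \<forall>Y\<in>vector_fields \<A>. \<forall>Z\<in>vector_fields \<A>.
        X (two_form \<omega> Y Z) - Y (two_form \<omega> X Z) + Z (two_form \<omega> X Y)
        - two_form \<omega> (vf_bracket X Y) Z + two_form \<omega> (vf_bracket X Z) Y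
        - two_form \<omega> (vf_bracket Y Z) X = 0)"

text \<open>The Hamiltonian vector field of \<open>f\<close> is determined by \<open>\<omega>(X\<^sub>f, \<cdot>) = df\<close>.\<close>

definition ham_vf ::
  "('m, 'e::real_normed_vector) atlas \<Rightarrow> ('m \<Rightarrow> 'm tangent \<Rightarrow> 'm tangent \<Rightarrow> real) \<Rightarrow>
   ('m \<Rightarrow> real) \<Rightarrow> 'm vfield" where
  "ham_vf \<A> \<omega> f =
     (THE X. X \<in> vector_fields \<A> \<and> (\<forall>p. \<forall>v\<in>tangent_space \<A> p. \<omega> p (vf_at X p) v = v f))"

definition poisson ::
  "('m, 'e::real_normed_vector) atlas \<Rightarrow> ('m \<Rightarrow> 'm tangent \<Rightarrow> 'm tangent \<Rightarrow> real) \<Rightarrow>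
   ('m \<Rightarrow> real) \<Rightarrow> ('m \<Rightarrow> real) \<Rightarrow> ('m \<Rightarrow> real)" where
  "poisson \<A> \<omega> f g = two_form \<omega> (ham_vf \<A> \<omega> f) (ham_vf \<A> \<omega> g)"

text \<open>
  The ground field \<open>\<real>\<close> or \<open>\<complex>\<close> is a type \<open>'k\<close> of class \<open>real_normed_field\<close> and
  \<open>euclidean_space\<close>; by the Gelfand-Mazur theorem \<open>real\<close> and \<open>complex\<close> are, up to isomorphism,
  the only such types. \<open>poissonK\<close> is the \<open>'k\<close>-bilinear extension of the Poisson bracket,
  computed by expanding \<open>'k\<close>-valued functions in the real basis of \<open>'k\<close>.
\<close>

definition poissonK ::
  "('m, 'e::real_normed_vector) atlas \<Rightarrow> ('m \<Rightarrow> 'm tangent \<Rightarrow> 'm tangent \<Rightarrow> real) \<Rightarrow>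
   ('m \<Rightarrow> 'k::{real_normed_field,euclidean_space}) \<Rightarrow> ('m \<Rightarrow> 'k) \<Rightarrow> ('m \<Rightarrow> 'k)" where
  "poissonK \<A> \<omega> f g =
     (\<lambda>p. \<Sum>b\<in>Basis. \<Sum>c\<in>Basis. poisson \<A> \<omega> (\<lambda>q. f q \<bullet> b) (\<lambda>q. g q \<bullet> c) p *\<^sub>R (b * c))"


section \<open>Hamiltonian Lie group actions\<close>

definition lie_group ::
  "('g::{second_countable_topology,t2_space}, 'e::real_normed_vector) atlas \<Rightarrow> 'g monoid \<Rightarrow> bool" where
  "lie_group \<A> G \<longleftrightarrow> smooth_manifold \<A> \<and> group G \<and> carrier G = UNIV \<and>
     smooth_map (prod_atlas \<A> \<A>) \<A> (\<lambda>(g, h). g \<otimes>\<^bsub>G\<^esub> h) \<and>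
     smooth_map \<A> \<A> (\<lambda>g. inv\<^bsub>G\<^esub> g)"

text \<open>The Lie algebra consists of the left invariant vector fields.\<close>

definition lie_algebra ::
  "('g, 'e::real_normed_vector) atlas \<Rightarrow> 'g monoid \<Rightarrow> 'g vfield set" where
  "lie_algebra \<A> G = {X \<in> vector_fields \<A>.
     \<forall>h. \<forall>f\<in>Cinf \<A>. X (\<lambda>g. f (h \<otimes>\<^bsub>G\<^esub> g)) = (\<lambda>g. X f (h \<otimes>\<^bsub>G\<^esub> g))}"

definition lie_basis ::
  "('g, 'e::real_normed_vector) atlas \<Rightarrow> 'g monoid \<Rightarrow> nat \<Rightarrow> (nat \<Rightarrow> 'g vfield) \<Rightarrow> bool" where
  "lie_basis \<A> G l e \<longleftrightarrow>
     (\<forall>a<l. e a \<in> lie_algebra \<A> G) \<and>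
     (\<forall>X\<in>lie_algebra \<A> G. \<exists>!c. (\<forall>a\<ge>l. c a = 0) \<and> X = (\<Sum>a<l. vf_scale (c a) (e a)))"

definition structure_constants ::
  "nat \<Rightarrow> (nat \<Rightarrow> 'g vfield) \<Rightarrow> (nat \<Rightarrow> nat \<Rightarrow> nat \<Rightarrow> real) \<Rightarrow> bool" where
  "structure_constants l e f \<longleftrightarrow>
     (\<forall>a<l. \<forall>b<l. vf_bracket (e a) (e b) = (\<Sum>c<l. vf_scale (f a b c) (e c)))"

definition smooth_symplectic_action ::
  "('g::{second_countable_topology,t2_space}, 'eg::real_normed_vector) atlas \<Rightarrow> 'g monoid \<Rightarrow>
   ('m::{second_countable_topology,t2_space}, 'e::real_normed_vector) atlas \<Rightarrow>
   ('m \<Rightarrow> 'm tangent \<Rightarrow> 'm tangent \<Rightarrow> real) \<Rightarrow> ('g \<Rightarrow> 'm \<Rightarrow> 'm) \<Rightarrow> bool" where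
  "smooth_symplectic_action \<G> G \<A> \<omega> act \<longleftrightarrow>
     group_action G UNIV act \<and>
     smooth_map (prod_atlas \<G> \<A>) \<A> (\<lambda>(g, p). act g p) \<and>
     (\<forall>g p. \<forall>v\<in>tangent_space \<A> p. \<forall>w\<in>tangent_space \<A> p.
        \<omega> (act g p) (\<lambda>f. v (f \<circ> act g)) (\<lambda>f. w (f \<circ> act g)) = \<omega> p v w)"

text \<open>
  \<open>J p X\<close> is \<open>\<langle>J(p), X\<rangle>\<close>. The second clause says that the Hamiltonian derivation
  \<open>{\<langle>J, X\<rangle>, \<cdot>}\<close> is the infinitesimal action of \<open>X\<close>, i.e. it is
  \<open>f \<mapsto> d/dt f(exp(-tX) p)\<close> at \<open>t = 0\<close>; by the chain rule this is minus the value
  at the unit element of \<open>X\<close> applied to \<open>g \<mapsto> f(g p)\<close>. This sign is the one compatible with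
  the last clause.
\<close>

definition moment_map ::
  "('g::{second_countable_topology,t2_space}, 'eg::real_normed_vector) atlas \<Rightarrow> 'g monoid \<Rightarrow>
   ('m::{second_countable_topology,t2_space}, 'e::real_normed_vector) atlas \<Rightarrow>
   ('m \<Rightarrow> 'm tangent \<Rightarrow> 'm tangent \<Rightarrow> real) \<Rightarrow> ('g \<Rightarrow> 'm \<Rightarrow> 'm) \<Rightarrow>
   ('m \<Rightarrow> 'g vfield \<Rightarrow> real) \<Rightarrow> bool" where
  "moment_map \<G> G \<A> \<omega> act J \<longleftrightarrow>
     (\<forall>p. \<forall>X\<in>lie_algebra \<G> G. \<forall>Y\<in>lie_algebra \<G> G. \<forall>r s.
        J p (vf_scale r X + vf_scale s Y) = r * J p X + s * J p Y) \<and>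
     (\<forall>X\<in>lie_algebra \<G> G. (\<lambda>p. J p X) \<in> Cinf \<A>) \<and>
     (\<forall>X\<in>lie_algebra \<G> G. \<forall>f\<in>Cinf \<A>.
        poisson \<A> \<omega> (\<lambda>p. J p X) f = (\<lambda>p. - X (\<lambda>g. f (act g p)) \<one>\<^bsub>G\<^esub>)) \<and>
     (\<forall>X\<in>lie_algebra \<G> G. \<forall>Y\<in>lie_algebra \<G> G.
        poisson \<A> \<omega> (\<lambda>p. J p X) (\<lambda>p. J p Y) = (\<lambda>p. J p (vf_bracket X Y)))"

definition zero_level ::
  "('g, 'eg::real_normed_vector) atlas \<Rightarrow> 'g monoid \<Rightarrow> ('m \<Rightarrow> 'g vfield \<Rightarrow> real) \<Rightarrow> 'm set" where
  "zero_level \<G> G J = {p. \<forall>X\<in>lie_algebra \<G> G. J p X = 0}"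

definition J_comp ::
  "('m \<Rightarrow> 'g vfield \<Rightarrow> real) \<Rightarrow> (nat \<Rightarrow> 'g vfield) \<Rightarrow> nat \<Rightarrow> 'm \<Rightarrow> 'k::real_normed_field" where
  "J_comp J e a = (\<lambda>p. of_real (J p (e a)))"


section \<open>Exterior algebras\<close>

text \<open>
  An element of the exterior algebra over \<open>'r\<close> on generators indexed by natural numbers is
  the family of its coefficients with respect to the monomials \<open>e\<^sub>S\<close>, the products
  of the generators in \<open>S\<close> in increasing order. \<open>ext_sign S T\<close> is the sign in
  \<open>e\<^sub>S e\<^sub>T = \<plusminus> e\<^bsub>S \<union> T\<^esub>\<close> for disjoint \<open>S\<close>, \<open>T\<close>.
\<close>

definition ext_sign :: "nat set \<Rightarrow> nat set \<Rightarrow> 'r::comm_ring_1" where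
  "ext_sign S T = (-1) ^ card {(s, t). s \<in> S \<and> t \<in> T \<and> t < s}"

definition ext_basis :: "nat set \<Rightarrow> nat set \<Rightarrow> 'r::comm_ring_1" where
  "ext_basis S = (\<lambda>U. if U = S then 1 else 0)"

text \<open>Elements of the tensor square are likewise families of coefficients of \<open>e\<^sub>S \<otimes> e\<^sub>T\<close>;
  \<open>ext_mu\<close> is the multiplication map on the tensor square.\<close>

definition ext_mu :: "(nat set \<Rightarrow> nat set \<Rightarrow> 'r::comm_ring_1) \<Rightarrow> nat set \<Rightarrow> 'r" where
  "ext_mu t = (\<lambda>U. \<Sum>S\<in>Pow U. ext_sign S (U - S) * t S (U - S))"

definition ext_mult :: "(nat set \<Rightarrow> 'r::comm_ring_1) \<Rightarrow> (nat set \<Rightarrow> 'r) \<Rightarrow> nat set \<Rightarrow> 'r" where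
  "ext_mult v w = ext_mu (\<lambda>S T. v S * w T)"

text \<open>Left derivative with respect to the generator \<open>i\<close>:
  \<open>e\<^sub>T \<mapsto> (-1)^(card {s\<in>T. s < i}) e\<^bsub>T - {i}\<^esub>\<close> if \<open>i \<in> T\<close>, and \<open>e\<^sub>T \<mapsto> 0\<close> otherwise.\<close>

definition ext_deriv :: "nat \<Rightarrow> (nat set \<Rightarrow> 'r::comm_ring_1) \<Rightarrow> nat set \<Rightarrow> 'r" where
  "ext_deriv i v = (\<lambda>S. if i \<in> S then 0 else (-1) ^ card {s\<in>S. s < i} * v (insert i S))"

text \<open>The graded tensor product \<open>\<partial>\<^sub>i \<otimes> \<partial>\<^sub>j\<close>, i.e.
  \<open>v \<otimes> w \<mapsto> (-1)^|v| \<partial>\<^sub>i v \<otimes> \<partial>\<^sub>j w\<close>.\<close>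

definition ext_deriv_tensor ::
  "nat \<Rightarrow> nat \<Rightarrow> (nat set \<Rightarrow> nat set \<Rightarrow> 'r::comm_ring_1) \<Rightarrow> nat set \<Rightarrow> nat set \<Rightarrow> 'r" where
  "ext_deriv_tensor i j t =
     (\<lambda>S T. ext_deriv i (\<lambda>S'. (-1) ^ card S' * ext_deriv j (t S') T) S)"


section \<open>The classical Koszul complex and the regularity hypotheses\<close>

definition Cinf_ring ::
  "('m, 'e::real_normed_vector) atlas \<Rightarrow> ('m \<Rightarrow> 'k::real_normed_field) ring" where
  "Cinf_ring \<A> = \<lparr>carrier = Cinf \<A>, mult = (*), one = 1, zero = 0, add = (+)\<rparr>"

definition generating_hypothesis ::
  "('m, 'e::real_normed_vector) atlas \<Rightarrow> nat \<Rightarrow> (nat \<Rightarrow> 'm \<Rightarrow> 'k::real_normed_field) \<Rightarrow> 'm set \<Rightarrow> bool" where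
  "generating_hypothesis \<A> l Jc Z \<longleftrightarrow>
     Idl\<^bsub>Cinf_ring \<A>\<^esub> (Jc ` {..<l}) = {f \<in> Cinf \<A>. \<forall>p\<in>Z. f p = 0}"

definition koszul_chains ::
  "('m, 'e::real_normed_vector) atlas \<Rightarrow> nat \<Rightarrow> nat \<Rightarrow> (nat set \<Rightarrow> 'm \<Rightarrow> 'k::real_normed_field) set" where
  "koszul_chains \<A> l n =
     {x. \<forall>S. x S \<in> Cinf \<A> \<and> (x S \<noteq> 0 \<longrightarrow> S \<subseteq> {..<l} \<and> card S = n)}"

text \<open>The superderivation with \<open>e\<^sub>a \<mapsto> J\<^sub>a\<close>.\<close>

definition koszul_diff ::
  "nat \<Rightarrow> (nat \<Rightarrow> 'm \<Rightarrow> 'k::real_normed_field) \<Rightarrow> (nat set \<Rightarrow> 'm \<Rightarrow> 'k) \<Rightarrow> nat set \<Rightarrow> 'm \<Rightarrow> 'k" where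
  "koszul_diff l Jc x = (\<lambda>S. \<Sum>a<l. Jc a * ext_deriv a x S)"

definition complete_intersection_hypothesis ::
  "('m, 'e::real_normed_vector) atlas \<Rightarrow> nat \<Rightarrow> (nat \<Rightarrow> 'm \<Rightarrow> 'k::real_normed_field) \<Rightarrow> bool" where
  "complete_intersection_hypothesis \<A> l Jc \<longleftrightarrow>
     (\<forall>n>0. \<forall>x\<in>koszul_chains \<A> l n. koszul_diff l Jc x = 0 \<longrightarrow>
        (\<exists>y\<in>koszul_chains \<A> l (n + 1). koszul_diff l Jc y = x))"


section \<open>Star products and quantum moment maps\<close>

definition iter_deriv ::
  "'e::real_normed_vector list \<Rightarrow> ('e \<Rightarrow> 'b::real_normed_vector) \<Rightarrow> ('e \<Rightarrow> 'b)" where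
  "iter_deriv vs f = foldr (\<lambda>v h x. frechet_derivative h (at x) v) vs f"

text \<open>Bidifferential operators: locally, in each chart, finite sums of products of iterated
  directional derivatives of the two arguments with smooth coefficients.\<close>

definition bidifferential ::
  "('m::topological_space, 'e::real_normed_vector) atlas \<Rightarrow>
   (('m \<Rightarrow> 'k::real_normed_field) \<Rightarrow> ('m \<Rightarrow> 'k) \<Rightarrow> ('m \<Rightarrow> 'k)) \<Rightarrow> bool" where
  "bidifferential \<A> D \<longleftrightarrow>
     (\<forall>f\<in>Cinf \<A>. \<forall>g\<in>Cinf \<A>. D f g \<in> Cinf \<A>) \<and>
     (\<forall>(U, \<phi>)\<in>\<A>. \<forall>p\<in>U. \<exists>W L (c :: 'e list \<Rightarrow> 'e list \<Rightarrow> 'e \<Rightarrow> 'k).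
        open W \<and> p \<in> W \<and> W \<subseteq> U \<and> finite L \<and>
        (\<forall>\<alpha> \<beta>. smooth_on (\<phi> ` W) (c \<alpha> \<beta>)) \<and>
        (\<forall>f\<in>Cinf \<A>. \<forall>g\<in>Cinf \<A>. \<forall>q\<in>W.
           D f g q = (\<Sum>\<alpha>\<in>L. \<Sum>\<beta>\<in>L. c \<alpha> \<beta> (\<phi> q) *
             iter_deriv \<alpha> (f \<circ> inv_into U \<phi>) (\<phi> q) * iter_deriv \<beta> (g \<circ> inv_into U \<phi>) (\<phi> q))))"

text \<open>
  \<open>\<mu> i\<close> is the \<open>i\<close>-th cochain, with \<open>\<mu> 0\<close> the pointwise product. The product of Laurent series
  has the \<open>n\<close>-th coefficient \<open>\<Sum>\<^bsub>i+j+k=n\<^esub> \<mu> i (F\<^sub>j) (G\<^sub>k)\<close>.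
\<close>

definition star ::
  "(nat \<Rightarrow> ('m \<Rightarrow> 'k::field) \<Rightarrow> ('m \<Rightarrow> 'k) \<Rightarrow> ('m \<Rightarrow> 'k)) \<Rightarrow>
   ('m \<Rightarrow> 'k) fls \<Rightarrow> ('m \<Rightarrow> 'k) fls \<Rightarrow> ('m \<Rightarrow> 'k) fls" where
  "star \<mu> F G = Abs_fls (\<lambda>n.
     \<Sum>j = fls_subdegree F..n - fls_subdegree G.
       \<Sum>k = fls_subdegree G..n - j. \<mu> (nat (n - j - k)) (fls_nth F j) (fls_nth G k))"

definition Cinf_fps ::
  "('m, 'e::real_normed_vector) atlas \<Rightarrow> ('m \<Rightarrow> 'k::real_normed_field) fps set" where
  "Cinf_fps \<A> = {F. \<forall>n. fps_nth F n \<in> Cinf \<A>}"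

definition Cinf_fls ::
  "('m, 'e::real_normed_vector) atlas \<Rightarrow> ('m \<Rightarrow> 'k::real_normed_field) fls set" where
  "Cinf_fls \<A> = {F. \<forall>n. fls_nth F n \<in> Cinf \<A>}"

definition star_product ::
  "('m::topological_space, 'e::real_normed_vector) atlas \<Rightarrow>
   ('m \<Rightarrow> 'm tangent \<Rightarrow> 'm tangent \<Rightarrow> real) \<Rightarrow>
   (nat \<Rightarrow> ('m \<Rightarrow> 'k::{real_normed_field,euclidean_space}) \<Rightarrow> ('m \<Rightarrow> 'k) \<Rightarrow> ('m \<Rightarrow> 'k)) \<Rightarrow> bool" where
  "star_product \<A> \<omega> \<mu> \<longleftrightarrow>
     (\<forall>f\<in>Cinf \<A>. \<forall>g\<in>Cinf \<A>. \<mu> 0 f g = f * g) \<and>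
     (\<forall>i\<ge>1. bidifferential \<A> (\<mu> i)) \<and>
     (\<forall>i. \<forall>f\<in>Cinf \<A>. \<forall>g\<in>Cinf \<A>. \<forall>h\<in>Cinf \<A>. \<forall>r s.
        \<mu> i (\<lambda>p. r * f p + s * g p) h = (\<lambda>p. r * \<mu> i f h p + s * \<mu> i g h p) \<and>
        \<mu> i h (\<lambda>p. r * f p + s * g p) = (\<lambda>p. r * \<mu> i h f p + s * \<mu> i h g p)) \<and>
     (\<forall>F\<in>Cinf_fps \<A>. \<forall>G\<in>Cinf_fps \<A>. \<forall>H\<in>Cinf_fps \<A>.
        star \<mu> (star \<mu> (fps_to_fls F) (fps_to_fls G)) (fps_to_fls H) =
        star \<mu> (fps_to_fls F) (star \<mu> (fps_to_fls G) (fps_to_fls H))) \<and>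
     (\<forall>F\<in>Cinf_fps \<A>. star \<mu> 1 (fps_to_fls F) = fps_to_fls F \<and>
                     star \<mu> (fps_to_fls F) 1 = fps_to_fls F) \<and>
     (\<forall>f\<in>Cinf \<A>. \<forall>g\<in>Cinf \<A>. \<mu> 1 f g - \<mu> 1 g f = poissonK \<A> \<omega> f g)"

definition real_const :: "real \<Rightarrow> 'm \<Rightarrow> 'k::real_normed_field" where
  "real_const r = (\<lambda>p. of_real r)"

definition quantum_moment_map ::
  "('g, 'eg::real_normed_vector) atlas \<Rightarrow> 'g monoid \<Rightarrow> ('m, 'e::real_normed_vector) atlas \<Rightarrow>
   (nat \<Rightarrow> ('m \<Rightarrow> 'k::real_normed_field) \<Rightarrow> ('m \<Rightarrow> 'k) \<Rightarrow> ('m \<Rightarrow> 'k)) \<Rightarrow>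
   ('m \<Rightarrow> 'g vfield \<Rightarrow> real) \<Rightarrow> ('g vfield \<Rightarrow> ('m \<Rightarrow> 'k) fps) \<Rightarrow> bool" where
  "quantum_moment_map \<G> G \<A> \<mu> J \<J> \<longleftrightarrow>
     (\<forall>X\<in>lie_algebra \<G> G. \<J> X \<in> Cinf_fps \<A>) \<and>
     (\<forall>X\<in>lie_algebra \<G> G. \<forall>Y\<in>lie_algebra \<G> G. \<forall>r s.
        \<J> (vf_scale r X + vf_scale s Y) =
          fps_const (real_const r) * \<J> X + fps_const (real_const s) * \<J> Y) \<and>
     (\<forall>X\<in>lie_algebra \<G> G. fps_nth (\<J> X) 0 = (\<lambda>p. of_real (J p X))) \<and>
     (\<forall>X\<in>lie_algebra \<G> G. \<forall>Y\<in>lie_algebra \<G> G.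
        star \<mu> (fps_to_fls (\<J> X)) (fps_to_fls (\<J> Y)) - star \<mu> (fps_to_fls (\<J> Y)) (fps_to_fls (\<J> X))
          = fls_X * fps_to_fls (\<J> (vf_bracket X Y)))"

definition J_shifted ::
  "nat \<Rightarrow> (nat \<Rightarrow> 'g vfield) \<Rightarrow> (nat \<Rightarrow> nat \<Rightarrow> nat \<Rightarrow> real) \<Rightarrow>
   ('g vfield \<Rightarrow> ('m \<Rightarrow> 'k::real_normed_field) fps) \<Rightarrow> nat \<Rightarrow> ('m \<Rightarrow> 'k) fls" where
  "J_shifted l e f \<J> a =
     fps_to_fls (\<J> (e a)) + fls_X * fls_const (real_const ((\<Sum>b<l. f a b b) / 2))"

definition star_ring ::
  "('m, 'e::real_normed_vector) atlas \<Rightarrow>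
   (nat \<Rightarrow> ('m \<Rightarrow> 'k::real_normed_field) \<Rightarrow> ('m \<Rightarrow> 'k) \<Rightarrow> ('m \<Rightarrow> 'k)) \<Rightarrow> ('m \<Rightarrow> 'k) fls ring" where
  "star_ring \<A> \<mu> = \<lparr>carrier = Cinf_fls \<A>, mult = star \<mu>, one = 1, zero = 0, add = (+)\<rparr>"

text \<open>The embedding of \<open>'k((\<nu>))\<close> into the series of functions as constant functions.\<close>

definition const_fls :: "'k::zero fls \<Rightarrow> ('m \<Rightarrow> 'k) fls" where
  "const_fls c = Abs_fls (\<lambda>n p. fls_nth c n)"


section \<open>Differential graded algebras and their cohomology\<close>

text \<open>
  Graded algebras over a field \<open>'s\<close>. The operations are indexed by degrees so that
  the homogeneous components need not be disjoint subsets of \<open>'a\<close>.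
\<close>

record ('s, 'a) graded_alg =
  gcarrier :: "int \<Rightarrow> 'a set"
  gadd :: "int \<Rightarrow> 'a \<Rightarrow> 'a \<Rightarrow> 'a"
  gzero :: "int \<Rightarrow> 'a"
  gscale :: "int \<Rightarrow> 's \<Rightarrow> 'a \<Rightarrow> 'a"
  gmult :: "int \<Rightarrow> int \<Rightarrow> 'a \<Rightarrow> 'a \<Rightarrow> 'a"
  gone :: "'a"

record ('s, 'a) dg_alg = "('s, 'a) graded_alg" +
  gdiff :: "int \<Rightarrow> 'a \<Rightarrow> 'a"

definition graded_alg_iso ::
  "('s, 'a, 'x) graded_alg_scheme \<Rightarrow> ('s, 'b, 'y) graded_alg_scheme \<Rightarrow> (int \<Rightarrow> 'a \<Rightarrow> 'b) \<Rightarrow> bool" where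
  "graded_alg_iso A B h \<longleftrightarrow>
     (\<forall>n. bij_betw (h n) (gcarrier A n) (gcarrier B n)) \<and>
     (\<forall>n. \<forall>x\<in>gcarrier A n. \<forall>y\<in>gcarrier A n. h n (gadd A n x y) = gadd B n (h n x) (h n y)) \<and>
     (\<forall>n c. \<forall>x\<in>gcarrier A n. h n (gscale A n c x) = gscale B n c (h n x)) \<and>
     (\<forall>m n. \<forall>x\<in>gcarrier A m. \<forall>y\<in>gcarrier A n.
        h (m + n) (gmult A m n x y) = gmult B m n (h m x) (h n y)) \<and>
     h 0 (gone A) = gone B"

definition graded_alg_isomorphic ::
  "('s, 'a, 'x) graded_alg_scheme \<Rightarrow> ('s, 'b, 'y) graded_alg_scheme \<Rightarrow> bool" where
  "graded_alg_isomorphic A B \<longleftrightarrow> (\<exists>h. graded_alg_iso A B h)"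

definition opposite_graded ::
  "('s::field, 'a, 'x) graded_alg_scheme \<Rightarrow> ('s, 'a) graded_alg" where
  "opposite_graded A = \<lparr>gcarrier = gcarrier A, gadd = gadd A, gzero = gzero A, gscale = gscale A,
     gmult = (\<lambda>m n a b. gscale A (m + n) ((-1) powi (m * n)) (gmult A n m b a)),
     gone = gone A\<rparr>"

definition cocycles :: "('s, 'a) dg_alg \<Rightarrow> int \<Rightarrow> 'a set" where
  "cocycles A n = {x \<in> gcarrier A n. gdiff A n x = gzero A (n + 1)}"

definition coboundaries :: "('s, 'a) dg_alg \<Rightarrow> int \<Rightarrow> 'a set" where
  "coboundaries A n = gdiff A (n - 1) ` gcarrier A (n - 1)"

text \<open>
  Cohomology classes are cosets of the coboundaries. The operations on classes are defined without
  choosing representatives, by adding the coboundaries to the elementwise operations.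
\<close>

definition coh_class :: "('s, 'a) dg_alg \<Rightarrow> int \<Rightarrow> 'a set \<Rightarrow> 'a set" where
  "coh_class A n Z = {gadd A n z b |z b. z \<in> Z \<and> b \<in> coboundaries A n}"

definition cohomology :: "('s, 'a) dg_alg \<Rightarrow> ('s, 'a set) graded_alg" where
  "cohomology A = \<lparr>
     gcarrier = (\<lambda>n. (\<lambda>z. coh_class A n {z}) ` cocycles A n),
     gadd = (\<lambda>n X Y. coh_class A n {gadd A n x y |x y. x \<in> X \<and> y \<in> Y}),
     gzero = coboundaries A,
     gscale = (\<lambda>n c X. coh_class A n (gscale A n c ` X)),
     gmult = (\<lambda>m n X Y. coh_class A (m + n) {gmult A m n x y |x y. x \<in> X \<and> y \<in> Y}),
     gone = coh_class A 0 {gone A}\<rparr>"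


section \<open>The BRST algebra\<close>

text \<open>
  The ghost \<open>\<xi>\<^sup>a\<close> is the generator with index \<open>a\<close> and the antighost \<open>\<xi>\<^sub>a\<close> the one with
  index \<open>l + a\<close>, for \<open>a < l\<close>. Elements of the BRST algebra are families of coefficients, in
  the Laurent series of smooth functions, of the monomials in these generators.
\<close>

definition ghost_number :: "nat \<Rightarrow> nat set \<Rightarrow> int" where
  "ghost_number l S =
     int (card {a. a < l \<and> a \<in> S}) - int (card {a. a < l \<and> l + a \<in> S})"

definition clifford_op ::
  "nat \<Rightarrow> (nat set \<Rightarrow> nat set \<Rightarrow> 'k::field fls) \<Rightarrow> nat set \<Rightarrow> nat set \<Rightarrow> 'k fls" where
  "clifford_op l t =
     (\<lambda>S T. - 2 * fls_X * (\<Sum>a<l. ext_deriv_tensor (l + a) a t S T))"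

text \<open>The exponential series stops at \<open>l\<close> since the operators
  \<open>\<partial>/\<partial>\<xi>\<^sub>a \<otimes> \<partial>/\<partial>\<xi>\<^sup>a\<close> commute and have square 0.\<close>

definition clifford_mult ::
  "nat \<Rightarrow> (nat set \<Rightarrow> 'k::field fls) \<Rightarrow> (nat set \<Rightarrow> 'k fls) \<Rightarrow> nat set \<Rightarrow> 'k fls" where
  "clifford_mult l v w =
     ext_mu (\<lambda>S T. \<Sum>k\<le>l. inverse (of_nat (fact k)) * (clifford_op l ^^ k) (\<lambda>S T. v S * w T) S T)"

definition brst_mult ::
  "(nat \<Rightarrow> ('m \<Rightarrow> 'k::field) \<Rightarrow> ('m \<Rightarrow> 'k) \<Rightarrow> ('m \<Rightarrow> 'k)) \<Rightarrow> nat \<Rightarrow>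
   (nat set \<Rightarrow> ('m \<Rightarrow> 'k) fls) \<Rightarrow> (nat set \<Rightarrow> ('m \<Rightarrow> 'k) fls) \<Rightarrow> nat set \<Rightarrow> ('m \<Rightarrow> 'k) fls" where
  "brst_mult \<mu> l x y = (\<lambda>U. \<Sum>S\<in>Pow {..<2 * l}. \<Sum>T\<in>Pow {..<2 * l}.
     const_fls (clifford_mult l (ext_basis S) (ext_basis T) U) * star \<mu> (x S) (y T))"

definition brst_theta ::
  "nat \<Rightarrow> (nat \<Rightarrow> nat \<Rightarrow> nat \<Rightarrow> real) \<Rightarrow> (nat \<Rightarrow> ('m \<Rightarrow> 'k::real_normed_field) fls) \<Rightarrow>
   nat set \<Rightarrow> ('m \<Rightarrow> 'k) fls" where
  "brst_theta l f J' = (\<lambda>U.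
     (\<Sum>a<l. \<Sum>b<l. \<Sum>c<l. fls_const (real_const (- f a b c / 4)) *
        ext_mult (ext_mult (ext_basis {a}) (ext_basis {b})) (ext_basis {l + c}) U)
     + (\<Sum>a<l. J' a * ext_basis {a} U))"

definition brst_alg ::
  "('m, 'e::real_normed_vector) atlas \<Rightarrow>
   (nat \<Rightarrow> ('m \<Rightarrow> 'k::real_normed_field) \<Rightarrow> ('m \<Rightarrow> 'k) \<Rightarrow> ('m \<Rightarrow> 'k)) \<Rightarrow> nat \<Rightarrow>
   (nat \<Rightarrow> nat \<Rightarrow> nat \<Rightarrow> real) \<Rightarrow> (nat \<Rightarrow> ('m \<Rightarrow> 'k) fls) \<Rightarrow>
   ('k fls, nat set \<Rightarrow> ('m \<Rightarrow> 'k) fls) dg_alg" where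
  "brst_alg \<A> \<mu> l f J' = \<lparr>
     gcarrier = (\<lambda>n. {x. \<forall>S. x S \<in> Cinf_fls \<A> \<and>
                         (x S \<noteq> 0 \<longrightarrow> S \<subseteq> {..<2 * l} \<and> ghost_number l S = n)}),
     gadd = (\<lambda>n. (+)),
     gzero = (\<lambda>n. 0),
     gscale = (\<lambda>n c x S. const_fls c * x S),
     gmult = (\<lambda>m n. brst_mult \<mu> l),
     gone = ext_basis {},
     gdiff = (\<lambda>n x S. fls_X_inv *
       (brst_mult \<mu> l (brst_theta l f J') x S
        - const_fls ((-1) powi n) * brst_mult \<mu> l x (brst_theta l f J') S))\<rparr>"


section \<open>Left modules over noncommutative rings and Ext algebras\<close>

locale left_module = R?: ring R + M?: abelian_group M
  for R :: "('a, 'x) ring_scheme" (structure)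
  and M :: "('a, 'b, 'y) module_scheme" (structure) +
  assumes lsmult_closed: "\<lbrakk>a \<in> carrier R; x \<in> carrier M\<rbrakk> \<Longrightarrow> a \<odot>\<^bsub>M\<^esub> x \<in> carrier M"
  and lsmult_l_distr: "\<lbrakk>a \<in> carrier R; b \<in> carrier R; x \<in> carrier M\<rbrakk> \<Longrightarrow>
        (a \<oplus>\<^bsub>R\<^esub> b) \<odot>\<^bsub>M\<^esub> x = a \<odot>\<^bsub>M\<^esub> x \<oplus>\<^bsub>M\<^esub> b \<odot>\<^bsub>M\<^esub> x"
  and lsmult_r_distr: "\<lbrakk>a \<in> carrier R; x \<in> carrier M; y \<in> carrier M\<rbrakk> \<Longrightarrow>
        a \<odot>\<^bsub>M\<^esub> (x \<oplus>\<^bsub>M\<^esub> y) = a \<odot>\<^bsub>M\<^esub> x \<oplus>\<^bsub>M\<^esub> a \<odot>\<^bsub>M\<^esub> y"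
  and lsmult_assoc: "\<lbrakk>a \<in> carrier R; b \<in> carrier R; x \<in> carrier M\<rbrakk> \<Longrightarrow>
        (a \<otimes>\<^bsub>R\<^esub> b) \<odot>\<^bsub>M\<^esub> x = a \<odot>\<^bsub>M\<^esub> (b \<odot>\<^bsub>M\<^esub> x)"
  and lsmult_one: "x \<in> carrier M \<Longrightarrow> \<one>\<^bsub>R\<^esub> \<odot>\<^bsub>M\<^esub> x = x"

definition left_hom ::
  "('a, 'x) ring_scheme \<Rightarrow> ('a, 'b, 'y) module_scheme \<Rightarrow> ('a, 'c, 'z) module_scheme \<Rightarrow> ('b \<Rightarrow> 'c) set" where
  "left_hom R M N = {h \<in> carrier M \<rightarrow>\<^sub>E carrier N.
     (\<forall>x\<in>carrier M. \<forall>y\<in>carrier M. h (x \<oplus>\<^bsub>M\<^esub> y) = h x \<oplus>\<^bsub>N\<^esub> h y) \<and>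
     (\<forall>a\<in>carrier R. \<forall>x\<in>carrier M. h (a \<odot>\<^bsub>M\<^esub> x) = a \<odot>\<^bsub>N\<^esub> h x)}"

definition left_ideal :: "('a, 'x) ring_scheme \<Rightarrow> 'a set \<Rightarrow> bool" where
  "left_ideal R I \<longleftrightarrow> subgroup I (add_monoid R) \<and> (\<forall>a\<in>carrier R. \<forall>x\<in>I. a \<otimes>\<^bsub>R\<^esub> x \<in> I)"

definition gen_left_ideal :: "('a, 'x) ring_scheme \<Rightarrow> 'a set \<Rightarrow> 'a set" where
  "gen_left_ideal R S = \<Inter>{I. left_ideal R I \<and> S \<subseteq> I}"

text \<open>The fields \<open>mult\<close> and \<open>one\<close> of a module record play no role.\<close>

definition left_quotient :: "('a, 'x) ring_scheme \<Rightarrow> 'a set \<Rightarrow> ('a, 'a set) module" where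
  "left_quotient R I = \<lparr>carrier = a_rcosets\<^bsub>R\<^esub> I, mult = undefined, one = undefined,
     zero = I, add = set_add R, smult = (\<lambda>a X. \<Union>x\<in>X. I +>\<^bsub>R\<^esub> (a \<otimes>\<^bsub>R\<^esub> x))\<rparr>"

definition free_left_module :: "('a, 'x) ring_scheme \<Rightarrow> 'i set \<Rightarrow> ('a, 'i \<Rightarrow> 'a) module" where
  "free_left_module R X = \<lparr>
     carrier = {u. (\<forall>i. u i \<in> carrier R) \<and> (\<forall>i. i \<notin> X \<longrightarrow> u i = \<zero>\<^bsub>R\<^esub>) \<and> finite {i. u i \<noteq> \<zero>\<^bsub>R\<^esub>}},
     mult = undefined, one = undefined,
     zero = (\<lambda>i. \<zero>\<^bsub>R\<^esub>), add = (\<lambda>u v i. u i \<oplus>\<^bsub>R\<^esub> v i), smult = (\<lambda>a u i. a \<otimes>\<^bsub>R\<^esub> u i)\<rparr>"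

text \<open>Projective modules are the direct summands of free modules. It is no restriction to index the
  basis of the free module by elements of \<open>M\<close>, since any generating family of \<open>M\<close> will do.\<close>

definition projective_left_module ::
  "('a, 'x) ring_scheme \<Rightarrow> ('a, 'b, 'y) module_scheme \<Rightarrow> bool" where
  "projective_left_module R M \<longleftrightarrow> left_module R M \<and>
     (\<exists>(X :: 'b set) i p. i \<in> left_hom R M (free_left_module R X) \<and>
        p \<in> left_hom R (free_left_module R X) M \<and> (\<forall>x\<in>carrier M. p (i x) = x))"

text \<open>Chain complexes are indexed by the integers; \<open>d n\<close> maps \<open>P n\<close> to \<open>P (n - 1)\<close>.\<close>

definition projective_resolution ::
  "('a, 'x) ring_scheme \<Rightarrow> ('a, 'b, 'y) module_scheme \<Rightarrow>
   (int \<Rightarrow> ('a, 'p) module) \<Rightarrow> (int \<Rightarrow> 'p \<Rightarrow> 'p) \<Rightarrow> ('p \<Rightarrow> 'b) \<Rightarrow> bool" where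
  "projective_resolution R B P d \<epsilon> \<longleftrightarrow>
     (\<forall>n. projective_left_module R (P n)) \<and>
     (\<forall>n<0. carrier (P n) = {\<zero>\<^bsub>P n\<^esub>}) \<and>
     (\<forall>n. d n \<in> left_hom R (P n) (P (n - 1))) \<and>
     \<epsilon> \<in> left_hom R (P 0) B \<and>
     \<epsilon> ` carrier (P 0) = carrier B \<and>
     {x \<in> carrier (P 0). \<epsilon> x = \<zero>\<^bsub>B\<^esub>} = d 1 ` carrier (P 1) \<and>
     (\<forall>n\<ge>1. {x \<in> carrier (P n). d n x = \<zero>\<^bsub>P (n - 1)\<^esub>} = d (n + 1) ` carrier (P (n + 1)))"

text \<open>
  The differential graded algebra \<open>Hom\<^sub>R(P, P)\<close>: an element \<open>\<phi>\<close> of degree \<open>n\<close> is a family of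
  module homomorphisms from \<open>P p\<close> to \<open>P (p - n)\<close>, the product is composition, and the differential is
  \<open>d \<circ> \<phi> - (-1)^n \<phi> \<circ> d\<close>. The map \<open>\<iota>\<close> embeds the ground field into the centre of \<open>R\<close>.
\<close>

definition hom_dga ::
  "('a, 'x) ring_scheme \<Rightarrow> ('s \<Rightarrow> 'a) \<Rightarrow> (int \<Rightarrow> ('a, 'p) module) \<Rightarrow> (int \<Rightarrow> 'p \<Rightarrow> 'p) \<Rightarrow>
   ('s, int \<Rightarrow> 'p \<Rightarrow> 'p) dg_alg" where
  "hom_dga R \<iota> P d = \<lparr>
     gcarrier = (\<lambda>n. {\<phi>. \<forall>p. \<phi> p \<in> left_hom R (P p) (P (p - n))}),
     gadd = (\<lambda>n \<phi> \<psi> p. \<lambda>x\<in>carrier (P p). \<phi> p x \<oplus>\<^bsub>P (p - n)\<^esub> \<psi> p x),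
     gzero = (\<lambda>n p. \<lambda>x\<in>carrier (P p). \<zero>\<^bsub>P (p - n)\<^esub>),
     gscale = (\<lambda>n c \<phi> p. \<lambda>x\<in>carrier (P p). \<iota> c \<odot>\<^bsub>P (p - n)\<^esub> \<phi> p x),
     gmult = (\<lambda>m n \<phi> \<psi> p. \<lambda>x\<in>carrier (P p). \<phi> (p - n) (\<psi> p x)),
     gone = (\<lambda>p. \<lambda>x\<in>carrier (P p). x),
     gdiff = (\<lambda>n \<phi> p. \<lambda>x\<in>carrier (P p).
        if even n then d (p - n) (\<phi> p x) \<ominus>\<^bsub>P (p - (n + 1))\<^esub> \<phi> (p - 1) (d p x)
        else d (p - n) (\<phi> p x) \<oplus>\<^bsub>P (p - (n + 1))\<^esub> \<phi> (p - 1) (d p x))\<rparr>"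

text \<open>\<open>Ext\<^sub>R(B, B)\<close> with the composition product, computed from a projective resolution \<open>(P, d)\<close>
  of \<open>B\<close>.\<close>

definition Ext_alg ::
  "('a, 'x) ring_scheme \<Rightarrow> ('s \<Rightarrow> 'a) \<Rightarrow> (int \<Rightarrow> ('a, 'p) module) \<Rightarrow> (int \<Rightarrow> 'p \<Rightarrow> 'p) \<Rightarrow>
   ('s, (int \<Rightarrow> 'p \<Rightarrow> 'p) set) graded_alg" where
  "Ext_alg R \<iota> P d = cohomology (hom_dga R \<iota> P d)"

end

theory Submission
  imports Defs
begin

text \<open>
  The BRST algebra is a matrix algebra in disguise, and the matrices are the endomorphisms of a
  resolution of \<open>B\<close>.

  The ghosts and antighosts satisfy the relations of a Clifford algebra on \<open>2l\<close> generators in which the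
  pairing is invertible once \<open>\<nu>\<close> is, so that this algebra acts on the exterior algebra of the antighosts
  (realised as the quotient of the Clifford algebra by the right ideal of the ghosts) by all
  endomorphisms. With coefficients in the star product algebra \<open>R\<close> this says that the BRST
  elements of degree \<open>n\<close> are, via right multiplication, exactly the families of \<open>R\<close>-linear maps from
  \<open>K\<^sub>p\<close> to \<open>K\<^bsub>p-n\<^esub>\<close>, where \<open>K\<^sub>p\<close> is the free left module on the subsets of cardinality \<open>p\<close>. The
  coefficients of this action form a block triangular matrix with invertible diagonal
  (\<open>rep_coeff_inverse\<close>), which gives bijectivity; multiplicativity is associativity of the
  Clifford product (\<open>rep_coeff_mult\<close>). Right multiplication reverses products, whence the opposite algebra.

  The charge \<open>\<theta>\<close> squares to zero: its cubic part does so by the Jacobi identity (\<open>cubic_square\<close>),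
  and the mixed terms cancel by the commutation relations of the quantum moment map, which survive the
  shift by the trace of the adjoint representation since this trace vanishes on commutators
  (\<open>trace_character\<close>, \<open>J'_commutator\<close>). Hence right multiplication by \<open>\<theta>/\<nu>\<close> makes \<open>K\<close> a complex,
  and \<open>D = [\<theta>, -]/\<nu>\<close> becomes the differential of the complex of its endomorphisms
  (\<open>opposite_brst_isomorphic\<close>).

  Finally \<open>K\<close> resolves \<open>B\<close> (\<open>koszul_resolution\<close>). The lowest order term of its differential in \<open>\<nu>\<close> is twice the
  classical Koszul differential up to sign (\<open>kdiff_leading\<close>), which is exact by the complete intersection
  hypothesis; a cycle is therefore a boundary up to higher order, and the corrections sum up because Laurent series
  are complete (\<open>koszul_exact\<close>). In degree zero the image of the differential consists of the
  combinations of the shifted moment map components, which is the left ideal defining \<open>B\<close>. Since the Ext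
  algebra can be computed from any projective resolution (\<open>Ext_alg_independent\<close>), the theorem follows.
\<close>

section \<open>Cohomology of differential graded algebras\<close>

text \<open>The part of the axioms of a differential graded algebra that makes its cohomology a graded
  algebra. Of the Leibniz rule only the consequences for cocycles are retained, since these are what
  descends to cohomology.\<close>

locale dga =
  fixes A :: "('s::field, 'a) dg_alg"
  assumes add_closed: "[|x \<in> gcarrier A n; y \<in> gcarrier A n|] ==> gadd A n x y \<in> gcarrier A n"
    and add_assoc: "[|x \<in> gcarrier A n; y \<in> gcarrier A n; z \<in> gcarrier A n|] ==>
      gadd A n (gadd A n x y) z = gadd A n x (gadd A n y z)"
    and add_comm: "[|x \<in> gcarrier A n; y \<in> gcarrier A n|] ==> gadd A n x y = gadd A n y x"
    and zero_closed: "gzero A n \<in> gcarrier A n"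
    and add_zero: "x \<in> gcarrier A n ==> gadd A n x (gzero A n) = x"
    and add_inverse: "x \<in> gcarrier A n ==> \<exists>y\<in>gcarrier A n. gadd A n x y = gzero A n"
    and diff_closed: "x \<in> gcarrier A n ==> gdiff A n x \<in> gcarrier A (n + 1)"
    and diff_add: "[|x \<in> gcarrier A n; y \<in> gcarrier A n|] ==>
      gdiff A n (gadd A n x y) = gadd A (n + 1) (gdiff A n x) (gdiff A n y)"
    and diff_diff: "x \<in> gcarrier A n ==> gdiff A (n + 1) (gdiff A n x) = gzero A (n + 1 + 1)"
    and scale_closed: "x \<in> gcarrier A n ==> gscale A n c x \<in> gcarrier A n"
    and scale_add: "[|x \<in> gcarrier A n; y \<in> gcarrier A n|] ==>
      gscale A n c (gadd A n x y) = gadd A n (gscale A n c x) (gscale A n c y)"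
    and diff_scale: "x \<in> gcarrier A n ==> gdiff A n (gscale A n c x) = gscale A (n + 1) c (gdiff A n x)"
    and mult_closed: "[|x \<in> gcarrier A m; y \<in> gcarrier A n|] ==> gmult A m n x y \<in> gcarrier A (m + n)"
    and mult_add_left: "[|x \<in> gcarrier A m; y \<in> gcarrier A m; z \<in> gcarrier A n|] ==>
      gmult A m n (gadd A m x y) z = gadd A (m + n) (gmult A m n x z) (gmult A m n y z)"
    and mult_add_right: "[|x \<in> gcarrier A m; y \<in> gcarrier A n; z \<in> gcarrier A n|] ==>
      gmult A m n x (gadd A n y z) = gadd A (m + n) (gmult A m n x y) (gmult A m n x z)"
    and mult_cocycles: "[|x \<in> cocycles A m; y \<in> cocycles A n|] ==> gmult A m n x y \<in> cocycles A (m + n)"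
    and mult_cocycle_coboundary: "[|x \<in> cocycles A m; y \<in> coboundaries A n|] ==>
      gmult A m n x y \<in> coboundaries A (m + n)"
    and mult_coboundary_cocycle: "[|x \<in> coboundaries A m; y \<in> cocycles A n|] ==>
      gmult A m n x y \<in> coboundaries A (m + n)"
    and one_cocycle: "gone A \<in> cocycles A 0"
begin

definition cohomologous :: "int => 'a => 'a => bool" where
  "cohomologous n z w \<longleftrightarrow> (\<exists>b\<in>coboundaries A n. z = gadd A n w b)"

lemma cocycle_closed: "z \<in> cocycles A n ==> z \<in> gcarrier A n"
  by (simp add: cocycles_def)

lemma coboundary_closed: "b \<in> coboundaries A n ==> b \<in> gcarrier A n"
  using diff_closed[of _ "n - 1"] by (auto simp: coboundaries_def)

lemma add_left_cancel:
  assumes "x \<in> gcarrier A n" "y \<in> gcarrier A n" "z \<in> gcarrier A n" "gadd A n x y = gadd A n x z"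
  shows "y = z"
proof -
  obtain x' where x': "x' \<in> gcarrier A n" "gadd A n x x' = gzero A n"
    using add_inverse[OF assms(1)] by blast
  have "gadd A n x' (gadd A n x y) = y" if "y \<in> gcarrier A n" for y
    using that x' assms(1) add_assoc[of x' n x y] add_comm[of x' n x] add_comm[of "gzero A n" n y] add_zero
      zero_closed by simp
  then show ?thesis using assms by metis
qed

lemma diff_zero: "gdiff A n (gzero A n) = gzero A (n + 1)"
proof -
  have "gadd A (n + 1) (gdiff A n (gzero A n)) (gdiff A n (gzero A n)) =
      gadd A (n + 1) (gdiff A n (gzero A n)) (gzero A (n + 1))"
    using diff_add[of "gzero A n" n "gzero A n"] by (simp add: zero_closed add_zero diff_closed)
  then show ?thesis using add_left_cancel diff_closed zero_closed by metis
qed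

lemma coboundary_add: "[|b \<in> coboundaries A n; c \<in> coboundaries A n|] ==> gadd A n b c \<in> coboundaries A n"
proof -
  assume "b \<in> coboundaries A n" "c \<in> coboundaries A n"
  then obtain x y where xy: "x \<in> gcarrier A (n - 1)" "b = gdiff A (n - 1) x"
    "y \<in> gcarrier A (n - 1)" "c = gdiff A (n - 1) y" by (auto simp: coboundaries_def)
  then have "gadd A n b c = gdiff A (n - 1) (gadd A (n - 1) x y)"
    using diff_add[of x "n - 1" y] by simp
  then show ?thesis using xy add_closed unfolding coboundaries_def by blast
qed

lemma coboundary_zero: "gzero A n \<in> coboundaries A n"
  unfolding coboundaries_def using diff_zero[of "n - 1"] zero_closed[of "n - 1"]
  by (auto intro!: image_eqI[of _ _ "gzero A (n - 1)"])

lemma coboundary_inverse: "b \<in> coboundaries A n ==> \<exists>c\<in>coboundaries A n. gadd A n b c = gzero A n"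
proof -
  assume "b \<in> coboundaries A n"
  then obtain x where x: "x \<in> gcarrier A (n - 1)" "b = gdiff A (n - 1) x"
    by (auto simp: coboundaries_def)
  obtain y where y: "y \<in> gcarrier A (n - 1)" "gadd A (n - 1) x y = gzero A (n - 1)"
    using add_inverse[OF x(1)] by blast
  have "gadd A n b (gdiff A (n - 1) y) = gzero A n"
    using diff_add[OF x(1) y(1)] diff_zero[of "n - 1"] x y by simp
  then show ?thesis using y(1) by (auto simp: coboundaries_def)
qed

lemma coboundary_cocycle: "b \<in> coboundaries A n ==> b \<in> cocycles A n"
proof -
  assume b: "b \<in> coboundaries A n"
  then obtain x where x: "x \<in> gcarrier A (n - 1)" "b = gdiff A (n - 1) x"
    by (auto simp: coboundaries_def)
  then show ?thesis using diff_diff[OF x(1)] coboundary_closed[OF b] by (simp add: cocycles_def)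
qed

lemma coboundary_scale: "b \<in> coboundaries A n ==> gscale A n c b \<in> coboundaries A n"
proof -
  assume "b \<in> coboundaries A n"
  then obtain x where x: "x \<in> gcarrier A (n - 1)" "b = gdiff A (n - 1) x"
    by (auto simp: coboundaries_def)
  then have "gscale A n c b = gdiff A (n - 1) (gscale A (n - 1) c x)"
    using diff_scale[of x "n - 1" c] by simp
  then show ?thesis using x scale_closed unfolding coboundaries_def by blast
qed

lemma cocycle_add: "[|x \<in> cocycles A n; y \<in> cocycles A n|] ==> gadd A n x y \<in> cocycles A n"
  by (simp add: cocycles_def add_closed diff_add add_zero zero_closed)

lemma scale_zero: "gscale A n c (gzero A n) = gzero A n"
proof -
  have "gadd A n (gscale A n c (gzero A n)) (gscale A n c (gzero A n)) =
      gadd A n (gscale A n c (gzero A n)) (gzero A n)"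
    using scale_add[of "gzero A n" n "gzero A n" c] by (simp add: zero_closed add_zero scale_closed)
  then show ?thesis using add_left_cancel scale_closed zero_closed by metis
qed

lemma cocycle_scale: "x \<in> cocycles A n ==> gscale A n c x \<in> cocycles A n"
  by (simp add: cocycles_def scale_closed diff_scale scale_zero)

lemma coh_class_UN: "coh_class A n Z = (\<Union>z\<in>Z. coh_class A n {z})"
  by (auto simp: coh_class_def)

lemma coh_class_UN_image: "coh_class A n (\<Union>v\<in>V. W v) = (\<Union>v\<in>V. coh_class A n (W v))"
  unfolding coh_class_def by blast

lemma mem_coh_class: "w \<in> coh_class A n {z} \<longleftrightarrow> cohomologous n w z"
  by (auto simp: coh_class_def cohomologous_def)

lemma cohomologous_refl: "z \<in> gcarrier A n ==> cohomologous n z z"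
  unfolding cohomologous_def using coboundary_zero add_zero by metis

lemma cohomologous_sym: "[|w \<in> gcarrier A n; cohomologous n z w|] ==> cohomologous n w z"
  unfolding cohomologous_def
  by (metis add_assoc add_zero coboundary_closed coboundary_inverse)

lemma cohomologous_trans:
  "[|z \<in> gcarrier A n; cohomologous n x y; cohomologous n y z|] ==> cohomologous n x z"
  unfolding cohomologous_def by (metis add_assoc coboundary_closed coboundary_add)

lemma cohomologous_cocycle: "[|w \<in> cocycles A n; cohomologous n z w|] ==> z \<in> cocycles A n"
  unfolding cohomologous_def using cocycle_add coboundary_cocycle by blast

lemma coh_class_eq_iff:
  "[|z \<in> gcarrier A n; w \<in> gcarrier A n|] ==>
    coh_class A n {z} = coh_class A n {w} \<longleftrightarrow> cohomologous n z w"
  using mem_coh_class cohomologous_refl cohomologous_sym cohomologous_trans by blast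

text \<open>The operations on classes take the coset of all elementwise results. This lemma reduces
  them to representatives: any nonempty part of a class generates the class.\<close>

lemma coh_class_absorb:
  assumes "w \<in> gcarrier A n" "W \<noteq> {}" "W \<subseteq> coh_class A n {w}"
  shows "coh_class A n W = coh_class A n {w}"
proof -
  have "coh_class A n {z} = coh_class A n {w}" if "z \<in> W" for z
  proof -
    have "cohomologous n z w" using that assms(3) mem_coh_class by blast
    moreover have "z \<in> gcarrier A n"
      using \<open>cohomologous n z w\<close> assms(1) add_closed coboundary_closed by (auto simp: cohomologous_def)
    ultimately show ?thesis using coh_class_eq_iff assms(1) by blast
  qed
  then show ?thesis using assms(2) coh_class_UN[of n W] by blast
qed

lemma cohomologous_add:
  assumes "x \<in> gcarrier A n" "y \<in> gcarrier A n" "cohomologous n x' x" "cohomologous n y' y"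
  shows "cohomologous n (gadd A n x' y') (gadd A n x y)"
proof -
  obtain b c where b: "b \<in> coboundaries A n" "x' = gadd A n x b"
    and c: "c \<in> coboundaries A n" "y' = gadd A n y c" using assms by (auto simp: cohomologous_def)
  note cl = coboundary_closed[OF b(1)] coboundary_closed[OF c(1)] assms(1,2)
  have "gadd A n (gadd A n x b) (gadd A n y c) = gadd A n (gadd A n x y) (gadd A n b c)"
    using cl by (simp add: add_assoc add_closed) (metis add_assoc add_closed add_comm)
  then show ?thesis using b c coboundary_add by (auto simp: cohomologous_def)
qed

lemma cohomologous_scale:
  "[|x \<in> gcarrier A n; cohomologous n x' x|] ==> cohomologous n (gscale A n c x') (gscale A n c x)"
  unfolding cohomologous_def using scale_add coboundary_scale coboundary_closed by metis

lemma cohomologous_mult: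
  assumes "x \<in> cocycles A m" "y \<in> cocycles A n" "cohomologous m x' x" "cohomologous n y' y"
  shows "cohomologous (m + n) (gmult A m n x' y') (gmult A m n x y)"
proof -
  have "cohomologous (m + n) (gmult A m n x' y') (gmult A m n x' y)"
    using assms mult_add_right mult_cocycle_coboundary cohomologous_cocycle
    unfolding cohomologous_def by (metis cocycle_closed coboundary_closed)
  moreover have "cohomologous (m + n) (gmult A m n x' y) (gmult A m n x y)"
    using assms mult_add_left mult_coboundary_cocycle
    unfolding cohomologous_def by (metis cocycle_closed coboundary_closed)
  ultimately show ?thesis using cohomologous_trans mult_closed assms cocycle_closed by meson
qed

lemma gadd_coh_class:
  assumes "x \<in> cocycles A n" "y \<in> cocycles A n"
  shows "gadd (cohomology A) n (coh_class A n {x}) (coh_class A n {y}) = coh_class A n {gadd A n x y}"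
  unfolding cohomology_def graded_alg.select_convs
proof (rule coh_class_absorb)
  show "{gadd A n x' y' |x' y'. x' \<in> coh_class A n {x} \<and> y' \<in> coh_class A n {y}} \<noteq> {}"
    using assms cocycle_closed mem_coh_class cohomologous_refl by blast
qed (use assms in \<open>auto simp: mem_coh_class cocycle_closed intro!: cohomologous_add\<close>,
    use assms in \<open>simp add: add_closed cocycle_closed\<close>)

lemma gscale_coh_class:
  assumes "x \<in> cocycles A n"
  shows "gscale (cohomology A) n c (coh_class A n {x}) = coh_class A n {gscale A n c x}"
  unfolding cohomology_def graded_alg.select_convs
proof (rule coh_class_absorb)
  show "gscale A n c ` coh_class A n {x} \<noteq> {}"
    using assms cocycle_closed mem_coh_class cohomologous_refl by blast
qed (use assms in \<open>auto simp: mem_coh_class cocycle_closed intro!: cohomologous_scale\<close>,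
    use assms in \<open>simp add: scale_closed cocycle_closed\<close>)

lemma gmult_coh_class:
  assumes "x \<in> cocycles A m" "y \<in> cocycles A n"
  shows "gmult (cohomology A) m n (coh_class A m {x}) (coh_class A n {y}) = coh_class A (m + n) {gmult A m n x y}"
  unfolding cohomology_def graded_alg.select_convs
proof (rule coh_class_absorb)
  show "{gmult A m n x' y' |x' y'. x' \<in> coh_class A m {x} \<and> y' \<in> coh_class A n {y}} \<noteq> {}"
    using assms cocycle_closed mem_coh_class cohomologous_refl by blast
qed (use assms in \<open>auto simp: mem_coh_class intro!: cohomologous_mult\<close>,
    use assms in \<open>simp add: mult_closed cocycle_closed\<close>)

lemma coh_class_scale_coh_class:
  assumes "V \<subseteq> gcarrier A n"
  shows "coh_class A n (gscale A n c ` coh_class A n V) = coh_class A n (gscale A n c ` V)"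
proof -
  have "coh_class A n (gscale A n c ` coh_class A n {v}) = coh_class A n {gscale A n c v}"
    if "v \<in> V" for v
  proof (rule coh_class_absorb)
    show "gscale A n c ` coh_class A n {v} \<noteq> {}"
      using assms that mem_coh_class cohomologous_refl by blast
    show "gscale A n c ` coh_class A n {v} \<subseteq> coh_class A n {gscale A n c v}"
      using assms that by (auto simp: mem_coh_class intro!: cohomologous_scale)
    show "gscale A n c v \<in> gcarrier A n" using assms that scale_closed by blast
  qed
  moreover have "coh_class A n (gscale A n c ` coh_class A n V) =
      (\<Union>v\<in>V. coh_class A n (gscale A n c ` coh_class A n {v}))"
  proof -
    have "gscale A n c ` coh_class A n V = (\<Union>v\<in>V. gscale A n c ` coh_class A n {v})"
      by (subst coh_class_UN) (simp add: image_UN)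
    then show ?thesis by (simp only: coh_class_UN_image)
  qed
  moreover have "coh_class A n (gscale A n c ` V) = (\<Union>v\<in>V. coh_class A n {gscale A n c v})"
    by (subst coh_class_UN) auto
  ultimately show ?thesis by simp
qed

end

text \<open>A map on cocycles that is bijective and multiplicative up to coboundaries induces an
  isomorphism in cohomology; it may be far from bijective or multiplicative itself.\<close>

lemma cohomology_isomorphic:
  assumes "dga A" and "dga B"
    and F: "\<And>n z. z \<in> cocycles A n ==> F n z \<in> cocycles B n"
    and F_iff: "\<And>n z w. [|z \<in> cocycles A n; w \<in> cocycles A n|] ==>
      dga.cohomologous B n (F n z) (F n w) \<longleftrightarrow> dga.cohomologous A n z w"
    and F_surj: "\<And>n w. w \<in> cocycles B n ==> \<exists>z\<in>cocycles A n. dga.cohomologous B n (F n z) w"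
    and F_add: "\<And>n z w. [|z \<in> cocycles A n; w \<in> cocycles A n|] ==>
      F n (gadd A n z w) = gadd B n (F n z) (F n w)"
    and F_scale: "\<And>n c z. z \<in> cocycles A n ==> F n (gscale A n c z) = gscale B n c (F n z)"
    and F_mult: "\<And>m n z w. [|z \<in> cocycles A m; w \<in> cocycles A n|] ==>
      dga.cohomologous B (m + n) (F (m + n) (gmult A m n z w)) (gmult B m n (F m z) (F n w))"
    and F_one: "dga.cohomologous B 0 (F 0 (gone A)) (gone B)"
  shows "graded_alg_isomorphic (cohomology A) (cohomology B)"
proof -
  interpret A: dga A by fact
  interpret B: dga B by fact
  define h where "h n X = coh_class B n (F n ` X)" for n X
  have h: "h n (coh_class A n {z}) = coh_class B n {F n z}" if z: "z \<in> cocycles A n" for n z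
    unfolding h_def
  proof (rule B.coh_class_absorb)
    show "F n z \<in> gcarrier B n" using F[OF z] B.cocycle_closed by blast
    show "F n ` coh_class A n {z} \<noteq> {}"
      using z A.cocycle_closed A.mem_coh_class A.cohomologous_refl by blast
    show "F n ` coh_class A n {z} \<subseteq> coh_class B n {F n z}"
      using z F_iff A.mem_coh_class B.mem_coh_class A.cohomologous_cocycle by blast
  qed
  have eq: "coh_class A n {z} = coh_class A n {w} \<longleftrightarrow> coh_class B n {F n z} = coh_class B n {F n w}"
    if "z \<in> cocycles A n" "w \<in> cocycles A n" for n z w
    using that F F_iff A.coh_class_eq_iff B.coh_class_eq_iff A.cocycle_closed B.cocycle_closed by metis
  have car: "gcarrier (cohomology A) n = (\<lambda>z. coh_class A n {z}) ` cocycles A n" for n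
    by (simp add: cohomology_def)
  have carB: "gcarrier (cohomology B) n = (\<lambda>z. coh_class B n {z}) ` cocycles B n" for n
    by (simp add: cohomology_def)
  have "graded_alg_iso (cohomology A) (cohomology B) h"
    unfolding graded_alg_iso_def
  proof (intro conjI allI ballI)
    fix n
    have "inj_on (h n) (gcarrier (cohomology A) n)"
      using eq by (auto simp: car inj_on_def h)
    moreover have "h n ` gcarrier (cohomology A) n = gcarrier (cohomology B) n"
    proof -
      have "\<exists>z\<in>cocycles A n. coh_class B n {w} = coh_class B n {F n z}" if w: "w \<in> cocycles B n" for w
        using F_surj[OF w] w F B.coh_class_eq_iff B.cocycle_closed by metis
      then show ?thesis using F by (auto simp: car carB h image_iff)
    qed
    ultimately show "bij_betw (h n) (gcarrier (cohomology A) n) (gcarrier (cohomology B) n)"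
      by (simp add: bij_betw_def)
  next
    fix n X Y assume "X \<in> gcarrier (cohomology A) n" "Y \<in> gcarrier (cohomology A) n"
    then obtain x y where *: "x \<in> cocycles A n" "X = coh_class A n {x}"
      "y \<in> cocycles A n" "Y = coh_class A n {y}" by (auto simp: car)
    then show "h n (gadd (cohomology A) n X Y) = gadd (cohomology B) n (h n X) (h n Y)"
      by (simp add: A.gadd_coh_class B.gadd_coh_class h A.cocycle_add F F_add)
  next
    fix n c X assume "X \<in> gcarrier (cohomology A) n"
    then obtain x where *: "x \<in> cocycles A n" "X = coh_class A n {x}" by (auto simp: car)
    then show "h n (gscale (cohomology A) n c X) = gscale (cohomology B) n c (h n X)"
      by (simp add: A.gscale_coh_class B.gscale_coh_class h A.cocycle_scale F F_scale)
  next
    fix m n X Y assume "X \<in> gcarrier (cohomology A) m" "Y \<in> gcarrier (cohomology A) n"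
    then obtain x y where *: "x \<in> cocycles A m" "X = coh_class A m {x}"
      "y \<in> cocycles A n" "Y = coh_class A n {y}" by (auto simp: car)
    have "coh_class B (m + n) {F (m + n) (gmult A m n x y)} =
        coh_class B (m + n) {gmult B m n (F m x) (F n y)}"
      using * F F_mult B.coh_class_eq_iff A.mult_cocycles B.mult_cocycles B.cocycle_closed by metis
    then show "h (m + n) (gmult (cohomology A) m n X Y) = gmult (cohomology B) m n (h m X) (h n Y)"
      using * by (simp add: A.gmult_coh_class B.gmult_coh_class h A.mult_cocycles F)
  next
    have "gone (cohomology A) = coh_class A 0 {gone A}" "gone (cohomology B) = coh_class B 0 {gone B}"
      by (simp_all add: cohomology_def)
    then show "h 0 (gone (cohomology A)) = gone (cohomology B)"
      using h[OF A.one_cocycle] F_one F[OF A.one_cocycle] B.coh_class_eq_iff B.one_cocycle B.cocycle_closed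
      by metis
  qed
  then show ?thesis by (auto simp: graded_alg_isomorphic_def)
qed

lemma image2: "{g x y |x y. x \<in> X \<and> y \<in> Y} = (\<lambda>(x, y). g x y) ` (X \<times> Y)"
  by auto

text \<open>An isomorphism of complexes that is multiplicative for the opposite product carries classes
  to classes as sets. Hence the axioms are needed for one of the two algebras only.\<close>

lemma opposite_cohomology_isomorphic:
  fixes A :: "('s::field, 'a) dg_alg" and B :: "('s, 'b) dg_alg"
  assumes "dga B"
    and closed: "\<And>n x y. [|x \<in> gcarrier A n; y \<in> gcarrier A n|] ==> gadd A n x y \<in> gcarrier A n"
      "\<And>n c x. x \<in> gcarrier A n ==> gscale A n c x \<in> gcarrier A n"
      "\<And>m n x y. [|x \<in> gcarrier A m; y \<in> gcarrier A n|] ==> gmult A m n x y \<in> gcarrier A (m + n)"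
      "\<And>n x. x \<in> gcarrier A n ==> gdiff A n x \<in> gcarrier A (n + 1)"
      "\<And>n. gzero A n \<in> gcarrier A n" "gone A \<in> gcarrier A 0"
    and bij: "\<And>n. bij_betw (\<Phi> n) (gcarrier A n) (gcarrier B n)"
    and add: "\<And>n x y. [|x \<in> gcarrier A n; y \<in> gcarrier A n|] ==> \<Phi> n (gadd A n x y) = gadd B n (\<Phi> n x) (\<Phi> n y)"
    and zero: "\<And>n. \<Phi> n (gzero A n) = gzero B n"
    and scale: "\<And>n c x. x \<in> gcarrier A n ==> \<Phi> n (gscale A n c x) = gscale B n c (\<Phi> n x)"
    and diff: "\<And>n x. x \<in> gcarrier A n ==> \<Phi> (n + 1) (gdiff A n x) = gdiff B n (\<Phi> n x)"
    and mult: "\<And>m n x y. [|x \<in> gcarrier A m; y \<in> gcarrier A n|] ==>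
      gscale B (m + n) ((-1) powi (m * n)) (\<Phi> (m + n) (gmult A n m y x)) = gmult B m n (\<Phi> m x) (\<Phi> n y)"
    and one: "\<Phi> 0 (gone A) = gone B"
  shows "graded_alg_isomorphic (opposite_graded (cohomology A)) (cohomology B)"
proof -
  interpret B: dga B by fact
  have \<Phi>: "\<Phi> n x \<in> gcarrier B n" if "x \<in> gcarrier A n" for n x
    using bij[of n] that by (auto simp: bij_betw_def)
  have cob: "coboundaries B n = \<Phi> n ` coboundaries A n" for n
  proof -
    have "gcarrier B (n - 1) = \<Phi> (n - 1) ` gcarrier A (n - 1)"
      using bij[of "n - 1"] by (simp add: bij_betw_def)
    then show ?thesis using diff[of _ "n - 1"] by (force simp: coboundaries_def image_image)
  qed
  have cob_closed: "b \<in> gcarrier A n" if "b \<in> coboundaries A n" for b n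
    using that closed(4)[of _ "n - 1"] by (auto simp: coboundaries_def)
  have coc: "cocycles B n = \<Phi> n ` cocycles A n" for n
  proof -
    have "\<Phi> (n + 1) (gdiff A n x) = gzero B (n + 1) \<longleftrightarrow> gdiff A n x = gzero A (n + 1)"
      if "x \<in> gcarrier A n" for x
      using bij[of "n + 1"] zero[of "n + 1"] closed(4)[OF that] closed(5)
      by (metis bij_betw_def inj_onD)
    moreover have "gcarrier B n = \<Phi> n ` gcarrier A n" using bij by (simp add: bij_betw_def)
    ultimately show ?thesis using diff by (auto simp: cocycles_def)
  qed
  have img: "\<Phi> n ` coh_class A n Z = coh_class B n (\<Phi> n ` Z)" if "Z \<subseteq> gcarrier A n" for n Z
  proof -
    have "\<Phi> n ` coh_class A n Z = (\<lambda>(z, b). \<Phi> n (gadd A n z b)) ` (Z \<times> coboundaries A n)"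
      by (simp add: coh_class_def image2 image_image case_prod_unfold)
    also have "\<dots> = (\<lambda>(z, b). gadd B n (\<Phi> n z) (\<Phi> n b)) ` (Z \<times> coboundaries A n)"
      using add that cob_closed by (intro image_cong) auto
    also have "\<dots> = coh_class B n (\<Phi> n ` Z)"
      unfolding coh_class_def image2 cob by force
    finally show ?thesis .
  qed
  have class_closed: "coh_class A n Z \<subseteq> gcarrier A n" if "Z \<subseteq> gcarrier A n" for n Z
    using that closed(1) cob_closed by (auto simp: coh_class_def)
  have coc_closed: "cocycles A n \<subseteq> gcarrier A n" for n by (auto simp: cocycles_def)
  have class_carrier: "X \<subseteq> gcarrier A n" if X: "X \<in> gcarrier (cohomology A) n" for X n
  proof -
    obtain z where "z \<in> cocycles A n" "X = coh_class A n {z}" using X by (auto simp: cohomology_def)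
    then show ?thesis using class_closed[of "{z}" n] coc_closed by auto
  qed
  define h where "h n X = \<Phi> n ` X" for n X
  have "graded_alg_iso (opposite_graded (cohomology A)) (cohomology B) h"
    unfolding graded_alg_iso_def
  proof (intro conjI allI ballI)
    fix n
    have "inj_on (h n) (gcarrier (cohomology A) n)"
    proof (rule inj_onI)
      fix X Y assume "X \<in> gcarrier (cohomology A) n" "Y \<in> gcarrier (cohomology A) n" "h n X = h n Y"
      then show "X = Y" using bij[of n] class_carrier unfolding h_def bij_betw_def
        by (metis inj_on_image_eq_iff)
    qed
    moreover have "h n ` gcarrier (cohomology A) n = gcarrier (cohomology B) n"
    proof -
      have "h n (coh_class A n {z}) = coh_class B n {\<Phi> n z}" if "z \<in> cocycles A n" for z
        using img[of "{z}" n] that coc_closed by (auto simp: h_def)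
      then show ?thesis by (auto simp: cohomology_def coc image_image)
    qed
    ultimately show "bij_betw (h n) (gcarrier (opposite_graded (cohomology A)) n) (gcarrier (cohomology B) n)"
      by (simp add: bij_betw_def opposite_graded_def)
  next
    fix n X Y assume "X \<in> gcarrier (opposite_graded (cohomology A)) n"
      "Y \<in> gcarrier (opposite_graded (cohomology A)) n"
    then have XY: "X \<subseteq> gcarrier A n" "Y \<subseteq> gcarrier A n"
      by (simp_all add: opposite_graded_def class_carrier)
    have "\<Phi> n ` {gadd A n x y |x y. x \<in> X \<and> y \<in> Y} = {gadd B n x y |x y. x \<in> \<Phi> n ` X \<and> y \<in> \<Phi> n ` Y}"
    proof -
      have "\<Phi> n ` {gadd A n x y |x y. x \<in> X \<and> y \<in> Y} = (\<lambda>(x, y). \<Phi> n (gadd A n x y)) ` (X \<times> Y)"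
        by (simp add: image2 image_image case_prod_unfold)
      also have "\<dots> = (\<lambda>(x, y). gadd B n (\<Phi> n x) (\<Phi> n y)) ` (X \<times> Y)"
        using XY by (intro image_cong) (auto intro!: add)
      finally show ?thesis unfolding image2 by force
    qed
    moreover have "{gadd A n x y |x y. x \<in> X \<and> y \<in> Y} \<subseteq> gcarrier A n" using XY closed(1) by blast
    ultimately show "h n (gadd (opposite_graded (cohomology A)) n X Y) = gadd (cohomology B) n (h n X) (h n Y)"
      using img by (simp add: h_def cohomology_def opposite_graded_def)
  next
    fix n c X assume "X \<in> gcarrier (opposite_graded (cohomology A)) n"
    then have X: "X \<subseteq> gcarrier A n"
      by (simp_all add: opposite_graded_def class_carrier)
    have "\<Phi> n ` gscale A n c ` X = gscale B n c ` \<Phi> n ` X"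
      unfolding image_image using X by (intro image_cong) (auto intro!: scale)
    moreover have "gscale A n c ` X \<subseteq> gcarrier A n" using X closed(2) by blast
    ultimately show "h n (gscale (opposite_graded (cohomology A)) n c X) = gscale (cohomology B) n c (h n X)"
      using img by (simp add: h_def cohomology_def opposite_graded_def)
  next
    fix m n X Y assume "X \<in> gcarrier (opposite_graded (cohomology A)) m"
      "Y \<in> gcarrier (opposite_graded (cohomology A)) n"
    then have XY: "X \<subseteq> gcarrier A m" "Y \<subseteq> gcarrier A n"
      by (simp_all add: opposite_graded_def class_carrier)
    define W where "W = {gmult A n m y x |y x. y \<in> Y \<and> x \<in> X}"
    define s :: 's where "s = (-1) powi (m * n)"
    have W: "W \<subseteq> gcarrier A (m + n)" using XY by (auto simp: W_def add.commute[of m n] intro!: closed(3))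
    have "h (m + n) (gmult (opposite_graded (cohomology A)) m n X Y) =
        \<Phi> (m + n) ` coh_class A (m + n) (gscale A (m + n) s ` coh_class A (m + n) W)"
      by (simp add: h_def cohomology_def opposite_graded_def s_def W_def add.commute[of m n])
    also have "\<dots> = coh_class B (m + n) (\<Phi> (m + n) ` gscale A (m + n) s ` coh_class A (m + n) W)"
      using class_closed[OF W] closed(2) by (intro img) blast
    also have "\<Phi> (m + n) ` gscale A (m + n) s ` coh_class A (m + n) W =
        gscale B (m + n) s ` \<Phi> (m + n) ` coh_class A (m + n) W"
      unfolding image_image using scale class_closed[OF W] by (intro image_cong) auto
    also have "\<Phi> (m + n) ` coh_class A (m + n) W = coh_class B (m + n) (\<Phi> (m + n) ` W)"
      by (rule img[OF W])
    also have "coh_class B (m + n) (gscale B (m + n) s ` coh_class B (m + n) (\<Phi> (m + n) ` W)) =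
        coh_class B (m + n) (gscale B (m + n) s ` \<Phi> (m + n) ` W)"
      using W \<Phi> by (intro B.coh_class_scale_coh_class) blast
    also have "gscale B (m + n) s ` \<Phi> (m + n) ` W =
        {gmult B m n x y |x y. x \<in> \<Phi> m ` X \<and> y \<in> \<Phi> n ` Y}"
    proof -
      have "gscale B (m + n) s ` \<Phi> (m + n) ` W =
          {gscale B (m + n) s (\<Phi> (m + n) (gmult A n m y x)) |x y. x \<in> X \<and> y \<in> Y}"
        by (auto simp: W_def image_image)
      also have "\<dots> = {gmult B m n (\<Phi> m x) (\<Phi> n y) |x y. x \<in> X \<and> y \<in> Y}"
        unfolding image2 s_def using XY by (intro image_cong) (auto intro!: mult)
      finally show ?thesis by auto
    qed
    finally show "h (m + n) (gmult (opposite_graded (cohomology A)) m n X Y) =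
        gmult (cohomology B) m n (h m X) (h n Y)"
      by (simp add: h_def cohomology_def)
  next
    show "h 0 (gone (opposite_graded (cohomology A))) = gone (cohomology B)"
      using img[of "{gone A}" 0] closed(6) one by (simp add: h_def cohomology_def opposite_graded_def)
  qed
  then show ?thesis by (auto simp: graded_alg_isomorphic_def)
qed

section \<open>Homomorphisms of left modules\<close>

lemma left_homI:
  assumes "h \<in> extensional (carrier M)" "\<And>x. x \<in> carrier M ==> h x \<in> carrier N"
    "\<And>x y. [|x \<in> carrier M; y \<in> carrier M|] ==> h (x \<oplus>\<^bsub>M\<^esub> y) = h x \<oplus>\<^bsub>N\<^esub> h y"
    "\<And>a x. [|a \<in> carrier R; x \<in> carrier M|] ==> h (a \<odot>\<^bsub>M\<^esub> x) = a \<odot>\<^bsub>N\<^esub> h x"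
  shows "h \<in> left_hom R M N"
  using assms by (auto simp: left_hom_def PiE_def)

lemma left_hom_closed: "[|h \<in> left_hom R M N; x \<in> carrier M|] ==> h x \<in> carrier N"
  by (auto simp: left_hom_def)

lemma left_hom_add: "[|h \<in> left_hom R M N; x \<in> carrier M; y \<in> carrier M|] ==> h (x \<oplus>\<^bsub>M\<^esub> y) = h x \<oplus>\<^bsub>N\<^esub> h y"
  by (auto simp: left_hom_def)

lemma left_hom_smult: "[|h \<in> left_hom R M N; a \<in> carrier R; x \<in> carrier M|] ==> h (a \<odot>\<^bsub>M\<^esub> x) = a \<odot>\<^bsub>N\<^esub> h x"
  by (auto simp: left_hom_def)

lemma left_hom_ext: "h \<in> left_hom R M N ==> h \<in> extensional (carrier M)"
  by (auto simp: left_hom_def PiE_def)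

lemma left_hom_eqI:
  "[|f \<in> left_hom R M N; g \<in> left_hom R M N'; \<And>x. x \<in> carrier M ==> f x = g x|] ==> f = g"
  by (rule extensionalityI[of _ "carrier M"]) (auto dest: left_hom_ext)

lemma left_module_abelian_group: "left_module R M ==> abelian_group M"
  by (simp add: left_module_def)

lemma left_hom_zero:
  assumes "abelian_group M" "abelian_group N" "h \<in> left_hom R M N"
  shows "h \<zero>\<^bsub>M\<^esub> = \<zero>\<^bsub>N\<^esub>"
proof -
  interpret M: abelian_group M by fact
  interpret N: abelian_group N by fact
  have "h \<zero>\<^bsub>M\<^esub> \<oplus>\<^bsub>N\<^esub> h \<zero>\<^bsub>M\<^esub> = h \<zero>\<^bsub>M\<^esub>"
    using left_hom_add[OF assms(3), of "\<zero>\<^bsub>M\<^esub>" "\<zero>\<^bsub>M\<^esub>"] by simp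
  then show ?thesis using left_hom_closed[OF assms(3), of "\<zero>\<^bsub>M\<^esub>"]
    by (metis M.zero_closed N.add.l_cancel_one)
qed

lemma left_hom_minus:
  assumes "abelian_group M" "abelian_group N" "h \<in> left_hom R M N" "x \<in> carrier M"
  shows "h (\<ominus>\<^bsub>M\<^esub> x) = \<ominus>\<^bsub>N\<^esub> h x"
proof -
  interpret M: abelian_group M by fact
  interpret N: abelian_group N by fact
  have "h x \<oplus>\<^bsub>N\<^esub> h (\<ominus>\<^bsub>M\<^esub> x) = \<zero>\<^bsub>N\<^esub>"
    using left_hom_add[OF assms(3,4), of "\<ominus>\<^bsub>M\<^esub> x"] left_hom_zero[OF assms(1-3)] assms(4)
    by (simp add: M.r_neg)
  then show ?thesis using left_hom_closed[OF assms(3)] assms(4)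
    by (metis M.a_inv_closed N.minus_equality N.a_comm)
qed

lemma left_hom_diff:
  assumes "abelian_group M" "abelian_group N" "h \<in> left_hom R M N" "x \<in> carrier M" "y \<in> carrier M"
  shows "h (x \<ominus>\<^bsub>M\<^esub> y) = h x \<ominus>\<^bsub>N\<^esub> h y"
  using assms by (simp add: a_minus_def left_hom_add left_hom_minus abelian_group.a_inv_closed)

context left_module
begin

lemma smult_zero: "a \<in> carrier R ==> a \<odot>\<^bsub>M\<^esub> \<zero>\<^bsub>M\<^esub> = \<zero>\<^bsub>M\<^esub>"
  using lsmult_r_distr[of a "\<zero>\<^bsub>M\<^esub>" "\<zero>\<^bsub>M\<^esub>"] lsmult_closed[of a "\<zero>\<^bsub>M\<^esub>"]
  by (metis M.zero_closed M.l_zero M.add.l_cancel_one)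

lemma zero_smult: "x \<in> carrier M ==> \<zero>\<^bsub>R\<^esub> \<odot>\<^bsub>M\<^esub> x = \<zero>\<^bsub>M\<^esub>"
  using lsmult_l_distr[of "\<zero>\<^bsub>R\<^esub>" "\<zero>\<^bsub>R\<^esub>" x] lsmult_closed[of "\<zero>\<^bsub>R\<^esub>" x]
  by (metis R.zero_closed R.l_zero M.add.l_cancel_one)

lemma smult_minus: "[|a \<in> carrier R; x \<in> carrier M|] ==> a \<odot>\<^bsub>M\<^esub> (\<ominus>\<^bsub>M\<^esub> x) = \<ominus>\<^bsub>M\<^esub> (a \<odot>\<^bsub>M\<^esub> x)"
  using lsmult_r_distr[of a x "\<ominus>\<^bsub>M\<^esub> x"] smult_zero[of a] lsmult_closed[of a]
  by (metis M.a_inv_closed M.minus_equality M.r_neg M.a_comm)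

end

lemma left_hom_compose:
  assumes "g \<in> left_hom R N L" "f \<in> left_hom R M N" "left_module R M"
  shows "(\<lambda>x\<in>carrier M. g (f x)) \<in> left_hom R M L"
proof -
  interpret M: left_module R M by fact
  show ?thesis
    by (rule left_homI) (use assms in \<open>simp_all add: left_hom_closed left_hom_add left_hom_smult
      M.lsmult_closed M.M.a_closed\<close>)
qed

lemma left_hom_sum:
  assumes "left_module R M" "left_module R N" "f \<in> left_hom R M N" "g \<in> left_hom R M N"
  shows "(\<lambda>x\<in>carrier M. f x \<oplus>\<^bsub>N\<^esub> g x) \<in> left_hom R M N"
proof -
  interpret M: left_module R M by fact
  interpret N: left_module R N by fact
  show ?thesis
  proof (rule left_homI)
    fix x y assume "x \<in> carrier M" "y \<in> carrier M"
    then show "(\<lambda>x\<in>carrier M. f x \<oplus>\<^bsub>N\<^esub> g x) (x \<oplus>\<^bsub>M\<^esub> y) =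
        (\<lambda>x\<in>carrier M. f x \<oplus>\<^bsub>N\<^esub> g x) x \<oplus>\<^bsub>N\<^esub> (\<lambda>x\<in>carrier M. f x \<oplus>\<^bsub>N\<^esub> g x) y"
      using assms by (simp add: left_hom_add left_hom_closed M.M.a_closed N.M.a_ac)
  next
    fix a x assume "a \<in> carrier R" "x \<in> carrier M"
    then show "(\<lambda>x\<in>carrier M. f x \<oplus>\<^bsub>N\<^esub> g x) (a \<odot>\<^bsub>M\<^esub> x) = a \<odot>\<^bsub>N\<^esub> (\<lambda>x\<in>carrier M. f x \<oplus>\<^bsub>N\<^esub> g x) x"
      using assms by (simp add: left_hom_smult left_hom_closed M.lsmult_closed N.lsmult_r_distr)
  qed (use assms in \<open>simp_all add: left_hom_closed N.M.a_closed\<close>)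
qed

lemma left_hom_neg:
  assumes "left_module R M" "left_module R N" "f \<in> left_hom R M N"
  shows "(\<lambda>x\<in>carrier M. \<ominus>\<^bsub>N\<^esub> f x) \<in> left_hom R M N"
proof -
  interpret M: left_module R M by fact
  interpret N: left_module R N by fact
  show ?thesis
    by (rule left_homI) (use assms in \<open>simp_all add: left_hom_closed left_hom_add left_hom_smult
      M.lsmult_closed N.smult_minus M.M.a_closed N.M.a_inv_closed N.M.minus_add\<close>)
qed

lemma left_hom_zero_map:
  assumes "left_module R M" "left_module R N"
  shows "(\<lambda>x\<in>carrier M. \<zero>\<^bsub>N\<^esub>) \<in> left_hom R M N"
proof -
  interpret M: left_module R M by fact
  interpret N: left_module R N by fact
  show ?thesis
    by (rule left_homI) (use assms in \<open>simp_all add: M.lsmult_closed M.M.a_closed N.smult_zero\<close>)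
qed

lemma left_hom_scale:
  assumes "left_module R M" "left_module R N" "f \<in> left_hom R M N" "c \<in> carrier R"
    "\<And>a. a \<in> carrier R ==> c \<otimes>\<^bsub>R\<^esub> a = a \<otimes>\<^bsub>R\<^esub> c"
  shows "(\<lambda>x\<in>carrier M. c \<odot>\<^bsub>N\<^esub> f x) \<in> left_hom R M N"
proof -
  interpret M: left_module R M by fact
  interpret N: left_module R N by fact
  show ?thesis
  proof (rule left_homI)
    fix a x assume "a \<in> carrier R" "x \<in> carrier M"
    then show "(\<lambda>x\<in>carrier M. c \<odot>\<^bsub>N\<^esub> f x) (a \<odot>\<^bsub>M\<^esub> x) = a \<odot>\<^bsub>N\<^esub> (\<lambda>x\<in>carrier M. c \<odot>\<^bsub>N\<^esub> f x) x"
      using assms by (simp add: left_hom_smult left_hom_closed M.lsmult_closed flip: N.lsmult_assoc)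
  qed (use assms in \<open>simp_all add: left_hom_closed left_hom_add
      M.M.a_closed N.lsmult_closed N.lsmult_r_distr\<close>)
qed


section \<open>Free modules and the lifting property\<close>

lemma free_left_module_simps [simp]:
  "\<zero>\<^bsub>free_left_module R X\<^esub> = (\<lambda>i. \<zero>\<^bsub>R\<^esub>)"
  "u \<oplus>\<^bsub>free_left_module R X\<^esub> v = (\<lambda>i. u i \<oplus>\<^bsub>R\<^esub> v i)"
  "a \<odot>\<^bsub>free_left_module R X\<^esub> u = (\<lambda>i. a \<otimes>\<^bsub>R\<^esub> u i)"
  by (simp_all add: free_left_module_def)

lemma mem_free_left_module: "u \<in> carrier (free_left_module R X) \<longleftrightarrow>
    (\<forall>i. u i \<in> carrier R) \<and> (\<forall>i. i \<notin> X \<longrightarrow> u i = \<zero>\<^bsub>R\<^esub>) \<and> finite {i. u i \<noteq> \<zero>\<^bsub>R\<^esub>}"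
  by (simp add: free_left_module_def)

lemma left_module_free:
  assumes "ring R"
  shows "left_module R (free_left_module R X)"
proof -
  interpret R: ring R by fact
  let ?F = "free_left_module R X"
  have add: "(\<lambda>i. u i \<oplus>\<^bsub>R\<^esub> v i) \<in> carrier ?F" if "u \<in> carrier ?F" "v \<in> carrier ?F" for u v
  proof -
    have "{i. u i \<oplus>\<^bsub>R\<^esub> v i \<noteq> \<zero>\<^bsub>R\<^esub>} \<subseteq> {i. u i \<noteq> \<zero>\<^bsub>R\<^esub>} \<union> {i. v i \<noteq> \<zero>\<^bsub>R\<^esub>}" by auto
    then have "finite {i. u i \<oplus>\<^bsub>R\<^esub> v i \<noteq> \<zero>\<^bsub>R\<^esub>}"
      by (rule finite_subset) (use that in \<open>simp add: mem_free_left_module\<close>)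
    then show ?thesis using that by (auto simp: mem_free_left_module)
  qed
  have smult: "(\<lambda>i. a \<otimes>\<^bsub>R\<^esub> u i) \<in> carrier ?F" if "a \<in> carrier R" "u \<in> carrier ?F" for a u
  proof -
    have "{i. a \<otimes>\<^bsub>R\<^esub> u i \<noteq> \<zero>\<^bsub>R\<^esub>} \<subseteq> {i. u i \<noteq> \<zero>\<^bsub>R\<^esub>}" using that by auto
    then show ?thesis using that finite_subset by (auto simp: mem_free_left_module)
  qed
  have neg: "(\<lambda>i. \<ominus>\<^bsub>R\<^esub> u i) \<in> carrier ?F" if "u \<in> carrier ?F" for u
  proof -
    have "{i. \<ominus>\<^bsub>R\<^esub> u i \<noteq> \<zero>\<^bsub>R\<^esub>} \<subseteq> {i. u i \<noteq> \<zero>\<^bsub>R\<^esub>}" using that by auto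
    then show ?thesis using that finite_subset by (auto simp: mem_free_left_module)
  qed
  have "abelian_group ?F"
  proof (rule abelian_groupI)
    show "u \<oplus>\<^bsub>?F\<^esub> v \<in> carrier ?F" if "u \<in> carrier ?F" "v \<in> carrier ?F" for u v
      using that add by simp
    show "\<zero>\<^bsub>?F\<^esub> \<in> carrier ?F" by (simp add: mem_free_left_module)
    show "u \<oplus>\<^bsub>?F\<^esub> v \<oplus>\<^bsub>?F\<^esub> w = u \<oplus>\<^bsub>?F\<^esub> (v \<oplus>\<^bsub>?F\<^esub> w)"
      if "u \<in> carrier ?F" "v \<in> carrier ?F" "w \<in> carrier ?F" for u v w
      using that by (simp add: mem_free_left_module fun_eq_iff R.a_assoc)
    show "u \<oplus>\<^bsub>?F\<^esub> v = v \<oplus>\<^bsub>?F\<^esub> u" if "u \<in> carrier ?F" "v \<in> carrier ?F" for u v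
      using that by (simp add: mem_free_left_module fun_eq_iff R.a_comm)
    show "\<zero>\<^bsub>?F\<^esub> \<oplus>\<^bsub>?F\<^esub> u = u" if "u \<in> carrier ?F" for u
      using that by (simp add: mem_free_left_module fun_eq_iff)
    fix u assume u: "u \<in> carrier ?F"
    show "\<exists>v\<in>carrier ?F. v \<oplus>\<^bsub>?F\<^esub> u = \<zero>\<^bsub>?F\<^esub>"
      using u neg[OF u] by (intro bexI[of _ "\<lambda>i. \<ominus>\<^bsub>R\<^esub> u i"]) (simp_all add: mem_free_left_module R.l_neg)
  qed
  moreover have "left_module_axioms R ?F"
    by unfold_locales
      (simp_all add: smult, simp_all add: mem_free_left_module fun_eq_iff R.l_distr R.r_distr R.m_assoc)
  ultimately show ?thesis using assms by (simp add: left_module_def)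
qed

lemma free_left_module_lift:
  fixes X :: "'i set"
  assumes "ring R" "left_module R M" "left_module R N"
    and f: "f \<in> left_hom R (free_left_module R X) N" and g: "g \<in> left_hom R M N"
    and sub: "f ` carrier (free_left_module R X) \<subseteq> g ` carrier M"
  shows "\<exists>h\<in>left_hom R (free_left_module R X) M. \<forall>x\<in>carrier (free_left_module R X). g (h x) = f x"
proof -
  let ?F = "free_left_module R X"
  interpret F: left_module R ?F by (rule left_module_free) fact
  interpret M: left_module R M by fact
  interpret N: left_module R N by fact
  define \<delta> where "\<delta> i = (\<lambda>j. if j = i then \<one>\<^bsub>R\<^esub> else \<zero>\<^bsub>R\<^esub>)" for i :: 'i
  have \<delta>: "\<delta> i \<in> carrier ?F" if "i \<in> X" for i
    using that by (auto simp: mem_free_left_module \<delta>_def)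
  have "\<exists>m. \<forall>i\<in>X. m i \<in> carrier M \<and> g (m i) = f (\<delta> i)"
  proof -
    have "\<forall>i\<in>X. \<exists>m. m \<in> carrier M \<and> g m = f (\<delta> i)"
    proof
      fix i assume "i \<in> X"
      then have "f (\<delta> i) \<in> g ` carrier M" using sub \<delta> by blast
      then show "\<exists>m. m \<in> carrier M \<and> g m = f (\<delta> i)" by (elim imageE) metis
    qed
    then show ?thesis by (rule bchoice)
  qed
  then obtain m where m: "\<And>i. i \<in> X ==> m i \<in> carrier M" "\<And>i. i \<in> X ==> g (m i) = f (\<delta> i)" by blast
  define S where "S A u = (\<Oplus>\<^bsub>M\<^esub>i\<in>A. u i \<odot>\<^bsub>M\<^esub> m i)" for A u
  define h where "h = (\<lambda>u\<in>carrier ?F. S {i. u i \<noteq> \<zero>\<^bsub>R\<^esub>} u)"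
  have term_closed: "u i \<odot>\<^bsub>M\<^esub> m i \<in> carrier M" if "u \<in> carrier ?F" "i \<in> X" for u i
    using that m by (auto simp: mem_free_left_module intro!: M.lsmult_closed)
  have h_eq: "h u = S A u" if "u \<in> carrier ?F" "finite A" "A \<subseteq> X" "{i. u i \<noteq> \<zero>\<^bsub>R\<^esub>} \<subseteq> A" for u A
  proof -
    have "S {i. u i \<noteq> \<zero>\<^bsub>R\<^esub>} u = S A u" unfolding S_def
    proof (rule M.M.add.finprod_mono_neutral_cong_left)
      show "u i \<odot>\<^bsub>M\<^esub> m i = \<zero>\<^bsub>M\<^esub>" if "i \<in> A - {i. u i \<noteq> \<zero>\<^bsub>R\<^esub>}" for i
        using that m \<open>A \<subseteq> X\<close> by (auto simp: M.zero_smult)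
      show "(\<lambda>i. u i \<odot>\<^bsub>M\<^esub> m i) \<in> A \<rightarrow> carrier M" using that term_closed by blast
    qed (use that in auto)
    then show ?thesis using that(1) by (simp add: h_def)
  qed
  have S_closed: "S A u \<in> carrier M" if "u \<in> carrier ?F" "A \<subseteq> X" for u A
    unfolding S_def using that term_closed by (intro M.M.finsum_closed) blast
  have supp: "{i. u i \<noteq> \<zero>\<^bsub>R\<^esub>} \<subseteq> X" "finite {i. u i \<noteq> \<zero>\<^bsub>R\<^esub>}" if "u \<in> carrier ?F" for u
    using that by (auto simp: mem_free_left_module)
  have h_hom: "h \<in> left_hom R ?F M"
  proof (rule left_homI)
    fix u v assume uv: "u \<in> carrier ?F" "v \<in> carrier ?F"
    let ?A = "{i. u i \<noteq> \<zero>\<^bsub>R\<^esub>} \<union> {i. v i \<noteq> \<zero>\<^bsub>R\<^esub>}"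
    have A: "finite ?A" "?A \<subseteq> X" using uv supp by auto
    have "h (u \<oplus>\<^bsub>?F\<^esub> v) = S ?A (u \<oplus>\<^bsub>?F\<^esub> v)"
    proof (rule h_eq)
      show "u \<oplus>\<^bsub>?F\<^esub> v \<in> carrier ?F" using uv by (rule F.M.a_closed)
      show "{i. (u \<oplus>\<^bsub>?F\<^esub> v) i \<noteq> \<zero>\<^bsub>R\<^esub>} \<subseteq> ?A" by auto
    qed (use A in auto)
    also have "\<dots> = (\<Oplus>\<^bsub>M\<^esub>i\<in>?A. u i \<odot>\<^bsub>M\<^esub> m i \<oplus>\<^bsub>M\<^esub> v i \<odot>\<^bsub>M\<^esub> m i)"
      unfolding S_def
    proof (rule M.M.finsum_cong'[OF refl])
      show "(\<lambda>i. u i \<odot>\<^bsub>M\<^esub> m i \<oplus>\<^bsub>M\<^esub> v i \<odot>\<^bsub>M\<^esub> m i) \<in> ?A \<rightarrow> carrier M"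
      proof (rule Pi_I)
        fix i assume "i \<in> ?A"
        then have "i \<in> X" using A(2) by blast
        then show "u i \<odot>\<^bsub>M\<^esub> m i \<oplus>\<^bsub>M\<^esub> v i \<odot>\<^bsub>M\<^esub> m i \<in> carrier M"
          using uv by (intro M.M.a_closed term_closed)
      qed
      fix i assume "i \<in> ?A"
      then have "i \<in> X" using A(2) by blast
      then show "(u \<oplus>\<^bsub>?F\<^esub> v) i \<odot>\<^bsub>M\<^esub> m i = u i \<odot>\<^bsub>M\<^esub> m i \<oplus>\<^bsub>M\<^esub> v i \<odot>\<^bsub>M\<^esub> m i"
        using uv m(1) by (simp add: mem_free_left_module M.lsmult_l_distr)
    qed
    also have "\<dots> = S ?A u \<oplus>\<^bsub>M\<^esub> S ?A v"
      unfolding S_def using A(2) uv term_closed by (subst M.M.finsum_addf) blast+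
    also have "\<dots> = h u \<oplus>\<^bsub>M\<^esub> h v" using uv A by (simp add: h_eq[of _ ?A])
    finally show "h (u \<oplus>\<^bsub>?F\<^esub> v) = h u \<oplus>\<^bsub>M\<^esub> h v" .
  next
    fix a u assume au: "a \<in> carrier R" "u \<in> carrier ?F"
    let ?A = "{i. u i \<noteq> \<zero>\<^bsub>R\<^esub>}"
    have A: "finite ?A" "?A \<subseteq> X" using au supp by auto
    have "finite B ==> B \<subseteq> X ==> a \<odot>\<^bsub>M\<^esub> S B u = S B (a \<odot>\<^bsub>?F\<^esub> u)" for B
    proof (induction rule: finite_induct)
      case empty
      then show ?case using au by (simp add: S_def M.smult_zero)
    next
      case (insert i B)
      have cl: "(\<lambda>i. a \<otimes>\<^bsub>R\<^esub> u i) \<in> carrier ?F" using F.lsmult_closed[OF au] by simp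
      have ui: "u i \<in> carrier R" using au by (simp add: mem_free_left_module)
      have S_ins: "S (insert i B) w = w i \<odot>\<^bsub>M\<^esub> m i \<oplus>\<^bsub>M\<^esub> S B w" if "w \<in> carrier ?F" for w
        unfolding S_def by (rule M.M.finsum_insert) (use insert that term_closed in auto)
      show ?case
        using insert au cl ui by (simp add: S_ins M.lsmult_r_distr term_closed S_closed M.lsmult_assoc m)
    qed
    then have "a \<odot>\<^bsub>M\<^esub> S ?A u = S ?A (a \<odot>\<^bsub>?F\<^esub> u)" using A by blast
    moreover have "h (a \<odot>\<^bsub>?F\<^esub> u) = S ?A (a \<odot>\<^bsub>?F\<^esub> u)"
    proof (rule h_eq)
      show "a \<odot>\<^bsub>?F\<^esub> u \<in> carrier ?F" using au by (rule F.lsmult_closed)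
      show "{i. (a \<odot>\<^bsub>?F\<^esub> u) i \<noteq> \<zero>\<^bsub>R\<^esub>} \<subseteq> ?A" using au(1) by auto
    qed (use A in auto)
    moreover have "h u = S ?A u" using au A by (simp add: h_eq)
    ultimately show "h (a \<odot>\<^bsub>?F\<^esub> u) = a \<odot>\<^bsub>M\<^esub> h u" by simp
  qed (use S_closed supp in \<open>auto simp: h_def\<close>)
  have "g (S A u) = f u" if "finite A" "u \<in> carrier ?F" "A \<subseteq> X" "\<forall>i. i \<notin> A \<longrightarrow> u i = \<zero>\<^bsub>R\<^esub>" for A u
    using that
  proof (induction A arbitrary: u rule: finite_induct)
    case empty
    then have "u = \<zero>\<^bsub>?F\<^esub>" by auto
    then have "f u = \<zero>\<^bsub>N\<^esub>" using left_hom_zero[OF _ _ f] F.M.abelian_group_axioms N.M.abelian_group_axioms by simp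
    then show ?case
      using left_hom_zero[OF _ _ g] M.M.abelian_group_axioms N.M.abelian_group_axioms by (simp add: S_def)
  next
    case (insert i A)
    define w where "w = u(i := \<zero>\<^bsub>R\<^esub>)"
    have w: "w \<in> carrier ?F"
    proof -
      have "{j. w j \<noteq> \<zero>\<^bsub>R\<^esub>} \<subseteq> {j. u j \<noteq> \<zero>\<^bsub>R\<^esub>}" by (auto simp: w_def)
      then have "finite {j. w j \<noteq> \<zero>\<^bsub>R\<^esub>}"
        by (rule finite_subset) (use insert.prems(1) in \<open>simp add: mem_free_left_module\<close>)
      then have "w \<in> carrier ?F \<longleftrightarrow> (\<forall>i. w i \<in> carrier R) \<and> (\<forall>i. i \<notin> X \<longrightarrow> w i = \<zero>\<^bsub>R\<^esub>)"
        by (simp add: mem_free_left_module)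
      then show ?thesis using insert.prems(1) by (simp add: mem_free_left_module w_def)
    qed
    have ui: "u i \<in> carrier R" and iX: "i \<in> X"
      using insert.prems by (auto simp: mem_free_left_module)
    have u: "u = w \<oplus>\<^bsub>?F\<^esub> u i \<odot>\<^bsub>?F\<^esub> \<delta> i"
      using insert.prems(1) by (auto simp: w_def \<delta>_def mem_free_left_module fun_eq_iff)
    have "S A w = S A u" unfolding S_def
      by (intro M.M.finsum_cong') (use insert term_closed in \<open>auto simp: w_def\<close>)
    then have "S (insert i A) u = u i \<odot>\<^bsub>M\<^esub> m i \<oplus>\<^bsub>M\<^esub> S A w"
      unfolding S_def using insert term_closed by (simp add: M.M.finsum_insert Pi_iff subset_iff)
    then have "g (S (insert i A) u) = u i \<odot>\<^bsub>N\<^esub> f (\<delta> i) \<oplus>\<^bsub>N\<^esub> g (S A w)"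
      using w iX ui insert.prems(2) m by (simp add: left_hom_add[OF g] left_hom_smult[OF g] term_closed
        S_closed M.lsmult_closed)
    also have "g (S A w) = f w"
    proof (rule insert.IH[OF w])
      show "\<forall>j. j \<notin> A \<longrightarrow> w j = \<zero>\<^bsub>R\<^esub>" using insert.prems(3) by (simp add: w_def)
    qed (use insert.prems in simp)
    also have "u i \<odot>\<^bsub>N\<^esub> f (\<delta> i) \<oplus>\<^bsub>N\<^esub> f w = f (w \<oplus>\<^bsub>?F\<^esub> u i \<odot>\<^bsub>?F\<^esub> \<delta> i)"
      using w \<delta>[OF iX] ui left_hom_add[OF f w, of "u i \<odot>\<^bsub>?F\<^esub> \<delta> i"] left_hom_smult[OF f ui \<delta>[OF iX]]
        F.lsmult_closed[OF ui \<delta>[OF iX]] left_hom_closed[OF f]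
      by (simp add: N.M.a_comm left_hom_closed[OF f w] N.lsmult_closed)
    finally show ?case using u by metis
  qed
  then have "g (h u) = f u" if "u \<in> carrier ?F" for u
    using that supp[OF that] by (auto simp: h_def)
  then show ?thesis using h_hom by blast
qed

lemma projective_lift:
  fixes Q :: "('a, 'b, 'y) module_scheme"
  assumes "projective_left_module R Q" "left_module R M" "left_module R N"
    and f: "f \<in> left_hom R Q N" and g: "g \<in> left_hom R M N"
    and sub: "f ` carrier Q \<subseteq> g ` carrier M"
  shows "\<exists>h\<in>left_hom R Q M. \<forall>x\<in>carrier Q. g (h x) = f x"
proof -
  obtain X i p where Q: "left_module R Q" and i: "i \<in> left_hom R Q (free_left_module R (X :: 'b set))"
    and p: "p \<in> left_hom R (free_left_module R X) Q" and pi: "\<And>x. x \<in> carrier Q ==> p (i x) = x"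
    using assms(1) unfolding projective_left_module_def by blast
  let ?F = "free_left_module R X"
  have ring: "ring R" using Q by (simp add: left_module_def)
  have fp: "(\<lambda>x\<in>carrier ?F. f (p x)) \<in> left_hom R ?F N"
    by (rule left_hom_compose[OF f p left_module_free[OF ring]])
  have "(\<lambda>x\<in>carrier ?F. f (p x)) ` carrier ?F \<subseteq> g ` carrier M"
    using sub left_hom_closed[OF p] by auto
  then obtain h where h: "h \<in> left_hom R ?F M" "\<And>x. x \<in> carrier ?F ==> g (h x) = f (p x)"
    using free_left_module_lift[OF ring assms(2,3) fp g] by auto
  have "(\<lambda>x\<in>carrier Q. h (i x)) \<in> left_hom R Q M" by (rule left_hom_compose[OF h(1) i Q])
  moreover have "g ((\<lambda>x\<in>carrier Q. h (i x)) x) = f x" if "x \<in> carrier Q" for x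
    using that h(2) left_hom_closed[OF i] pi by simp
  ultimately show ?thesis by blast
qed

section \<open>Complexes of homomorphisms\<close>

locale chain_complex =
  fixes R :: "('a, 'x) ring_scheme" and X :: "int => ('a, 'b) module" and d :: "int => 'b => 'b"
  assumes left_module: "left_module R (X n)"
    and diff_hom: "d n \<in> left_hom R (X n) (X (n - 1))"
    and diff_diff: "x \<in> carrier (X n) ==> d (n - 1) (d n x) = \<zero>\<^bsub>X (n - 2)\<^esub>"
begin

lemma abelian: "abelian_group (X n)"
  using left_module left_module_abelian_group by blast

lemma diff_closed: "x \<in> carrier (X n) ==> m = n - 1 ==> d n x \<in> carrier (X m)"
  by (simp add: left_hom_closed[OF diff_hom])

lemma diff_add: "[|x \<in> carrier (X n); y \<in> carrier (X n); m = n - 1|] ==>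
    d n (x \<oplus>\<^bsub>X n\<^esub> y) = d n x \<oplus>\<^bsub>X m\<^esub> d n y"
  by (simp add: left_hom_add[OF diff_hom])

lemma diff_minus: "[|x \<in> carrier (X n); m = n - 1|] ==> d n (\<ominus>\<^bsub>X n\<^esub> x) = \<ominus>\<^bsub>X m\<^esub> d n x"
  by (simp add: left_hom_minus[OF abelian abelian diff_hom])

lemma diff_diff': "[|x \<in> carrier (X n); m = n - 1; k = n - 2|] ==> d m (d n x) = \<zero>\<^bsub>X k\<^esub>"
  by (simp add: diff_diff)

lemma diff_zero: "m = n - 1 ==> d n \<zero>\<^bsub>X n\<^esub> = \<zero>\<^bsub>X m\<^esub>"
  by (simp add: left_hom_zero[OF abelian abelian diff_hom])

end

definition hom_deg :: "('a, 'x) ring_scheme => (int => ('a, 'b) module) => (int => ('a, 'c) module) => int =>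
    (int => 'b => 'c) set" where
  "hom_deg R X Y n = {\<phi>. \<forall>p. \<phi> p \<in> left_hom R (X p) (Y (p - n))}"

definition hom_comp :: "(int => ('a, 'b) module) => int => (int => 'c => 'e) => (int => 'b => 'c) => int => 'b => 'e" where
  "hom_comp X n \<phi> \<psi> = (\<lambda>p. \<lambda>x\<in>carrier (X p). \<phi> (p - n) (\<psi> p x))"

definition id_hom :: "(int => ('a, 'b) module) => int => 'b => 'b" where
  "id_hom X = (\<lambda>p. \<lambda>x\<in>carrier (X p). x)"

definition msign :: "('a, 'b) module => int => 'b => 'b" where
  "msign M n x = (if even n then x else \<ominus>\<^bsub>M\<^esub> x)"

text \<open>Cocycles of degree \<open>n\<close> in the complex of homomorphisms are the families that commute with
  the differentials up to the sign \<open>(-1)^n\<close>, and coboundaries are the null-homotopic families.\<close>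

definition hom_cocycle :: "('a, 'x) ring_scheme => (int => ('a, 'b) module) => (int => 'b => 'b) =>
    (int => ('a, 'c) module) => (int => 'c => 'c) => int => (int => 'b => 'c) => bool" where
  "hom_cocycle R X d Y d' n \<phi> \<longleftrightarrow> \<phi> \<in> hom_deg R X Y n \<and>
    (\<forall>p. \<forall>x\<in>carrier (X p). d' (p - n) (\<phi> p x) = msign (Y (p - n - 1)) n (\<phi> (p - 1) (d p x)))"

definition homotopic :: "('a, 'x) ring_scheme => (int => ('a, 'b) module) => (int => 'b => 'b) =>
    (int => ('a, 'c) module) => (int => 'c => 'c) => int => (int => 'b => 'c) => (int => 'b => 'c) => bool" where
  "homotopic R X d Y d' n \<phi> \<psi> \<longleftrightarrow> (\<exists>s\<in>hom_deg R X Y (n - 1). \<forall>p. \<forall>x\<in>carrier (X p).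
    \<phi> p x = \<psi> p x \<oplus>\<^bsub>Y (p - n)\<^esub>
      (d' (p - n + 1) (s p x) \<oplus>\<^bsub>Y (p - n)\<^esub> msign (Y (p - n)) n (s (p - 1) (d p x))))"

lemma msign_closed: "abelian_group M ==> x \<in> carrier M ==> msign M n x \<in> carrier M"
  by (simp add: msign_def abelian_group.a_inv_closed)

lemma msign_add: "abelian_group M ==> x \<in> carrier M ==> y \<in> carrier M ==>
    msign M n (x \<oplus>\<^bsub>M\<^esub> y) = msign M n x \<oplus>\<^bsub>M\<^esub> msign M n y"
  by (simp add: msign_def abelian_group.minus_add)

lemma msign_msign: "abelian_group M ==> x \<in> carrier M ==> msign M m (msign M n x) = msign M (m + n) x"
  by (auto simp: msign_def abelian_group.minus_minus)

lemma left_hom_msign: "abelian_group M ==> abelian_group N ==> h \<in> left_hom R M N ==> x \<in> carrier M ==>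
    h (msign M n x) = msign N n (h x)"
  by (simp add: msign_def left_hom_minus)

lemma hom_degD: "\<phi> \<in> hom_deg R X Y n ==> q = p - n ==> \<phi> p \<in> left_hom R (X p) (Y q)"
  by (simp add: hom_deg_def)

lemma hom_deg_closed: "[|\<phi> \<in> hom_deg R X Y n; x \<in> carrier (X p); q = p - n|] ==> \<phi> p x \<in> carrier (Y q)"
  by (rule left_hom_closed[OF hom_degD])

lemma hom_deg_add: "[|\<phi> \<in> hom_deg R X Y n; x \<in> carrier (X p); y \<in> carrier (X p); q = p - n|] ==>
    \<phi> p (x \<oplus>\<^bsub>X p\<^esub> y) = \<phi> p x \<oplus>\<^bsub>Y q\<^esub> \<phi> p y"
  by (rule left_hom_add[OF hom_degD])

lemma hom_deg_msign: "[|chain_complex R X d; chain_complex R Y d'; \<phi> \<in> hom_deg R X Y n; x \<in> carrier (X p); q = p - n|]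
    ==> \<phi> p (msign (X p) k x) = msign (Y q) k (\<phi> p x)"
  by (rule left_hom_msign[OF _ _ hom_degD]) (auto intro: chain_complex.abelian)

lemma hom_deg_eqI:
  "[|\<phi> \<in> hom_deg R X Y n; \<psi> \<in> hom_deg R X Y n; \<And>p x. x \<in> carrier (X p) ==> \<phi> p x = \<psi> p x|] ==> \<phi> = \<psi>"
  by (rule ext, rule left_hom_eqI) (auto intro: hom_degD)

lemma hom_comp_deg:
  assumes "chain_complex R X d" "\<phi> \<in> hom_deg R Y Z m" "\<psi> \<in> hom_deg R X Y n" "k = m + n"
  shows "hom_comp X n \<phi> \<psi> \<in> hom_deg R X Z k"
proof -
  have "(\<lambda>x\<in>carrier (X p). \<phi> (p - n) (\<psi> p x)) \<in> left_hom R (X p) (Z (p - k))" for p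
    by (rule left_hom_compose[of _ _ "Y (p - n)"])
      (use assms in \<open>auto intro!: hom_degD chain_complex.left_module\<close>)
  then show ?thesis by (simp add: hom_deg_def hom_comp_def)
qed

lemma hom_comp_assoc:
  assumes "\<psi> \<in> hom_deg R Y Z n" "\<rho> \<in> hom_deg R X Y k" "m = n + k"
  shows "hom_comp X m \<phi> (hom_comp X k \<psi> \<rho>) = hom_comp X k (hom_comp Y n \<phi> \<psi>) \<rho>"
proof -
  have e: "p - m = p - k - n" for p using assms(3) by simp
  show ?thesis
    using hom_deg_closed[OF assms(2)] by (auto simp: hom_comp_def fun_eq_iff restrict_def e)
qed

lemma id_hom_deg: "chain_complex R X d ==> id_hom X \<in> hom_deg R X X 0"
proof -
  assume "chain_complex R X d"
  then interpret chain_complex R X d .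
  interpret X: left_module R "X p" for p by (rule left_module)
  show ?thesis
    by (auto simp: hom_deg_def id_hom_def intro!: left_homI X.M.a_closed X.lsmult_closed)
qed

lemma id_hom_cocycle: "chain_complex R X d ==> hom_cocycle R X d X d 0 (id_hom X)"
  using id_hom_deg by (auto simp: hom_cocycle_def msign_def id_hom_def chain_complex.diff_closed)

lemma hom_comp_id_left: "\<phi> \<in> hom_deg R X Y n ==> hom_comp X n (id_hom Y) \<phi> = \<phi>"
  by (rule ext, rule extensionalityI)
    (auto simp: hom_comp_def id_hom_def hom_deg_closed intro: left_hom_ext hom_degD)

lemma hom_comp_id_right: "\<phi> \<in> hom_deg R X Y n ==> hom_comp X 0 \<phi> (id_hom X) = \<phi>"
  by (rule ext, rule extensionalityI)
    (auto simp: hom_comp_def id_hom_def hom_deg_closed intro: left_hom_ext hom_degD)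

lemma hom_cocycleD: "[|hom_cocycle R X d Y d' n \<phi>; x \<in> carrier (X p); q = p - n; r = p - n - 1; p' = p - 1|] ==>
    d' q (\<phi> p x) = msign (Y r) n (\<phi> p' (d p x))"
  by (simp add: hom_cocycle_def)

lemma hom_cocycle_comp:
  assumes X: "chain_complex R X d" and Y: "chain_complex R Y d'" and Z: "chain_complex R Z d''"
    and \<phi>: "hom_cocycle R Y d' Z d'' m \<phi>" and \<psi>: "hom_cocycle R X d Y d' n \<psi>" and k: "k = m + n"
  shows "hom_cocycle R X d Z d'' k (hom_comp X n \<phi> \<psi>)"
  unfolding hom_cocycle_def
proof (intro conjI allI ballI)
  have deg: "\<phi> \<in> hom_deg R Y Z m" "\<psi> \<in> hom_deg R X Y n" using \<phi> \<psi> by (auto simp: hom_cocycle_def)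
  show "hom_comp X n \<phi> \<psi> \<in> hom_deg R X Z k" by (rule hom_comp_deg[OF X deg k])
  fix p x assume x: "x \<in> carrier (X p)"
  have dx: "d p x \<in> carrier (X (p - 1))" using x chain_complex.diff_closed[OF X] by blast
  have e: "p - k = p - n - m" "p - 1 - n = p - n - 1" "p - n - 1 - m = p - n - m - 1" using k by auto
  have \<psi>x: "\<psi> p x \<in> carrier (Y (p - n))" using hom_deg_closed[OF deg(2) x] by simp
  have \<psi>dx: "\<psi> (p - 1) (d p x) \<in> carrier (Y (p - n - 1))" by (rule hom_deg_closed[OF deg(2) dx]) simp
  have "d'' (p - n - m) (\<phi> (p - n) (\<psi> p x)) = msign (Z (p - n - m - 1)) m (\<phi> (p - n - 1) (d' (p - n) (\<psi> p x)))"
    by (rule hom_cocycleD[OF \<phi> \<psi>x]) (simp_all add: k)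
  also have "d' (p - n) (\<psi> p x) = msign (Y (p - n - 1)) n (\<psi> (p - 1) (d p x))"
    using \<psi> x by (simp add: hom_cocycle_def)
  also have "\<phi> (p - n - 1) \<dots> = msign (Z (p - n - m - 1)) n (\<phi> (p - n - 1) (\<psi> (p - 1) (d p x)))"
    using hom_deg_msign[OF Y Z deg(1) \<psi>dx] e by simp
  also have "msign (Z (p - n - m - 1)) m \<dots> = msign (Z (p - n - m - 1)) k (\<phi> (p - n - 1) (\<psi> (p - 1) (d p x)))"
    using msign_msign[OF chain_complex.abelian[OF Z]] hom_deg_closed[OF deg(1) \<psi>dx] e k by simp
  finally show "d'' (p - k) (hom_comp X n \<phi> \<psi> p x) =
      msign (Z (p - k - 1)) k (hom_comp X n \<phi> \<psi> (p - 1) (d p x))"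
    using x dx by (simp add: hom_comp_def e)
qed

text \<open>If \<open>s\<close> is a homotopy for \<open>\<phi>\<close>, then \<open>s \<circ> \<psi>\<close> is one for \<open>\<phi> \<circ> \<psi>\<close>.\<close>

lemma homotopic_comp_right:
  assumes X: "chain_complex R X d" and Y: "chain_complex R Y d'" and Z: "chain_complex R Z d''"
    and h: "homotopic R Y d' Z d'' m \<phi> \<phi>'" and \<psi>: "hom_cocycle R X d Y d' n \<psi>" and k: "k = m + n"
  shows "homotopic R X d Z d'' k (hom_comp X n \<phi> \<psi>) (hom_comp X n \<phi>' \<psi>)"
proof -
  obtain s where s: "s \<in> hom_deg R Y Z (m - 1)" and eq: "\<And>p x. x \<in> carrier (Y p) ==>
    \<phi> p x = \<phi>' p x \<oplus>\<^bsub>Z (p - m)\<^esub> (d'' (p - m + 1) (s p x) \<oplus>\<^bsub>Z (p - m)\<^esub> msign (Z (p - m)) m (s (p - 1) (d' p x)))"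
    using h unfolding homotopic_def by blast
  have deg: "\<psi> \<in> hom_deg R X Y n" using \<psi> by (auto simp: hom_cocycle_def)
  show ?thesis unfolding homotopic_def
  proof (intro bexI allI ballI)
    show "hom_comp X n s \<psi> \<in> hom_deg R X Z (k - 1)" by (rule hom_comp_deg[OF X s deg]) (simp add: k)
    fix p x assume x: "x \<in> carrier (X p)"
    have dx: "d p x \<in> carrier (X (p - 1))" using x chain_complex.diff_closed[OF X] by blast
    have e: "p - k = p - n - m" "p - 1 - n = p - n - 1" "p - n - 1 - (m - 1) = p - n - m" using k by auto
    have \<psi>x: "\<psi> p x \<in> carrier (Y (p - n))" using hom_deg_closed[OF deg x] by simp
    have \<psi>dx: "\<psi> (p - 1) (d p x) \<in> carrier (Y (p - n - 1))" by (rule hom_deg_closed[OF deg dx]) simp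
    have "d' (p - n) (\<psi> p x) = msign (Y (p - n - 1)) n (\<psi> (p - 1) (d p x))"
      using \<psi> x by (simp add: hom_cocycle_def)
    then have "s (p - n - 1) (d' (p - n) (\<psi> p x)) = msign (Z (p - n - m)) n (s (p - n - 1) (\<psi> (p - 1) (d p x)))"
      using hom_deg_msign[OF Y Z s \<psi>dx] e by simp
    then have "msign (Z (p - n - m)) m (s (p - n - 1) (d' (p - n) (\<psi> p x))) =
        msign (Z (p - n - m)) k (s (p - n - 1) (\<psi> (p - 1) (d p x)))"
      using msign_msign[OF chain_complex.abelian[OF Z]] hom_deg_closed[OF s \<psi>dx] e k by simp
    then show "hom_comp X n \<phi> \<psi> p x = hom_comp X n \<phi>' \<psi> p x \<oplus>\<^bsub>Z (p - k)\<^esub>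
        (d'' (p - k + 1) (hom_comp X n s \<psi> p x) \<oplus>\<^bsub>Z (p - k)\<^esub>
          msign (Z (p - k)) k (hom_comp X n s \<psi> (p - 1) (d p x)))"
      using eq[OF \<psi>x] x dx by (simp add: hom_comp_def e)
  qed
qed

text \<open>If \<open>s\<close> is a homotopy for \<open>\<psi>\<close>, then \<open>\<plusminus> \<phi> \<circ> s\<close> is one for \<open>\<phi> \<circ> \<psi>\<close>.\<close>

lemma homotopic_comp_left:
  assumes X: "chain_complex R X d" and Y: "chain_complex R Y d'" and Z: "chain_complex R Z d''"
    and \<phi>: "hom_cocycle R Y d' Z d'' m \<phi>" and h: "homotopic R X d Y d' n \<psi> \<psi>'"
    and \<psi>': "\<psi>' \<in> hom_deg R X Y n" and k: "k = m + n"
  shows "homotopic R X d Z d'' k (hom_comp X n \<phi> \<psi>) (hom_comp X n \<phi> \<psi>')"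
proof -
  obtain s where s: "s \<in> hom_deg R X Y (n - 1)" and eq: "\<And>p x. x \<in> carrier (X p) ==>
    \<psi> p x = \<psi>' p x \<oplus>\<^bsub>Y (p - n)\<^esub> (d' (p - n + 1) (s p x) \<oplus>\<^bsub>Y (p - n)\<^esub> msign (Y (p - n)) n (s (p - 1) (d p x)))"
    using h unfolding homotopic_def by blast
  have deg: "\<phi> \<in> hom_deg R Y Z m" using \<phi> by (auto simp: hom_cocycle_def)
  interpret Y: chain_complex R Y d' by fact
  interpret Z: chain_complex R Z d'' by fact
  have abY: "abelian_group (Y q)" and abZ: "abelian_group (Z q)" for q by (rule Y.abelian Z.abelian)+
  define t where "t p = (\<lambda>x\<in>carrier (X p). msign (Z (p - (k - 1))) m (\<phi> (p - n + 1) (s p x)))" for p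
  have t: "t \<in> hom_deg R X Z (k - 1)"
  proof -
    have c: "hom_comp X (n - 1) \<phi> s \<in> hom_deg R X Z (k - 1)" by (rule hom_comp_deg[OF X deg s]) (simp add: k)
    have "t p \<in> left_hom R (X p) (Z (p - (k - 1)))" for p
    proof -
      have r: "hom_comp X (n - 1) \<phi> s p \<in> left_hom R (X p) (Z (p - (k - 1)))" using c by (simp add: hom_deg_def)
      have "t p = (if even m then hom_comp X (n - 1) \<phi> s p
          else (\<lambda>x\<in>carrier (X p). \<ominus>\<^bsub>Z (p - (k - 1))\<^esub> hom_comp X (n - 1) \<phi> s p x))"
        by (auto simp: t_def hom_comp_def msign_def fun_eq_iff restrict_def diff_diff_eq2 algebra_simps)
      then show ?thesis
        using r left_hom_neg[OF chain_complex.left_module[OF X] Z.left_module r] by simp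
    qed
    then show ?thesis by (simp add: hom_deg_def)
  qed
  show ?thesis unfolding homotopic_def
  proof (intro bexI allI ballI)
    show "t \<in> hom_deg R X Z (k - 1)" by fact
    fix p x assume x: "x \<in> carrier (X p)"
    have dx: "d p x \<in> carrier (X (p - 1))" using x chain_complex.diff_closed[OF X] by blast
    have e: "p - k = p - n - m" "p - (k - 1) = p - n - m + 1" "p - 1 - (k - 1) = p - n - m"
      "p - 1 - n + 1 = p - n" "p - n + 1 - m = p - n - m + 1" "p - n + 1 - 1 = p - n" using k by auto
    have sx: "s p x \<in> carrier (Y (p - n + 1))" by (rule hom_deg_closed[OF s x]) simp
    have sdx: "s (p - 1) (d p x) \<in> carrier (Y (p - n))" by (rule hom_deg_closed[OF s dx]) simp
    have dsx: "d' (p - n + 1) (s p x) \<in> carrier (Y (p - n))" using Y.diff_closed[OF sx] by simp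
    have psx: "\<phi> (p - n + 1) (s p x) \<in> carrier (Z (p - n - m + 1))"
      using hom_deg_closed[OF deg sx] by (simp add: e)
    have psdx: "\<phi> (p - n) (s (p - 1) (d p x)) \<in> carrier (Z (p - n - m))"
      using hom_deg_closed[OF deg sdx] by (simp add: e)
    have pdsx: "\<phi> (p - n) (d' (p - n + 1) (s p x)) \<in> carrier (Z (p - n - m))"
      using hom_deg_closed[OF deg dsx] by (simp add: e)
    have "d'' (p - n + 1 - m) (\<phi> (p - n + 1) (s p x)) =
        msign (Z (p - n - m)) m (\<phi> (p - n) (d' (p - n + 1) (s p x)))"
      by (rule hom_cocycleD[OF \<phi> sx]) simp_all
    then have "msign (Z (p - n - m)) m (d'' (p - n - m + 1) (\<phi> (p - n + 1) (s p x))) =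
        \<phi> (p - n) (d' (p - n + 1) (s p x))"
      using pdsx by (simp add: e msign_msign[OF abZ]) (simp add: msign_def)
    then have 1: "d'' (p - n - m + 1) (msign (Z (p - n - m + 1)) m (\<phi> (p - n + 1) (s p x))) =
        \<phi> (p - n) (d' (p - n + 1) (s p x))"
      using left_hom_msign[OF abZ abZ Z.diff_hom psx] by simp
    have 2: "msign (Z (p - n - m)) k (msign (Z (p - n - m)) m (\<phi> (p - n) (s (p - 1) (d p x)))) =
        \<phi> (p - n) (msign (Y (p - n)) n (s (p - 1) (d p x)))"
      using hom_deg_msign[OF Y.chain_complex_axioms Z.chain_complex_axioms deg sdx refl, of n] k psdx
      by (simp add: msign_msign[OF abZ]) (simp add: msign_def)
    have "\<phi> (p - n) (\<psi> p x) = \<phi> (p - n) (\<psi>' p x) \<oplus>\<^bsub>Z (p - n - m)\<^esub>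
        (\<phi> (p - n) (d' (p - n + 1) (s p x)) \<oplus>\<^bsub>Z (p - n - m)\<^esub>
         \<phi> (p - n) (msign (Y (p - n)) n (s (p - 1) (d p x))))"
      using eq[OF x] hom_deg_add[OF deg _ _ refl] hom_deg_closed[OF \<psi>' x refl] dsx
        msign_closed[OF abY sdx] abelian_monoid.a_closed[OF abelian_group.axioms(1)[OF abY]]
      by simp
    then show "hom_comp X n \<phi> \<psi> p x = hom_comp X n \<phi> \<psi>' p x \<oplus>\<^bsub>Z (p - k)\<^esub>
        (d'' (p - k + 1) (t p x) \<oplus>\<^bsub>Z (p - k)\<^esub> msign (Z (p - k)) k (t (p - 1) (d p x)))"
      using x dx 1 2 by (simp add: hom_comp_def t_def e)
  qed
qed

section \<open>The endomorphism algebra of a complex\<close>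

locale endomorphism_complex = chain_complex R X d
  for R :: "('a, 'x) ring_scheme" and X :: "int => ('a, 'b) module" and d :: "int => 'b => 'b" +
  fixes \<iota> :: "'s::field => 'a"
  assumes scalar_closed: "\<iota> c \<in> carrier R"
    and scalar_central: "r \<in> carrier R ==> \<iota> c \<otimes>\<^bsub>R\<^esub> r = r \<otimes>\<^bsub>R\<^esub> \<iota> c"
begin

abbreviation "H \<equiv> hom_dga R \<iota> X d"

lemma ab: "abelian_group (X p)" by (rule abelian)

lemma a_closed: "x \<in> carrier (X p) ==> y \<in> carrier (X p) ==> x \<oplus>\<^bsub>X p\<^esub> y \<in> carrier (X p)"
  using ab by (simp add: abelian_group.axioms abelian_monoid.a_closed)

lemma hom_dga_simps:
  "gcarrier H n = hom_deg R X X n"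
  "gadd H n \<phi> \<psi> = (\<lambda>p. \<lambda>x\<in>carrier (X p). \<phi> p x \<oplus>\<^bsub>X (p - n)\<^esub> \<psi> p x)"
  "gzero H n = (\<lambda>p. \<lambda>x\<in>carrier (X p). \<zero>\<^bsub>X (p - n)\<^esub>)"
  "gscale H n c \<phi> = (\<lambda>p. \<lambda>x\<in>carrier (X p). \<iota> c \<odot>\<^bsub>X (p - n)\<^esub> \<phi> p x)"
  "gmult H m n \<phi> \<psi> = hom_comp X n \<phi> \<psi>"
  "gone H = id_hom X"
  "gdiff H n \<phi> = (\<lambda>p. \<lambda>x\<in>carrier (X p).
      d (p - n) (\<phi> p x) \<oplus>\<^bsub>X (p - (n + 1))\<^esub> msign (X (p - (n + 1))) (n + 1) (\<phi> (p - 1) (d p x)))"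
  by (simp_all add: hom_dga_def hom_deg_def hom_comp_def id_hom_def msign_def a_minus_def)
    (auto simp: fun_eq_iff restrict_def a_minus_def)

lemma sum_deg: "\<phi> \<in> hom_deg R X X n ==> \<psi> \<in> hom_deg R X X n ==> gadd H n \<phi> \<psi> \<in> hom_deg R X X n"
  by (simp add: hom_dga_simps(2) hom_deg_def left_hom_sum left_module)

lemma zero_deg: "gzero H n \<in> hom_deg R X X n"
  by (simp add: hom_dga_simps(3) hom_deg_def left_hom_zero_map left_module)

lemma scale_deg: "\<phi> \<in> hom_deg R X X n ==> gscale H n c \<phi> \<in> hom_deg R X X n"
  by (simp add: hom_dga_simps(4) hom_deg_def left_hom_scale left_module scalar_closed scalar_central)

lemma neg_deg: "\<phi> \<in> hom_deg R X X n ==> (\<lambda>p. \<lambda>x\<in>carrier (X p). \<ominus>\<^bsub>X (p - n)\<^esub> \<phi> p x) \<in> hom_deg R X X n"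
  by (simp add: hom_deg_def left_hom_neg left_module)

lemma diff_deg:
  assumes "\<phi> \<in> hom_deg R X X n"
  shows "gdiff H n \<phi> \<in> hom_deg R X X (n + 1)"
proof -
  have "gdiff H n \<phi> p \<in> left_hom R (X p) (X (p - (n + 1)))" for p
  proof -
    have 1: "(\<lambda>x\<in>carrier (X p). d (p - n) (\<phi> p x)) \<in> left_hom R (X p) (X (p - (n + 1)))"
      by (rule left_hom_compose[OF _ hom_degD[OF assms refl] left_module])
        (use diff_hom[of "p - n"] in \<open>simp add: algebra_simps\<close>)
    have 2: "(\<lambda>x\<in>carrier (X p). \<phi> (p - 1) (d p x)) \<in> left_hom R (X p) (X (p - (n + 1)))"
      by (rule left_hom_compose[OF _ diff_hom left_module]) (rule hom_degD[OF assms], simp)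
    have 3: "(\<lambda>x\<in>carrier (X p). msign (X (p - (n + 1))) (n + 1) (\<phi> (p - 1) (d p x)))
        \<in> left_hom R (X p) (X (p - (n + 1)))"
    proof (cases "even (n + 1)")
      case True
      then show ?thesis using 2 unfolding msign_def by simp
    next
      case False
      have "(\<lambda>x\<in>carrier (X p). \<ominus>\<^bsub>X (p - (n + 1))\<^esub> (\<lambda>x\<in>carrier (X p). \<phi> (p - 1) (d p x)) x)
          \<in> left_hom R (X p) (X (p - (n + 1)))"
        by (rule left_hom_neg[OF left_module left_module 2])
      moreover have "(\<lambda>x\<in>carrier (X p). \<ominus>\<^bsub>X (p - (n + 1))\<^esub> (\<lambda>x\<in>carrier (X p). \<phi> (p - 1) (d p x)) x) =
          (\<lambda>x\<in>carrier (X p). msign (X (p - (n + 1))) (n + 1) (\<phi> (p - 1) (d p x)))"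
        using False by (intro restrict_ext) (simp only: msign_def restrict_apply' if_False)
      ultimately show ?thesis by (simp only:)
    qed
    have "gdiff H n \<phi> p = (\<lambda>x\<in>carrier (X p). (\<lambda>x\<in>carrier (X p). d (p - n) (\<phi> p x)) x \<oplus>\<^bsub>X (p - (n + 1))\<^esub>
        (\<lambda>x\<in>carrier (X p). msign (X (p - (n + 1))) (n + 1) (\<phi> (p - 1) (d p x))) x)"
      unfolding hom_dga_simps(7) by (intro restrict_ext) (simp only: restrict_apply')
    then show ?thesis using left_hom_sum[OF left_module left_module 1 3] by (simp only:)
  qed
  then show ?thesis by (simp only: hom_deg_def mem_Collect_eq) blast
qed

lemma cocycles_hom_dga: "\<phi> \<in> cocycles H n \<longleftrightarrow> hom_cocycle R X d X d n \<phi>"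
proof -
  have "gdiff H n \<phi> = gzero H (n + 1) \<longleftrightarrow> (\<forall>p. \<forall>x\<in>carrier (X p). d (p - n) (\<phi> p x) =
      msign (X (p - n - 1)) n (\<phi> (p - 1) (d p x)))" if \<phi>: "\<phi> \<in> hom_deg R X X n"
  proof -
    have "gdiff H n \<phi> = gzero H (n + 1) \<longleftrightarrow>
        (\<forall>p. \<forall>x\<in>carrier (X p). gdiff H n \<phi> p x = gzero H (n + 1) p x)"
      using hom_deg_eqI[OF diff_deg[OF \<phi>] zero_deg] by auto
    also have "\<dots> \<longleftrightarrow> (\<forall>p. \<forall>x\<in>carrier (X p). d (p - n) (\<phi> p x) =
      msign (X (p - n - 1)) n (\<phi> (p - 1) (d p x)))"
    proof (intro iff_allI ball_cong refl)
      fix p x assume x: "x \<in> carrier (X p)"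
      interpret Y: abelian_group "X (p - n - 1)" by (rule ab)
      have e: "p - (n + 1) = p - n - 1" by simp
      have a: "d (p - n) (\<phi> p x) \<in> carrier (X (p - n - 1))"
        by (rule diff_closed[OF hom_deg_closed[OF \<phi> x refl] refl])
      have b: "\<phi> (p - 1) (d p x) \<in> carrier (X (p - n - 1))"
        by (rule hom_deg_closed[OF \<phi> diff_closed[OF x refl]]) simp
      have "u \<oplus>\<^bsub>X (p - n - 1)\<^esub> v = \<zero>\<^bsub>X (p - n - 1)\<^esub> \<longleftrightarrow> u = \<ominus>\<^bsub>X (p - n - 1)\<^esub> v"
        if "u \<in> carrier (X (p - n - 1))" "v \<in> carrier (X (p - n - 1))" for u v
        using that Y.minus_equality Y.l_neg by metis
      then show "gdiff H n \<phi> p x = gzero H (n + 1) p x \<longleftrightarrow>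
          d (p - n) (\<phi> p x) = msign (X (p - n - 1)) n (\<phi> (p - 1) (d p x))"
        using x a b by (simp add: hom_dga_simps e msign_def)
    qed
    finally show ?thesis .
  qed
  then show ?thesis by (auto simp: cocycles_def hom_cocycle_def hom_dga_simps(1))
qed

lemma homotopic_iff_diff:
  assumes "\<phi> \<in> hom_deg R X X n" "\<psi> \<in> hom_deg R X X n"
  shows "homotopic R X d X d n \<phi> \<psi> \<longleftrightarrow> (\<exists>s\<in>hom_deg R X X (n - 1). \<phi> = gadd H n \<psi> (gdiff H (n - 1) s))"
  unfolding homotopic_def
proof (intro bex_cong refl iffI)
  fix s assume s: "s \<in> hom_deg R X X (n - 1)"
  have e: "p - (n - 1) = p - n + 1" for p :: int by simp
  have ds: "gdiff H (n - 1) s \<in> hom_deg R X X n" using diff_deg[OF s] by simp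
  have eq: "gadd H n \<psi> (gdiff H (n - 1) s) p x = \<psi> p x \<oplus>\<^bsub>X (p - n)\<^esub>
      (d (p - n + 1) (s p x) \<oplus>\<^bsub>X (p - n)\<^esub> msign (X (p - n)) n (s (p - 1) (d p x)))" if "x \<in> carrier (X p)" for p x
    using that by (simp add: hom_dga_simps e)
  show "\<phi> = gadd H n \<psi> (gdiff H (n - 1) s)" if "\<forall>p. \<forall>x\<in>carrier (X p). \<phi> p x = \<psi> p x \<oplus>\<^bsub>X (p - n)\<^esub>
      (d (p - n + 1) (s p x) \<oplus>\<^bsub>X (p - n)\<^esub> msign (X (p - n)) n (s (p - 1) (d p x)))"
    by (rule hom_deg_eqI[OF assms(1) sum_deg[OF assms(2) ds]]) (simp only: eq that)
  show "\<forall>p. \<forall>x\<in>carrier (X p). \<phi> p x = \<psi> p x \<oplus>\<^bsub>X (p - n)\<^esub>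
      (d (p - n + 1) (s p x) \<oplus>\<^bsub>X (p - n)\<^esub> msign (X (p - n)) n (s (p - 1) (d p x)))"
    if "\<phi> = gadd H n \<psi> (gdiff H (n - 1) s)"
    using eq by (simp only: that) blast
qed

lemma coboundaries_hom_dga: "\<phi> \<in> coboundaries H n \<longleftrightarrow> \<phi> \<in> hom_deg R X X n \<and> homotopic R X d X d n \<phi> (gzero H n)"
proof -
  have z: "gadd H n (gzero H n) \<psi> = \<psi>" if "\<psi> \<in> hom_deg R X X n" for \<psi>
  proof (rule hom_deg_eqI[OF sum_deg[OF zero_deg that] that])
    fix p x assume x: "x \<in> carrier (X p)"
    interpret Y: abelian_group "X (p - n)" by (rule ab)
    show "gadd H n (gzero H n) \<psi> p x = \<psi> p x"
      using x hom_deg_closed[OF that x refl] by (simp add: hom_dga_simps)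
  qed
  have ds: "gdiff H (n - 1) s \<in> hom_deg R X X n" if "s \<in> hom_deg R X X (n - 1)" for s
    using diff_deg[OF that] by simp
  have "\<phi> \<in> coboundaries H n \<longleftrightarrow> (\<exists>s\<in>hom_deg R X X (n - 1). \<phi> = gdiff H (n - 1) s)"
    by (auto simp: coboundaries_def hom_dga_simps(1))
  also have "\<dots> \<longleftrightarrow> \<phi> \<in> hom_deg R X X n \<and> (\<exists>s\<in>hom_deg R X X (n - 1). \<phi> = gadd H n (gzero H n) (gdiff H (n - 1) s))"
    using z ds by metis
  finally show ?thesis using homotopic_iff_diff[OF _ zero_deg] by blast
qed

sublocale H: dga H
proof unfold_locales
  fix n :: int and \<phi> \<psi> \<rho>
  assume "\<phi> \<in> gcarrier H n" "\<psi> \<in> gcarrier H n"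
  then have deg: "\<phi> \<in> hom_deg R X X n" "\<psi> \<in> hom_deg R X X n" by (simp_all only: hom_dga_simps(1))
  show "gadd H n \<phi> \<psi> \<in> gcarrier H n" using deg by (simp only: hom_dga_simps(1) sum_deg)
  have cl: "\<phi> p x \<in> carrier (X (p - n))" "\<psi> p x \<in> carrier (X (p - n))" if "x \<in> carrier (X p)" for p x
    using deg that by (auto intro: hom_deg_closed)
  show "gadd H n \<phi> \<psi> = gadd H n \<psi> \<phi>"
  proof (rule hom_deg_eqI[OF sum_deg[OF deg] sum_deg[OF deg(2,1)]])
    fix p x assume x: "x \<in> carrier (X p)"
    interpret Y: abelian_group "X (p - n)" by (rule ab)
    show "gadd H n \<phi> \<psi> p x = gadd H n \<psi> \<phi> p x" using x cl by (simp add: hom_dga_simps Y.a_comm)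
  qed
  show "gscale H n c (gadd H n \<phi> \<psi>) = gadd H n (gscale H n c \<phi>) (gscale H n c \<psi>)" for c
  proof (rule hom_deg_eqI[OF scale_deg[OF sum_deg[OF deg]] sum_deg[OF scale_deg scale_deg, OF deg]])
    fix p x assume x: "x \<in> carrier (X p)"
    interpret Y: left_module R "X (p - n)" by (rule left_module)
    show "gscale H n c (gadd H n \<phi> \<psi>) p x = gadd H n (gscale H n c \<phi>) (gscale H n c \<psi>) p x"
      using x cl scalar_closed by (simp add: hom_dga_simps Y.lsmult_r_distr)
  qed
  show "gdiff H n (gadd H n \<phi> \<psi>) = gadd H (n + 1) (gdiff H n \<phi>) (gdiff H n \<psi>)"
  proof (rule hom_deg_eqI[OF diff_deg[OF sum_deg[OF deg]] sum_deg[OF diff_deg diff_deg, OF deg]])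
    fix p x assume x: "x \<in> carrier (X p)"
    interpret Y: abelian_group "X (p - (n + 1))" by (rule ab)
    have dx: "d p x \<in> carrier (X (p - 1))" using diff_closed x by simp
    have e: "p - 1 - n = p - (n + 1)" by simp
    have c: "d (p - n) (\<phi> p x) \<in> carrier (X (p - (n + 1)))" "d (p - n) (\<psi> p x) \<in> carrier (X (p - (n + 1)))"
      "\<phi> (p - 1) (d p x) \<in> carrier (X (p - (n + 1)))" "\<psi> (p - 1) (d p x) \<in> carrier (X (p - (n + 1)))"
      by (auto intro!: diff_closed cl x hom_deg_closed[OF deg(1)] hom_deg_closed[OF deg(2)] dx)
    have m: "msign (X (p - (n + 1))) (n + 1) (\<phi> (p - 1) (d p x)) \<in> carrier (X (p - (n + 1)))"
      "msign (X (p - (n + 1))) (n + 1) (\<psi> (p - 1) (d p x)) \<in> carrier (X (p - (n + 1)))"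
      using c msign_closed[OF ab] by blast+
    have "d (p - n) (\<phi> p x \<oplus>\<^bsub>X (p - n)\<^esub> \<psi> p x) = d (p - n) (\<phi> p x) \<oplus>\<^bsub>X (p - (n + 1))\<^esub> d (p - n) (\<psi> p x)"
      by (rule diff_add[OF cl(1)[OF x] cl(2)[OF x]]) simp
    then show "gdiff H n (gadd H n \<phi> \<psi>) p x = gadd H (n + 1) (gdiff H n \<phi>) (gdiff H n \<psi>) p x"
      using x dx c m by (simp only: hom_dga_simps restrict_apply' e msign_add[OF ab] Y.a_ac Y.a_closed)
  qed
next
  fix n :: int and \<phi> \<psi> \<rho>
  assume "\<phi> \<in> gcarrier H n" "\<psi> \<in> gcarrier H n" "\<rho> \<in> gcarrier H n"
  then have deg: "\<phi> \<in> hom_deg R X X n" "\<psi> \<in> hom_deg R X X n" "\<rho> \<in> hom_deg R X X n"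
    by (simp_all only: hom_dga_simps(1))
  show "gadd H n (gadd H n \<phi> \<psi>) \<rho> = gadd H n \<phi> (gadd H n \<psi> \<rho>)"
  proof (rule hom_deg_eqI[OF sum_deg[OF sum_deg[OF deg(1,2)] deg(3)] sum_deg[OF deg(1) sum_deg[OF deg(2,3)]]])
    fix p x assume x: "x \<in> carrier (X p)"
    interpret Y: abelian_group "X (p - n)" by (rule ab)
    show "gadd H n (gadd H n \<phi> \<psi>) \<rho> p x = gadd H n \<phi> (gadd H n \<psi> \<rho>) p x"
      using x deg[THEN hom_deg_closed, OF x refl] by (simp add: hom_dga_simps Y.a_assoc)
  qed
next
  fix n :: int
  show "gzero H n \<in> gcarrier H n" by (simp only: hom_dga_simps(1) zero_deg)
next
  fix n :: int and \<phi> assume "\<phi> \<in> gcarrier H n"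
  then have deg: "\<phi> \<in> hom_deg R X X n" by (simp only: hom_dga_simps(1))
  show "gadd H n \<phi> (gzero H n) = \<phi>"
  proof (rule hom_deg_eqI[OF sum_deg[OF deg zero_deg] deg])
    fix p x assume x: "x \<in> carrier (X p)"
    interpret Y: abelian_group "X (p - n)" by (rule ab)
    show "gadd H n \<phi> (gzero H n) p x = \<phi> p x"
      using x hom_deg_closed[OF deg x refl] by (simp add: hom_dga_simps)
  qed
  show "\<exists>\<psi>\<in>gcarrier H n. gadd H n \<phi> \<psi> = gzero H n"
  proof (rule bexI)
    show "(\<lambda>p. \<lambda>x\<in>carrier (X p). \<ominus>\<^bsub>X (p - n)\<^esub> \<phi> p x) \<in> gcarrier H n"
      using neg_deg[OF deg] by (simp only: hom_dga_simps(1))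
    show "gadd H n \<phi> (\<lambda>p. \<lambda>x\<in>carrier (X p). \<ominus>\<^bsub>X (p - n)\<^esub> \<phi> p x) = gzero H n"
    proof (rule hom_deg_eqI[OF sum_deg[OF deg neg_deg[OF deg]] zero_deg])
      fix p x assume x: "x \<in> carrier (X p)"
      interpret Y: abelian_group "X (p - n)" by (rule ab)
      show "gadd H n \<phi> (\<lambda>p. \<lambda>x\<in>carrier (X p). \<ominus>\<^bsub>X (p - n)\<^esub> \<phi> p x) p x = gzero H n p x"
        using x hom_deg_closed[OF deg x refl] by (simp add: hom_dga_simps Y.r_neg)
    qed
  qed
  show "gdiff H n \<phi> \<in> gcarrier H (n + 1)" using diff_deg[OF deg] by (simp only: hom_dga_simps(1))
  show "gdiff H (n + 1) (gdiff H n \<phi>) = gzero H (n + 1 + 1)"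
  proof (rule hom_deg_eqI[OF diff_deg[OF diff_deg[OF deg]] zero_deg])
    fix p x assume x: "x \<in> carrier (X p)"
    have dx: "d p x \<in> carrier (X (p - 1))" using diff_closed x by simp
    let ?Y = "X (p - (n + 1 + 1))" and ?Z = "X (p - (n + 1))"
    interpret Y: abelian_group ?Y by (rule ab)
    have px: "\<phi> p x \<in> carrier (X (p - n))" by (rule hom_deg_closed[OF deg x refl])
    have pdx: "\<phi> (p - 1) (d p x) \<in> carrier ?Z" by (rule hom_deg_closed[OF deg dx]) simp
    have dpx: "d (p - n) (\<phi> p x) \<in> carrier ?Z" by (rule diff_closed[OF px]) simp
    have dpdx: "d (p - (n + 1)) (\<phi> (p - 1) (d p x)) \<in> carrier ?Y" by (rule diff_closed[OF pdx]) simp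
    have m: "msign ?Z (n + 1) (\<phi> (p - 1) (d p x)) \<in> carrier ?Z" by (rule msign_closed[OF ab pdx])
    have 1: "d (p - (n + 1)) (d (p - n) (\<phi> p x)) = \<zero>\<^bsub>?Y\<^esub>" by (rule diff_diff'[OF px]) simp_all
    have 2: "d (p - (n + 1)) (d (p - n) (\<phi> p x) \<oplus>\<^bsub>?Z\<^esub> msign ?Z (n + 1) (\<phi> (p - 1) (d p x))) =
        d (p - (n + 1)) (d (p - n) (\<phi> p x)) \<oplus>\<^bsub>?Y\<^esub> d (p - (n + 1)) (msign ?Z (n + 1) (\<phi> (p - 1) (d p x)))"
      by (rule diff_add[OF dpx m]) simp
    have 3: "d (p - (n + 1)) (msign ?Z (n + 1) (\<phi> (p - 1) (d p x))) =
        msign ?Y (n + 1) (d (p - (n + 1)) (\<phi> (p - 1) (d p x)))"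
      using diff_minus[OF pdx, of "p - (n + 1 + 1)"] by (simp add: msign_def)
    have 4: "\<phi> (p - 1 - 1) (d (p - 1) (d p x)) = \<zero>\<^bsub>?Y\<^esub>"
    proof -
      have "d (p - 1) (d p x) = \<zero>\<^bsub>X (p - 1 - 1)\<^esub>" by (rule diff_diff'[OF x]) simp_all
      moreover have "\<phi> (p - 1 - 1) \<in> left_hom R (X (p - 1 - 1)) ?Y" by (rule hom_degD[OF deg]) simp
      ultimately show ?thesis using left_hom_zero[OF ab ab] by metis
    qed
    have e: "p - 1 - n = p - (n + 1)" "p - 1 - (n + 1) = p - (n + 1 + 1)" by simp_all
    have "gdiff H n \<phi> (p - 1) (d p x) = d (p - (n + 1)) (\<phi> (p - 1) (d p x)) \<oplus>\<^bsub>?Y\<^esub>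
        msign ?Y (n + 1) \<zero>\<^bsub>?Y\<^esub>"
      using dx by (simp only: hom_dga_simps(7) restrict_apply' e 4)
    also have "msign ?Y (n + 1) \<zero>\<^bsub>?Y\<^esub> = \<zero>\<^bsub>?Y\<^esub>"
      by (simp only: msign_def Y.minus_equality[OF Y.l_zero[OF Y.zero_closed] Y.zero_closed Y.zero_closed] if_cancel)
    finally have 5: "gdiff H n \<phi> (p - 1) (d p x) = d (p - (n + 1)) (\<phi> (p - 1) (d p x))"
      by (simp only: Y.r_zero[OF dpdx])
    have "gdiff H (n + 1) (gdiff H n \<phi>) p x = d (p - (n + 1)) (gdiff H n \<phi> p x) \<oplus>\<^bsub>?Y\<^esub>
        msign ?Y (n + 1 + 1) (gdiff H n \<phi> (p - 1) (d p x))"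
      using x by (simp only: hom_dga_simps(7)[of "n + 1"] restrict_apply')
    also have "d (p - (n + 1)) (gdiff H n \<phi> p x) = msign ?Y (n + 1) (d (p - (n + 1)) (\<phi> (p - 1) (d p x)))"
      using x by (simp only: hom_dga_simps(7)[of n] restrict_apply' 2 1 3 Y.l_zero[OF msign_closed[OF ab dpdx]])
    also have "\<dots> \<oplus>\<^bsub>?Y\<^esub> msign ?Y (n + 1 + 1) (gdiff H n \<phi> (p - 1) (d p x)) = \<zero>\<^bsub>?Y\<^esub>"
    proof -
      have "even (n + 1 + 1) \<longleftrightarrow> odd (n + 1)" by simp
      then show ?thesis
        by (cases "even (n + 1)") (simp_all only: 5 msign_def if_True if_False not_True_eq_False
          not_False_eq_True Y.l_neg[OF dpdx] Y.r_neg[OF dpdx])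
    qed
    finally show "gdiff H (n + 1) (gdiff H n \<phi>) p x = gzero H (n + 1 + 1) p x"
      using x by (simp only: hom_dga_simps(3) restrict_apply')
  qed
  fix c
  show "gscale H n c \<phi> \<in> gcarrier H n" using scale_deg[OF deg] by (simp only: hom_dga_simps(1))
  show "gdiff H n (gscale H n c \<phi>) = gscale H (n + 1) c (gdiff H n \<phi>)"
  proof (rule hom_deg_eqI[OF diff_deg[OF scale_deg[OF deg]] scale_deg[OF diff_deg[OF deg]]])
    fix p x assume x: "x \<in> carrier (X p)"
    let ?Y = "X (p - (n + 1))"
    interpret Y: left_module R ?Y by (rule left_module)
    have dx: "d p x \<in> carrier (X (p - 1))" using diff_closed x by simp
    have e: "p - 1 - n = p - (n + 1)" by simp
    have px: "\<phi> p x \<in> carrier (X (p - n))" by (rule hom_deg_closed[OF deg x refl])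
    have pdx: "\<phi> (p - 1) (d p x) \<in> carrier ?Y" by (rule hom_deg_closed[OF deg dx]) simp
    have dpx: "d (p - n) (\<phi> p x) \<in> carrier ?Y" by (rule diff_closed[OF px]) simp
    have 1: "d (p - n) (\<iota> c \<odot>\<^bsub>X (p - n)\<^esub> \<phi> p x) = \<iota> c \<odot>\<^bsub>?Y\<^esub> d (p - n) (\<phi> p x)"
      using left_hom_smult[OF diff_hom scalar_closed px] by (simp add: algebra_simps)
    have 2: "msign ?Y (n + 1) (\<iota> c \<odot>\<^bsub>?Y\<^esub> \<phi> (p - 1) (d p x)) = \<iota> c \<odot>\<^bsub>?Y\<^esub> msign ?Y (n + 1) (\<phi> (p - 1) (d p x))"
      using pdx by (simp add: msign_def Y.smult_minus scalar_closed)
    show "gdiff H n (gscale H n c \<phi>) p x = gscale H (n + 1) c (gdiff H n \<phi>) p x"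
      using x dx by (simp only: hom_dga_simps(4,7) restrict_apply' e 1 2
          Y.lsmult_r_distr[OF scalar_closed dpx msign_closed[OF ab pdx]])
  qed
next
  fix m n :: int and \<phi> \<psi> assume "\<phi> \<in> gcarrier H m" "\<psi> \<in> gcarrier H n"
  then have deg: "\<phi> \<in> hom_deg R X X m" "\<psi> \<in> hom_deg R X X n" by (simp_all only: hom_dga_simps(1))
  show "gmult H m n \<phi> \<psi> \<in> gcarrier H (m + n)"
    unfolding hom_dga_simps by (rule hom_comp_deg[OF chain_complex_axioms deg refl])
next
  fix m n :: int and \<phi> \<psi> \<rho> assume "\<phi> \<in> gcarrier H m" "\<psi> \<in> gcarrier H m" "\<rho> \<in> gcarrier H n"
  then have deg: "\<phi> \<in> hom_deg R X X m" "\<psi> \<in> hom_deg R X X m" "\<rho> \<in> hom_deg R X X n"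
    by (simp_all only: hom_dga_simps(1))
  have e: "p - n - m = p - (m + n)" for p by simp
  show "gmult H m n (gadd H m \<phi> \<psi>) \<rho> = gadd H (m + n) (gmult H m n \<phi> \<rho>) (gmult H m n \<psi> \<rho>)"
    using hom_deg_closed[OF deg(3) _ refl] by (auto simp: hom_dga_simps hom_comp_def fun_eq_iff restrict_def e)
next
  fix m n :: int and \<phi> \<psi> \<rho> assume "\<phi> \<in> gcarrier H m" "\<psi> \<in> gcarrier H n" "\<rho> \<in> gcarrier H n"
  then have deg: "\<phi> \<in> hom_deg R X X m" "\<psi> \<in> hom_deg R X X n" "\<rho> \<in> hom_deg R X X n"
    by (simp_all only: hom_dga_simps(1))
  have e: "p - n - m = p - (m + n)" for p by simp
  have a: "\<phi> (p - n) (\<psi> p x \<oplus>\<^bsub>X (p - n)\<^esub> \<rho> p x) = \<phi> (p - n) (\<psi> p x) \<oplus>\<^bsub>X (p - (m + n))\<^esub> \<phi> (p - n) (\<rho> p x)"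
    if x: "x \<in> carrier (X p)" for p x
    by (rule hom_deg_add[OF deg(1) hom_deg_closed[OF deg(2) x refl] hom_deg_closed[OF deg(3) x refl]]) simp
  show "gmult H m n \<phi> (gadd H n \<psi> \<rho>) = gadd H (m + n) (gmult H m n \<phi> \<psi>) (gmult H m n \<phi> \<rho>)"
    using a by (auto simp: hom_dga_simps hom_comp_def fun_eq_iff restrict_def)
next
  fix m n :: int and \<phi> \<psi> assume "\<phi> \<in> cocycles H m" "\<psi> \<in> cocycles H n"
  then show "gmult H m n \<phi> \<psi> \<in> cocycles H (m + n)"
    using hom_cocycle_comp[OF chain_complex_axioms chain_complex_axioms chain_complex_axioms _ _ refl]
    by (simp add: cocycles_hom_dga hom_dga_simps(5))
next
  fix m n :: int and \<phi> \<psi> assume \<phi>: "\<phi> \<in> cocycles H m" and \<psi>: "\<psi> \<in> coboundaries H n"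
  have deg: "\<phi> \<in> hom_deg R X X m" using \<phi> by (simp add: cocycles_hom_dga hom_cocycle_def)
  have z: "hom_comp X n \<phi> (gzero H n) = gzero H (m + n)"
  proof (rule hom_deg_eqI[OF hom_comp_deg[OF chain_complex_axioms deg zero_deg refl] zero_deg])
    fix p x assume x: "x \<in> carrier (X p)"
    have "\<phi> (p - n) \<in> left_hom R (X (p - n)) (X (p - (m + n)))" by (rule hom_degD[OF deg]) simp
    then show "hom_comp X n \<phi> (gzero H n) p x = gzero H (m + n) p x"
      using x left_hom_zero[OF ab ab] by (simp add: hom_comp_def hom_dga_simps)
  qed
  show "gmult H m n \<phi> \<psi> \<in> coboundaries H (m + n)"
    using homotopic_comp_left[OF chain_complex_axioms chain_complex_axioms chain_complex_axioms _ _ zero_deg refl, of m \<phi> n \<psi>]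
      \<phi> \<psi> deg hom_comp_deg[OF chain_complex_axioms deg _ refl]
    by (simp add: cocycles_hom_dga coboundaries_hom_dga hom_dga_simps(5) z)
next
  fix m n :: int and \<phi> \<psi> assume \<phi>: "\<phi> \<in> coboundaries H m" and \<psi>: "\<psi> \<in> cocycles H n"
  have deg: "\<psi> \<in> hom_deg R X X n" using \<psi> by (simp add: cocycles_hom_dga hom_cocycle_def)
  have e: "p - n - m = p - (m + n)" for p by simp
  have z: "hom_comp X n (gzero H m) \<psi> = gzero H (m + n)"
    using hom_deg_closed[OF deg _ refl] by (auto simp: hom_comp_def hom_dga_simps fun_eq_iff restrict_def e)
  show "gmult H m n \<phi> \<psi> \<in> coboundaries H (m + n)"
    using homotopic_comp_right[OF chain_complex_axioms chain_complex_axioms chain_complex_axioms _ _ refl, of m \<phi> "gzero H m" n \<psi>]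
      \<phi> \<psi> deg hom_comp_deg[OF chain_complex_axioms _ deg refl, of \<phi> X m]
    by (simp add: cocycles_hom_dga coboundaries_hom_dga hom_dga_simps(5) z)
next
  show "gone H \<in> cocycles H 0"
    using id_hom_cocycle[OF chain_complex_axioms] by (simp add: cocycles_hom_dga hom_dga_simps(6))
qed

lemma cohomologous_iff:
  "\<phi> \<in> hom_deg R X X n ==> \<psi> \<in> hom_deg R X X n ==>
    H.cohomologous n \<phi> \<psi> \<longleftrightarrow> homotopic R X d X d n \<phi> \<psi>"
  unfolding H.cohomologous_def by (subst homotopic_iff_diff) (auto simp: coboundaries_def hom_dga_simps(1))

end

section \<open>Projective resolutions\<close>

lemma projective_left_module_imp: "projective_left_module R M ==> left_module R M"
  by (simp add: projective_left_module_def)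

locale resolution =
  fixes R :: "('a, 'x) ring_scheme" and B :: "('a, 'b) module" and P :: "int => ('a, 'p) module"
    and d :: "int => 'p => 'p" and \<epsilon> :: "'p => 'b"
  assumes res: "projective_resolution R B P d \<epsilon>"
begin

lemma projective: "projective_left_module R (P n)"
  and negative: "n < 0 ==> carrier (P n) = {\<zero>\<^bsub>P n\<^esub>}"
  and d_hom: "d n \<in> left_hom R (P n) (P (n - 1))"
  and augmentation_hom: "\<epsilon> \<in> left_hom R (P 0) B"
  and augmentation_surj: "\<epsilon> ` carrier (P 0) = carrier B"
  and augmentation_kernel: "{x \<in> carrier (P 0). \<epsilon> x = \<zero>\<^bsub>B\<^esub>} = d 1 ` carrier (P 1)"
  and exact: "n \<ge> 1 ==> {x \<in> carrier (P n). d n x = \<zero>\<^bsub>P (n - 1)\<^esub>} = d (n + 1) ` carrier (P (n + 1))"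
  using res by (simp_all add: projective_resolution_def)

sublocale chain_complex R P d
proof (rule chain_complex.intro)
  show "left_module R (P n)" for n using projective projective_left_module_imp by blast
  show "d n \<in> left_hom R (P n) (P (n - 1))" for n by (rule d_hom)
  fix n x assume x: "x \<in> carrier (P n)"
  have dx: "d n x \<in> carrier (P (n - 1))" using left_hom_closed[OF d_hom x] .
  show "d (n - 1) (d n x) = \<zero>\<^bsub>P (n - 2)\<^esub>"
  proof (cases "n \<ge> 2")
    case True
    have "d n x \<in> d (n - 1 + 1) ` carrier (P (n - 1 + 1))" using x by simp
    then have "d n x \<in> {x \<in> carrier (P (n - 1)). d (n - 1) x = \<zero>\<^bsub>P (n - 1 - 1)\<^esub>}"
      using exact[of "n - 1"] True by simp
    then show ?thesis by simp
  next
    case False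
    have "d (n - 1) (d n x) \<in> carrier (P (n - 1 - 1))" by (rule left_hom_closed[OF d_hom dx])
    then show ?thesis using False negative[of "n - 2"] by simp
  qed
qed

end

text \<open>The family is built degree by degree. The hypothesis carried along is that the composite with
  the next differential lands in the image of the differential of the target, which is what
  projectivity needs in order to lift.\<close>

lemma resolution_comparison:
  fixes P :: "int => ('a, 'p) module" and Q :: "int => ('a, 'q) module"
  assumes "resolution R B P d \<epsilon>" and "resolution R B Q d' \<epsilon>'" and B: "left_module R B"
  shows "\<exists>v. hom_cocycle R P d Q d' 0 v \<and> (\<forall>x\<in>carrier (P 0). \<epsilon>' (v 0 x) = \<epsilon> x)"
proof -
  interpret P: resolution R B P d \<epsilon> by fact
  interpret Q: resolution R B Q d' \<epsilon>' by fact
  define good where "good n f \<longleftrightarrow> f \<in> left_hom R (P (int n)) (Q (int n)) \<and>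
    (\<forall>x\<in>carrier (P (int n + 1)). f (d (int n + 1) x) \<in> d' (int n + 1) ` carrier (Q (int n + 1)))
    \<and> (n = 0 \<longrightarrow> (\<forall>x\<in>carrier (P 0). \<epsilon>' (f x) = \<epsilon> x))" for n f
  have "\<exists>f. good 0 f"
  proof -
    obtain f where f: "f \<in> left_hom R (P 0) (Q 0)" "\<And>x. x \<in> carrier (P 0) ==> \<epsilon>' (f x) = \<epsilon> x"
      using projective_lift[OF P.projective Q.left_module B P.augmentation_hom Q.augmentation_hom]
        P.augmentation_surj Q.augmentation_surj by auto
    have "f (d 1 x) \<in> d' 1 ` carrier (Q 1)" if "x \<in> carrier (P 1)" for x
    proof -
      have "d 1 x \<in> {x \<in> carrier (P 0). \<epsilon> x = \<zero>\<^bsub>B\<^esub>}" using that P.augmentation_kernel by simp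
      then have "f (d 1 x) \<in> {x \<in> carrier (Q 0). \<epsilon>' x = \<zero>\<^bsub>B\<^esub>}"
        using f left_hom_closed[OF f(1)] by simp
      then show ?thesis using Q.augmentation_kernel by simp
    qed
    then show ?thesis using f by (auto simp: good_def)
  qed
  moreover have "\<exists>g. good (Suc n) g \<and> (\<forall>x\<in>carrier (P (int n + 1)). d' (int n + 1) (g x) = f (d (int n + 1) x))"
    if f: "good n f" for n f
  proof -
    let ?m = "int n + 1"
    have hom: "(\<lambda>x\<in>carrier (P ?m). f (d ?m x)) \<in> left_hom R (P ?m) (Q (int n))"
      using f P.diff_hom[of ?m] by (intro left_hom_compose[of f R "P (int n)"] P.left_module) (auto simp: good_def)
    have d': "d' ?m \<in> left_hom R (Q ?m) (Q (int n))" using Q.diff_hom[of ?m] by simp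
    obtain g where g: "g \<in> left_hom R (P ?m) (Q ?m)"
      "\<And>x. x \<in> carrier (P ?m) ==> d' ?m (g x) = f (d ?m x)"
    proof -
      have "(\<lambda>x\<in>carrier (P ?m). f (d ?m x)) ` carrier (P ?m) \<subseteq> d' ?m ` carrier (Q ?m)"
        using f by (auto simp: good_def)
      then show ?thesis
        using that projective_lift[OF P.projective Q.left_module Q.left_module hom d'] by auto
    qed
    have "g (d (?m + 1) x) \<in> d' (?m + 1) ` carrier (Q (?m + 1))" if x: "x \<in> carrier (P (?m + 1))" for x
    proof -
      have dx: "d (?m + 1) x \<in> carrier (P ?m)" by (rule P.diff_closed[OF x]) simp
      have "d ?m (d (?m + 1) x) = \<zero>\<^bsub>P (int n)\<^esub>" by (rule P.diff_diff'[OF x]) simp_all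
      moreover have "f \<zero>\<^bsub>P (int n)\<^esub> = \<zero>\<^bsub>Q (int n)\<^esub>"
      proof -
        have "f \<in> left_hom R (P (int n)) (Q (int n))" using f by (simp add: good_def)
        then show ?thesis by (rule left_hom_zero[OF P.abelian Q.abelian])
      qed
      ultimately have "d' ?m (g (d (?m + 1) x)) = \<zero>\<^bsub>Q (?m - 1)\<^esub>" using g(2)[OF dx] by simp
      then have "g (d (?m + 1) x) \<in> {x \<in> carrier (Q ?m). d' ?m x = \<zero>\<^bsub>Q (?m - 1)\<^esub>}"
        using left_hom_closed[OF g(1) dx] by simp
      also have "\<dots> = d' (?m + 1) ` carrier (Q (?m + 1))" using Q.exact[of ?m] by simp
      finally show ?thesis .
    qed
    then show ?thesis using g by (auto simp: good_def add.commute)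
  qed
  ultimately have "\<exists>w. \<forall>n. good n (w n) \<and> (\<forall>x\<in>carrier (P (int n + 1)). d' (int n + 1) (w (Suc n) x) = w n (d (int n + 1) x))"
    by (intro dependent_nat_choice) auto
  then obtain w where w: "\<And>n. good n (w n)"
    "\<And>n x. x \<in> carrier (P (int n + 1)) ==> d' (int n + 1) (w (Suc n) x) = w n (d (int n + 1) x)" by blast
  define v where "v p = (if p < 0 then \<lambda>x\<in>carrier (P p). \<zero>\<^bsub>Q p\<^esub> else w (nat p))" for p
  have v_hom: "v p \<in> left_hom R (P p) (Q p)" for p
  proof -
    have "w n \<in> left_hom R (P (int n)) (Q (int n))" for n using w(1)[of n] by (simp add: good_def)
    from this[of "nat p"] show ?thesis
      using left_hom_zero_map[OF P.left_module Q.left_module] by (cases "p < 0") (simp_all add: v_def)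
  qed
  have "d' p (v p x) = v (p - 1) (d p x)" if x: "x \<in> carrier (P p)" for p x
  proof (cases "p \<ge> 1")
    case True
    then obtain n where "p = int n + 1" by (metis add.commute zle_iff_zadd)
    then show ?thesis using w(2)[of x n] x by (simp add: v_def nat_add_distrib)
  next
    case False
    have "carrier (Q (p - 1)) = {\<zero>\<^bsub>Q (p - 1)\<^esub>}" using False Q.negative by simp
    moreover have "d' p (v p x) \<in> carrier (Q (p - 1))"
      by (rule Q.diff_closed[OF left_hom_closed[OF v_hom x] refl])
    moreover have "v (p - 1) (d p x) \<in> carrier (Q (p - 1))"
      by (rule left_hom_closed[OF v_hom P.diff_closed[OF x refl]])
    ultimately show ?thesis by simp
  qed
  moreover have "\<forall>x\<in>carrier (P 0). \<epsilon>' (v 0 x) = \<epsilon> x" using w(1)[of 0] by (simp add: v_def good_def)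
  ultimately show ?thesis
    using v_hom by (intro exI[of _ v]) (simp add: hom_cocycle_def hom_deg_def msign_def)
qed

text \<open>The difference of two lifts of the same map is built up as a boundary degree by degree, again
  because the modules of the source are projective and the target is exact.\<close>

lemma resolution_homotopy:
  fixes P :: "int => ('a, 'p) module" and Q :: "int => ('a, 'q) module"
  assumes "resolution R B P d \<epsilon>" and "resolution R B Q d' \<epsilon>'" and B: "left_module R B"
    and w: "hom_cocycle R P d Q d' 0 w" and w': "hom_cocycle R P d Q d' 0 w'"
    and eq: "\<And>x. x \<in> carrier (P 0) ==> \<epsilon>' (w 0 x) = \<epsilon>' (w' 0 x)"
  shows "homotopic R P d Q d' 0 w w'"
proof -
  interpret P: resolution R B P d \<epsilon> by fact
  interpret Q: resolution R B Q d' \<epsilon>' by fact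
  interpret B: left_module R B by fact
  interpret Qm: left_module R "Q n" for n by (rule Q.left_module)
  define u where "u p = (\<lambda>x\<in>carrier (P p). w p x \<ominus>\<^bsub>Q p\<^esub> w' p x)" for p
  have w_hom: "w p \<in> left_hom R (P p) (Q p)" "w' p \<in> left_hom R (P p) (Q p)" for p
    using w w' by (simp_all add: hom_cocycle_def hom_deg_def)
  have w_diff: "d' p (w p x) = w (p - 1) (d p x)" "d' p (w' p x) = w' (p - 1) (d p x)"
    if "x \<in> carrier (P p)" for p x
    using w w' that by (simp_all add: hom_cocycle_def msign_def)
  have sub_hom: "(\<lambda>x\<in>carrier (P p). f x \<ominus>\<^bsub>Q q\<^esub> g x) \<in> left_hom R (P p) (Q q)"
    if "f \<in> left_hom R (P p) (Q q)" "g \<in> left_hom R (P p) (Q q)" for f g p q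
  proof -
    have "(\<lambda>x\<in>carrier (P p). f x \<ominus>\<^bsub>Q q\<^esub> g x) =
        (\<lambda>x\<in>carrier (P p). f x \<oplus>\<^bsub>Q q\<^esub> (\<lambda>x\<in>carrier (P p). \<ominus>\<^bsub>Q q\<^esub> g x) x)"
      by (auto simp: a_minus_def)
    then show ?thesis
      using left_hom_sum[OF P.left_module Q.left_module that(1) left_hom_neg[OF P.left_module Q.left_module that(2)]]
      by simp
  qed
  have u_hom: "u p \<in> left_hom R (P p) (Q p)" for p unfolding u_def by (rule sub_hom[OF w_hom])
  have u_diff: "d' p (u p x) = u (p - 1) (d p x)" if x: "x \<in> carrier (P p)" for p x
    using x w_diff[OF x] left_hom_diff[OF Q.abelian Q.abelian Q.diff_hom, of "w p x" p "w' p x"]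
      left_hom_closed[OF w_hom(1) x] left_hom_closed[OF w_hom(2) x] P.diff_closed[OF x refl]
    by (simp add: u_def)
  have u0: "\<epsilon>' (u 0 x) = \<zero>\<^bsub>B\<^esub>" if x: "x \<in> carrier (P 0)" for x
    using x eq[OF x] left_hom_diff[OF Q.abelian B.M.abelian_group_axioms Q.augmentation_hom, of "w 0 x" "w' 0 x"]
      left_hom_closed[OF w_hom(1) x] left_hom_closed[OF w_hom(2) x] left_hom_closed[OF Q.augmentation_hom]
    by (simp add: u_def a_minus_def B.M.r_neg)
  define good where "good n s \<longleftrightarrow> s \<in> left_hom R (P (int n)) (Q (int n + 1)) \<and>
    (\<forall>x\<in>carrier (P (int n + 1)). u (int n + 1) x \<ominus>\<^bsub>Q (int n + 1)\<^esub> s (d (int n + 1) x)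
      \<in> d' (int n + 2) ` carrier (Q (int n + 2)))
    \<and> (n = 0 \<longrightarrow> (\<forall>x\<in>carrier (P 0). d' 1 (s x) = u 0 x))" for n s
  have "\<exists>s. good 0 s"
  proof -
    have d1: "d' 1 \<in> left_hom R (Q 1) (Q 0)" using Q.diff_hom[of 1] by simp
    have "u 0 ` carrier (P 0) \<subseteq> d' 1 ` carrier (Q 1)"
      using u0 left_hom_closed[OF u_hom, of _ 0] Q.augmentation_kernel by blast
    then obtain s where s: "s \<in> left_hom R (P 0) (Q 1)" "\<And>x. x \<in> carrier (P 0) ==> d' 1 (s x) = u 0 x"
      using projective_lift[OF P.projective Q.left_module Q.left_module u_hom d1] by auto
    have "u 1 x \<ominus>\<^bsub>Q 1\<^esub> s (d 1 x) \<in> d' 2 ` carrier (Q 2)" if x: "x \<in> carrier (P 1)" for x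
    proof -
      have dx: "d 1 x \<in> carrier (P 0)" by (rule P.diff_closed[OF x]) simp
      have c: "u 1 x \<in> carrier (Q 1)" "s (d 1 x) \<in> carrier (Q 1)"
        using left_hom_closed[OF u_hom x] left_hom_closed[OF s(1) dx] by auto
      have "d' 1 (u 1 x \<ominus>\<^bsub>Q 1\<^esub> s (d 1 x)) = d' 1 (u 1 x) \<ominus>\<^bsub>Q 0\<^esub> d' 1 (s (d 1 x))"
        by (rule left_hom_diff[OF Q.abelian Q.abelian d1 c])
      also have "\<dots> = \<zero>\<^bsub>Q 0\<^esub>"
        using u_diff[OF x] s(2)[OF dx] left_hom_closed[OF u_hom dx] by (simp add: a_minus_def Qm.M.r_neg)
      finally have "u 1 x \<ominus>\<^bsub>Q 1\<^esub> s (d 1 x) \<in> {x \<in> carrier (Q 1). d' 1 x = \<zero>\<^bsub>Q (1 - 1)\<^esub>}"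
        using c by simp
      also have "\<dots> = d' 2 ` carrier (Q 2)" using Q.exact[of 1] by simp
      finally show ?thesis .
    qed
    then show ?thesis using s by (auto simp: good_def)
  qed
  moreover have "\<exists>t. good (Suc n) t \<and> (\<forall>x\<in>carrier (P (int n + 1)). d' (int n + 2) (t x) =
      u (int n + 1) x \<ominus>\<^bsub>Q (int n + 1)\<^esub> s (d (int n + 1) x))"
    if s: "good n s" for n s
  proof -
    let ?m = "int n + 1"
    have s_hom: "s \<in> left_hom R (P (int n)) (Q ?m)" using s by (simp add: good_def)
    have sd: "(\<lambda>x\<in>carrier (P ?m). s (d ?m x)) \<in> left_hom R (P ?m) (Q ?m)"
      using P.diff_hom[of ?m] by (intro left_hom_compose[OF s_hom] P.left_module) simp
    have hom: "(\<lambda>x\<in>carrier (P ?m). u ?m x \<ominus>\<^bsub>Q ?m\<^esub> (\<lambda>x\<in>carrier (P ?m). s (d ?m x)) x) \<in> left_hom R (P ?m) (Q ?m)"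
      by (rule sub_hom[OF u_hom sd])
    have d2: "d' (?m + 1) \<in> left_hom R (Q (?m + 1)) (Q ?m)"
      using Q.diff_hom[of "?m + 1"] by (simp only: add_diff_cancel_right')
    have m2: "int n + 2 = ?m + 1" by simp
    obtain t where t: "t \<in> left_hom R (P ?m) (Q (?m + 1))"
      "\<And>x. x \<in> carrier (P ?m) ==> d' (?m + 1) (t x) = u ?m x \<ominus>\<^bsub>Q ?m\<^esub> s (d ?m x)"
    proof -
      have "(\<lambda>x\<in>carrier (P ?m). u ?m x \<ominus>\<^bsub>Q ?m\<^esub> (\<lambda>x\<in>carrier (P ?m). s (d ?m x)) x) ` carrier (P ?m)
          \<subseteq> d' (?m + 1) ` carrier (Q (?m + 1))"
        using s unfolding good_def m2 by auto
      then show ?thesis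
        using that projective_lift[OF P.projective Q.left_module Q.left_module hom d2] by auto
    qed
    have "u (?m + 1) x \<ominus>\<^bsub>Q (?m + 1)\<^esub> t (d (?m + 1) x) \<in> d' (?m + 2) ` carrier (Q (?m + 2))"
      if x: "x \<in> carrier (P (?m + 1))" for x
    proof -
      have dx: "d (?m + 1) x \<in> carrier (P ?m)" by (rule P.diff_closed[OF x]) simp
      have c: "u (?m + 1) x \<in> carrier (Q (?m + 1))" "t (d (?m + 1) x) \<in> carrier (Q (?m + 1))"
        using left_hom_closed[OF u_hom x] left_hom_closed[OF t(1) dx] by auto
      have udx: "u ?m (d (?m + 1) x) \<in> carrier (Q ?m)" by (rule left_hom_closed[OF u_hom dx])
      have "d ?m (d (?m + 1) x) = \<zero>\<^bsub>P (int n)\<^esub>" by (rule P.diff_diff'[OF x]) simp_all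
      then have "s (d ?m (d (?m + 1) x)) = \<zero>\<^bsub>Q ?m\<^esub>"
        using left_hom_zero[OF P.abelian Q.abelian s_hom] by simp
      then have "d' (?m + 1) (t (d (?m + 1) x)) = u ?m (d (?m + 1) x)"
        using t(2)[OF dx] udx by (simp add: a_minus_def Qm.M.minus_equality[OF Qm.M.l_zero[OF Qm.M.zero_closed] Qm.M.zero_closed Qm.M.zero_closed])
      moreover have "d' (?m + 1) (u (?m + 1) x) = u ?m (d (?m + 1) x)" using u_diff[OF x]
        by (simp only: add_diff_cancel_right')
      moreover have "d' (?m + 1) (u (?m + 1) x \<ominus>\<^bsub>Q (?m + 1)\<^esub> t (d (?m + 1) x)) =
          d' (?m + 1) (u (?m + 1) x) \<ominus>\<^bsub>Q ?m\<^esub> d' (?m + 1) (t (d (?m + 1) x))"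
        by (rule left_hom_diff[OF Q.abelian Q.abelian d2 c])
      ultimately have "d' (?m + 1) (u (?m + 1) x \<ominus>\<^bsub>Q (?m + 1)\<^esub> t (d (?m + 1) x)) = \<zero>\<^bsub>Q ?m\<^esub>"
        using udx by (simp add: a_minus_def Qm.M.r_neg)
      then have "d' (?m + 1) (u (?m + 1) x \<ominus>\<^bsub>Q (?m + 1)\<^esub> t (d (?m + 1) x)) = \<zero>\<^bsub>Q (?m + 1 - 1)\<^esub>"
        by (simp only: add_diff_cancel_right')
      then have "u (?m + 1) x \<ominus>\<^bsub>Q (?m + 1)\<^esub> t (d (?m + 1) x) \<in>
          {x \<in> carrier (Q (?m + 1)). d' (?m + 1) x = \<zero>\<^bsub>Q (?m + 1 - 1)\<^esub>}"
        using c Qm.M.minus_closed by simp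
      moreover have "?m + 2 = ?m + 1 + 1" by simp
      ultimately show ?thesis using Q.exact[of "?m + 1"] by auto
    qed
    moreover have e: "int (Suc n) = ?m" by simp
    moreover have "Suc n \<noteq> 0" by simp
    ultimately have "good (Suc n) t" using t(1) unfolding good_def e by blast
    then show ?thesis using t(2) unfolding m2 by blast
  qed
  ultimately have "\<exists>s. \<forall>n. good n (s n) \<and> (\<forall>x\<in>carrier (P (int n + 1)). d' (int n + 2) (s (Suc n) x) =
      u (int n + 1) x \<ominus>\<^bsub>Q (int n + 1)\<^esub> s n (d (int n + 1) x))"
    by (intro dependent_nat_choice) auto
  then obtain s where s: "\<And>n. good n (s n)" "\<And>n x. x \<in> carrier (P (int n + 1)) ==>
      d' (int n + 2) (s (Suc n) x) = u (int n + 1) x \<ominus>\<^bsub>Q (int n + 1)\<^esub> s n (d (int n + 1) x)" by blast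
  define t where "t p = (if p < 0 then \<lambda>x\<in>carrier (P p). \<zero>\<^bsub>Q (p + 1)\<^esub> else s (nat p))" for p
  have t_hom: "t p \<in> left_hom R (P p) (Q (p + 1))" for p
  proof -
    have "s n \<in> left_hom R (P (int n)) (Q (int n + 1))" for n using s(1)[of n] by (simp add: good_def)
    from this[of "nat p"] show ?thesis
      using left_hom_zero_map[OF P.left_module Q.left_module] by (cases "p < 0") (simp_all add: t_def)
  qed
  have t_eq: "u p x = d' (p + 1) (t p x) \<oplus>\<^bsub>Q p\<^esub> t (p - 1) (d p x)" if x: "x \<in> carrier (P p)" for p x
  proof -
    have dx: "d p x \<in> carrier (P (p - 1))" by (rule P.diff_closed[OF x refl])
    have tx: "d' (p + 1) (t p x) \<in> carrier (Q p)" by (rule Q.diff_closed[OF left_hom_closed[OF t_hom x]]) simp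
    have tdx: "t (p - 1) (d p x) \<in> carrier (Q p)" using left_hom_closed[OF t_hom dx] by simp
    have ux: "u p x \<in> carrier (Q p)" by (rule left_hom_closed[OF u_hom x])
    consider "p < 0" | "p = 0" | n where "p = int n + 1"
      by (metis add.commute int_one_le_iff_zero_less linorder_neqE_linordered_idom zle_iff_zadd)
    then show ?thesis
    proof cases
      case 1
      then have "carrier (Q p) = {\<zero>\<^bsub>Q p\<^esub>}" by (rule Q.negative)
      then show ?thesis using tx tdx ux by (metis Qm.M.l_zero singletonD)
    next
      case 2
      then have "t (p - 1) (d p x) = \<zero>\<^bsub>Q p\<^esub>" using dx by (simp add: t_def)
      moreover have "d' (p + 1) (t p x) = u p x" using s(1)[of 0] 2 x by (simp add: t_def good_def)
      ultimately show ?thesis using ux by simp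
    next
      case 3
      have "d' (p + 1) (t p x) = u p x \<ominus>\<^bsub>Q p\<^esub> t (p - 1) (d p x)"
      proof -
        have e: "t p = s (Suc n)" "t (p - 1) = s n" "p + 1 = int n + 2"
          using 3 by (simp_all add: t_def nat_add_distrib)
        show ?thesis unfolding e using s(2)[of x n] x unfolding 3 by blast
      qed
      then show ?thesis using ux tdx by (simp add: a_minus_def Qm.M.a_assoc Qm.M.l_neg)
    qed
  qed
  have "w p x = w' p x \<oplus>\<^bsub>Q p\<^esub> (d' (p + 1) (t p x) \<oplus>\<^bsub>Q p\<^esub> t (p - 1) (d p x))" if x: "x \<in> carrier (P p)" for p x
  proof -
    have c: "w p x \<in> carrier (Q p)" "w' p x \<in> carrier (Q p)"
      using left_hom_closed[OF w_hom(1) x] left_hom_closed[OF w_hom(2) x] .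
    have "w' p x \<oplus>\<^bsub>Q p\<^esub> u p x = u p x \<oplus>\<^bsub>Q p\<^esub> w' p x"
      by (rule Qm.M.a_comm[OF c(2) left_hom_closed[OF u_hom x]])
    also have "\<dots> = w p x" using c x by (simp add: u_def a_minus_def Qm.M.a_assoc Qm.M.l_neg)
    finally show ?thesis using t_eq[OF x] by simp
  qed
  then show ?thesis
    using t_hom unfolding homotopic_def by (intro bexI[of _ t]) (auto simp: msign_def hom_deg_def)
qed

text \<open>Conjugating with mutually inverse homotopy equivalences \<open>u\<close> and \<open>v\<close> between two
  resolutions, \<open>\<phi> \<mapsto> u \<circ> \<phi> \<circ> v\<close>, is multiplicative and bijective up to homotopy.\<close>

theorem Ext_alg_independent:
  fixes R :: "('a, 'x) ring_scheme" and B :: "('a, 'b) module"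
    and P :: "int => ('a, 'p) module" and Q :: "int => ('a, 'q) module" and \<iota> :: "'s::field => 'a"
  assumes Qres: "projective_resolution R B Q d' \<epsilon>'" and Pres: "projective_resolution R B P d \<epsilon>"
    and B: "left_module R B"
    and \<iota>: "\<And>c. \<iota> c \<in> carrier R" "\<And>c r. r \<in> carrier R ==> \<iota> c \<otimes>\<^bsub>R\<^esub> r = r \<otimes>\<^bsub>R\<^esub> \<iota> c"
  shows "graded_alg_isomorphic (Ext_alg R \<iota> Q d') (Ext_alg R \<iota> P d)"
proof -
  interpret P: resolution R B P d \<epsilon> by unfold_locales fact
  interpret Q: resolution R B Q d' \<epsilon>' by unfold_locales fact
  interpret PH: endomorphism_complex R P d \<iota> by unfold_locales (fact \<iota>)+
  interpret QH: endomorphism_complex R Q d' \<iota> by unfold_locales (fact \<iota>)+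
  note cP = P.chain_complex_axioms and cQ = Q.chain_complex_axioms
  obtain u where u: "hom_cocycle R Q d' P d 0 u" "\<And>x. x \<in> carrier (Q 0) ==> \<epsilon> (u 0 x) = \<epsilon>' x"
    using resolution_comparison[OF Q.resolution_axioms P.resolution_axioms B] by blast
  obtain v where v: "hom_cocycle R P d Q d' 0 v" "\<And>x. x \<in> carrier (P 0) ==> \<epsilon>' (v 0 x) = \<epsilon> x"
    using resolution_comparison[OF P.resolution_axioms Q.resolution_axioms B] by blast
  have u_deg: "u \<in> hom_deg R Q P 0" and v_deg: "v \<in> hom_deg R P Q 0"
    using u v by (auto simp: hom_cocycle_def)
  have uv: "hom_cocycle R P d P d 0 (hom_comp P 0 u v)" by (rule hom_cocycle_comp[OF cP cQ cP u(1) v(1)]) simp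
  have vu: "hom_cocycle R Q d' Q d' 0 (hom_comp Q 0 v u)" by (rule hom_cocycle_comp[OF cQ cP cQ v(1) u(1)]) simp
  have uv_id: "homotopic R P d P d 0 (hom_comp P 0 u v) (id_hom P)"
    by (rule resolution_homotopy[OF P.resolution_axioms P.resolution_axioms B uv id_hom_cocycle[OF cP]])
      (use u v in \<open>simp add: hom_comp_def id_hom_def hom_deg_closed[OF v_deg]\<close>)
  have vu_id: "homotopic R Q d' Q d' 0 (hom_comp Q 0 v u) (id_hom Q)"
    by (rule resolution_homotopy[OF Q.resolution_axioms Q.resolution_axioms B vu id_hom_cocycle[OF cQ]])
      (use u v in \<open>simp add: hom_comp_def id_hom_def hom_deg_closed[OF u_deg]\<close>)
  define F where "F n \<phi> = hom_comp P n u (hom_comp P 0 \<phi> v)" for n \<phi>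
  define E where "E n \<psi> = hom_comp Q n v (hom_comp Q 0 \<psi> u)" for n \<psi>
  have F_coc: "hom_cocycle R P d P d n (F n \<phi>)" if "hom_cocycle R Q d' Q d' n \<phi>" for n \<phi>
    unfolding F_def by (rule hom_cocycle_comp[OF cP cQ cP u(1) hom_cocycle_comp[OF cP cQ cQ that v(1)]]) simp_all
  have E_coc: "hom_cocycle R Q d' Q d' n (E n \<psi>)" if "hom_cocycle R P d P d n \<psi>" for n \<psi>
    unfolding E_def by (rule hom_cocycle_comp[OF cQ cP cQ v(1) hom_cocycle_comp[OF cQ cP cP that u(1)]]) simp_all
  have coc_deg: "\<phi> \<in> hom_deg R X Y n" if "hom_cocycle R X dX Y dY n \<phi>" for X Y dX dY n \<phi>
    using that by (simp add: hom_cocycle_def)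
  have F_hom: "homotopic R P d P d n (F n \<phi>) (F n \<phi>')"
    if "hom_cocycle R Q d' Q d' n \<phi>'" "homotopic R Q d' Q d' n \<phi> \<phi>'" for n \<phi> \<phi>'
    unfolding F_def
    by (rule homotopic_comp_left[OF cP cQ cP u(1) homotopic_comp_right[OF cP cQ cQ that(2) v(1)]
        hom_comp_deg[OF cP coc_deg[OF that(1)] v_deg]]) simp_all
  have E_hom: "homotopic R Q d' Q d' n (E n \<phi>) (E n \<phi>')"
    if "hom_cocycle R P d P d n \<phi>'" "homotopic R P d P d n \<phi> \<phi>'" for n \<phi> \<phi>'
    unfolding E_def
    by (rule homotopic_comp_left[OF cQ cP cQ v(1) homotopic_comp_right[OF cQ cP cP that(2) u(1)]
        hom_comp_deg[OF cQ coc_deg[OF that(1)] u_deg]]) simp_all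
  have FE: "homotopic R P d P d n (F n (E n \<psi>)) \<psi>" if \<psi>: "hom_cocycle R P d P d n \<psi>" for n \<psi>
  proof -
    have \<psi>_deg: "\<psi> \<in> hom_deg R P P n" by (rule coc_deg[OF \<psi>])
    have c: "hom_cocycle R P d P d n (hom_comp P 0 \<psi> (hom_comp P 0 u v))"
      by (rule hom_cocycle_comp[OF cP cP cP \<psi> uv]) simp
    have "F n (E n \<psi>) = hom_comp P n (hom_comp P 0 u v) (hom_comp P 0 \<psi> (hom_comp P 0 u v))"
    proof -
      have \<psi>u: "hom_comp Q 0 \<psi> u \<in> hom_deg R Q P n" by (rule hom_comp_deg[OF cQ \<psi>_deg u_deg]) simp
      have "hom_comp P 0 (E n \<psi>) v = hom_comp P n v (hom_comp P 0 (hom_comp Q 0 \<psi> u) v)"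
        unfolding E_def by (rule hom_comp_assoc[OF \<psi>u v_deg, symmetric]) simp
      also have "hom_comp P 0 (hom_comp Q 0 \<psi> u) v = hom_comp P 0 \<psi> (hom_comp P 0 u v)"
        by (rule hom_comp_assoc[OF u_deg v_deg, symmetric]) simp
      finally have "F n (E n \<psi>) = hom_comp P n u (hom_comp P n v (hom_comp P 0 \<psi> (hom_comp P 0 u v)))"
        by (simp add: F_def)
      also have "\<dots> = hom_comp P n (hom_comp P 0 u v) (hom_comp P 0 \<psi> (hom_comp P 0 u v))"
        by (rule hom_comp_assoc[OF v_deg coc_deg[OF c]]) simp
      finally show ?thesis .
    qed
    moreover have "homotopic R P d P d n (hom_comp P n (hom_comp P 0 u v) (hom_comp P 0 \<psi> (hom_comp P 0 u v)))
        (hom_comp P n (id_hom P) (hom_comp P 0 \<psi> (hom_comp P 0 u v)))"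
      by (rule homotopic_comp_right[OF cP cP cP uv_id c]) simp
    moreover have "homotopic R P d P d n (hom_comp P 0 \<psi> (hom_comp P 0 u v)) (hom_comp P 0 \<psi> (id_hom P))"
      by (rule homotopic_comp_left[OF cP cP cP \<psi> uv_id id_hom_deg[OF cP]]) simp
    moreover have "F n (E n \<psi>) \<in> hom_deg R P P n" using F_coc[OF E_coc[OF \<psi>]] coc_deg by blast
    ultimately show ?thesis
      using PH.H.cohomologous_trans[of \<psi> n] PH.cohomologous_iff \<psi>_deg coc_deg[OF c]
        hom_comp_id_left[OF coc_deg[OF c]] hom_comp_id_right[OF \<psi>_deg] PH.hom_dga_simps(1) by metis
  qed
  have EF: "homotopic R Q d' Q d' n (E n (F n \<psi>)) \<psi>" if \<psi>: "hom_cocycle R Q d' Q d' n \<psi>" for n \<psi>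
  proof -
    have \<psi>_deg: "\<psi> \<in> hom_deg R Q Q n" by (rule coc_deg[OF \<psi>])
    have c: "hom_cocycle R Q d' Q d' n (hom_comp Q 0 \<psi> (hom_comp Q 0 v u))"
      by (rule hom_cocycle_comp[OF cQ cQ cQ \<psi> vu]) simp
    have "E n (F n \<psi>) = hom_comp Q n (hom_comp Q 0 v u) (hom_comp Q 0 \<psi> (hom_comp Q 0 v u))"
    proof -
      have \<psi>v: "hom_comp P 0 \<psi> v \<in> hom_deg R P Q n" by (rule hom_comp_deg[OF cP \<psi>_deg v_deg]) simp
      have "hom_comp Q 0 (F n \<psi>) u = hom_comp Q n u (hom_comp Q 0 (hom_comp P 0 \<psi> v) u)"
        unfolding F_def by (rule hom_comp_assoc[OF \<psi>v u_deg, symmetric]) simp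
      also have "hom_comp Q 0 (hom_comp P 0 \<psi> v) u = hom_comp Q 0 \<psi> (hom_comp Q 0 v u)"
        by (rule hom_comp_assoc[OF v_deg u_deg, symmetric]) simp
      finally have "E n (F n \<psi>) = hom_comp Q n v (hom_comp Q n u (hom_comp Q 0 \<psi> (hom_comp Q 0 v u)))"
        by (simp add: E_def)
      also have "\<dots> = hom_comp Q n (hom_comp Q 0 v u) (hom_comp Q 0 \<psi> (hom_comp Q 0 v u))"
        by (rule hom_comp_assoc[OF u_deg coc_deg[OF c]]) simp
      finally show ?thesis .
    qed
    moreover have "homotopic R Q d' Q d' n (hom_comp Q n (hom_comp Q 0 v u) (hom_comp Q 0 \<psi> (hom_comp Q 0 v u)))
        (hom_comp Q n (id_hom Q) (hom_comp Q 0 \<psi> (hom_comp Q 0 v u)))"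
      by (rule homotopic_comp_right[OF cQ cQ cQ vu_id c]) simp
    moreover have "homotopic R Q d' Q d' n (hom_comp Q 0 \<psi> (hom_comp Q 0 v u)) (hom_comp Q 0 \<psi> (id_hom Q))"
      by (rule homotopic_comp_left[OF cQ cQ cQ \<psi> vu_id id_hom_deg[OF cQ]]) simp
    moreover have "E n (F n \<psi>) \<in> hom_deg R Q Q n" using E_coc[OF F_coc[OF \<psi>]] coc_deg by blast
    ultimately show ?thesis
      using QH.H.cohomologous_trans[of \<psi> n] QH.cohomologous_iff \<psi>_deg coc_deg[OF c]
        hom_comp_id_left[OF coc_deg[OF c]] hom_comp_id_right[OF \<psi>_deg] QH.hom_dga_simps(1) by metis
  qed
  show ?thesis unfolding Ext_alg_def
  proof (rule cohomology_isomorphic[where F = F])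
    fix n \<phi> assume "\<phi> \<in> cocycles (hom_dga R \<iota> Q d') n"
    then show "F n \<phi> \<in> cocycles (hom_dga R \<iota> P d) n"
      using F_coc by (simp add: QH.cocycles_hom_dga PH.cocycles_hom_dga)
  next
    fix n \<phi> \<psi> assume "\<phi> \<in> cocycles (hom_dga R \<iota> Q d') n" "\<psi> \<in> cocycles (hom_dga R \<iota> Q d') n"
    then have c: "hom_cocycle R Q d' Q d' n \<phi>" "hom_cocycle R Q d' Q d' n \<psi>" by (simp_all add: QH.cocycles_hom_dga)
    note deg = coc_deg[OF c(1)] coc_deg[OF c(2)]
    note Fdeg = coc_deg[OF F_coc[OF c(1)]] coc_deg[OF F_coc[OF c(2)]]
    note EFdeg = coc_deg[OF E_coc[OF F_coc[OF c(1)]]] coc_deg[OF E_coc[OF F_coc[OF c(2)]]]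
    show "PH.H.cohomologous n (F n \<phi>) (F n \<psi>) \<longleftrightarrow> QH.H.cohomologous n \<phi> \<psi>"
      unfolding QH.cohomologous_iff[OF deg] PH.cohomologous_iff[OF Fdeg]
    proof
      assume "homotopic R P d P d n (F n \<phi>) (F n \<psi>)"
      then have 1: "QH.H.cohomologous n (E n (F n \<phi>)) (E n (F n \<psi>))"
        using E_hom[OF F_coc[OF c(2)]] QH.cohomologous_iff[OF EFdeg] by blast
      have 2: "QH.H.cohomologous n (E n (F n \<phi>)) \<phi>" using EF[OF c(1)] QH.cohomologous_iff[OF EFdeg(1) deg(1)] by blast
      have 3: "QH.H.cohomologous n (E n (F n \<psi>)) \<psi>" using EF[OF c(2)] QH.cohomologous_iff[OF EFdeg(2) deg(2)] by blast
      have car: "\<phi> \<in> gcarrier (hom_dga R \<iota> Q d') n" "\<psi> \<in> gcarrier (hom_dga R \<iota> Q d') n"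
        "E n (F n \<psi>) \<in> gcarrier (hom_dga R \<iota> Q d') n"
        using deg EFdeg by (simp_all only: QH.hom_dga_simps(1))
      have "QH.H.cohomologous n \<phi> \<psi>"
        by (rule QH.H.cohomologous_trans[OF car(2) QH.H.cohomologous_trans[OF car(3)
            QH.H.cohomologous_sym[OF car(1) 2] 1] 3])
      then show "homotopic R Q d' Q d' n \<phi> \<psi>" using QH.cohomologous_iff[OF deg] by blast
    next
      assume "homotopic R Q d' Q d' n \<phi> \<psi>"
      then show "homotopic R P d P d n (F n \<phi>) (F n \<psi>)" by (rule F_hom[OF c(2)])
    qed
  next
    fix n \<psi> assume "\<psi> \<in> cocycles (hom_dga R \<iota> P d) n"
    then have c: "hom_cocycle R P d P d n \<psi>" by (simp add: PH.cocycles_hom_dga)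
    show "\<exists>\<phi>\<in>cocycles (hom_dga R \<iota> Q d') n. PH.H.cohomologous n (F n \<phi>) \<psi>"
    proof (rule bexI)
      show "E n \<psi> \<in> cocycles (hom_dga R \<iota> Q d') n" using E_coc[OF c] by (simp add: QH.cocycles_hom_dga)
      show "PH.H.cohomologous n (F n (E n \<psi>)) \<psi>"
        using FE[OF c] PH.cohomologous_iff[OF coc_deg[OF F_coc[OF E_coc[OF c]]] coc_deg[OF c]] by blast
    qed
  next
    fix n \<phi> \<psi> assume "\<phi> \<in> cocycles (hom_dga R \<iota> Q d') n" "\<psi> \<in> cocycles (hom_dga R \<iota> Q d') n"
    then have deg: "\<phi> \<in> hom_deg R Q Q n" "\<psi> \<in> hom_deg R Q Q n"
      by (auto simp: QH.cocycles_hom_dga intro: coc_deg)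
    show "F n (gadd (hom_dga R \<iota> Q d') n \<phi> \<psi>) = gadd (hom_dga R \<iota> P d) n (F n \<phi>) (F n \<psi>)"
    proof (intro ext)
      fix p x
      have "u (p - n) (\<phi> p (v p x) \<oplus>\<^bsub>Q (p - n)\<^esub> \<psi> p (v p x)) =
          u (p - n) (\<phi> p (v p x)) \<oplus>\<^bsub>P (p - n)\<^esub> u (p - n) (\<psi> p (v p x))" if "x \<in> carrier (P p)"
      proof -
        have vx: "v p x \<in> carrier (Q p)" by (rule hom_deg_closed[OF v_deg that]) simp
        show ?thesis
          by (rule hom_deg_add[OF u_deg hom_deg_closed[OF deg(1) vx refl] hom_deg_closed[OF deg(2) vx refl]]) simp
      qed
      then show "F n (gadd (hom_dga R \<iota> Q d') n \<phi> \<psi>) p x = gadd (hom_dga R \<iota> P d) n (F n \<phi>) (F n \<psi>) p x"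
        using hom_deg_closed[OF v_deg, of x p p]
        by (simp add: F_def hom_comp_def QH.hom_dga_simps(2) PH.hom_dga_simps(2) restrict_def)
    qed
  next
    fix n c \<phi> assume "\<phi> \<in> cocycles (hom_dga R \<iota> Q d') n"
    then have deg: "\<phi> \<in> hom_deg R Q Q n" by (auto simp: QH.cocycles_hom_dga intro: coc_deg)
    show "F n (gscale (hom_dga R \<iota> Q d') n c \<phi>) = gscale (hom_dga R \<iota> P d) n c (F n \<phi>)"
    proof (intro ext)
      fix p x
      have "u (p - n) (\<iota> c \<odot>\<^bsub>Q (p - n)\<^esub> \<phi> p (v p x)) = \<iota> c \<odot>\<^bsub>P (p - n)\<^esub> u (p - n) (\<phi> p (v p x))"
        if "x \<in> carrier (P p)"
      proof -
        have vx: "v p x \<in> carrier (Q p)" by (rule hom_deg_closed[OF v_deg that]) simp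
        show ?thesis
          by (rule left_hom_smult[OF hom_degD[OF u_deg] \<iota>(1) hom_deg_closed[OF deg vx refl]]) simp
      qed
      then show "F n (gscale (hom_dga R \<iota> Q d') n c \<phi>) p x = gscale (hom_dga R \<iota> P d) n c (F n \<phi>) p x"
        using hom_deg_closed[OF v_deg, of x p p]
        by (simp add: F_def hom_comp_def QH.hom_dga_simps(4) PH.hom_dga_simps(4) restrict_def)
    qed
  next
    fix m n \<phi> \<psi> assume "\<phi> \<in> cocycles (hom_dga R \<iota> Q d') m" "\<psi> \<in> cocycles (hom_dga R \<iota> Q d') n"
    then have c: "hom_cocycle R Q d' Q d' m \<phi>" "hom_cocycle R Q d' Q d' n \<psi>" by (simp_all add: QH.cocycles_hom_dga)
    note deg = coc_deg[OF c(1)] coc_deg[OF c(2)]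
    have \<psi>v: "hom_cocycle R P d Q d' n (hom_comp P 0 \<psi> v)" by (rule hom_cocycle_comp[OF cP cQ cQ c(2) v(1)]) simp
    have u\<phi>: "hom_cocycle R Q d' P d m (hom_comp Q m u \<phi>)" by (rule hom_cocycle_comp[OF cQ cQ cP u(1) c(1)]) simp
    have "F (m + n) (hom_comp Q n \<phi> \<psi>) = hom_comp P n (hom_comp Q m u \<phi>) (hom_comp P n (id_hom Q) (hom_comp P 0 \<psi> v))"
    proof -
      have "hom_comp P 0 (hom_comp Q n \<phi> \<psi>) v = hom_comp P n \<phi> (hom_comp P 0 \<psi> v)"
        by (rule hom_comp_assoc[OF deg(2) v_deg, symmetric]) simp
      then have "F (m + n) (hom_comp Q n \<phi> \<psi>) = hom_comp P (m + n) u (hom_comp P n \<phi> (hom_comp P 0 \<psi> v))"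
        by (simp add: F_def)
      also have "\<dots> = hom_comp P n (hom_comp Q m u \<phi>) (hom_comp P 0 \<psi> v)"
        by (rule hom_comp_assoc[OF deg(1) coc_deg[OF \<psi>v]]) simp
      finally show ?thesis using hom_comp_id_left[OF coc_deg[OF \<psi>v]] by simp
    qed
    moreover have "hom_comp P n (F m \<phi>) (F n \<psi>) =
        hom_comp P n (hom_comp Q m u \<phi>) (hom_comp P n (hom_comp Q 0 v u) (hom_comp P 0 \<psi> v))"
    proof -
      have "F m \<phi> = hom_comp P 0 (hom_comp Q m u \<phi>) v"
        unfolding F_def by (rule hom_comp_assoc[OF deg(1) v_deg]) simp
      then have "hom_comp P n (F m \<phi>) (F n \<psi>) = hom_comp P n (hom_comp Q m u \<phi>) (hom_comp P n v (F n \<psi>))"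
        using hom_comp_assoc[OF v_deg coc_deg[OF F_coc[OF c(2)]], of n "hom_comp Q m u \<phi>"] by simp
      also have "hom_comp P n v (F n \<psi>) = hom_comp P n (hom_comp Q 0 v u) (hom_comp P 0 \<psi> v)"
        unfolding F_def by (rule hom_comp_assoc[OF u_deg coc_deg[OF \<psi>v]]) simp
      finally show ?thesis .
    qed
    moreover have "homotopic R P d P d (m + n)
        (hom_comp P n (hom_comp Q m u \<phi>) (hom_comp P n (hom_comp Q 0 v u) (hom_comp P 0 \<psi> v)))
        (hom_comp P n (hom_comp Q m u \<phi>) (hom_comp P n (id_hom Q) (hom_comp P 0 \<psi> v)))"
      by (rule homotopic_comp_left[OF cP cQ cP u\<phi> homotopic_comp_right[OF cP cQ cQ vu_id \<psi>v]])
        (simp_all add: hom_comp_id_left[OF coc_deg[OF \<psi>v]] coc_deg[OF \<psi>v])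
    ultimately have "homotopic R P d P d (m + n) (hom_comp P n (F m \<phi>) (F n \<psi>)) (F (m + n) (hom_comp Q n \<phi> \<psi>))"
      by simp
    moreover have "hom_cocycle R P d P d (m + n) (hom_comp P n (F m \<phi>) (F n \<psi>))"
      by (rule hom_cocycle_comp[OF cP cP cP F_coc[OF c(1)] F_coc[OF c(2)] refl])
    moreover have "hom_cocycle R P d P d (m + n) (F (m + n) (hom_comp Q n \<phi> \<psi>))"
      by (rule F_coc[OF hom_cocycle_comp[OF cQ cQ cQ c refl]])
    ultimately have "PH.H.cohomologous (m + n) (F (m + n) (hom_comp Q n \<phi> \<psi>)) (hom_comp P n (F m \<phi>) (F n \<psi>))"
      using PH.H.cohomologous_sym PH.cohomologous_iff coc_deg PH.hom_dga_simps(1) by metis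
    then show "PH.H.cohomologous (m + n) (F (m + n) (gmult (hom_dga R \<iota> Q d') m n \<phi> \<psi>))
        (gmult (hom_dga R \<iota> P d) m n (F m \<phi>) (F n \<psi>))"
      by (simp only: QH.hom_dga_simps(5) PH.hom_dga_simps(5))
  next
    have "F 0 (id_hom Q) = hom_comp P 0 u v" by (simp add: F_def hom_comp_id_left[OF v_deg])
    then show "PH.H.cohomologous 0 (F 0 (gone (hom_dga R \<iota> Q d'))) (gone (hom_dga R \<iota> P d))"
      using uv_id PH.cohomologous_iff[OF coc_deg[OF uv] id_hom_deg[OF cP]]
      by (simp only: QH.hom_dga_simps(6) PH.hom_dga_simps(6))
  qed (rule PH.H.dga_axioms QH.H.dga_axioms)+
qed

section \<open>The Clifford product\<close>

definition below_sign :: "nat => nat set => 'r::comm_ring_1" where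
  "below_sign i S = (-1) ^ card {s\<in>S. s < i}"

definition parity_sign :: "nat set => 'r::comm_ring_1" where
  "parity_sign S = (-1) ^ card S"

definition wedge :: "nat => (nat set => 'r::comm_ring_1) => nat set => 'r" where
  "wedge i v = (\<lambda>S. if i \<in> S then below_sign i S * v (S - {i}) else 0)"

lemma ext_deriv_below: "ext_deriv i v = (\<lambda>S. if i \<in> S then 0 else below_sign i S * v (insert i S))"
  by (auto simp: ext_deriv_def below_sign_def)

lemma below_sign_insert: "below_sign i (insert j S) = (if j < i \<and> j \<notin> S then - below_sign i S else below_sign i S)"
proof -
  have fin: "finite {s\<in>S. s < i}" by (rule finite_subset[of _ "{..<i}"]) auto
  have "{s \<in> insert j S. s < i} = (if j < i then insert j {s\<in>S. s < i} else {s\<in>S. s < i})" by auto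
  then show ?thesis using fin by (auto simp: below_sign_def insert_absorb)
qed

lemma below_sign_remove: "below_sign i (S - {j}) =
    (if j < i \<and> j \<in> S then - below_sign i S else below_sign i S :: 'r::comm_ring_1)"
proof (cases "j \<in> S")
  case True
  then show ?thesis using below_sign_insert[where 'a = 'r, of i j "S - {j}"] by (auto simp: insert_absorb)
qed simp

lemma below_sign_square [simp]: "below_sign i S * below_sign i S = (1 :: 'r::comm_ring_1)"
  "below_sign i S * (below_sign i S * x) = (x :: 'r)"
  by (simp_all add: below_sign_def flip: power_mult_distrib mult.assoc)

lemma below_sign_unit: "below_sign i S = (1 :: 'r::comm_ring_1) \<or> below_sign i S = (- 1 :: 'r)"
  by (cases "even (card {s\<in>S. s < i})") (auto simp: below_sign_def)

lemma parity_sign_insert: "finite S ==> parity_sign (insert j S) = (if j \<in> S then parity_sign S else - parity_sign S)"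
  by (auto simp: parity_sign_def insert_absorb)

lemma parity_sign_remove: "finite S ==>
    parity_sign (S - {j}) = (if j \<in> S then - parity_sign S else parity_sign S :: 'r::comm_ring_1)"
  using parity_sign_insert[where 'a = 'r, of "S - {j}" j] by (auto simp: insert_absorb)

lemma parity_sign_square [simp]: "parity_sign S * parity_sign S = (1 :: 'r::comm_ring_1)"
  "parity_sign S * (parity_sign S * x) = (x :: 'r)"
  by (simp_all add: parity_sign_def flip: power_mult_distrib mult.assoc)


subsection \<open>Operators on the tensor square\<close>

type_synonym 'r tensor2 = "nat set => nat set => 'r"

definition finitary :: "'r::zero tensor2 => bool" where
  "finitary t \<longleftrightarrow> (\<forall>S T. t S T \<noteq> 0 \<longrightarrow> finite S \<and> finite T)"

definition finitary1 :: "(nat set => 'r::zero) => bool" where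
  "finitary1 v \<longleftrightarrow> (\<forall>S. v S \<noteq> 0 \<longrightarrow> finite S)"

definition left_wedge :: "nat => 'r::comm_ring_1 tensor2 => 'r tensor2" where
  "left_wedge i t = (\<lambda>S T. wedge i (\<lambda>S'. t S' T) S)"

definition left_deriv :: "nat => 'r::comm_ring_1 tensor2 => 'r tensor2" where
  "left_deriv a t = (\<lambda>S T. ext_deriv a (\<lambda>S'. t S' T) S)"

definition right_deriv :: "nat => 'r::comm_ring_1 tensor2 => 'r tensor2" where
  "right_deriv a t = (\<lambda>S T. parity_sign S * ext_deriv a (t S) T)"

lemma finitary_eqI:
  "[|finitary t; finitary t'; \<And>S T. finite S ==> finite T ==> t S T = t' S T|] ==> t = t'"
  unfolding finitary_def by (intro ext) metis

lemma ext_deriv_tensor_below: "ext_deriv_tensor i j t = (\<lambda>S T. if i \<in> S \<or> j \<in> T then 0 else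
    below_sign i S * (parity_sign (insert i S) * (below_sign j T * t (insert i S) (insert j T))))"
  by (auto simp: ext_deriv_tensor_def ext_deriv_below parity_sign_def fun_eq_iff)

lemma finitary_left_wedge: "finitary t ==> finitary (left_wedge i t)"
  unfolding finitary_def left_wedge_def wedge_def by (auto split: if_splits) (metis finite_Diff2 finite.emptyI finite_insert mult_zero_right)+

lemma finitary_left_deriv: "finitary t ==> finitary (left_deriv i t)"
  unfolding finitary_def left_deriv_def ext_deriv_below by (auto split: if_splits) (metis finite_insert mult_zero_right)+

lemma finitary_right_deriv: "finitary t ==> finitary (right_deriv i t)"
  unfolding finitary_def right_deriv_def ext_deriv_below by (auto split: if_splits) (metis finite_insert mult_zero_right)+

lemma finitary_ext_deriv_tensor: "finitary t ==> finitary (ext_deriv_tensor i j t)"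
  unfolding finitary_def ext_deriv_tensor_below by (auto split: if_splits) (metis finite_insert mult_zero_right)+

lemma ext_deriv_tensor_left_wedge:
  assumes "i \<noteq> j" "finite S"
  shows "ext_deriv_tensor j b (left_wedge i t) S T = left_wedge i (ext_deriv_tensor j b t) S T"
proof (cases "i \<in> S \<and> j \<notin> S \<and> b \<notin> T")
  case True
  have e: "insert j S - {i} = insert j (S - {i})" using assms by auto
  show ?thesis
    using True assms by (cases "j < i")
      (auto simp: ext_deriv_tensor_below left_wedge_def wedge_def e below_sign_insert below_sign_remove
        parity_sign_insert parity_sign_remove mult_ac)
next
  case False
  then show ?thesis using assms by (auto simp: ext_deriv_tensor_below left_wedge_def wedge_def)
qed

lemma ext_deriv_tensor_left_wedge_same:
  assumes "finite S"
  shows "ext_deriv_tensor j b (left_wedge j t) S T = left_wedge j (ext_deriv_tensor j b t) S T - right_deriv b t S T"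
proof (cases "b \<in> T")
  case True
  then show ?thesis by (simp add: ext_deriv_tensor_below left_wedge_def wedge_def right_deriv_def ext_deriv_below)
next
  case False
  have "insert j (S - {j}) = S" if "j \<in> S" using that by auto
  then show ?thesis
    using False assms by (cases "j \<in> S")
      (simp_all add: ext_deriv_tensor_below left_wedge_def wedge_def right_deriv_def ext_deriv_below
        below_sign_insert below_sign_remove parity_sign_insert parity_sign_remove mult_ac)
qed

lemma ext_deriv_tensor_left_deriv:
  assumes "a \<noteq> j" "finite S"
  shows "ext_deriv_tensor j b (left_deriv a t) S T = left_deriv a (ext_deriv_tensor j b t) S T"
proof (cases "a \<notin> S \<and> j \<notin> S \<and> b \<notin> T")
  case True
  then show ?thesis
    using assms by (cases "j < a")
      (auto simp: ext_deriv_tensor_below left_deriv_def ext_deriv_below below_sign_insert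
        parity_sign_insert insert_commute mult_ac)
next
  case False
  then show ?thesis using assms by (auto simp: ext_deriv_tensor_below left_deriv_def ext_deriv_below)
qed

lemma ext_deriv_tensor_right_deriv:
  assumes "finite S"
  shows "ext_deriv_tensor j b (right_deriv a t) S T = right_deriv a (ext_deriv_tensor j b t) S T"
proof (cases "a \<noteq> b \<and> a \<notin> T \<and> j \<notin> S \<and> b \<notin> T")
  case True
  then show ?thesis
    using assms by (cases "b < a")
      (auto simp: ext_deriv_tensor_below right_deriv_def ext_deriv_below below_sign_insert
        parity_sign_insert insert_commute mult_ac)
next
  case False
  then show ?thesis using assms by (auto simp: ext_deriv_tensor_below right_deriv_def ext_deriv_below)
qed

subsection \<open>The exponential\<close>

definition clifford_exp :: "nat => 'k::field fls tensor2 => 'k fls tensor2" where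
  "clifford_exp l t = (\<lambda>S T. \<Sum>k\<le>l. inverse (of_nat (fact k)) * (clifford_op l ^^ k) t S T)"

lemma finitary_clifford_op: "finitary t ==> finitary (clifford_op l t)"
proof -
  assume t: "finitary t"
  have "clifford_op l t S T = 0" if "\<not> (finite S \<and> finite T)" for S T
    using that finitary_ext_deriv_tensor[OF t] unfolding clifford_op_def finitary_def
    by (auto intro!: sum.neutral)
  then show ?thesis by (auto simp: finitary_def)
qed

lemma finitary_clifford_op_power: "finitary t ==> finitary ((clifford_op l ^^ k) t)"
  by (induction k) (simp_all add: finitary_clifford_op)

lemma clifford_op_add: "clifford_op l (\<lambda>S T. t S T + t' S T) = (\<lambda>S T. clifford_op l t S T + clifford_op l t' S T)"
proof -
  have "ext_deriv_tensor i j (\<lambda>S T. t S T + t' S T) S T = ext_deriv_tensor i j t S T + ext_deriv_tensor i j t' S T"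
    for i j S T by (simp add: ext_deriv_tensor_below distrib_left)
  then show ?thesis by (simp add: clifford_op_def sum.distrib distrib_left)
qed

lemma clifford_op_scale: "clifford_op l (\<lambda>S T. c * t S T) = (\<lambda>S T. c * clifford_op l t S T)"
proof -
  have "ext_deriv_tensor i j (\<lambda>S T. c * t S T) S T = c * ext_deriv_tensor i j t S T" for i j S T
    by (simp add: ext_deriv_tensor_below mult_ac)
  then show ?thesis by (simp add: clifford_op_def sum_distrib_left[symmetric] mult_ac)
qed

lemma clifford_op_sum: "finite I ==>
    clifford_op l (\<lambda>S T. \<Sum>i\<in>I. c i * t i S T) = (\<lambda>S T. \<Sum>i\<in>I. c i * clifford_op l (t i) S T)"
proof (induction rule: finite_induct)
  case empty
  show ?case by (simp add: clifford_op_def ext_deriv_tensor_below cong: if_cong)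
next
  case (insert i I)
  then show ?case
    using clifford_op_add[of l "\<lambda>S T. c i * t i S T" "\<lambda>S T. \<Sum>i\<in>I. c i * t i S T"]
    by (simp add: clifford_op_scale)
qed

lemma clifford_op_power_sum: "finite I ==> (clifford_op l ^^ k) (\<lambda>S T. \<Sum>i\<in>I. c i * t i S T) =
    (\<lambda>S T. \<Sum>i\<in>I. c i * (clifford_op l ^^ k) (t i) S T)"
  by (induction k) (simp_all add: clifford_op_sum)

lemma clifford_exp_sum: "finite I ==> clifford_exp l (\<lambda>S T. \<Sum>i\<in>I. c i * t i S T) =
    (\<lambda>S T. \<Sum>i\<in>I. c i * clifford_exp l (t i) S T)"
  by (auto simp: clifford_exp_def clifford_op_power_sum sum_distrib_left fun_eq_iff mult_ac
      intro: sum.swap)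

lemma clifford_op_left_wedge:
  assumes t: "finitary t" and i: "i < l"
  shows "clifford_op l (left_wedge i t) = left_wedge i (clifford_op l t)"
proof (rule finitary_eqI)
  fix S T :: "nat set" assume "finite S"
  then have "ext_deriv_tensor (l + b) b (left_wedge i t) S T = left_wedge i (ext_deriv_tensor (l + b) b t) S T" for b
    using i by (intro ext_deriv_tensor_left_wedge) auto
  then show "clifford_op l (left_wedge i t) S T = left_wedge i (clifford_op l t) S T"
    by (simp add: clifford_op_def left_wedge_def wedge_def sum_distrib_left mult_ac)
qed (use t in \<open>simp_all add: finitary_clifford_op finitary_left_wedge\<close>)

lemma clifford_op_left_wedge_antighost:
  assumes t: "finitary t" and a: "a < l"
  shows "clifford_op l (left_wedge (l + a) t) =
    (\<lambda>S T. left_wedge (l + a) (clifford_op l t) S T + 2 * fls_X * right_deriv a t S T)"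
proof (rule finitary_eqI)
  fix S T :: "nat set" assume S: "finite S"
  have "ext_deriv_tensor (l + b) b (left_wedge (l + a) t) S T =
      left_wedge (l + a) (ext_deriv_tensor (l + b) b t) S T - (if b = a then right_deriv a t S T else 0)" for b
    using ext_deriv_tensor_left_wedge[of "l + a" "l + b"] ext_deriv_tensor_left_wedge_same S by auto
  then have "clifford_op l (left_wedge (l + a) t) S T =
      - 2 * fls_X * ((\<Sum>b<l. left_wedge (l + a) (ext_deriv_tensor (l + b) b t) S T) - right_deriv a t S T)"
    using a by (simp add: clifford_op_def sum_subtractf)
  then show "clifford_op l (left_wedge (l + a) t) S T =
      left_wedge (l + a) (clifford_op l t) S T + 2 * fls_X * right_deriv a t S T"
    by (simp add: clifford_op_def left_wedge_def wedge_def sum_distrib_left algebra_simps)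
next
  have "finitary (left_wedge (l + a) (clifford_op l t))" "finitary (right_deriv a t)"
    using t by (simp_all add: finitary_clifford_op finitary_left_wedge finitary_right_deriv)
  then show "finitary (\<lambda>S T. left_wedge (l + a) (clifford_op l t) S T + 2 * fls_X * right_deriv a t S T)"
    unfolding finitary_def by (metis add_0 mult_zero_right)
qed (use t in \<open>simp_all add: finitary_clifford_op finitary_left_wedge\<close>)

lemma clifford_op_left_deriv:
  assumes t: "finitary t" and a: "a < l"
  shows "clifford_op l (left_deriv a t) = left_deriv a (clifford_op l t)"
proof (rule finitary_eqI)
  fix S T :: "nat set" assume "finite S"
  then have "ext_deriv_tensor (l + b) b (left_deriv a t) S T = left_deriv a (ext_deriv_tensor (l + b) b t) S T" for b
    using a by (intro ext_deriv_tensor_left_deriv) auto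
  then show "clifford_op l (left_deriv a t) S T = left_deriv a (clifford_op l t) S T"
    by (simp add: clifford_op_def left_deriv_def ext_deriv_below sum_distrib_left mult_ac)
qed (use t in \<open>simp_all add: finitary_clifford_op finitary_left_deriv\<close>)

lemma clifford_op_right_deriv:
  assumes t: "finitary t"
  shows "clifford_op l (right_deriv a t) = right_deriv a (clifford_op l t)"
proof (rule finitary_eqI)
  fix S T :: "nat set" assume "finite S"
  then have "ext_deriv_tensor (l + b) b (right_deriv a t) S T = right_deriv a (ext_deriv_tensor (l + b) b t) S T" for b
    by (intro ext_deriv_tensor_right_deriv)
  then show "clifford_op l (right_deriv a t) S T = right_deriv a (clifford_op l t) S T"
    by (simp add: clifford_op_def right_deriv_def ext_deriv_below sum_distrib_left mult_ac)
qed (use t in \<open>simp_all add: finitary_clifford_op finitary_right_deriv\<close>)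

lemma clifford_exp_commute:
  assumes "finitary t" and C: "\<And>t. finitary t ==> clifford_op l (f t) = f (clifford_op l t)"
    and f: "\<And>c t. f (\<lambda>S T. \<Sum>k\<le>l. c k * t k S T) = (\<lambda>S T. \<Sum>k\<le>l. c k * f (t k) S T)"
  shows "clifford_exp l (f t) = f (clifford_exp l t)"
proof -
  have "(clifford_op l ^^ k) (f t) = f ((clifford_op l ^^ k) t)" for k
    by (induction k) (simp_all add: C finitary_clifford_op_power assms(1))
  then show ?thesis by (simp add: clifford_exp_def f)
qed

lemma clifford_exp_left_wedge:
  "finitary t ==> i < l ==> clifford_exp l (left_wedge i t) = left_wedge i (clifford_exp l t)"
  by (rule clifford_exp_commute)
    (simp_all add: clifford_op_left_wedge, auto simp: left_wedge_def wedge_def fun_eq_iff sum_distrib_left mult_ac)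

lemma clifford_exp_left_deriv:
  "finitary t ==> a < l ==> clifford_exp l (left_deriv a t) = left_deriv a (clifford_exp l t)"
  by (rule clifford_exp_commute)
    (simp_all add: clifford_op_left_deriv, auto simp: left_deriv_def ext_deriv_below fun_eq_iff sum_distrib_left mult_ac)

lemma clifford_exp_right_deriv:
  "finitary t ==> clifford_exp l (right_deriv a t) = right_deriv a (clifford_exp l t)"
  by (rule clifford_exp_commute)
    (simp_all add: clifford_op_right_deriv, auto simp: right_deriv_def ext_deriv_below fun_eq_iff sum_distrib_left mult_ac)

lemma clifford_op_zeroI:
  "(\<And>b. b < l ==> ext_deriv_tensor (l + b) b t S T = 0) ==> clifford_op l t S T = 0"
  by (simp add: clifford_op_def)

text \<open>Every factor of the exponent removes another ghost from the right factor, of which there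
  are only \<open>l\<close>. This is why the truncated exponential series behaves like the full one.\<close>

lemma clifford_op_power_vanish:
  assumes "\<And>S T. card (T \<inter> {..<l}) \<ge> m ==> t S T = 0"
  shows "card (T \<inter> {..<l}) + k \<ge> m ==> (clifford_op l ^^ k) t S T = 0"
proof (induction k arbitrary: S T)
  case 0
  then show ?case using assms by simp
next
  case (Suc k)
  have "ext_deriv_tensor (l + b) b ((clifford_op l ^^ k) t) S T = 0" if b: "b < l" for b
  proof (cases "b \<in> T")
    case False
    then have "card (insert b T \<inter> {..<l}) = Suc (card (T \<inter> {..<l}))" using b by simp
    then have "(clifford_op l ^^ k) t (insert (l + b) S) (insert b T) = 0" using Suc by simp
    then show ?thesis by (simp add: ext_deriv_tensor_below)
  qed (simp add: ext_deriv_tensor_below)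
  then show ?case by (simp add: clifford_op_zeroI)
qed

lemma clifford_op_power_right_deriv_vanish:
  assumes "a < l" shows "(clifford_op l ^^ l) (right_deriv a t) S T = 0"
proof (rule clifford_op_power_vanish[where m = l])
  fix S T :: "nat set" assume "card (T \<inter> {..<l}) \<ge> l"
  then have "T \<inter> {..<l} = {..<l}" by (intro card_subset_eq) (auto intro: antisym card_mono[of "{..<l}", simplified])
  then have "a \<in> T" using assms by blast
  then show "right_deriv a t S T = 0" by (simp add: right_deriv_def ext_deriv_below)
qed simp

lemma clifford_exp_left_wedge_antighost:
  fixes t :: "'k::field_char_0 fls tensor2"
  assumes t: "finitary t" and a: "a < l"
  shows "clifford_exp l (left_wedge (l + a) t) =
    (\<lambda>S T. left_wedge (l + a) (clifford_exp l t) S T + 2 * fls_X * right_deriv a (clifford_exp l t) S T)"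
proof (intro ext)
  fix S T
  let ?C = "clifford_op l" and ?D = "right_deriv a t"
  have pow: "(?C ^^ k) (left_wedge (l + a) t) =
      (\<lambda>S T. left_wedge (l + a) ((?C ^^ k) t) S T + of_nat k * (2 * fls_X) * (?C ^^ (k - 1)) ?D S T)" for k
  proof (induction k)
    case (Suc k)
    have D: "(?C ^^ k) ?D = right_deriv a ((?C ^^ k) t)" for k
      by (induction k) (simp_all add: clifford_op_right_deriv finitary_clifford_op_power t)
    have "(?C ^^ Suc k) (left_wedge (l + a) t) = (\<lambda>S T. ?C (left_wedge (l + a) ((?C ^^ k) t)) S T +
        of_nat k * (2 * fls_X) * ?C ((?C ^^ (k - 1)) ?D) S T)"
      by (simp add: Suc.IH clifford_op_add clifford_op_scale)
    also have "\<dots> = (\<lambda>S T. left_wedge (l + a) (?C ((?C ^^ k) t)) S T + 2 * fls_X * (?C ^^ k) ?D S T +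
        of_nat k * (2 * fls_X) * (?C ^^ k) ?D S T)"
    proof -
      have e: "of_nat k * (2 * fls_X) * ?C ((?C ^^ (k - 1)) ?D) S T = of_nat k * (2 * fls_X) * (?C ^^ k) ?D S T" for S T
        by (cases k) simp_all
      show ?thesis
        by (simp only: e) (simp add: clifford_op_left_wedge_antighost[OF finitary_clifford_op_power[OF t] a] D)
    qed
    finally show ?case by (simp add: algebra_simps)
  qed simp
  have "clifford_exp l (left_wedge (l + a) t) S T =
      (\<Sum>k\<le>l. inverse (of_nat (fact k)) * left_wedge (l + a) ((?C ^^ k) t) S T) +
      2 * fls_X * (\<Sum>k\<le>l. inverse (of_nat (fact k)) * of_nat k * (?C ^^ (k - 1)) ?D S T)"
    by (simp add: clifford_exp_def pow distrib_left sum.distrib sum_distrib_left mult_ac)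
  also have "(\<Sum>k\<le>l. inverse (of_nat (fact k)) * left_wedge (l + a) ((?C ^^ k) t) S T) =
      left_wedge (l + a) (clifford_exp l t) S T"
    by (simp add: clifford_exp_def left_wedge_def wedge_def sum_distrib_left mult_ac)
  also have "(\<Sum>k\<le>l. inverse (of_nat (fact k)) * of_nat k * (?C ^^ (k - 1)) ?D S T) =
      (\<Sum>k<l. inverse (of_nat (fact k)) * (?C ^^ k) ?D S T)"
  proof -
    have "inverse (of_nat (fact (Suc k))) * of_nat (Suc k) = (inverse (of_nat (fact k)) :: 'k fls)" for k
    proof -
      have "of_nat (fact (Suc k)) = (of_nat (Suc k) * of_nat (fact k) :: 'k fls)"
        by (simp only: fact_Suc of_nat_mult of_nat_id)
      moreover have "(of_nat (Suc k) :: 'k fls) \<noteq> 0"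
        by (metis fls_of_nat fls_const_nonzero of_nat_eq_0_iff nat.distinct(1))
      ultimately show ?thesis by (simp add: field_simps del: of_nat_Suc fact_Suc)
    qed
    then show ?thesis
      unfolding lessThan_Suc_atMost[symmetric] sum.lessThan_Suc_shift by simp
  qed
  also have "\<dots> = clifford_exp l ?D S T"
    unfolding clifford_exp_def lessThan_Suc_atMost[symmetric]
    by (simp add: clifford_op_power_right_deriv_vanish[OF a])
  finally show "clifford_exp l (left_wedge (l + a) t) S T =
      left_wedge (l + a) (clifford_exp l t) S T + 2 * fls_X * right_deriv a (clifford_exp l t) S T"
    by (simp add: clifford_exp_right_deriv[OF t])
qed

subsection \<open>Multiplication in the exterior algebra\<close>

lemma ext_sign_insert_left:
  assumes "finite S" "finite Q" "i \<notin> S"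
  shows "ext_sign (insert i S) Q = ext_sign S Q * below_sign i Q"
proof -
  have "{(s, t). s \<in> insert i S \<and> t \<in> Q \<and> t < s} = {(s, t). s \<in> S \<and> t \<in> Q \<and> t < s} \<union> {i} \<times> {t\<in>Q. t < i}" by auto
  moreover have "finite {(s, t). s \<in> S \<and> t \<in> Q \<and> t < s}"
    by (rule finite_subset[of _ "S \<times> Q"]) (use assms in auto)
  moreover have "finite ({i} \<times> {t\<in>Q. t < i})" using assms by simp
  moreover have "{(s, t). s \<in> S \<and> t \<in> Q \<and> t < s} \<inter> {i} \<times> {t\<in>Q. t < i} = {}" using assms(3) by blast
  ultimately have "card {(s, t). s \<in> insert i S \<and> t \<in> Q \<and> t < s} =
      card {(s, t). s \<in> S \<and> t \<in> Q \<and> t < s} + card ({i} \<times> {t\<in>Q. t < i})"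
    by (simp only: card_Un_disjoint)
  then show ?thesis by (simp add: ext_sign_def below_sign_def power_add card_cartesian_product_singleton)
qed

lemma ext_sign_insert_right:
  assumes "finite S" "finite Q" "i \<notin> Q" "i \<notin> S"
  shows "ext_sign S (insert i Q) = ext_sign S Q * parity_sign S * below_sign i S"
proof -
  have "{(s, t). s \<in> S \<and> t \<in> insert i Q \<and> t < s} = {(s, t). s \<in> S \<and> t \<in> Q \<and> t < s} \<union> {s\<in>S. i < s} \<times> {i}" by auto
  moreover have "finite {(s, t). s \<in> S \<and> t \<in> Q \<and> t < s}"
    by (rule finite_subset[of _ "S \<times> Q"]) (use assms in auto)
  moreover have "finite ({s\<in>S. i < s} \<times> {i})" using assms by simp
  moreover have "{(s, t). s \<in> S \<and> t \<in> Q \<and> t < s} \<inter> {s\<in>S. i < s} \<times> {i} = {}" using assms(3) by blast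
  ultimately have 1: "card {(s, t). s \<in> S \<and> t \<in> insert i Q \<and> t < s} =
      card {(s, t). s \<in> S \<and> t \<in> Q \<and> t < s} + card ({s\<in>S. i < s} \<times> {i})"
    by (simp only: card_Un_disjoint)
  have "S \<subseteq> {s\<in>S. i < s} \<union> {s\<in>S. s < i}"
  proof
    fix x assume x: "x \<in> S"
    then have "x \<noteq> i" using assms(4) by blast
    then have "i < x \<or> x < i" by arith
    then show "x \<in> {s\<in>S. i < s} \<union> {s\<in>S. s < i}" using x by blast
  qed
  then have "S = {s\<in>S. i < s} \<union> {s\<in>S. s < i}" by blast
  moreover have "card ({s\<in>S. i < s} \<union> {s\<in>S. s < i}) = card {s\<in>S. i < s} + card {s\<in>S. s < i}"
    by (rule card_Un_disjoint) (use assms in auto)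
  ultimately have 2: "card S = card {s\<in>S. i < s} + card {s\<in>S. s < i}" by metis
  have "(-1 :: 'a) ^ card {s\<in>S. i < s} = (-1) ^ card S * (-1) ^ card {s\<in>S. s < i}"
    unfolding 2 by (simp add: power_add mult.assoc flip: power_mult_distrib)
  then show ?thesis using 1
    by (simp add: ext_sign_def below_sign_def parity_sign_def power_add card_cartesian_product mult.assoc)
qed

lemma sum_Pow_insert:
  assumes "finite V" "i \<notin> V"
  shows "(\<Sum>S\<in>Pow (insert i V). g S) = (\<Sum>S\<in>Pow V. g S) + (\<Sum>S\<in>Pow V. g (insert i S))"
proof -
  have inj: "inj_on (insert i) (Pow V)" using assms by (intro inj_onI) (metis PowD insert_ident subsetD)
  have "(\<Sum>S\<in>Pow (insert i V). g S) = (\<Sum>S\<in>Pow V. g S) + (\<Sum>S\<in>insert i ` Pow V. g S)"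
    unfolding Pow_insert using assms by (intro sum.union_disjoint) auto
  then show ?thesis by (simp add: sum.reindex[OF inj])
qed

lemma ext_mu_infinite: "infinite U ==> ext_mu t U = 0"
  by (simp add: ext_mu_def)

lemma ext_mu_left_wedge: "ext_mu (left_wedge i t) = wedge i (ext_mu t)"
proof
  fix U
  show "ext_mu (left_wedge i t) U = wedge i (ext_mu t) U"
  proof (cases "finite U \<and> i \<in> U")
    case True
    define V where "V = U - {i}"
    have V: "U = insert i V" "finite V" "i \<notin> V" using True by (auto simp: V_def)
    have "ext_mu (left_wedge i t) U = (\<Sum>S\<in>Pow V. ext_sign S (U - S) * left_wedge i t S (U - S)) +
        (\<Sum>S\<in>Pow V. ext_sign (insert i S) (U - insert i S) * left_wedge i t (insert i S) (U - insert i S))"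
      unfolding ext_mu_def V(1) by (rule sum_Pow_insert) (use V in auto)
    also have "(\<Sum>S\<in>Pow V. ext_sign S (U - S) * left_wedge i t S (U - S)) = 0"
      using V by (intro sum.neutral) (auto simp: left_wedge_def wedge_def)
    also have "(\<Sum>S\<in>Pow V. ext_sign (insert i S) (U - insert i S) * left_wedge i t (insert i S) (U - insert i S)) =
        (\<Sum>S\<in>Pow V. below_sign i U * (ext_sign S (V - S) * t S (V - S)))"
    proof (rule sum.cong[OF refl])
      fix S assume S: "S \<in> Pow V"
      then have fin: "finite S" "finite (V - S)" and iS: "i \<notin> S" and e: "U - insert i S = V - S" "insert i S - {i} = S"
        using V by (auto intro: finite_subset)
      have "{s\<in>V. s < i} = {s\<in>S. s < i} \<union> {s\<in>V - S. s < i}" using S by auto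
      then have "card {s\<in>V. s < i} = card {s\<in>S. s < i} + card {s\<in>V - S. s < i}"
        using fin by (simp add: card_Un_disjoint disjoint_iff)
      then have "below_sign i V = below_sign i S * (below_sign i (V - S) :: 'a)"
        by (simp add: below_sign_def power_add)
      then show "ext_sign (insert i S) (U - insert i S) * left_wedge i t (insert i S) (U - insert i S) =
          below_sign i U * (ext_sign S (V - S) * t S (V - S))"
        using V by (simp add: e left_wedge_def wedge_def ext_sign_insert_left[OF fin iS] below_sign_insert iS mult_ac)
    qed
    also have "\<dots> = below_sign i U * ext_mu t V" by (simp add: ext_mu_def sum_distrib_left)
    finally show ?thesis using True by (simp add: wedge_def V_def)
  next
    case False
    then show ?thesis
      by (auto simp: wedge_def ext_mu_infinite) (auto simp: ext_mu_def left_wedge_def wedge_def intro!: sum.neutral)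
  qed
qed

lemma ext_mu_deriv: "ext_mu (left_deriv a t) U + ext_mu (right_deriv a t) U = ext_deriv a (ext_mu t) U"
proof (cases "finite U")
  case fin: True
  show ?thesis
  proof (cases "a \<in> U")
    case True
    define V where "V = U - {a}"
    have V: "U = insert a V" "finite V" "a \<notin> V" using True fin by (auto simp: V_def)
    have "ext_mu (left_deriv a t) U + ext_mu (right_deriv a t) U =
        (\<Sum>S\<in>Pow U. ext_sign S (U - S) * (left_deriv a t S (U - S) + right_deriv a t S (U - S)))"
      by (simp add: ext_mu_def distrib_left sum.distrib)
    also have "\<dots> = (\<Sum>S\<in>Pow V. ext_sign S (U - S) * (left_deriv a t S (U - S) + right_deriv a t S (U - S))) +
      (\<Sum>S\<in>Pow V. ext_sign (insert a S) (U - insert a S) * (left_deriv a t (insert a S) (U - insert a S) +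
        right_deriv a t (insert a S) (U - insert a S)))"
      unfolding V(1) by (rule sum_Pow_insert) (use V in auto)
    also have "\<dots> = (\<Sum>S\<in>Pow V. 0)"
      unfolding sum.distrib[symmetric]
    proof (rule sum.cong[OF refl])
      fix S assume S: "S \<in> Pow V"
      define Q where "Q = V - S"
      have *: "finite S" "finite Q" "a \<notin> S" "a \<notin> Q" "U - S = insert a Q" "U - insert a S = Q"
        using S V by (auto simp: Q_def intro: finite_subset)
      show "ext_sign S (U - S) * (left_deriv a t S (U - S) + right_deriv a t S (U - S)) +
        ext_sign (insert a S) (U - insert a S) * (left_deriv a t (insert a S) (U - insert a S) +
        right_deriv a t (insert a S) (U - insert a S)) = 0"
        using * by (simp add: left_deriv_def right_deriv_def ext_deriv_below ext_sign_insert_left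
            ext_sign_insert_right parity_sign_insert below_sign_insert mult_ac)
    qed
    finally show ?thesis using True by (simp add: ext_deriv_below)
  next
    case False
    have "ext_deriv a (ext_mu t) U = (\<Sum>S\<in>Pow U. below_sign a U * (ext_sign S (insert a U - S) * t S (insert a U - S))) +
        (\<Sum>S\<in>Pow U. below_sign a U * (ext_sign (insert a S) (insert a U - insert a S) * t (insert a S) (insert a U - insert a S)))"
      using False fin by (simp add: ext_deriv_below ext_mu_def sum_Pow_insert distrib_left sum_distrib_left)
    also have "\<dots> = ext_mu (right_deriv a t) U + ext_mu (left_deriv a t) U"
      unfolding ext_mu_def sum.distrib[symmetric]
    proof (rule sum.cong[OF refl])
      fix S assume S: "S \<in> Pow U"
      define Q where "Q = U - S"
      have *: "finite S" "finite Q" "a \<notin> S" "a \<notin> Q" "insert a U - S = insert a Q" "insert a U - insert a S = Q"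
        using S False fin by (auto simp: Q_def intro: finite_subset)
      have "{s\<in>U. s < a} = {s\<in>S. s < a} \<union> {s\<in>Q. s < a}" using S by (auto simp: Q_def)
      then have "card {s\<in>U. s < a} = card {s\<in>S. s < a} + card {s\<in>Q. s < a}"
        using * by (simp add: card_Un_disjoint disjoint_iff Q_def)
      then have "below_sign a U = below_sign a S * (below_sign a Q :: 'a)"
        by (simp add: below_sign_def power_add)
      then show "below_sign a U * (ext_sign S (insert a U - S) * t S (insert a U - S)) +
          below_sign a U * (ext_sign (insert a S) (insert a U - insert a S) * t (insert a S) (insert a U - insert a S)) =
          ext_sign S (U - S) * right_deriv a t S (U - S) + ext_sign S (U - S) * left_deriv a t S (U - S)"
        using * by (simp add: Q_def[symmetric] left_deriv_def right_deriv_def ext_deriv_below ext_sign_insert_left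
            ext_sign_insert_right mult_ac)
    qed
    finally show ?thesis by (simp add: add.commute)
  qed
next
  case False
  then show ?thesis by (simp add: ext_mu_infinite ext_deriv_below)
qed

section \<open>Left multiplication by generators\<close>

subsection \<open>Left multiplication by generators\<close>

definition lop :: "nat => nat => (nat set => 'k::field_char_0 fls) => nat set => 'k fls" where
  "lop l i v = (\<lambda>U. wedge i v U + (if l \<le> i then 2 * fls_X * ext_deriv (i - l) v U else 0))"

lemma clifford_mult_exp: "clifford_mult l v w = ext_mu (clifford_exp l (\<lambda>S T. v S * w T))"
  by (simp add: clifford_mult_def clifford_exp_def)

lemma finitary1_clifford_mult: "finitary1 (clifford_mult l v w)"
  unfolding finitary1_def clifford_mult_exp using ext_mu_infinite by blast

lemma ext_mu_sum: "ext_mu (\<lambda>S T. \<Sum>i\<in>I. c i * t i S T) U = (\<Sum>i\<in>I. c i * ext_mu (t i) U)"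
  unfolding ext_mu_def by (simp add: sum_distrib_left mult_ac) (rule sum.swap)

lemma clifford_mult_sum_right: "finite I ==>
    clifford_mult l v (\<lambda>T. \<Sum>i\<in>I. c i * w i T) U = (\<Sum>i\<in>I. c i * clifford_mult l v (w i) U)"
  using clifford_exp_sum[of I l c "\<lambda>i S T. v S * w i T"]
  by (simp add: clifford_mult_exp ext_mu_sum sum_distrib_left mult_ac)

lemma clifford_mult_sum_left: "finite I ==>
    clifford_mult l (\<lambda>T. \<Sum>i\<in>I. c i * v i T) w U = (\<Sum>i\<in>I. c i * clifford_mult l (v i) w U)"
  using clifford_exp_sum[of I l c "\<lambda>i S T. v i S * w T"]
  by (simp add: clifford_mult_exp ext_mu_sum sum_distrib_right mult.assoc)

lemma lop_sum: "lop l i (\<lambda>U. \<Sum>j\<in>J. c j * v j U) U = (\<Sum>j\<in>J. c j * lop l i (v j) U)"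
  by (simp add: lop_def wedge_def ext_deriv_below sum_distrib_left sum.distrib distrib_left mult_ac)

lemma finitary1_lop: "finitary1 v ==> finitary1 (lop l i v)"
proof -
  assume v: "finitary1 v"
  have "lop l i v U = 0" if "infinite U" for U
  proof -
    have "v (U - {i}) = 0" "v (insert (i - l) U) = 0" using v that by (auto simp: finitary1_def)
    then show ?thesis by (simp add: lop_def wedge_def ext_deriv_below)
  qed
  then show ?thesis by (auto simp: finitary1_def)
qed

lemma finitary_tensor: "finitary1 v ==> finitary1 w ==> finitary (\<lambda>S T. v S * w T :: 'r::comm_ring_1)"
  by (auto simp: finitary_def finitary1_def) (metis mult_zero_left mult_zero_right)+

text \<open>Multiplication by an antighost on the left factor fails to commute with the exponent, and
  the commutator is the derivative of the right factor; together with the derivative of the left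
  factor this is the derivative of the product.\<close>

lemma clifford_mult_lop:
  assumes v: "finitary1 v" and w: "finitary1 w" and i: "i < 2 * l"
  shows "clifford_mult l (lop l i v) w = lop l i (clifford_mult l v w)"
proof (cases "i < l")
  case True
  have "(\<lambda>S T. lop l i v S * w T) = left_wedge i (\<lambda>S T. v S * w T)"
    using True by (auto simp: lop_def left_wedge_def wedge_def fun_eq_iff)
  then show ?thesis
    using True clifford_exp_left_wedge[OF finitary_tensor[OF v w] True]
    by (simp add: clifford_mult_exp ext_mu_left_wedge lop_def)
next
  case False
  then obtain a where a: "i = l + a" "a < l" using i by (metis add_less_cancel_left le_Suc_ex mult_2 not_less)
  let ?t = "\<lambda>S T. v S * w T"
  let ?E = "clifford_exp l ?t"
  have fin: "finitary ?t" by (rule finitary_tensor[OF v w])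
  have "(\<lambda>S T. lop l i v S * w T) =
      (\<lambda>S T. \<Sum>b\<in>{False, True}. (if b then 2 * fls_X else 1) * (if b then left_deriv a ?t else left_wedge i ?t) S T)"
    by (auto simp: a lop_def left_wedge_def left_deriv_def wedge_def ext_deriv_below fun_eq_iff algebra_simps)
  then have "clifford_exp l (\<lambda>S T. lop l i v S * w T) =
      (\<lambda>S T. clifford_exp l (left_wedge i ?t) S T + 2 * fls_X * clifford_exp l (left_deriv a ?t) S T)"
    by (simp only: clifford_exp_sum finite.insertI finite.emptyI) simp
  also have "\<dots> = (\<lambda>S T. \<Sum>b\<in>{0, 1, 2 :: nat}. (if b = 0 then 1 else 2 * fls_X) *
      (if b = 0 then left_wedge i ?E else if b = 1 then right_deriv a ?E else left_deriv a ?E) S T)"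
    using clifford_exp_left_wedge_antighost[OF fin a(2)] clifford_exp_left_deriv[OF fin a(2)]
    by (simp add: a algebra_simps)
  finally have "clifford_mult l (lop l i v) w U = ext_mu (left_wedge i ?E) U +
      2 * fls_X * (ext_mu (left_deriv a ?E) U + ext_mu (right_deriv a ?E) U)" for U
    by (simp only: clifford_mult_exp ext_mu_sum) (simp add: algebra_simps)
  then show ?thesis
    by (simp add: fun_eq_iff ext_mu_deriv ext_mu_left_wedge lop_def a clifford_mult_exp)
qed

lemma clifford_mult_one_left:
  assumes w: "finitary1 w"
  shows "clifford_mult l (ext_basis {}) w = w"
proof
  fix U
  let ?t = "\<lambda>S T. ext_basis {} S * w T"
  have 0: "clifford_op l ?t = (\<lambda>S T. 0)"
    by (intro ext clifford_op_zeroI) (simp add: ext_deriv_tensor_below ext_basis_def)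
  have "clifford_op l (\<lambda>S T. 0) = (\<lambda>S T. 0 :: 'a fls)"
    by (intro ext clifford_op_zeroI) (simp add: ext_deriv_tensor_below)
  then have "(clifford_op l ^^ k) (\<lambda>S T. 0) = (\<lambda>S T. 0 :: 'a fls)" for k
    by (induction k) simp_all
  then have pow: "(clifford_op l ^^ k) ?t = (if k = 0 then ?t else (\<lambda>S T. 0))" for k
    by (cases k) (simp_all add: funpow_swap1 0)
  have "clifford_exp l ?t S T = ?t S T" for S T
  proof -
    have "clifford_exp l ?t S T = (\<Sum>k\<in>{0}. inverse (of_nat (fact k)) * (clifford_op l ^^ k) ?t S T)"
      unfolding clifford_exp_def by (rule sum.mono_neutral_right) (auto simp: pow)
    then show ?thesis by simp
  qed
  then have "clifford_mult l (ext_basis {}) w U = ext_mu ?t U" by (simp add: clifford_mult_exp ext_mu_def)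
  also have "\<dots> = w U"
  proof (cases "finite U")
    case True
    have "ext_mu ?t U = (\<Sum>S\<in>{{}}. ext_sign S (U - S) * ?t S (U - S))"
      unfolding ext_mu_def by (rule sum.mono_neutral_right) (auto simp: ext_basis_def True)
    then show ?thesis by (simp add: ext_sign_def ext_basis_def)
  qed (use w in \<open>auto simp: ext_mu_infinite finitary1_def\<close>)
  finally show "clifford_mult l (ext_basis {}) w U = w U" .
qed

lemma finitary1_basis: "finite S ==> finitary1 (ext_basis S)"
  by (auto simp: finitary1_def ext_basis_def)

lemma clifford_mult_one_basis:
  "finite S ==> clifford_mult l (ext_basis {}) (ext_basis S) U = (if U = S then 1 else 0)"
  by (subst clifford_mult_one_left, erule finitary1_basis, simp add: ext_basis_def)

lemma ext_basis_insert:
  assumes "\<forall>s\<in>S. i < s"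
  shows "ext_basis (insert i S) = lop l i (ext_basis S)"
proof
  fix U
  have "i \<notin> S" using assms by blast
  then have e: "i \<in> U \<and> U - {i} = S \<longleftrightarrow> U = insert i S" by auto
  have "{s \<in> insert i S. s < i} = {}" using assms by auto
  then have "below_sign i (insert i S) = (1 :: 'a fls)" unfolding below_sign_def by (simp only: card.empty power_0)
  then have "wedge i (ext_basis S) U = (ext_basis (insert i S) U :: 'a fls)"
    using e by (auto simp: wedge_def ext_basis_def)
  moreover have "ext_deriv (i - l) (ext_basis S) U = (0 :: 'a fls)"
    using assms by (auto simp: ext_deriv_below ext_basis_def)
  ultimately show "ext_basis (insert i S) U = (lop l i (ext_basis S) U :: 'a fls)" by (simp add: lop_def)
qed

lemma clifford_mult_basis_insert:
  "[|finite S; \<forall>s\<in>S. i < s; i < 2 * l; finitary1 w|] ==>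
    clifford_mult l (ext_basis (insert i S)) w = lop l i (clifford_mult l (ext_basis S) w)"
  by (simp add: ext_basis_insert[of S i l] clifford_mult_lop finitary1_basis)

lemma clifford_mult_basis_one:
  assumes "finite S" "S \<subseteq> {..<2 * l}"
  shows "clifford_mult l (ext_basis S) (ext_basis {}) = (ext_basis S :: nat set => 'k::field_char_0 fls)"
  using assms
proof (induction S rule: finite_linorder_min_induct)
  case empty
  show ?case by (simp add: clifford_mult_one_left finitary1_basis)
next
  case (insert i S)
  then have "clifford_mult l (ext_basis (insert i S)) (ext_basis {}) = lop l i (ext_basis S :: nat set => 'k fls)"
    by (simp add: clifford_mult_basis_insert finitary1_basis)
  also have "\<dots> = ext_basis (insert i S)" by (rule ext_basis_insert[OF insert.hyps(2), symmetric])
  finally show ?case .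
qed

lemma clifford_mult_basis_assoc:
  fixes v w :: "nat set => 'k::field_char_0 fls"
  assumes "finite S" "S \<subseteq> {..<2 * l}" "finitary1 v" "finitary1 w"
  shows "clifford_mult l (clifford_mult l (ext_basis S) v) w = clifford_mult l (ext_basis S) (clifford_mult l v w)"
  using assms
proof (induction S rule: finite_linorder_min_induct)
  case empty
  then show ?case by (simp add: clifford_mult_one_left finitary1_clifford_mult)
next
  case (insert i S)
  then show ?case
    by (simp add: clifford_mult_basis_insert clifford_mult_lop finitary1_clifford_mult)
qed

lemma basis_expansion:
  assumes "\<And>T. v T \<noteq> 0 ==> T \<subseteq> {..<n :: nat}"
  shows "v = (\<lambda>T. \<Sum>S\<in>Pow {..<n}. v S * ext_basis S T)"
proof
  fix T
  have "(\<Sum>S\<in>Pow {..<n}. v S * ext_basis S T) = (\<Sum>S\<in>Pow {..<n}. if S = T then v T else 0)"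
    by (intro sum.cong) (auto simp: ext_basis_def)
  also have "\<dots> = v T" using assms[of T] by auto
  finally show "v T = (\<Sum>S\<in>Pow {..<n}. v S * ext_basis S T)" by simp
qed

lemma lop_nonzero:
  assumes "lop l i z U \<noteq> 0"
  shows "(i \<in> U \<and> z (U - {i}) \<noteq> 0) \<or> (l \<le> i \<and> i - l \<notin> U \<and> z (insert (i - l) U) \<noteq> 0)"
  using assms by (auto simp: lop_def wedge_def ext_deriv_below split: if_splits)

lemma ghost_number_insert:
  assumes "i \<notin> S" "i < 2 * l"
  shows "ghost_number l (insert i S) = ghost_number l S + (if i < l then 1 else - 1)"
proof (cases "i < l")
  case True
  then have "{a. a < l \<and> a \<in> insert i S} = insert i {a. a < l \<and> a \<in> S}"
    "{a. a < l \<and> l + a \<in> insert i S} = {a. a < l \<and> l + a \<in> S}" by auto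
  then show ?thesis using True assms by (simp add: ghost_number_def)
next
  case False
  then have "{a. a < l \<and> l + a \<in> insert i S} = insert (i - l) {a. a < l \<and> l + a \<in> S}"
    "{a. a < l \<and> a \<in> insert i S} = {a. a < l \<and> a \<in> S}" using assms by auto
  moreover have "i - l \<notin> {a. a < l \<and> l + a \<in> S}" using False assms by auto
  ultimately show ?thesis using False assms by (simp add: ghost_number_def)
qed

lemma ghost_number_empty [simp]: "ghost_number l {} = 0"
  by (simp add: ghost_number_def)

lemma clifford_mult_support:
  fixes w :: "nat set => 'k::field_char_0 fls"
  assumes "finite S" "S \<subseteq> {..<2 * l}" and w: "finitary1 w" "\<And>T. w T \<noteq> 0 ==> T \<subseteq> {..<2 * l} \<and> ghost_number l T = n"
  shows "clifford_mult l (ext_basis S) w U \<noteq> 0 ==>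
    U \<subseteq> {..<2 * l} \<and> ghost_number l U = ghost_number l S + n \<and> S \<inter> {..<l} \<subseteq> U"
  using assms(1,2)
proof (induction S arbitrary: U rule: finite_linorder_min_induct)
  case empty
  then show ?case using w by (simp add: clifford_mult_one_left)
next
  case (insert i S)
  define z where "z = clifford_mult l (ext_basis S) w"
  have i: "i < 2 * l" "i \<notin> S" using insert by auto
  have IH: "U \<subseteq> {..<2 * l} \<and> ghost_number l U = ghost_number l S + n \<and> S \<inter> {..<l} \<subseteq> U"
    if "z U \<noteq> 0" for U using insert that by (auto simp: z_def)
  have "lop l i z U \<noteq> 0" using insert i w by (simp add: clifford_mult_basis_insert z_def)
  then consider "i \<in> U" "z (U - {i}) \<noteq> 0" | "l \<le> i" "i - l \<notin> U" "z (insert (i - l) U) \<noteq> 0"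
    using lop_nonzero by blast
  then show ?case
  proof cases
    case 1
    have "U = insert i (U - {i})" using 1 by blast
    then have "ghost_number l U = ghost_number l (U - {i}) + (if i < l then 1 else - 1)"
      using ghost_number_insert[of i "U - {i}" l] i by auto
    then show ?thesis using IH[OF 1(2)] ghost_number_insert[of i S l] i 1(1) by auto
  next
    case 2
    have "S \<inter> {..<l} = {}" using insert.hyps(2) 2(1) by force
    moreover have "ghost_number l (insert (i - l) U) = ghost_number l U + 1"
      using ghost_number_insert[of "i - l" U l] 2 i by simp
    ultimately show ?thesis using IH[OF 2(3)] ghost_number_insert[of i S l] i 2(1) by auto
  qed
qed


subsection \<open>The action on the antighosts\<close>

definition lift :: "nat => nat set => nat set" where
  "lift l T = (+) l ` T"

lemma lift_simps [simp]: "lift l {} = {}" "lift l (insert b T) = insert (l + b) (lift l T)"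
  "finite (lift l T) \<longleftrightarrow> finite T" "l + b \<in> lift l T \<longleftrightarrow> b \<in> T"
  by (auto simp: lift_def finite_image_iff)

lemma lift_inject [simp]: "lift l T = lift l V \<longleftrightarrow> T = V"
  by (simp add: lift_def inj_image_eq_iff)

lemma lift_remove: "lift l T - {l + b} = lift l (T - {b})"
  by (auto simp: lift_def)

lemma lift_ghost: "a < l ==> a \<notin> lift l T" by (auto simp: lift_def)

lemma lift_subset: "T \<subseteq> {..<l} ==> lift l T \<subseteq> {..<2 * l}" by (auto simp: lift_def)

lemma ghost_number_lift: "T \<subseteq> {..<l} ==> ghost_number l (lift l T) = - int (card T)"
proof -
  assume T: "T \<subseteq> {..<l}"
  then have "{a. a < l \<and> a \<in> lift l T} = {}" "{a. a < l \<and> l + a \<in> lift l T} = T"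
    by (auto simp: lift_ghost)
  then show ?thesis by (simp only: ghost_number_def) simp
qed

lemma clifford_mult_lift_insert:
  assumes "finite T" "\<forall>t\<in>T. b < t" "b < l" "finitary1 w"
  shows "clifford_mult l (ext_basis (lift l (insert b T))) w = lop l (l + b) (clifford_mult l (ext_basis (lift l T)) w)"
  using assms by (simp, intro clifford_mult_basis_insert) (auto simp: lift_def)

lemma lop_antighost: "lop l (l + b) z U = (if l + b \<in> U then below_sign (l + b) U * z (U - {l + b}) else 0)
    + 2 * fls_X * (if b \<in> U then 0 else below_sign b U * z (insert b U))"
  by (simp add: lop_def wedge_def ext_deriv_below)

lemma lift_mult_support:
  assumes "finite T" "T \<subseteq> {..<l}" "A \<subseteq> {..<l}" "finite B"
  shows "clifford_mult l (ext_basis (lift l T)) (ext_basis (A \<union> lift l B)) U \<noteq> (0 :: 'k::field_char_0 fls) ==>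
    A \<subseteq> T \<union> U \<and> U \<inter> {..<l} \<subseteq> A"
  using assms(1,2)
proof (induction T arbitrary: U rule: finite_linorder_min_induct)
  case empty
  have "finite A" using assms(3) finite_subset by blast
  then have "U = A \<union> lift l B"
    using empty assms(4) by (simp add: clifford_mult_one_basis split: if_splits)
  then show ?case by (auto simp: lift_def)
next
  case (insert b T)
  have fin: "finite (A \<union> lift l B)" using assms(3,4) finite_subset by auto
  have b: "b < l" using insert.prems by simp
  have "lop l (l + b) (clifford_mult l (ext_basis (lift l T)) (ext_basis (A \<union> lift l B))) U \<noteq> (0 :: 'k fls)"
    using insert.prems(1) unfolding clifford_mult_lift_insert[OF insert.hyps(1,2) b finitary1_basis[OF fin]] .
  from lop_nonzero[OF this] insert show ?case by auto
qed

text \<open>A ghost in the second factor either survives or is contracted with an antighost of the first.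
  If every antighost is needed for a contraction, then the contraction gives a nonzero scalar.\<close>

lemma lift_mult_diagonal:
  assumes "finite T" "T \<subseteq> {..<l}" "G \<subseteq> {..<l}" "T \<inter> G = {}"
  shows "\<exists>\<kappa>\<noteq>0. \<forall>B V. B \<subseteq> {..<l} \<longrightarrow> V \<subseteq> {..<l} \<longrightarrow>
    clifford_mult l (ext_basis (lift l T)) (ext_basis ((T \<union> G) \<union> lift l B)) (G \<union> lift l V) =
      (if B = V then \<kappa> else (0 :: 'k::field_char_0 fls))"
  using assms
proof (induction T arbitrary: G rule: finite_linorder_min_induct)
  case empty
  have "G \<union> lift l V = G \<union> lift l B \<longleftrightarrow> V = B" for B V
  proof -
    have "(G \<union> lift l V) - {..<l} = lift l V" for V using empty(2) by (auto simp: lift_def)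
    then show ?thesis by (metis lift_inject)
  qed
  moreover have "finite (G \<union> lift l B)" if "B \<subseteq> {..<l}" for B
    using that empty(2) finite_subset by auto
  ultimately show ?case
    by (intro exI[of _ 1]) (auto simp: clifford_mult_one_basis)
next
  case (insert b T)
  have b: "b < l" "b \<notin> T" "b \<notin> G" "T \<subseteq> {..<l}" using insert by auto
  obtain \<kappa> :: "'k fls" where \<kappa>: "\<kappa> \<noteq> 0" "\<And>B V. B \<subseteq> {..<l} ==> V \<subseteq> {..<l} ==>
    clifford_mult l (ext_basis (lift l T)) (ext_basis ((T \<union> insert b G) \<union> lift l B)) (insert b G \<union> lift l V) =
      (if B = V then \<kappa> else 0)"
    using insert.IH[of "insert b G"] insert.prems b by auto
  have "clifford_mult l (ext_basis (lift l (insert b T))) (ext_basis ((insert b T \<union> G) \<union> lift l B)) (G \<union> lift l V) =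
      (if B = V then 2 * fls_X * (below_sign b G * \<kappa>) else 0)"
    if BV: "B \<subseteq> {..<l}" "V \<subseteq> {..<l}" for B V
  proof -
    let ?A = "insert b T \<union> G" and ?U = "G \<union> lift l V"
    define z :: "nat set => 'k fls" where "z = clifford_mult l (ext_basis (lift l T)) (ext_basis (?A \<union> lift l B))"
    have A: "?A \<subseteq> {..<l}" using insert.prems by auto
    have finB: "finite B" using BV finite_subset by blast
    have fin: "finite (?A \<union> lift l B)" using A finB finite_subset by auto
    have "clifford_mult l (ext_basis (lift l (insert b T))) (ext_basis (?A \<union> lift l B)) ?U = lop l (l + b) z ?U"
      unfolding z_def by (subst clifford_mult_lift_insert[OF insert.hyps(1,2) b(1) finitary1_basis[OF fin]]) (rule refl)
    also have "z (?U - {l + b}) = 0"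
    proof (rule ccontr)
      assume "z (?U - {l + b}) \<noteq> 0"
      then have "?A \<subseteq> T \<union> (?U - {l + b})"
        using lift_mult_support[OF insert.hyps(1) b(4) A finB] unfolding z_def by blast
      then show False using b lift_ghost[OF b(1)] by auto
    qed
    then have "lop l (l + b) z ?U = 2 * fls_X * (below_sign b ?U * z (insert b ?U))"
      using b lift_ghost[OF b(1)] by (simp add: lop_antighost)
    also have "z (insert b ?U) = (if B = V then \<kappa> else 0)"
    proof -
      have "?A = T \<union> insert b G" "insert b ?U = insert b G \<union> lift l V" by auto
      then show ?thesis unfolding z_def using \<kappa>(2)[OF BV] by metis
    qed
    also have "below_sign b ?U = (below_sign b G :: 'k fls)"
    proof -
      have "{s \<in> ?U. s < b} = {s \<in> G. s < b}" using b(1) by (auto simp: lift_def)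
      then show ?thesis unfolding below_sign_def by (simp only:)
    qed
    finally show ?thesis by simp
  qed
  moreover have "2 * fls_X * (below_sign b G * \<kappa>) \<noteq> 0"
    using \<kappa>(1) below_sign_unit[where 'r = "'k fls", of b G] by auto
  ultimately show ?case by blast
qed

lemma lift_mult_order:
  assumes "finite T" "T \<subseteq> {..<l}" "A \<subseteq> {..<l}" "finite B"
  shows "m < int (card A) - int (card (U \<inter> {..<l})) ==>
    fls_nth (clifford_mult l (ext_basis (lift l T)) (ext_basis (A \<union> lift l B)) U) m = (0 :: 'a::field_char_0)"
  using assms(1,2)
proof (induction T arbitrary: U m rule: finite_linorder_min_induct)
  case empty
  have finA: "finite A" using assms(3) finite_subset by blast
  show ?case
  proof (cases "U = A \<union> lift l B")
    case True
    then have "U \<inter> {..<l} = A" using assms(3) by (auto simp: lift_def)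
    then show ?thesis using empty finA assms(4) True
      by (simp add: clifford_mult_one_basis)
  next
    case False
    then show ?thesis using finA assms(4) by (simp add: clifford_mult_one_basis)
  qed
next
  case (insert b T)
  define z where "z = (clifford_mult l (ext_basis (lift l T)) (ext_basis (A \<union> lift l B)) :: nat set => 'a fls)"
  have fin: "finite (A \<union> lift l B)" using assms(3,4) finite_subset by auto
  have b: "b < l" using insert.prems by simp
  have IH: "fls_nth (z U) m = 0" if "m < int (card A) - int (card (U \<inter> {..<l}))" for U m
    unfolding z_def using insert.IH[OF that] insert.prems by simp
  have sg: "fls_nth (below_sign i S * x) m = 0" if "fls_nth x m = 0" for x :: "'a fls" and i S m
    using that below_sign_unit[where 'r = "'a fls", of i S] by auto
  have "(U - {l + b}) \<inter> {..<l} = U \<inter> {..<l}" by auto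
  then have 1: "fls_nth (if l + b \<in> U then below_sign (l + b) U * z (U - {l + b}) else 0) m = 0"
    using IH[of m "U - {l + b}"] insert.prems(1) sg by auto
  have 2: "fls_nth (if b \<in> U then 0 else below_sign b U * z (insert b U)) (m - 1) = 0"
  proof (cases "b \<in> U")
    case False
    then have "insert b U \<inter> {..<l} = insert b (U \<inter> {..<l})" using b by auto
    then have "card (insert b U \<inter> {..<l}) = Suc (card (U \<inter> {..<l}))" using False by simp
    then show ?thesis using IH[of "m - 1" "insert b U"] insert.prems(1) sg False by simp
  qed simp
  have "fls_nth (2 * fls_X * y) m = 2 * fls_nth y (m - 1)" for y :: "'a fls"
  proof -
    have "fls_nth (2 * (fls_X * y)) m = 2 * fls_nth (fls_X * y) m"
      by (metis fls_plus_nth mult_2)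
    moreover have "fls_nth (fls_X * y) m = fls_nth y (m - 1)" by (simp add: fls_X_times_conv_shift)
    ultimately show ?thesis by (simp only: mult.assoc)
  qed
  then show ?case
    unfolding clifford_mult_lift_insert[OF insert.hyps(1,2) b finitary1_basis[OF fin]]
    using 1 2 by (simp only: lop_antighost fls_plus_nth z_def[symmetric]) simp
qed

lemma lift_mult_ghost:
  assumes "finite T" "T \<subseteq> {..<l}" "a < l"
  shows "clifford_mult l (ext_basis (lift l T)) (ext_basis {a}) (lift l V) =
      (if a \<in> T \<and> V = T - {a} then 2 * fls_X * (-1) ^ card {t\<in>T. a < t} else (0 :: 'k::field_char_0 fls))"
    and "b < l ==> b \<notin> T ==> clifford_mult l (ext_basis (lift l T)) (ext_basis {a}) (insert b (lift l V)) =
      (if a = b \<and> V = T then (-1) ^ card T else (0 :: 'k fls))"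
  using assms(1,2)
proof (induction T arbitrary: V b rule: finite_linorder_min_induct)
  case empty
  {
    case 1
    have "lift l V \<noteq> {a}" using lift_ghost[OF assms(3)] by blast
    then show ?case by (simp add: clifford_mult_one_basis)
  next
    case 2
    have "insert b (lift l V) = {a} \<longleftrightarrow> a = b \<and> V = {}"
      using lift_ghost[OF assms(3), of V] by (auto simp: lift_def)
    then show ?case by (simp add: clifford_mult_one_basis)
  }
next
  case (insert c T)
  define z where "z = (clifford_mult l (ext_basis (lift l T)) (ext_basis {a}) :: nat set => 'k fls)"
  have IH1: "z (lift l V) = (if a \<in> T \<and> V = T - {a} then 2 * fls_X * (-1) ^ card {t\<in>T. a < t} else 0)" if "T \<subseteq> {..<l}" for V
    unfolding z_def by (rule insert.IH(1)[OF that])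
  have IH2: "z (insert b (lift l V)) = (if a = b \<and> V = T then (-1) ^ card T else 0)"
    if "b < l" "b \<notin> T" "T \<subseteq> {..<l}" for b V unfolding z_def by (rule insert.IH(2)[OF that])
  have mult: "clifford_mult l (ext_basis (lift l (insert c T))) (ext_basis {a}) = lop l (l + c) z" if "c < l"
    unfolding z_def by (rule clifford_mult_lift_insert[OF insert.hyps(1,2) that finitary1_basis]) simp
  {
    case 1
    then have c: "c < l" "c \<notin> T" "c \<notin> lift l V" "T \<subseteq> {..<l}" using insert.hyps lift_ghost by auto
    have e: "{s \<in> lift l V. s < c} = {}" using c(1) by (auto simp: lift_def)
    have bs: "below_sign c (lift l V) = (1 :: 'k fls)" unfolding below_sign_def e by simp
    have bl: "below_sign (l + c) (lift l V) = (1 :: 'k fls)" if "V = insert c (T - {a})"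
    proof -
      have "{s \<in> lift l V. s < l + c} = {}" using that insert.hyps(2) by (auto simp: lift_def)
      then show ?thesis unfolding below_sign_def by (simp only: card.empty power_0)
    qed
    have "lop l (l + c) z (lift l V) = (if c \<in> V then below_sign (l + c) (lift l V) * z (lift l (V - {c})) else 0) +
        2 * fls_X * z (insert c (lift l V))"
      using c by (simp add: lop_antighost lift_remove bs)
    also have "z (insert c (lift l V)) = (if a = c \<and> V = T then (-1) ^ card T else 0)"
      by (rule IH2[OF c(1,2,4)])
    also have "(if c \<in> V then below_sign (l + c) (lift l V) * z (lift l (V - {c})) else 0) =
        (if a \<in> T \<and> V = insert c (T - {a}) then 2 * fls_X * (-1) ^ card {t\<in>T. a < t} else 0)"
    proof -
      have "c \<in> V \<and> V - {c} = T - {a} \<longleftrightarrow> V = insert c (T - {a})" using c(2) by auto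
      then show ?thesis using IH1[OF c(4)] bl by auto
    qed
    also have "(if a \<in> T \<and> V = insert c (T - {a}) then 2 * fls_X * (-1) ^ card {t\<in>T. a < t} else 0) +
        2 * fls_X * (if a = c \<and> V = T then (-1) ^ card T else 0) =
        (if a \<in> insert c T \<and> V = insert c T - {a} then 2 * fls_X * (-1) ^ card {t\<in>insert c T. a < t} else (0 :: 'k fls))"
    proof (cases "a = c")
      case True
      then have "{t\<in>insert c T. a < t} = T" "insert c T - {a} = T" using insert.hyps(2) c(2) by auto
      then show ?thesis using True c(2) by simp
    next
      case False
      have "{t\<in>insert c T. a < t} = {t\<in>T. a < t}" if "a \<in> T" using that insert.hyps(2) by auto
      moreover have "insert c T - {a} = insert c (T - {a})" using False by auto
      ultimately show ?thesis using False by auto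
    qed
    finally show ?case unfolding mult[OF c(1)] .
  next
    case 2
    then have c: "c < l" "c \<notin> T" "T \<subseteq> {..<l}" "b \<noteq> c" "b \<notin> T" using insert.hyps by auto
    let ?U = "insert b (lift l V)"
    have cU: "c \<notin> ?U" "l + c \<in> ?U \<longleftrightarrow> c \<in> V" "?U - {l + c} = insert b (lift l (V - {c}))"
      using c lift_ghost[OF c(1)] 2(1) by (auto simp: lift_def)
    have "z (insert c ?U) = 0"
    proof (rule ccontr)
      assume "z (insert c ?U) \<noteq> 0"
      then have "insert c ?U \<inter> {..<l} \<subseteq> {a}"
        using lift_mult_support[OF insert.hyps(1) c(3), of "{a}" "{}"] assms(3) unfolding z_def by auto
      then show False using c 2(1) by auto
    qed
    then have "lop l (l + c) z ?U = (if c \<in> V then below_sign (l + c) ?U * z (insert b (lift l (V - {c}))) else 0)"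
      using cU by (simp add: lop_antighost)
    also have "z (insert b (lift l (V - {c}))) = (if a = b \<and> V - {c} = T then (-1) ^ card T else 0)"
      by (rule IH2[OF 2(1) c(5,3)])
    also have "(if c \<in> V then below_sign (l + c) ?U * (if a = b \<and> V - {c} = T then (-1) ^ card T else 0) else 0) =
        (if a = b \<and> V = insert c T then (-1) ^ card (insert c T) else (0 :: 'k fls))"
    proof (cases "V = insert c T")
      case True
      have "{s \<in> ?U. s < l + c} = {b}" using True 2(1) insert.hyps(2) by (auto simp: lift_def)
      then have "below_sign (l + c) ?U = (- 1 :: 'k fls)" unfolding below_sign_def by (simp only:) simp
      moreover have "V - {c} = T" using True c(2) by auto
      ultimately show ?thesis using True c(2) insert.hyps(1) by simp
    next
      case False
      then have "\<not> (c \<in> V \<and> V - {c} = T)" by auto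
      then show ?thesis using False by auto
    qed
    finally show ?case unfolding mult[OF c(1)] .
  }
qed

section \<open>The Clifford algebra as a matrix algebra\<close>

text \<open>A matrix that is block triangular with invertible scalar diagonal blocks is invertible.\<close>

lemma triangular_inverse:
  fixes m :: "'p => 'q => 'p => 'q => 'f::field" and r :: "'p => nat"
  assumes fin: "finite P" "finite Q"
    and low: "\<And>T V A B. [|T \<in> P; V \<in> Q; A \<in> P; B \<in> Q; m T V A B \<noteq> 0|] ==> A = T \<or> r A < r T"
    and diag: "\<And>T. T \<in> P ==> \<exists>\<kappa>\<noteq>0. \<forall>V\<in>Q. \<forall>B\<in>Q. m T V T B = (if V = B then \<kappa> else 0)"
  shows "\<exists>n. (\<forall>T\<in>P. \<forall>V\<in>Q. \<forall>T'\<in>P. \<forall>V'\<in>Q.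
      (\<Sum>A\<in>P. \<Sum>B\<in>Q. m T V A B * n A B T' V') = (if T = T' \<and> V = V' then 1 else 0)) \<and>
    (\<forall>A\<in>P. \<forall>B\<in>Q. \<forall>A'\<in>P. \<forall>B'\<in>Q.
      (\<Sum>T\<in>P. \<Sum>V\<in>Q. n A B T V * m T V A' B') = (if A = A' \<and> B = B' then 1 else 0))"
proof -
  define app where "app x T V = (\<Sum>A\<in>P. \<Sum>B\<in>Q. m T V A B * x A B)" for x T V
  obtain \<kappa> where \<kappa>: "\<And>T. T \<in> P ==> \<kappa> T \<noteq> 0"
    "\<And>T V B. [|T \<in> P; V \<in> Q; B \<in> Q|] ==> m T V T B = (if V = B then \<kappa> T else 0)"
  proof -
    have "\<forall>T\<in>P. \<exists>k. k \<noteq> 0 \<and> (\<forall>V\<in>Q. \<forall>B\<in>Q. m T V T B = (if V = B then k else 0))" using diag by blast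
    then obtain k where "\<forall>T\<in>P. k T \<noteq> 0 \<and> (\<forall>V\<in>Q. \<forall>B\<in>Q. m T V T B = (if V = B then k T else 0))"
      by (rule bchoice[THEN exE])
    then show ?thesis using that by blast
  qed
  have app_top: "app x T V = \<kappa> T * x T V"
    if T: "T \<in> P" "V \<in> Q" and 0: "\<And>A B. [|A \<in> P; B \<in> Q; r A < r T|] ==> x A B = 0" for x T V
  proof -
    have "app x T V = (\<Sum>A\<in>P. if A = T then (\<Sum>B\<in>Q. m T V T B * x T B) else 0)"
      unfolding app_def
    proof (rule sum.cong[OF refl])
      fix A assume A: "A \<in> P"
      have "m T V A B * x A B = 0" if "A \<noteq> T" "B \<in> Q" for B
        using low[OF T A that(2)] 0[OF A that(2)] that(1) by fastforce
      then show "(\<Sum>B\<in>Q. m T V A B * x A B) = (if A = T then (\<Sum>B\<in>Q. m T V T B * x T B) else 0)"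
        by (auto intro: sum.neutral)
    qed
    also have "\<dots> = (\<Sum>B\<in>Q. m T V T B * x T B)" using T fin by simp
    also have "\<dots> = (\<Sum>B\<in>Q. if V = B then \<kappa> T * x T V else 0)"
      using T \<kappa>(2) by (intro sum.cong) auto
    finally show ?thesis using T fin by simp
  qed
  have inj: "x A B = 0" if 0: "\<And>T V. [|T \<in> P; V \<in> Q|] ==> app x T V = 0" and AB: "A \<in> P" "B \<in> Q" for x A B
    using AB
  proof (induction "r A" arbitrary: A B rule: less_induct)
    case less
    then have "app x A B = \<kappa> A * x A B" by (intro app_top) auto
    then show ?case using 0 less.prems \<kappa>(1) by auto
  qed
  have surj: "\<exists>x. \<forall>T\<in>P. r T < k \<longrightarrow> (\<forall>V\<in>Q. app x T V = y T V)" for y k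
  proof (induction k)
    case (Suc k)
    then obtain x where x: "\<And>T V. [|T \<in> P; V \<in> Q; r T < k|] ==> app x T V = y T V" by blast
    define c where "c A B = (if r A = k then (y A B - app x A B) / \<kappa> A else 0)" for A B
    have "app (\<lambda>A B. x A B + c A B) T V = y T V" if T: "T \<in> P" "V \<in> Q" "r T < Suc k" for T V
    proof -
      have "app c T V = \<kappa> T * c T V" by (rule app_top) (use T in \<open>auto simp: c_def\<close>)
      moreover have "app (\<lambda>A B. x A B + c A B) T V = app x T V + app c T V"
        by (simp add: app_def distrib_left sum.distrib)
      ultimately show ?thesis using x[OF T(1,2)] T \<kappa>(1) by (auto simp: c_def less_Suc_eq)
    qed
    then show ?case by blast
  qed auto
  obtain k where k: "\<And>T. T \<in> P ==> r T < k"
  proof -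
    have "finite (r ` P)" using fin by simp
    then obtain k where "r ` P \<subseteq> {..<k}" using finite_nat_iff_bounded by blast
    then show ?thesis using that by blast
  qed
  define n' where "n' T' V' = (SOME x. \<forall>T\<in>P. \<forall>V\<in>Q. app x T V = (if T = T' \<and> V = V' then 1 else 0))" for T' V'
  have n': "app (n' T' V') T V = (if T = T' \<and> V = V' then 1 else 0)" if TV: "T \<in> P" "V \<in> Q" for T' V' T V
  proof -
    have "\<exists>x. \<forall>T\<in>P. \<forall>V\<in>Q. app x T V = (if T = T' \<and> V = V' then 1 else 0)"
      using surj[of k "\<lambda>T V. if T = T' \<and> V = V' then 1 else 0"] k by blast
    then have "\<forall>T\<in>P. \<forall>V\<in>Q. app (n' T' V') T V = (if T = T' \<and> V = V' then 1 else 0)"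
      unfolding n'_def by (rule someI_ex)
    then show ?thesis using TV by blast
  qed
  define n where "n A B T V = n' T V A B" for A B T V
  have right: "(\<Sum>A\<in>P. \<Sum>B\<in>Q. m T V A B * n A B T' V') = (if T = T' \<and> V = V' then 1 else 0)"
    if "T \<in> P" "V \<in> Q" for T V T' V'
    using n'[OF that] by (simp add: app_def n_def)
  have "(\<Sum>T\<in>P. \<Sum>V\<in>Q. n A B T V * m T V A' B') = (if A = A' \<and> B = B' then 1 else 0)"
    if AB: "A \<in> P" "B \<in> Q" "A' \<in> P" "B' \<in> Q" for A B A' B'
  proof -
    define x where "x A B = (\<Sum>T\<in>P. \<Sum>V\<in>Q. n A B T V * m T V A' B') - (if A = A' \<and> B = B' then 1 else 0)" for A B
    have "app x T V = 0" if TV: "T \<in> P" "V \<in> Q" for T V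
    proof -
      have "app x T V = (\<Sum>A\<in>P. \<Sum>B\<in>Q. m T V A B * (\<Sum>T'\<in>P. \<Sum>V'\<in>Q. n A B T' V' * m T' V' A' B'))
          - (\<Sum>A\<in>P. \<Sum>B\<in>Q. m T V A B * (if A = A' \<and> B = B' then 1 else 0))"
        by (simp add: app_def x_def right_diff_distrib sum_subtractf)
      also have "(\<Sum>A\<in>P. \<Sum>B\<in>Q. m T V A B * (if A = A' \<and> B = B' then 1 else 0)) = m T V A' B'"
      proof -
        have "(\<Sum>A\<in>P. \<Sum>B\<in>Q. m T V A B * (if A = A' \<and> B = B' then 1 else 0)) =
            (\<Sum>A\<in>P. if A = A' then (\<Sum>B\<in>Q. if B = B' then m T V A' B' else 0) else 0)"
          by (intro sum.cong refl) (auto intro!: sum.cong)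
        then show ?thesis using fin AB by simp
      qed
      also have "(\<Sum>A\<in>P. \<Sum>B\<in>Q. m T V A B * (\<Sum>T'\<in>P. \<Sum>V'\<in>Q. n A B T' V' * m T' V' A' B')) =
          (\<Sum>(A, B)\<in>P \<times> Q. \<Sum>(T', V')\<in>P \<times> Q. m T V A B * n A B T' V' * m T' V' A' B')"
        by (simp add: sum.cartesian_product[symmetric] sum_distrib_left mult.assoc)
      also have "\<dots> = (\<Sum>(T', V')\<in>P \<times> Q. (\<Sum>(A, B)\<in>P \<times> Q. m T V A B * n A B T' V') * m T' V' A' B')"
        unfolding case_prod_unfold sum_distrib_right by (rule sum.swap)
      also have "\<dots> = (\<Sum>T'\<in>P. \<Sum>V'\<in>Q. (if T = T' \<and> V = V' then 1 else 0) * m T' V' A' B')"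
        by (simp add: sum.cartesian_product[symmetric] right[OF TV])
      also have "\<dots> = (\<Sum>T'\<in>P. if T = T' then (\<Sum>V'\<in>Q. if V = V' then m T V A' B' else 0) else 0)"
        by (intro sum.cong refl) (auto intro!: sum.cong)
      also have "\<dots> = m T V A' B'" using fin TV by simp
      finally show ?thesis by simp
    qed
    then have "x A B = 0" by (rule inj[OF _ AB(1,2)])
    then show ?thesis by (simp add: x_def)
  qed
  then show ?thesis using right by blast
qed

text \<open>Coefficient of \<open>V\<close> in the product of the antighost monomial \<open>T\<close> with \<open>S\<close> from the right, where sets of
  antighosts are given by their indices below \<open>l\<close>. Terms with ghosts are dropped; by the lemma on
  products below this is compatible with multiplication.\<close>

definition rep_coeff :: "nat => nat set => nat set => nat set => 'k::field_char_0 fls" where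
  "rep_coeff l T S V = clifford_mult l (ext_basis (lift l T)) (ext_basis S) (lift l V)"

lemma lift_split: "S \<subseteq> {..<2 * l} ==> S = (S \<inter> {..<l}) \<union> lift l {b. b < l \<and> l + b \<in> S}"
proof -
  assume S: "S \<subseteq> {..<2 * l}"
  have "x \<in> lift l {b. b < l \<and> l + b \<in> S}" if "x \<in> S" "\<not> x < l" for x
  proof -
    have "x = l + (x - l)" "x - l < l" using that S by auto
    then show ?thesis unfolding lift_def using that(1) by (intro image_eqI[of _ _ "x - l"]) auto
  qed
  then show ?thesis by (auto simp: lift_def)
qed

lemma bij_betw_split:
  "bij_betw (\<lambda>(A, B). A \<union> lift l B) (Pow {..<l} \<times> Pow {..<l}) (Pow {..<2 * l})"
  unfolding bij_betw_def
proof
  have 1: "(A \<union> lift l B) \<inter> {..<l} = A" "{b. b < l \<and> l + b \<in> A \<union> lift l B} = B"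
    if "A \<subseteq> {..<l}" "B \<subseteq> {..<l}" for A B using that by (auto simp: lift_def)
  show "inj_on (\<lambda>(A, B). A \<union> lift l B) (Pow {..<l} \<times> Pow {..<l})"
  proof (rule inj_onI)
    fix p q assume pq: "p \<in> Pow {..<l} \<times> Pow {..<l}" "q \<in> Pow {..<l} \<times> Pow {..<l}"
      "(\<lambda>(A, B). A \<union> lift l B) p = (\<lambda>(A, B). A \<union> lift l B) q"
    obtain A B A' B' where p: "p = (A, B)" and q: "q = (A', B')" by fastforce
    have sub: "A \<subseteq> {..<l}" "B \<subseteq> {..<l}" "A' \<subseteq> {..<l}" "B' \<subseteq> {..<l}" and e: "A \<union> lift l B = A' \<union> lift l B'"
      using pq by (simp_all add: p q)
    have "(A \<union> lift l B) \<inter> {..<l} = (A' \<union> lift l B') \<inter> {..<l}"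
      "{b. b < l \<and> l + b \<in> A \<union> lift l B} = {b. b < l \<and> l + b \<in> A' \<union> lift l B'}" by (simp_all only: e)
    then have "A = A'" "B = B'" unfolding 1[OF sub(1,2)] 1[OF sub(3,4)] .
    then show "p = q" unfolding p q by simp
  qed
  show "(\<lambda>(A, B). A \<union> lift l B) ` (Pow {..<l} \<times> Pow {..<l}) = Pow {..<2 * l}"
  proof
    show "(\<lambda>(A, B). A \<union> lift l B) ` (Pow {..<l} \<times> Pow {..<l}) \<subseteq> Pow {..<2 * l}"
    proof (rule image_subsetI)
      fix p assume p: "p \<in> Pow {..<l} \<times> Pow {..<l}"
      obtain A B where "p = (A, B)" by fastforce
      then show "(\<lambda>(A, B). A \<union> lift l B) p \<in> Pow {..<2 * l}"
        using p lift_subset[of B l] by (simp add: subset_iff) fastforce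
    qed
    show "Pow {..<2 * l} \<subseteq> (\<lambda>(A, B). A \<union> lift l B) ` (Pow {..<l} \<times> Pow {..<l})"
    proof
      fix S assume "S \<in> Pow {..<2 * l}"
      then show "S \<in> (\<lambda>(A, B). A \<union> lift l B) ` (Pow {..<l} \<times> Pow {..<l})"
        using lift_split[of S l] by (intro image_eqI[of _ _ "(S \<inter> {..<l}, {b. b < l \<and> l + b \<in> S})"]) auto
    qed
  qed
qed

text \<open>Write \<open>A\<close> for the ghosts and \<open>B\<close> for the antighosts of \<open>S\<close>. All ghosts have to be contracted, so
  the coefficient vanishes unless \<open>A \<subseteq> T\<close>. For \<open>A = T\<close> it is a nonzero scalar if \<open>V\<close> corresponds to \<open>B\<close>,
  and zero otherwise. So the matrix indexed by the pairs \<open>(T, V)\<close> and \<open>(A, B)\<close> is block triangular.\<close>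

lemma rep_coeff_inverse:
  "\<exists>n :: nat set => nat set => nat set => 'k::field_char_0 fls.
    (\<forall>T\<in>Pow {..<l}. \<forall>V\<in>Pow {..<l}. \<forall>T'\<in>Pow {..<l}. \<forall>V'\<in>Pow {..<l}.
      (\<Sum>S\<in>Pow {..<2 * l}. rep_coeff l T S V * n S T' V') = (if T = T' \<and> V = V' then 1 else 0)) \<and>
    (\<forall>S\<in>Pow {..<2 * l}. \<forall>S'\<in>Pow {..<2 * l}.
      (\<Sum>T\<in>Pow {..<l}. \<Sum>V\<in>Pow {..<l}. n S T V * rep_coeff l T S' V) = (if S = S' then 1 else 0))"
proof -
  let ?P = "Pow {..<l}"
  define m :: "nat set => nat set => nat set => nat set => 'k fls"
    where "m T V A B = rep_coeff l T (A \<union> lift l B) V" for T V A B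
  have fins: "finite T" if "T \<subseteq> {..<l}" for T using that finite_subset by blast
  have low: "A = T \<or> card A < card T" if "T \<in> ?P" "V \<in> ?P" "A \<in> ?P" "B \<in> ?P" "m T V A B \<noteq> 0" for T V A B
  proof -
    have "A \<subseteq> T \<union> lift l V"
      using that lift_mult_support[where 'k = 'k, of T l A B "lift l V"] fins by (simp add: m_def rep_coeff_def)
    then have "A \<subseteq> T" using that(3) lift_ghost[of _ l V] by auto
    moreover have "finite T" using that(1) fins by blast
    ultimately show ?thesis using psubset_card_mono[of T A] by blast
  qed
  have diag: "\<exists>\<kappa>\<noteq>0. \<forall>V\<in>?P. \<forall>B\<in>?P. m T V T B = (if V = B then \<kappa> else 0)" if T: "T \<in> ?P" for T
  proof -
    obtain \<kappa> :: "'k fls" where "\<kappa> \<noteq> 0" "\<And>B V. B \<subseteq> {..<l} ==> V \<subseteq> {..<l} ==> m T V T B = (if B = V then \<kappa> else 0)"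
      using lift_mult_diagonal[where 'k = 'k, of T l "{}"] T fins by (auto simp: m_def rep_coeff_def)
    then show ?thesis by (intro exI[of _ \<kappa>]) auto
  qed
  have fin: "finite ?P" by simp
  have "\<exists>n'. (\<forall>T\<in>?P. \<forall>V\<in>?P. \<forall>T'\<in>?P. \<forall>V'\<in>?P.
      (\<Sum>A\<in>?P. \<Sum>B\<in>?P. m T V A B * n' A B T' V') = (if T = T' \<and> V = V' then 1 else 0)) \<and>
    (\<forall>A\<in>?P. \<forall>B\<in>?P. \<forall>A'\<in>?P. \<forall>B'\<in>?P.
      (\<Sum>T\<in>?P. \<Sum>V\<in>?P. n' A B T V * m T V A' B') = (if A = A' \<and> B = B' then 1 else 0))"
    by (rule triangular_inverse[where r = card])
      (rule fin, rule fin, rule low, assumption+, rule diag, assumption)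
  then obtain n' where n': "\<forall>T\<in>?P. \<forall>V\<in>?P. \<forall>T'\<in>?P. \<forall>V'\<in>?P.
      (\<Sum>A\<in>?P. \<Sum>B\<in>?P. m T V A B * n' A B T' V') = (if T = T' \<and> V = V' then 1 else 0)"
    "\<forall>A\<in>?P. \<forall>B\<in>?P. \<forall>A'\<in>?P. \<forall>B'\<in>?P.
      (\<Sum>T\<in>?P. \<Sum>V\<in>?P. n' A B T V * m T V A' B') = (if A = A' \<and> B = B' then 1 else 0)"
    by blast
  define n where "n S T V = n' (S \<inter> {..<l}) {b. b < l \<and> l + b \<in> S} T V" for S T V
  have 1: "(A \<union> lift l B) \<inter> {..<l} = A" "{b. b < l \<and> l + b \<in> A \<union> lift l B} = B"
    if "A \<subseteq> {..<l}" "B \<subseteq> {..<l}" for A B using that by (auto simp: lift_def)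
  have sum_split: "(\<Sum>S\<in>Pow {..<2 * l}. g S) = (\<Sum>A\<in>?P. \<Sum>B\<in>?P. g (A \<union> lift l B))" for g :: "nat set => 'k fls"
    using sum.reindex_bij_betw[OF bij_betw_split, of g l]
    by (simp add: case_prod_unfold sum.cartesian_product)
  show ?thesis
  proof (intro exI[of _ n] conjI ballI)
    fix T V T' V' assume TV: "T \<in> ?P" "V \<in> ?P" "T' \<in> ?P" "V' \<in> ?P"
    have "(\<Sum>S\<in>Pow {..<2 * l}. rep_coeff l T S V * n S T' V') = (\<Sum>A\<in>?P. \<Sum>B\<in>?P. m T V A B * n' A B T' V')"
      unfolding sum_split m_def n_def by (intro sum.cong refl) (simp only: 1 Pow_iff)
    then show "(\<Sum>S\<in>Pow {..<2 * l}. rep_coeff l T S V * n S T' V') = (if T = T' \<and> V = V' then 1 else 0)"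
      using n'(1) TV by simp
  next
    fix S S' assume S: "S \<in> Pow {..<2 * l}" "S' \<in> Pow {..<2 * l}"
    let ?A = "S \<inter> {..<l}" and ?B = "{b. b < l \<and> l + b \<in> S}"
    let ?A' = "S' \<inter> {..<l}" and ?B' = "{b. b < l \<and> l + b \<in> S'}"
    have e: "S = ?A \<union> lift l ?B" "S' = ?A' \<union> lift l ?B'" using S lift_split by blast+
    have "?A \<in> ?P" "?B \<in> ?P" "?A' \<in> ?P" "?B' \<in> ?P" by auto
    then have "(\<Sum>T\<in>?P. \<Sum>V\<in>?P. n' ?A ?B T V * m T V ?A' ?B') = (if ?A = ?A' \<and> ?B = ?B' then 1 else 0)"
      using n'(2) by blast
    moreover have "?A = ?A' \<and> ?B = ?B' \<longleftrightarrow> S = S'"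
    proof
      assume AB: "?A = ?A' \<and> ?B = ?B'"
      show "S = S'" by (subst e(1), subst e(2)) (simp only: AB)
    qed simp
    moreover have "m T V ?A' ?B' = rep_coeff l T S' V" for T V unfolding m_def by (subst (2) e(2)) (rule refl)
    ultimately show "(\<Sum>T\<in>?P. \<Sum>V\<in>?P. n S T V * rep_coeff l T S' V) = (if S = S' then 1 else 0)"
      by (simp add: n_def)
  qed
qed

lemma finite_subset_lessThan: "S \<subseteq> {..<n :: nat} ==> finite S"
  using finite_subset by blast

lemma clifford_coeff_support:
  assumes "S \<subseteq> {..<2 * l}" "T \<subseteq> {..<2 * l}" "clifford_mult l (ext_basis S) (ext_basis T) U \<noteq> (0 :: 'k::field_char_0 fls)"
  shows "U \<subseteq> {..<2 * l} \<and> ghost_number l U = ghost_number l S + ghost_number l T \<and> S \<inter> {..<l} \<subseteq> U"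
  using assms finite_subset_lessThan
  by (intro clifford_mult_support[where w = "ext_basis T :: nat set => 'k fls"])
    (auto simp: ext_basis_def finitary1_def split: if_splits)

text \<open>Ghosts of the left factor survive in a product. Hence the span of the monomials with a ghost is
  a right ideal, and the Clifford algebra acts from the right on the quotient, the exterior algebra
  of the antighosts.\<close>

lemma rep_coeff_mult:
  assumes S: "S \<subseteq> {..<2 * l}" "S' \<subseteq> {..<2 * l}" and T: "T \<subseteq> {..<l}"
  shows "(\<Sum>U\<in>Pow {..<2 * l}. clifford_mult l (ext_basis S) (ext_basis S') U * rep_coeff l T U V) =
    (\<Sum>W\<in>Pow {..<l}. rep_coeff l T S W * rep_coeff l W S' V :: 'k::field_char_0 fls)"
proof -
  let ?e = "ext_basis :: nat set => nat set => 'k fls" and ?L = "lift l"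
  have fin: "finite S" "finite S'" "finite (?L T)" using assms finite_subset_lessThan by auto
  have LT: "?L T \<subseteq> {..<2 * l}" by (rule lift_subset[OF T])
  have exp: "clifford_mult l (?e A) (?e B) = (\<lambda>U'. \<Sum>U\<in>Pow {..<2 * l}. clifford_mult l (?e A) (?e B) U * ?e U U')"
    if "A \<subseteq> {..<2 * l}" "B \<subseteq> {..<2 * l}" for A B
    by (rule basis_expansion) (use clifford_coeff_support that in blast)
  have "(\<Sum>U\<in>Pow {..<2 * l}. clifford_mult l (?e S) (?e S') U * rep_coeff l T U V) =
      clifford_mult l (?e (?L T)) (clifford_mult l (?e S) (?e S')) (?L V)"
    by (subst (2) exp[OF S], subst clifford_mult_sum_right) (simp_all add: rep_coeff_def)
  also have "\<dots> = clifford_mult l (clifford_mult l (?e (?L T)) (?e S)) (?e S') (?L V)"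
    by (simp only: clifford_mult_basis_assoc[OF fin(3) LT finitary1_basis[OF fin(1)] finitary1_basis[OF fin(2)]])
  also have "\<dots> =
      (\<Sum>U\<in>Pow {..<2 * l}. clifford_mult l (?e (?L T)) (?e S) U * clifford_mult l (?e U) (?e S') (?L V))"
    by (subst exp[OF LT S(1)], subst clifford_mult_sum_left) simp_all
  also have "\<dots> = (\<Sum>U\<in>?L ` Pow {..<l}. clifford_mult l (?e (?L T)) (?e S) U * clifford_mult l (?e U) (?e S') (?L V))"
  proof (rule sum.mono_neutral_right)
    show "?L ` Pow {..<l} \<subseteq> Pow {..<2 * l}"
    proof (rule image_subsetI)
      fix B assume "B \<in> Pow {..<l}"
      then show "?L B \<in> Pow {..<2 * l}" using lift_subset[of B l] by simp
    qed
    show "\<forall>U\<in>Pow {..<2 * l} - ?L ` Pow {..<l}.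
        clifford_mult l (?e (?L T)) (?e S) U * clifford_mult l (?e U) (?e S') (?L V) = 0"
    proof
      fix U assume U: "U \<in> Pow {..<2 * l} - ?L ` Pow {..<l}"
      have "clifford_mult l (?e U) (?e S') (?L V) = 0"
      proof (rule ccontr)
        assume "clifford_mult l (?e U) (?e S') (?L V) \<noteq> 0"
        then have "U \<inter> {..<l} \<subseteq> ?L V" using clifford_coeff_support[of U l S'] U S by blast
        then have "U \<inter> {..<l} = {}" using lift_ghost[of _ l V] by auto
        then have "U = ?L {b. b < l \<and> l + b \<in> U}" using lift_split[of U l] U by auto
        moreover have "{b. b < l \<and> l + b \<in> U} \<in> Pow {..<l}" by auto
        ultimately show False using U by blast
      qed
      then show "clifford_mult l (?e (?L T)) (?e S) U * clifford_mult l (?e U) (?e S') (?L V) = 0" by simp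
    qed
  qed simp
  also have "\<dots> = (\<Sum>W\<in>Pow {..<l}. rep_coeff l T S W * rep_coeff l W S' V)"
    by (subst sum.reindex) (auto simp: inj_on_def rep_coeff_def)
  finally show ?thesis .
qed

lemma rep_coeff_degree:
  assumes "T \<subseteq> {..<l}" "V \<subseteq> {..<l}" "S \<subseteq> {..<2 * l}" "rep_coeff l T S V \<noteq> (0 :: 'k::field_char_0 fls)"
  shows "int (card V) = int (card T) - ghost_number l S"
  using clifford_coeff_support[where 'k = 'k, OF lift_subset[OF assms(1)] assms(3), of "lift l V"] assms
  by (simp add: rep_coeff_def ghost_number_lift)

lemma rep_coeff_one:
  "T \<subseteq> {..<l} ==> rep_coeff l T {} V = (if T = V then 1 else (0 :: 'k::field_char_0 fls))"
  using clifford_mult_basis_one[of "lift l T" l, where 'k = 'k] lift_subset[of T l] finite_subset_lessThan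
  by (auto simp: rep_coeff_def ext_basis_def[of "lift l T"])

lemma rep_coeff_ghost:
  "[|T \<subseteq> {..<l}; a < l|] ==> rep_coeff l T {a} V =
    (if a \<in> T \<and> V = T - {a} then 2 * fls_X * (-1) ^ card {t\<in>T. a < t} else (0 :: 'k::field_char_0 fls))"
  unfolding rep_coeff_def by (rule lift_mult_ghost(1)) (auto intro: finite_subset_lessThan)

text \<open>Every ghost of the right factor has to be removed by a contraction, which costs a factor \<open>\<nu>\<close>.\<close>

lemma rep_coeff_order:
  assumes "T \<subseteq> {..<l}" "A \<subseteq> {..<l}" "finite B" "m < int (card A)"
  shows "fls_nth (rep_coeff l T (A \<union> lift l B) V) m = (0 :: 'k::field_char_0)"
proof -
  have "lift l V \<inter> {..<l} = {}" using lift_ghost[of _ l V] by auto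
  then show ?thesis
    unfolding rep_coeff_def using assms finite_subset_lessThan by (intro lift_mult_order) auto
qed

subsection \<open>Anticommutation relations\<close>

lemma wedge_wedge: "wedge i (wedge j v) S = - wedge j (wedge i v) S"
proof (cases "i \<in> S \<and> j \<in> S \<and> i \<noteq> j")
  case True
  have "S - {i} - {j} = S - {j} - {i}" by auto
  then show ?thesis using True by (cases "i < j") (auto simp: wedge_def below_sign_remove mult_ac)
next
  case False
  then show ?thesis by (auto simp: wedge_def)
qed

lemma ext_deriv_ext_deriv: "ext_deriv i (ext_deriv j v) S = - ext_deriv j (ext_deriv i v) S"
proof (cases "i \<notin> S \<and> j \<notin> S \<and> i \<noteq> j")
  case True
  then show ?thesis
    by (cases "i < j") (auto simp: ext_deriv_below below_sign_insert mult_ac insert_commute)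
next
  case False
  then show ?thesis by (auto simp: ext_deriv_below)
qed

lemma ext_deriv_wedge: "ext_deriv i (wedge j v) S = - wedge j (ext_deriv i v) S + (if i = j then v S else 0)"
proof (cases "i = j")
  case True
  then show ?thesis by (auto simp: ext_deriv_below wedge_def below_sign_insert below_sign_remove insert_absorb)
next
  case False
  show ?thesis
  proof (cases "i \<notin> S \<and> j \<in> S")
    case True
    have "insert i S - {j} = insert i (S - {j})" using False by auto
    then show ?thesis using False True
      by (cases "i < j") (auto simp: ext_deriv_below wedge_def below_sign_insert below_sign_remove mult_ac)
  next
    case False2: False
    then show ?thesis using False by (auto simp: ext_deriv_below wedge_def)
  qed
qed

lemma wedge_add: "wedge i (\<lambda>S. v S + c * w S) U = wedge i v U + c * wedge i w U"
  by (simp add: wedge_def algebra_simps)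

lemma ext_deriv_add: "ext_deriv i (\<lambda>S. v S + c * w S) U = ext_deriv i v U + c * ext_deriv i w U"
  by (simp add: ext_deriv_below algebra_simps)

lemma lop_ghost: "a < l ==> lop l a v = wedge a v"
  by (simp add: lop_def)

lemma lop_antighost_eq: "lop l (l + c) v = (\<lambda>S. wedge (l + c) v S + 2 * fls_X * ext_deriv c v S)"
  by (simp add: lop_def)

lemma ghost_ghost: "a < l ==> b < l ==> lop l a (lop l b v) U = - lop l b (lop l a v) U"
  by (simp add: lop_ghost wedge_wedge[of a b])

lemma antighost_ghost:
  assumes "a < l" "c < l"
  shows "lop l (l + c) (lop l a v) U = - lop l a (lop l (l + c) v) U + (if a = c then 2 * fls_X * v U else 0)"
proof -
  have "lop l (l + c) (lop l a v) U = wedge (l + c) (wedge a v) U + 2 * fls_X * ext_deriv c (wedge a v) U"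
    using assms by (simp only: lop_ghost lop_antighost_eq)
  moreover have "lop l a (lop l (l + c) v) U = wedge a (wedge (l + c) v) U + 2 * fls_X * wedge a (ext_deriv c v) U"
    using assms by (simp only: lop_ghost lop_antighost_eq wedge_add)
  ultimately show ?thesis
    unfolding wedge_wedge[of "l + c" a] ext_deriv_wedge[of c a] by (simp add: algebra_simps)
qed

lemma antighost_antighost: "c < l ==> d < l ==> lop l (l + c) (lop l (l + d) v) U = - lop l (l + d) (lop l (l + c) v) U"
  using wedge_wedge[of "l + c" "l + d" v U] ext_deriv_ext_deriv[of c d v U]
    ext_deriv_wedge[of c "l + d" v U] ext_deriv_wedge[of d "l + c" v U]
  unfolding lop_antighost_eq wedge_add ext_deriv_add by (simp add: algebra_simps)

section \<open>The cubic part of the charge\<close>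

subsection \<open>The cubic term of the BRST charge\<close>

definition cubic :: "nat => (nat => nat => nat => 'k::field_char_0 fls) => nat set => 'k fls" where
  "cubic l \<phi> = (\<lambda>U. \<Sum>p\<in>{..<l} \<times> {..<l} \<times> {..<l}. (case p of (a, b, c) => \<phi> a b c) *
    (case p of (a, b, c) => lop l a (lop l b (lop l (l + c) (ext_basis {})))) U)"

lemma lop_uminus: "lop l i (\<lambda>U. - v U) = (\<lambda>U. - lop l i v U)"
  by (auto simp: lop_def wedge_def ext_deriv_below fun_eq_iff)

lemma lop_add: "lop l i (\<lambda>U. v U + c * w U) = (\<lambda>U. lop l i v U + c * lop l i w U)"
  by (auto simp: lop_def wedge_add ext_deriv_add fun_eq_iff algebra_simps)

lemma ghost_ghost': "a < l ==> b < l ==> lop l a (lop l b v) = (\<lambda>U. - lop l b (lop l a v) U)"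
  using ghost_ghost[of a l b v] by (auto simp: fun_eq_iff)

lemma antighost_ghost': "a < l ==> c < l ==> lop l (l + c) (lop l a v) =
    (\<lambda>U. - lop l a (lop l (l + c) v) U + (if a = c then 2 * fls_X else 0) * v U)"
  using antighost_ghost[of a l c v] by (auto simp: fun_eq_iff)

lemma antighost_antighost': "a < l ==> b < l ==>
    lop l (l + a) (lop l (l + b) v) = (\<lambda>U. - lop l (l + b) (lop l (l + a) v) U)"
  using antighost_antighost[of a l b v] by (auto simp: fun_eq_iff)

lemma ghost_pair_commute: "[|a < l; b < l; d < l|] ==> lop l a (lop l b (lop l d v)) = lop l d (lop l a (lop l b v))"
  by (simp add: ghost_ghost'[of b l d] ghost_ghost'[of a l d] lop_uminus)

lemma clifford_mult_generator:
  "[|i < 2 * l; finitary1 w|] ==> clifford_mult l (ext_basis {i}) w = lop l i w"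
  using clifford_mult_basis_insert[of "{}" i l w] by (simp add: clifford_mult_one_left)

lemma ext_basis_generator: "ext_basis {i} = lop l i (ext_basis {})"
  by (rule ext_basis_insert) simp

lemma finitary1_cubic: "finitary1 (cubic l \<phi>)"
proof -
  have "cubic l \<phi> U = 0" if "infinite U" for U
  proof -
    have "finitary1 (lop l a (lop l b (lop l (l + c) (ext_basis {}))))" for a b c
      by (intro finitary1_lop finitary1_basis) simp
    then have "lop l a (lop l b (lop l (l + c) (ext_basis {}))) U = (0 :: 'a fls)" for a b c
      using that by (auto simp: finitary1_def)
    then show ?thesis by (auto simp: cubic_def intro!: sum.neutral)
  qed
  then show ?thesis by (auto simp: finitary1_def)
qed

lemma cubic_mult:
  assumes w: "finitary1 w"
  shows "clifford_mult l (cubic l \<phi>) w U = (\<Sum>(a, b, c)\<in>{..<l} \<times> {..<l} \<times> {..<l}.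
    \<phi> a b c * lop l a (lop l b (lop l (l + c) w)) U)"
proof -
  have "clifford_mult l (lop l a (lop l b (lop l (l + c) (ext_basis {})))) w = lop l a (lop l b (lop l (l + c) w))"
    if "a < l" "b < l" "c < l" for a b c
    using that w by (simp add: clifford_mult_lop finitary1_lop finitary1_basis clifford_mult_one_left)
  then show ?thesis
    unfolding cubic_def by (subst clifford_mult_sum_left) (auto intro!: sum.cong)
qed

lemma lop_cubic: "lop l i (cubic l \<phi>) U = (\<Sum>(a, b, c)\<in>{..<l} \<times> {..<l} \<times> {..<l}.
    \<phi> a b c * lop l i (lop l a (lop l b (lop l (l + c) (ext_basis {})))) U)"
  unfolding cubic_def by (subst lop_sum) (auto intro!: sum.cong)

lemma lop_sum': "lop l i (\<lambda>U. \<Sum>j\<in>J. c j * v j U) = (\<lambda>U. \<Sum>j\<in>J. c j * lop l i (v j) U)"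
  using lop_sum by blast

lemma cubic_ghost_anticommutator:
  assumes d: "d < l"
  shows "clifford_mult l (cubic l \<phi>) (ext_basis {d}) U + clifford_mult l (ext_basis {d}) (cubic l \<phi>) U =
    2 * fls_X * (\<Sum>a<l. \<Sum>b<l. \<phi> a b d * lop l a (lop l b (ext_basis {})) U)"
proof -
  let ?I = "{..<l} \<times> {..<l} \<times> {..<l}" and ?e = "ext_basis {} :: nat set => 'a fls"
  have "clifford_mult l (cubic l \<phi>) (ext_basis {d}) U + clifford_mult l (ext_basis {d}) (cubic l \<phi>) U =
      (\<Sum>(a, b, c)\<in>?I. \<phi> a b c * lop l a (lop l b (lop l (l + c) (lop l d ?e))) U) +
      (\<Sum>(a, b, c)\<in>?I. \<phi> a b c * lop l d (lop l a (lop l b (lop l (l + c) ?e))) U)"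
    using d by (simp add: cubic_mult clifford_mult_generator finitary1_cubic finitary1_basis lop_cubic
        ext_basis_generator[of d l, symmetric])
  also have "\<dots> = (\<Sum>(a, b, c)\<in>?I. if d = c then 2 * fls_X * (\<phi> a b d * lop l a (lop l b ?e) U) else 0)"
    unfolding sum.distrib[symmetric]
  proof (rule sum.cong[OF refl])
    fix p assume "p \<in> ?I"
    then obtain a b c where p: "p = (a, b, c)" and abc: "a < l" "b < l" "c < l" by auto
    have E1: "lop l d (lop l a (lop l b (lop l (l + c) ?e))) = lop l a (lop l b (lop l d (lop l (l + c) ?e)))"
      by (rule ghost_pair_commute[symmetric]) (use abc d in auto)
    have "lop l (l + c) (lop l d ?e) =
        (\<lambda>U. - lop l d (lop l (l + c) ?e) U + (if d = c then 2 * fls_X else 0) * ?e U)"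
      by (rule antighost_ghost'[OF d abc(3)])
    then have E2: "lop l a (lop l b (lop l (l + c) (lop l d ?e))) U =
        - lop l a (lop l b (lop l d (lop l (l + c) ?e))) U + (if d = c then 2 * fls_X else 0) * lop l a (lop l b ?e) U"
      by (simp only: lop_add lop_uminus)
    have E3: "t * (- y + k * w) + t * y = k * (t * w)" for t y k w :: "'a fls" by (simp add: algebra_simps)
    show "(case p of (a, b, c) => \<phi> a b c * lop l a (lop l b (lop l (l + c) (lop l d ?e))) U) +
        (case p of (a, b, c) => \<phi> a b c * lop l d (lop l a (lop l b (lop l (l + c) ?e))) U) =
        (case p of (a, b, c) => if d = c then 2 * fls_X * (\<phi> a b d * lop l a (lop l b ?e) U) else 0)"
      unfolding p prod.case E1 E2 E3 by simp
  qed
  also have "\<dots> = (\<Sum>a<l. \<Sum>b<l. 2 * fls_X * (\<phi> a b d * lop l a (lop l b ?e) U))"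
    using d by (simp add: sum.cartesian_product[symmetric])
  finally show ?thesis by (simp add: sum_distrib_left)
qed

lemma fls_of_nat_nonzero: "(of_nat (Suc n) :: 'k::field_char_0 fls) \<noteq> 0"
  by (metis fls_of_nat fls_const_nonzero of_nat_eq_0_iff nat.distinct(1))

lemma fls_double_zero: "x + x = 0 ==> x = (0 :: 'k::field_char_0 fls)"
  using fls_of_nat_nonzero[where 'k = 'k, of 1] by (simp add: mult_2[symmetric])

lemma fls_triple_zero: "x + x + x = 0 ==> x = (0 :: 'k::field_char_0 fls)"
proof -
  assume "x + x + x = 0"
  then have "of_nat (Suc 2) * x = 0" by (simp only: of_nat_Suc of_nat_numeral distrib_right mult_1_left mult_2 add.assoc)
  then show ?thesis using fls_of_nat_nonzero[where 'k = 'k, of 2] by (simp only: mult_eq_0_iff) simp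
qed

text \<open>The square vanishes by antisymmetry and the Jacobi identity: two contractions never occur,
  no contraction gives an antisymmetric expression, and one contraction gives the Jacobi sum.\<close>

lemma cubic_square:
  fixes \<phi> :: "nat => nat => nat => 'k::field_char_0 fls"
  assumes anti: "\<And>a b c. [|a < l; b < l; c < l|] ==> \<phi> a b c = - \<phi> b a c"
    and jacobi: "\<And>a b e g. [|a < l; b < l; e < l; g < l|] ==>
      (\<Sum>c<l. \<phi> a b c * \<phi> c e g) + (\<Sum>c<l. \<phi> b e c * \<phi> c a g) + (\<Sum>c<l. \<phi> e a c * \<phi> c b g) = 0"
  shows "clifford_mult l (cubic l \<phi>) (cubic l \<phi>) U = 0"
proof -
  let ?I = "{..<l} \<times> {..<l} \<times> {..<l}" and ?e = "ext_basis {} :: nat set => 'k fls"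
  define x where "x a b d e c g = lop l a (lop l b (lop l d (lop l e (lop l (l + c) (lop l (l + g) ?e))))) U" for a b d e c g
  define y where "y a b d g = lop l a (lop l b (lop l d (lop l (l + g) ?e))) U" for a b d g
  have lop3: "lop l a (lop l b (lop l (l + c) (cubic l \<phi>))) U =
      (\<Sum>(d, e, g)\<in>?I. \<phi> d e g * lop l a (lop l b (lop l (l + c) (lop l d (lop l e (lop l (l + g) ?e))))) U)" for a b c
    unfolding cubic_def lop_sum' by (auto intro!: sum.cong)
  have move: "lop l a (lop l b (lop l (l + c) (lop l d (lop l e (lop l (l + g) ?e))))) U =
      x a b d e c g + ((if d = c then 2 * fls_X else 0) * y a b e g - (if e = c then 2 * fls_X else 0) * y a b d g)"
    if l: "a < l" "b < l" "c < l" "d < l" "e < l" "g < l" for a b c d e g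
  proof -
    have 1: "lop l (l + c) (lop l e (lop l (l + g) ?e)) = (\<lambda>U. - lop l e (lop l (l + c) (lop l (l + g) ?e)) U
        + (if e = c then 2 * fls_X else 0) * lop l (l + g) ?e U)"
      by (rule antighost_ghost'[OF l(5,3)])
    have 2: "lop l (l + c) (lop l d (lop l e (lop l (l + g) ?e))) = (\<lambda>U. - lop l d (lop l (l + c) (lop l e (lop l (l + g) ?e))) U
        + (if d = c then 2 * fls_X else 0) * lop l e (lop l (l + g) ?e) U)"
      by (rule antighost_ghost'[OF l(4,3)])
    show ?thesis unfolding 2 lop_add lop_uminus 1 x_def y_def by simp
  qed
  have x_anti: "x d e a b g c = - x a b d e c g" if l: "a < l" "b < l" "c < l" "d < l" "e < l" "g < l" for a b c d e g
    unfolding x_def antighost_antighost'[OF l(6,3)] lop_uminus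
      ghost_pair_commute[OF l(4,5,1)] ghost_pair_commute[OF l(4,5,2)] ..
  have y_cyclic: "y a b d g = y d a b g" if "a < l" "b < l" "d < l" for a b d g
    unfolding y_def by (simp only: ghost_pair_commute[OF that])
  define S1 where "S1 = (\<Sum>(a, b, c)\<in>?I. \<Sum>(d, e, g)\<in>?I. \<phi> a b c * \<phi> d e g * x a b d e c g)"
  define S2 where "S2 = (\<Sum>a<l. \<Sum>b<l. \<Sum>e<l. \<Sum>g<l. (\<Sum>c<l. \<phi> a b c * \<phi> c e g) * y a b e g)"
  have "S1 = (\<Sum>(d, e, g)\<in>?I. \<Sum>(a, b, c)\<in>?I. \<phi> a b c * \<phi> d e g * x a b d e c g)"
    unfolding S1_def case_prod_unfold by (rule sum.swap)
  also have "\<dots> = - S1"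
    unfolding S1_def sum_negf[symmetric]
  proof (intro sum.cong refl)
    fix q assume "q \<in> ?I"
    then obtain d e g where q: "q = (d, e, g)" and deg: "d < l" "e < l" "g < l" by auto
    have "(\<Sum>p\<in>?I. case p of (a, b, c) => \<phi> a b c * \<phi> d e g * x a b d e c g) =
        (\<Sum>p\<in>?I. - (case p of (a, b, c) => \<phi> d e g * \<phi> a b c * x d e a b g c))"
    proof (rule sum.cong[OF refl])
      fix p assume "p \<in> ?I"
      then obtain a b c where p: "p = (a, b, c)" and abc: "a < l" "b < l" "c < l" by auto
      show "(case p of (a, b, c) => \<phi> a b c * \<phi> d e g * x a b d e c g) =
          - (case p of (a, b, c) => \<phi> d e g * \<phi> a b c * x d e a b g c)"
        unfolding p prod.case x_anti[OF abc deg] by simp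
    qed
    then show "(case q of (d, e, g) => \<Sum>(a, b, c)\<in>?I. \<phi> a b c * \<phi> d e g * x a b d e c g) =
        - (case q of (a, b, c) => \<Sum>(d, e, g)\<in>?I. \<phi> a b c * \<phi> d e g * x a b d e c g)"
      unfolding q prod.case sum_negf .
  qed
  finally have "S1 + S1 = 0" by (simp only: eq_neg_iff_add_eq_0)
  then have S1: "S1 = 0" by (rule fls_double_zero)
  have rot: "(\<Sum>a<l. \<Sum>b<l. \<Sum>e<l. F a b e) = (\<Sum>a<l. \<Sum>b<l. \<Sum>e<l. F b e a)" for F :: "nat => nat => nat => 'k fls"
  proof -
    have "(\<Sum>a<l. \<Sum>b<l. \<Sum>e<l. F b e a) = (\<Sum>b<l. \<Sum>a<l. \<Sum>e<l. F b e a)" by (rule sum.swap)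
    also have "\<dots> = (\<Sum>b<l. \<Sum>e<l. \<Sum>a<l. F b e a)" by (intro sum.cong refl sum.swap)
    finally show ?thesis by simp
  qed
  define F where "F a b e = (\<Sum>g<l. (\<Sum>c<l. \<phi> a b c * \<phi> c e g) * y a b e g)" for a b e
  have "S2 = (\<Sum>a<l. \<Sum>b<l. \<Sum>e<l. F a b e)" by (simp add: S2_def F_def)
  moreover have "S2 = (\<Sum>a<l. \<Sum>b<l. \<Sum>e<l. F b e a)" using calculation rot[of F] by simp
  moreover have "S2 = (\<Sum>a<l. \<Sum>b<l. \<Sum>e<l. F e a b)" using calculation(2) rot[of "\<lambda>a b e. F b e a"] by simp
  ultimately have "S2 + S2 + S2 = (\<Sum>a<l. \<Sum>b<l. \<Sum>e<l. F a b e + F b e a + F e a b)"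
    by (simp add: sum.distrib)
  also have "\<dots> = 0"
  proof (intro sum.neutral ballI)
    fix a b e assume "a \<in> {..<l}" "b \<in> {..<l}" "e \<in> {..<l}"
    then have l: "a < l" "b < l" "e < l" by auto
    have "F a b e + F b e a + F e a b = (\<Sum>g<l. ((\<Sum>c<l. \<phi> a b c * \<phi> c e g) + (\<Sum>c<l. \<phi> b e c * \<phi> c a g)
        + (\<Sum>c<l. \<phi> e a c * \<phi> c b g)) * y a b e g)"
      using y_cyclic[OF l] y_cyclic[OF l(3,1,2)] by (simp add: F_def sum.distrib distrib_right)
    then show "F a b e + F b e a + F e a b = 0" using jacobi[OF l] by simp
  qed
  finally have S2: "S2 = 0" by (rule fls_triple_zero)
  have inner: "(\<Sum>(d, e, g)\<in>?I. \<phi> d e g * ((if d = c then 2 * fls_X else 0) * y a b e g - (if e = c then 2 * fls_X else 0) * y a b d g)) =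
      4 * fls_X * (\<Sum>e<l. \<Sum>g<l. \<phi> c e g * y a b e g)" if c: "c < l" for a b c
  proof -
    define Z where "Z = (\<Sum>e<l. \<Sum>g<l. \<phi> c e g * y a b e g)"
    have "(\<Sum>(d, e, g)\<in>?I. \<phi> d e g * ((if d = c then 2 * fls_X else 0) * y a b e g)) =
        (\<Sum>d<l. if d = c then (\<Sum>e<l. \<Sum>g<l. 2 * fls_X * (\<phi> c e g * y a b e g)) else 0)"
      unfolding sum.cartesian_product[symmetric] by (intro sum.cong refl) (auto simp: mult_ac)
    then have A: "(\<Sum>(d, e, g)\<in>?I. \<phi> d e g * ((if d = c then 2 * fls_X else 0) * y a b e g)) = 2 * fls_X * Z"
      using c by (simp add: Z_def sum_distrib_left)
    have "(\<Sum>(d, e, g)\<in>?I. \<phi> d e g * ((if e = c then 2 * fls_X else 0) * y a b d g)) =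
        (\<Sum>d<l. \<Sum>e<l. if e = c then (\<Sum>g<l. 2 * fls_X * (\<phi> d c g * y a b d g)) else 0)"
      unfolding sum.cartesian_product[symmetric] by (intro sum.cong refl) (auto simp: mult_ac)
    also have "\<dots> = (\<Sum>d<l. \<Sum>g<l. 2 * fls_X * (\<phi> d c g * y a b d g))" using c by simp
    also have "\<dots> = (\<Sum>d<l. \<Sum>g<l. - (2 * fls_X * (\<phi> c d g * y a b d g)))"
      using anti[OF _ c] by (auto intro!: sum.cong)
    also have "\<dots> = - (2 * fls_X * Z)" by (simp only: Z_def sum_distrib_left sum_negf)
    finally have B: "(\<Sum>(d, e, g)\<in>?I. \<phi> d e g * ((if e = c then 2 * fls_X else 0) * y a b d g)) = - (2 * fls_X * Z)" .
    have "(\<Sum>(d, e, g)\<in>?I. \<phi> d e g * ((if d = c then 2 * fls_X else 0) * y a b e g - (if e = c then 2 * fls_X else 0) * y a b d g)) =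
        (\<Sum>(d, e, g)\<in>?I. \<phi> d e g * ((if d = c then 2 * fls_X else 0) * y a b e g)) -
        (\<Sum>(d, e, g)\<in>?I. \<phi> d e g * ((if e = c then 2 * fls_X else 0) * y a b d g))"
      by (simp only: right_diff_distrib sum_subtractf case_prod_unfold)
    also have "\<dots> = 2 * fls_X * Z - - (2 * fls_X * Z)" by (simp only: A B)
    also have "\<dots> = 4 * fls_X * Z" by (simp add: algebra_simps)
    finally show ?thesis unfolding Z_def .
  qed
  have "clifford_mult l (cubic l \<phi>) (cubic l \<phi>) U = (\<Sum>(a, b, c)\<in>?I. \<Sum>(d, e, g)\<in>?I. \<phi> a b c *
      (\<phi> d e g * (x a b d e c g + ((if d = c then 2 * fls_X else 0) * y a b e g - (if e = c then 2 * fls_X else 0) * y a b d g))))"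
    unfolding cubic_mult[OF finitary1_cubic] lop3
    by (intro sum.cong refl) (auto simp: sum_distrib_left move intro!: sum.cong)
  also have "\<dots> = S1 + (\<Sum>(a, b, c)\<in>?I. \<phi> a b c * (4 * fls_X * (\<Sum>e<l. \<Sum>g<l. \<phi> c e g * y a b e g)))"
    unfolding S1_def sum.distrib[symmetric]
  proof (intro sum.cong refl, clarify)
    fix a b c assume "c < l"
    show "(\<Sum>(d, e, g)\<in>?I. \<phi> a b c * (\<phi> d e g * (x a b d e c g + ((if d = c then 2 * fls_X else 0) * y a b e g
          - (if e = c then 2 * fls_X else 0) * y a b d g)))) =
        (\<Sum>(d, e, g)\<in>?I. \<phi> a b c * \<phi> d e g * x a b d e c g) +
        \<phi> a b c * (4 * fls_X * (\<Sum>e<l. \<Sum>g<l. \<phi> c e g * y a b e g))"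
      unfolding inner[OF \<open>c < l\<close>, symmetric]
      by (simp add: sum_distrib_left sum.distrib[symmetric] case_prod_unfold distrib_left mult.assoc)
  qed
  also have "(\<Sum>(a, b, c)\<in>?I. \<phi> a b c * (4 * fls_X * (\<Sum>e<l. \<Sum>g<l. \<phi> c e g * y a b e g))) = 4 * fls_X * S2"
  proof -
    have "(\<Sum>c<l. \<phi> a b c * (4 * fls_X * (\<Sum>e<l. \<Sum>g<l. \<phi> c e g * y a b e g))) =
        4 * fls_X * (\<Sum>e<l. \<Sum>g<l. (\<Sum>c<l. \<phi> a b c * \<phi> c e g) * y a b e g)" for a b
    proof -
      have "(\<Sum>c<l. \<phi> a b c * (4 * fls_X * (\<Sum>e<l. \<Sum>g<l. \<phi> c e g * y a b e g))) =
          (\<Sum>c<l. \<Sum>e<l. \<Sum>g<l. 4 * fls_X * (\<phi> a b c * \<phi> c e g * y a b e g))"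
        by (simp add: sum_distrib_left mult_ac)
      also have "\<dots> = (\<Sum>e<l. \<Sum>c<l. \<Sum>g<l. 4 * fls_X * (\<phi> a b c * \<phi> c e g * y a b e g))" by (rule sum.swap)
      also have "\<dots> = (\<Sum>e<l. \<Sum>g<l. \<Sum>c<l. 4 * fls_X * (\<phi> a b c * \<phi> c e g * y a b e g))"
        by (intro sum.cong refl sum.swap)
      finally show ?thesis by (simp add: sum_distrib_left sum_distrib_right)
    qed
    then show ?thesis by (simp add: S2_def sum.cartesian_product[symmetric] sum_distrib_left)
  qed
  finally show ?thesis by (simp add: S1 S2)
qed

lemma cubic_monomial:
  assumes "lop l a (lop l b (lop l (l + c) (ext_basis {}))) U \<noteq> (0 :: 'k::field_char_0 fls)" "a < l" "b < l"
  shows "U = {a, b} \<union> lift l {c} \<and> a \<noteq> b"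
proof -
  have "lop l (l + c) (ext_basis {}) = (ext_basis {l + c} :: nat set => 'k fls)"
    by (rule ext_basis_generator[symmetric])
  then have "a \<in> U \<and> b \<in> U - {a} \<and> U - {a} - {b} = {l + c}"
    using assms by (auto simp: lop_ghost wedge_def ext_basis_def split: if_splits)
  then show ?thesis by auto
qed

lemma cubic_support:
  assumes "cubic l \<phi> U \<noteq> (0 :: 'k::field_char_0 fls)"
  shows "\<exists>a<l. \<exists>b<l. \<exists>c<l. a \<noteq> b \<and> U = {a, b} \<union> lift l {c}"
proof -
  obtain a b c where "a < l" "b < l" "c < l" "lop l a (lop l b (lop l (l + c) (ext_basis {}))) U \<noteq> (0 :: 'k fls)"
  proof -
    have "\<exists>p\<in>{..<l} \<times> {..<l} \<times> {..<l}. (case p of (a, b, c) => lop l a (lop l b (lop l (l + c) (ext_basis {})))) U \<noteq> (0 :: 'k fls)"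
      using assms unfolding cubic_def by (metis (no_types, lifting) mult_zero_right sum.neutral)
    then show ?thesis using that by auto
  qed
  then show ?thesis using cubic_monomial by blast
qed

section \<open>The BRST algebra as an endomorphism algebra\<close>

text \<open>Only the ring structure of the star product algebra and the centrality of the scalars enter the
  comparison of the BRST algebra with endomorphisms. The set \<open>C\<close> stands for the Laurent series with smooth
  coefficients inside the ring of all Laurent series of functions.\<close>

locale star_algebra =
  fixes C :: "'r::comm_ring_1 set" and st :: "'r => 'r => 'r" and sc :: "'k::field_char_0 fls => 'r => 'r"
    and l :: nat
  assumes zero_C: "0 \<in> C" and add_C: "[|x \<in> C; y \<in> C|] ==> x + y \<in> C" and uminus_C: "x \<in> C ==> - x \<in> C"
    and one_C: "1 \<in> C" and st_C: "[|x \<in> C; y \<in> C|] ==> st x y \<in> C"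
    and st_assoc: "[|x \<in> C; y \<in> C; z \<in> C|] ==> st (st x y) z = st x (st y z)"
    and st_add_left: "[|x \<in> C; y \<in> C; z \<in> C|] ==> st (x + y) z = st x z + st y z"
    and st_add_right: "[|x \<in> C; y \<in> C; z \<in> C|] ==> st x (y + z) = st x y + st x z"
    and one_st: "x \<in> C ==> st 1 x = x" and st_one: "x \<in> C ==> st x 1 = x"
    and sc_C: "x \<in> C ==> sc c x \<in> C"
    and sc_add_right: "sc c (x + y) = sc c x + sc c y" and sc_add_left: "sc (c + d) x = sc c x + sc d x"
    and sc_sc: "sc c (sc d x) = sc (c * d) x" and sc_one: "sc 1 x = x"
    and st_sc_left: "[|x \<in> C; y \<in> C|] ==> st (sc c x) y = sc c (st x y)"
    and st_sc_right: "[|x \<in> C; y \<in> C|] ==> st x (sc c y) = sc c (st x y)"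
begin

lemma sc_zero_left [simp]: "sc 0 x = 0" using sc_add_left[of 0 0 x] by simp
lemma sc_zero_right [simp]: "sc c 0 = 0" using sc_add_right[of c 0 0] by simp
lemma sc_uminus_left: "sc (- c) x = - sc c x"
  using sc_add_left[of c "- c" x] by (simp add: eq_neg_iff_add_eq_0 add.commute)
lemma sc_uminus_right: "sc c (- x) = - sc c x"
  using sc_add_right[of c x "- x"] by (simp add: eq_neg_iff_add_eq_0 add.commute)
lemma sc_diff_right: "sc c (x - y) = sc c x - sc c y"
  using sc_add_right[of c x "- y"] by (simp add: sc_uminus_right)
lemma st_zero_left [simp]: "x \<in> C ==> st 0 x = 0" using st_add_left[of 0 0 x] zero_C by simp
lemma st_zero_right [simp]: "x \<in> C ==> st x 0 = 0" using st_add_right[of x 0 0] zero_C by simp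

lemma sum_C: "(\<And>i. i \<in> I ==> x i \<in> C) ==> (\<Sum>i\<in>I. x i) \<in> C"
  by (induction I rule: infinite_finite_induct) (auto simp: zero_C add_C)

lemma sc_sum_left: "sc (\<Sum>i\<in>I. c i) x = (\<Sum>i\<in>I. sc (c i) x)"
  by (induction I rule: infinite_finite_induct) (auto simp: sc_add_left)

lemma sc_sum_right: "sc c (\<Sum>i\<in>I. x i) = (\<Sum>i\<in>I. sc c (x i))"
  by (induction I rule: infinite_finite_induct) (auto simp: sc_add_right)

lemma st_sum_left: "(\<And>i. i \<in> I ==> x i \<in> C) ==> y \<in> C ==> st (\<Sum>i\<in>I. x i) y = (\<Sum>i\<in>I. st (x i) y)"
proof (induction I rule: infinite_finite_induct)
  case (insert i I)
  then show ?case using st_add_left[of "x i" "\<Sum>i\<in>I. x i" y] sum_C[of I x] by simp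
qed auto

lemma st_sum_right: "(\<And>i. i \<in> I ==> x i \<in> C) ==> y \<in> C ==> st y (\<Sum>i\<in>I. x i) = (\<Sum>i\<in>I. st y (x i))"
proof (induction I rule: infinite_finite_induct)
  case (insert i I)
  then show ?case using st_add_right[of y "x i" "\<Sum>i\<in>I. x i"] sum_C[of I x] by simp
qed auto

definition R :: "'r ring" where
  "R = \<lparr>carrier = C, mult = st, one = 1, zero = 0, add = (+)\<rparr>"

lemma R_simps [simp]: "carrier R = C" "x \<otimes>\<^bsub>R\<^esub> y = st x y" "\<one>\<^bsub>R\<^esub> = 1" "\<zero>\<^bsub>R\<^esub> = 0" "x \<oplus>\<^bsub>R\<^esub> y = x + y"
  by (simp_all add: R_def)

lemma ring_R: "ring R"
proof (rule ringI)
  show "abelian_group R"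
    by (rule abelian_groupI) (auto simp: add_C zero_C add_ac intro!: bexI[of _ "- x" for x] uminus_C)
  show "Group.monoid R"
    by (rule monoidI) (auto simp: st_C one_C st_assoc one_st st_one)
qed (auto simp: st_add_left st_add_right)

definition coeffs :: "(nat set => 'r) => bool" where "coeffs x \<longleftrightarrow> (\<forall>S. x S \<in> C)"

definition bmult :: "(nat set => 'r) => (nat set => 'r) => nat set => 'r" where
  "bmult x y = (\<lambda>U. \<Sum>S\<in>Pow {..<2 * l}. \<Sum>T\<in>Pow {..<2 * l}.
     sc (clifford_mult l (ext_basis S) (ext_basis T) U) (st (x S) (y T)))"

definition degree_part :: "int => (nat set => 'r) set" where
  "degree_part n = {x. \<forall>S. x S \<in> C \<and> (x S \<noteq> 0 \<longrightarrow> S \<subseteq> {..<2 * l} \<and> ghost_number l S = n)}"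

definition koszul :: "int => ('r, nat set => 'r) module" where
  "koszul p = free_left_module R {S. S \<subseteq> {..<l} \<and> int (card S) = p}"

text \<open>The matrix of right multiplication by \<open>x\<close>, acting on row vectors so that it commutes with the
  left module structure.\<close>

definition mat :: "(nat set => 'r) => nat set => nat set => 'r" where
  "mat x T V = (\<Sum>S\<in>Pow {..<2 * l}. sc (rep_coeff l T S V) (x S))"

definition act :: "(nat set => 'r) => (nat set => 'r) => nat set => 'r" where
  "act x k = (\<lambda>V. if V \<subseteq> {..<l} then \<Sum>T\<in>Pow {..<l}. st (k T) (mat x T V) else 0)"

lemma coeffs_degree_part: "x \<in> degree_part n ==> coeffs x"
  by (simp add: degree_part_def coeffs_def)

lemma mat_C: "coeffs x ==> mat x T V \<in> C"
  unfolding mat_def coeffs_def by (intro sum_C sc_C) auto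

lemma coeffs_bmult: "coeffs x ==> coeffs y ==> coeffs (bmult x y)"
  unfolding coeffs_def bmult_def by (intro allI sum_C sc_C st_C) auto

lemma coeffs_act: "coeffs x ==> coeffs k ==> coeffs (act x k)"
  unfolding coeffs_def act_def using mat_C[unfolded coeffs_def] by (auto intro!: sum_C st_C zero_C)

lemma mat_bmult:
  assumes x: "coeffs x" and y: "coeffs y" and T: "T \<subseteq> {..<l}"
  shows "mat (bmult x y) T V = (\<Sum>W\<in>Pow {..<l}. st (mat x T W) (mat y W V))"
proof -
  let ?P = "Pow {..<2 * l}"
  have xC: "x S \<in> C" and yC: "y S \<in> C" for S using x y by (auto simp: coeffs_def)
  have "mat (bmult x y) T V = (\<Sum>U\<in>?P. \<Sum>S\<in>?P. \<Sum>S'\<in>?P.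
      sc (clifford_mult l (ext_basis S) (ext_basis S') U * rep_coeff l T U V) (st (x S) (y S')))"
    by (simp add: mat_def bmult_def sc_sum_right sc_sc mult.commute)
  also have "\<dots> = (\<Sum>S\<in>?P. \<Sum>U\<in>?P. \<Sum>S'\<in>?P.
      sc (clifford_mult l (ext_basis S) (ext_basis S') U * rep_coeff l T U V) (st (x S) (y S')))"
    by (rule sum.swap)
  also have "\<dots> = (\<Sum>S\<in>?P. \<Sum>S'\<in>?P. \<Sum>U\<in>?P.
      sc (clifford_mult l (ext_basis S) (ext_basis S') U * rep_coeff l T U V) (st (x S) (y S')))"
    by (intro sum.cong refl sum.swap)
  also have "\<dots> = (\<Sum>S\<in>?P. \<Sum>S'\<in>?P. sc (\<Sum>W\<in>Pow {..<l}. rep_coeff l T S W * rep_coeff l W S' V) (st (x S) (y S')))"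
  proof (intro sum.cong refl)
    fix S S' assume "S \<in> ?P" "S' \<in> ?P"
    then have "(\<Sum>U\<in>?P. clifford_mult l (ext_basis S) (ext_basis S') U * rep_coeff l T U V) =
        (\<Sum>W\<in>Pow {..<l}. rep_coeff l T S W * rep_coeff l W S' V :: 'k fls)"
      by (intro rep_coeff_mult[OF _ _ T]) auto
    then show "(\<Sum>U\<in>?P. sc (clifford_mult l (ext_basis S) (ext_basis S') U * rep_coeff l T U V) (st (x S) (y S'))) =
        sc (\<Sum>W\<in>Pow {..<l}. rep_coeff l T S W * rep_coeff l W S' V) (st (x S) (y S'))"
      by (simp only: sc_sum_left[symmetric])
  qed
  also have "\<dots> = (\<Sum>S\<in>?P. \<Sum>W\<in>Pow {..<l}. \<Sum>S'\<in>?P. sc (rep_coeff l T S W * rep_coeff l W S' V) (st (x S) (y S')))"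
    unfolding sc_sum_left by (intro sum.cong refl sum.swap)
  also have "\<dots> = (\<Sum>W\<in>Pow {..<l}. \<Sum>S\<in>?P. \<Sum>S'\<in>?P. sc (rep_coeff l T S W * rep_coeff l W S' V) (st (x S) (y S')))"
    by (rule sum.swap)
  also have "\<dots> = (\<Sum>W\<in>Pow {..<l}. st (mat x T W) (mat y W V))"
  proof (rule sum.cong[OF refl])
    fix W
    have "st (mat x T W) (mat y W V) = (\<Sum>S\<in>?P. st (sc (rep_coeff l T S W) (x S)) (mat y W V))"
      unfolding mat_def[of x] by (rule st_sum_left) (auto intro: sc_C xC mat_C y)
    also have "\<dots> = (\<Sum>S\<in>?P. \<Sum>S'\<in>?P. st (sc (rep_coeff l T S W) (x S)) (sc (rep_coeff l W S' V) (y S')))"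
      unfolding mat_def[of y] by (intro sum.cong refl st_sum_right) (auto intro: sc_C xC yC)
    also have "\<dots> = (\<Sum>S\<in>?P. \<Sum>S'\<in>?P. sc (rep_coeff l T S W * rep_coeff l W S' V) (st (x S) (y S')))"
      by (simp add: st_sc_left st_sc_right sc_sc sc_C st_C xC yC mult.commute)
    finally show "(\<Sum>S\<in>?P. \<Sum>S'\<in>?P. sc (rep_coeff l T S W * rep_coeff l W S' V) (st (x S) (y S'))) =
        st (mat x T W) (mat y W V)" ..
  qed
  finally show ?thesis .
qed

lemma act_bmult:
  assumes x: "coeffs x" and y: "coeffs y" and k: "coeffs k"
  shows "act (bmult x y) k = act y (act x k)"
proof
  fix V
  have kC: "k T \<in> C" for T using k by (auto simp: coeffs_def)
  have "(\<Sum>T\<in>Pow {..<l}. st (k T) (mat (bmult x y) T V)) =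
      (\<Sum>T\<in>Pow {..<l}. \<Sum>W\<in>Pow {..<l}. st (st (k T) (mat x T W)) (mat y W V))"
    by (intro sum.cong refl) (simp add: mat_bmult[OF x y] st_sum_right st_C mat_C x y kC st_assoc)
  also have "\<dots> = (\<Sum>W\<in>Pow {..<l}. \<Sum>T\<in>Pow {..<l}. st (st (k T) (mat x T W)) (mat y W V))" by (rule sum.swap)
  also have "\<dots> = (\<Sum>W\<in>Pow {..<l}. st (act x k W) (mat y W V))"
    by (intro sum.cong refl) (simp add: act_def st_sum_left st_C mat_C x y kC)
  finally show "act (bmult x y) k V = act y (act x k) V" by (simp add: act_def)
qed

lemma mat_add: "mat (\<lambda>S. x S + y S) T V = mat x T V + mat y T V"
  by (simp add: mat_def sc_add_right sum.distrib)

lemma mat_scale: "mat (\<lambda>S. sc c (x S)) T V = sc c (mat x T V)"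
  by (simp add: mat_def sc_sum_right sc_sc mult.commute)

lemma act_add_left: "[|coeffs x; coeffs y; coeffs k|] ==> act (\<lambda>S. x S + y S) k V = act x k V + act y k V"
  by (simp add: act_def mat_add st_add_right mat_C coeffs_def[of k] sum.distrib)

lemma act_scale_left: "[|coeffs x; coeffs k|] ==> act (\<lambda>S. sc c (x S)) k V = sc c (act x k V)"
  by (simp add: act_def mat_scale st_sc_right mat_C coeffs_def[of k] sc_sum_right)

lemma act_add_right: "[|coeffs x; coeffs k; coeffs k'|] ==> act x (\<lambda>S. k S + k' S) V = act x k V + act x k' V"
  by (simp add: act_def st_add_left mat_C coeffs_def[of k] coeffs_def[of k'] sum.distrib)

lemma act_scale_right: "[|coeffs x; coeffs k|] ==> act x (\<lambda>S. sc c (k S)) V = sc c (act x k V)"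
  by (simp add: act_def st_sc_left mat_C coeffs_def[of k] sc_sum_right)

lemma act_smult: "[|coeffs x; coeffs k; a \<in> C|] ==> act x (\<lambda>S. st a (k S)) V = st a (act x k V)"
  by (simp add: act_def st_assoc mat_C coeffs_def[of k] st_sum_right st_C)

lemma mem_koszul: "k \<in> carrier (koszul p) \<longleftrightarrow>
    (\<forall>T. k T \<in> C \<and> (k T \<noteq> 0 \<longrightarrow> T \<subseteq> {..<l} \<and> int (card T) = p))"
proof -
  have "finite {T. k T \<noteq> 0}" if "\<forall>T. k T \<noteq> 0 \<longrightarrow> T \<subseteq> {..<l} \<and> int (card T) = p"
    by (rule finite_subset[of _ "Pow {..<l}"]) (use that in auto)
  then show ?thesis by (auto simp: koszul_def mem_free_left_module)
qed

lemma koszul_simps [simp]: "k \<oplus>\<^bsub>koszul p\<^esub> k' = (\<lambda>T. k T + k' T)" "a \<odot>\<^bsub>koszul p\<^esub> k = (\<lambda>T. st a (k T))"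
  "\<zero>\<^bsub>koszul p\<^esub> = (\<lambda>T. 0)"
  by (simp_all add: koszul_def)

lemma koszul_module: "left_module R (koszul p)"
  unfolding koszul_def by (rule left_module_free[OF ring_R])

lemma coeffs_koszul: "k \<in> carrier (koszul p) ==> coeffs k"
  by (simp add: mem_koszul coeffs_def)

lemma mat_degree:
  assumes "x \<in> degree_part n" "T \<subseteq> {..<l}" "V \<subseteq> {..<l}" "mat x T V \<noteq> 0"
  shows "int (card V) = int (card T) - n"
proof -
  obtain S where S: "S \<in> Pow {..<2 * l}" "sc (rep_coeff l T S V) (x S) \<noteq> 0"
    using assms(4) unfolding mat_def by (meson sum.not_neutral_contains_not_neutral)
  then have nz: "rep_coeff l T S V \<noteq> (0 :: 'k fls)" "x S \<noteq> 0" by auto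
  have "ghost_number l S = n" using assms(1) nz(2) by (simp add: degree_part_def)
  moreover have "int (card V) = int (card T) - ghost_number l S"
    using rep_coeff_degree[OF assms(2,3) _ nz(1)] S(1) by blast
  ultimately show ?thesis by simp
qed

lemma act_koszul:
  assumes x: "x \<in> degree_part n" and k: "k \<in> carrier (koszul p)" and q: "q = p - n"
  shows "act x k \<in> carrier (koszul q)"
  unfolding mem_koszul
proof (intro allI conjI impI)
  fix V
  show "act x k V \<in> C" using coeffs_act[OF coeffs_degree_part[OF x] coeffs_koszul[OF k]] by (simp add: coeffs_def)
  assume nz: "act x k V \<noteq> 0"
  then show V: "V \<subseteq> {..<l}" by (auto simp: act_def split: if_splits)
  obtain T where T: "T \<in> Pow {..<l}" "st (k T) (mat x T V) \<noteq> 0"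
    using nz V unfolding act_def by (auto elim: sum.not_neutral_contains_not_neutral)
  have kT: "k T \<in> C" using k by (simp add: mem_koszul)
  have "k T \<noteq> 0" using T(2) mat_C[OF coeffs_degree_part[OF x]] by auto
  then have "int (card T) = p" using k by (simp add: mem_koszul)
  moreover have "mat x T V \<noteq> 0" using T(2) kT by auto
  then have "int (card V) = int (card T) - n" using mat_degree[OF x _ V] T(1) by blast
  ultimately show "int (card V) = q" using q by simp
qed

lemma basis_koszul: "T \<subseteq> {..<l} ==> ext_basis T \<in> carrier (koszul (int (card T)))"
  by (auto simp: mem_koszul ext_basis_def zero_C one_C)

lemma act_basis: "coeffs x ==> T \<subseteq> {..<l} ==> V \<subseteq> {..<l} ==> act x (ext_basis T) V = mat x T V"
proof -
  assume x: "coeffs x" and T: "T \<subseteq> {..<l}" and V: "V \<subseteq> {..<l}"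
  have "(\<Sum>T'\<in>Pow {..<l}. st (ext_basis T T') (mat x T' V)) = (\<Sum>T'\<in>Pow {..<l}. if T' = T then mat x T V else 0)"
    by (intro sum.cong refl) (auto simp: ext_basis_def one_st mat_C x)
  then show ?thesis using T V by (simp add: act_def)
qed

lemma mat_inverse:
  "\<exists>n :: nat set => nat set => nat set => 'k fls. (\<forall>x S. S \<subseteq> {..<2 * l} \<longrightarrow> (\<Sum>T\<in>Pow {..<l}. \<Sum>V\<in>Pow {..<l}. sc (n S T V) (mat x T V)) = x S) \<and>
    (\<forall>Y T V. T \<subseteq> {..<l} \<longrightarrow> V \<subseteq> {..<l} \<longrightarrow>
      mat (\<lambda>S. if S \<subseteq> {..<2 * l} then \<Sum>T\<in>Pow {..<l}. \<Sum>V\<in>Pow {..<l}. sc (n S T V) (Y T V) else 0) T V = Y T V)"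
proof -
  let ?P = "Pow {..<l}" and ?Q = "Pow {..<2 * l}"
  obtain n :: "nat set => nat set => nat set => 'k fls" where
    n1: "\<And>T V T' V'. [|T \<in> ?P; V \<in> ?P; T' \<in> ?P; V' \<in> ?P|] ==>
      (\<Sum>S\<in>?Q. rep_coeff l T S V * n S T' V') = (if T = T' \<and> V = V' then 1 else 0)" and
    n2: "\<And>S S'. [|S \<in> ?Q; S' \<in> ?Q|] ==>
      (\<Sum>T\<in>?P. \<Sum>V\<in>?P. n S T V * rep_coeff l T S' V) = (if S = S' then 1 else 0)"
    using rep_coeff_inverse[where 'k = 'k, of l] by blast
  show ?thesis
  proof (intro exI[of _ n] conjI allI impI)
    fix x S assume S: "S \<subseteq> {..<2 * l}"
    have "(\<Sum>T\<in>?P. \<Sum>V\<in>?P. sc (n S T V) (mat x T V)) =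
        (\<Sum>T\<in>?P. \<Sum>V\<in>?P. \<Sum>S'\<in>?Q. sc (n S T V * rep_coeff l T S' V) (x S'))"
      by (simp add: mat_def sc_sum_right sc_sc)
    also have "\<dots> = (\<Sum>T\<in>?P. \<Sum>S'\<in>?Q. \<Sum>V\<in>?P. sc (n S T V * rep_coeff l T S' V) (x S'))"
      by (intro sum.cong refl sum.swap)
    also have "\<dots> = (\<Sum>S'\<in>?Q. \<Sum>T\<in>?P. \<Sum>V\<in>?P. sc (n S T V * rep_coeff l T S' V) (x S'))" by (rule sum.swap)
    also have "\<dots> = (\<Sum>S'\<in>?Q. sc (if S = S' then 1 else 0) (x S'))"
      using S by (intro sum.cong refl) (simp add: sc_sum_left[symmetric] n2)
    also have "\<dots> = (\<Sum>S'\<in>?Q. if S' = S then x S else 0)" by (intro sum.cong refl) (auto simp: sc_one)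
    also have "\<dots> = x S" using S by simp
    finally show "(\<Sum>T\<in>?P. \<Sum>V\<in>?P. sc (n S T V) (mat x T V)) = x S" .
  next
    fix Y :: "nat set => nat set => 'r" and T V assume TV: "T \<subseteq> {..<l}" "V \<subseteq> {..<l}"
    have "mat (\<lambda>S. if S \<subseteq> {..<2 * l} then \<Sum>T\<in>?P. \<Sum>V\<in>?P. sc (n S T V) (Y T V) else 0) T V =
        (\<Sum>S\<in>?Q. \<Sum>T'\<in>?P. \<Sum>V'\<in>?P. sc (rep_coeff l T S V * n S T' V') (Y T' V'))"
      unfolding mat_def by (intro sum.cong refl) (simp add: sc_sum_right sc_sc)
    also have "\<dots> = (\<Sum>T'\<in>?P. \<Sum>S\<in>?Q. \<Sum>V'\<in>?P. sc (rep_coeff l T S V * n S T' V') (Y T' V'))" by (rule sum.swap)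
    also have "\<dots> = (\<Sum>T'\<in>?P. \<Sum>V'\<in>?P. \<Sum>S\<in>?Q. sc (rep_coeff l T S V * n S T' V') (Y T' V'))"
      by (intro sum.cong refl sum.swap)
    also have "\<dots> = (\<Sum>T'\<in>?P. \<Sum>V'\<in>?P. sc (if T = T' \<and> V = V' then 1 else 0) (Y T' V'))"
      using TV by (intro sum.cong refl) (simp add: sc_sum_left[symmetric] n1)
    also have "\<dots> = (\<Sum>T'\<in>?P. if T' = T then Y T V else 0)"
    proof (rule sum.cong[OF refl])
      fix T'
      have "(\<Sum>V'\<in>?P. sc (if T = T' \<and> V = V' then 1 else 0) (Y T' V')) =
          (\<Sum>V'\<in>?P. if V' = V then (if T' = T then Y T V else 0) else 0)"
        by (intro sum.cong refl) (auto simp: sc_one)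
      then show "(\<Sum>V'\<in>?P. sc (if T = T' \<and> V = V' then 1 else 0) (Y T' V')) = (if T' = T then Y T V else 0)"
        using TV by simp
    qed
    also have "\<dots> = Y T V" using TV by simp
    finally show "mat (\<lambda>S. if S \<subseteq> {..<2 * l} then \<Sum>T\<in>?P. \<Sum>V\<in>?P. sc (n S T V) (Y T V) else 0) T V = Y T V" .
  qed
qed

lemma mat_inject:
  assumes "\<And>S. x S \<noteq> 0 ==> S \<subseteq> {..<2 * l}" "\<And>S. y S \<noteq> 0 ==> S \<subseteq> {..<2 * l}"
    and "\<And>T V. [|T \<subseteq> {..<l}; V \<subseteq> {..<l}|] ==> mat x T V = mat y T V"
  shows "x = y"
proof
  fix S
  show "x S = y S"
  proof (cases "S \<subseteq> {..<2 * l}")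
    case True
    obtain n :: "nat set => nat set => nat set => 'k fls" where
      n': "\<forall>x S. S \<subseteq> {..<2 * l} \<longrightarrow> (\<Sum>T\<in>Pow {..<l}. \<Sum>V\<in>Pow {..<l}. sc (n S T V) (mat x T V)) = x S"
      using mat_inverse by (elim exE conjE) (rule that)
    note n = n'[rule_format, OF True]
    have "x S = (\<Sum>T\<in>Pow {..<l}. \<Sum>V\<in>Pow {..<l}. sc (n S T V) (mat x T V))" by (rule n[symmetric])
    also have "\<dots> = (\<Sum>T\<in>Pow {..<l}. \<Sum>V\<in>Pow {..<l}. sc (n S T V) (mat y T V))"
      using assms(3) by (intro sum.cong refl) auto
    also have "\<dots> = y S" by (rule n)
    finally show ?thesis .
  next
    case False
    have "x S = 0" using assms(1)[of S] False by argo
    moreover have "y S = 0" using assms(2)[of S] False by argo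
    ultimately show ?thesis by simp
  qed
qed

lemma mat_surj:
  assumes Y: "\<And>T V. Y T V \<in> C"
    "\<And>T V. [|T \<subseteq> {..<l}; V \<subseteq> {..<l}; Y T V \<noteq> 0|] ==> int (card V) = int (card T) - n"
  shows "\<exists>x\<in>degree_part n. \<forall>T\<subseteq>{..<l}. \<forall>V\<subseteq>{..<l}. mat x T V = Y T V"
proof -
  obtain i :: "nat set => nat set => nat set => 'k fls" where i': "\<forall>Y T V. T \<subseteq> {..<l} \<longrightarrow> V \<subseteq> {..<l} \<longrightarrow>
      mat (\<lambda>S. if S \<subseteq> {..<2 * l} then \<Sum>T\<in>Pow {..<l}. \<Sum>V\<in>Pow {..<l}. sc (i S T V) (Y T V) else 0) T V = Y T V"
    using mat_inverse by (elim exE conjE) (rule that)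
  note i = i'[rule_format]
  define x where "x = (\<lambda>S. if S \<subseteq> {..<2 * l} then \<Sum>T\<in>Pow {..<l}. \<Sum>V\<in>Pow {..<l}. sc (i S T V) (Y T V) else 0)"
  define z where "z S = (if ghost_number l S = n then x S else 0)" for S
  have x_mat: "mat x T V = Y T V" if "T \<subseteq> {..<l}" "V \<subseteq> {..<l}" for T V unfolding x_def by (rule i[OF that])
  have xC: "x S \<in> C" for S unfolding x_def using Y(1) by (auto intro!: sum_C sc_C zero_C)
  have z: "z \<in> degree_part n"
    using xC zero_C by (auto simp: degree_part_def z_def x_def split: if_splits)
  moreover have "mat z T V = Y T V" if TV: "T \<subseteq> {..<l}" "V \<subseteq> {..<l}" for T V
  proof (cases "int (card V) = int (card T) - n")
    case True
    have "mat z T V = mat x T V" unfolding mat_def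
    proof (intro sum.cong refl)
      fix S assume S: "S \<in> Pow {..<2 * l}"
      have "rep_coeff l T S V = (0 :: 'k fls)" if "ghost_number l S \<noteq> n"
        using rep_coeff_degree[where 'k = 'k, OF TV, of S] S that True by auto
      then show "sc (rep_coeff l T S V) (z S) = sc (rep_coeff l T S V) (x S)" by (auto simp: z_def)
    qed
    then show ?thesis using x_mat TV by simp
  next
    case False
    then have "mat z T V = 0" "Y T V = 0" using mat_degree[OF z TV] Y(2)[OF TV] by auto
    then show ?thesis by simp
  qed
  ultimately show ?thesis by blast
qed

end

section \<open>Right multiplication and the BRST differential\<close>

context star_algebra
begin

definition scalar :: "'k fls => 'r" where "scalar c = sc c 1"

definition brst :: "(nat set => 'r) => ('k fls, nat set => 'r) dg_alg" where
  "brst \<theta> = \<lparr>gcarrier = degree_part, gadd = (\<lambda>n. (+)), gzero = (\<lambda>n. 0),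
     gscale = (\<lambda>n c x S. sc c (x S)), gmult = (\<lambda>m n. bmult), gone = ext_basis {},
     gdiff = (\<lambda>n x S. sc fls_X_inv (bmult \<theta> x S - sc ((-1) powi n) (bmult x \<theta> S)))\<rparr>"

definition kdiff :: "(nat set => 'r) => int => (nat set => 'r) => nat set => 'r" where
  "kdiff \<theta> p = (\<lambda>k\<in>carrier (koszul p). \<lambda>V. sc fls_X_inv (act \<theta> k V))"

definition degree_sign :: "int => 'k fls" where
  "degree_sign n = (if even (n * (n + 1) div 2) then 1 else - 1)"

definition rep :: "int => (nat set => 'r) => int => (nat set => 'r) => nat set => 'r" where
  "rep n x = (\<lambda>p. \<lambda>k\<in>carrier (koszul p). \<lambda>V. sc (degree_sign n) (act x k V))"

lemma minus_one_powi: "((-1) powi n :: 'k fls) = (if even n then 1 else - 1)"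
  by (simp add: power_int_minus_left)

lemma half_product: "2 * (n * (n + 1) div 2) = n * (n + 1)" for n :: int
  by simp

lemma degree_sign_add: "degree_sign (m + n) * (-1) powi (m * n) = degree_sign m * degree_sign n"
proof -
  have "2 * ((m + n) * (m + n + 1) div 2) = 2 * (m * (m + 1) div 2 + n * (n + 1) div 2 + m * n)"
    using half_product[of "m + n"] half_product[of m] half_product[of n] by (simp add: algebra_simps)
  moreover have "2 * a = 2 * b ==> a = b" for a b :: int by simp
  ultimately have "(m + n) * (m + n + 1) div 2 = m * (m + 1) div 2 + n * (n + 1) div 2 + m * n" by blast
  moreover have "((-1) powi (m * n) :: 'k fls) = (if even (m * n) then 1 else - 1)" by (simp add: minus_one_powi)
  ultimately show ?thesis unfolding degree_sign_def by (simp only: even_add) auto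
qed

lemma degree_sign_Suc: "degree_sign (n + 1) = (if odd n then degree_sign n else - degree_sign n)"
  using degree_sign_add[of n 1] by (auto simp: degree_sign_def minus_one_powi split: if_splits)

lemma degree_sign_square: "degree_sign n * degree_sign n = 1" by (simp add: degree_sign_def)

lemma degree_sign_nonzero: "degree_sign n \<noteq> 0" by (simp add: degree_sign_def)

lemma degree_partI:
  "(\<And>S. x S \<in> C) ==> (\<And>S. \<not> (S \<subseteq> {..<2 * l} \<and> ghost_number l S = n) ==> x S = 0) ==> x \<in> degree_part n"
  unfolding degree_part_def mem_Collect_eq by blast

lemma degree_part_C: "x \<in> degree_part n ==> x S \<in> C"
  unfolding degree_part_def by blast

lemma degree_part_zero: "x \<in> degree_part n ==> \<not> (S \<subseteq> {..<2 * l} \<and> ghost_number l S = n) ==> x S = 0"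
  unfolding degree_part_def by blast

lemma koszul_zero: "k \<in> carrier (koszul p) ==> \<not> (T \<subseteq> {..<l} \<and> int (card T) = p) ==> k T = 0"
  unfolding mem_koszul by blast

lemma koszul_scale: "k \<in> carrier (koszul p) ==> (\<lambda>T. sc c (k T)) \<in> carrier (koszul p)"
proof -
  assume k: "k \<in> carrier (koszul p)"
  have "sc c (k T) = 0" if "\<not> (T \<subseteq> {..<l} \<and> int (card T) = p)" for T using koszul_zero[OF k that] by simp
  moreover have "sc c (k T) \<in> C" for T using k by (simp add: mem_koszul sc_C)
  ultimately show ?thesis unfolding mem_koszul by blast
qed

lemma bmult_degree:
  assumes "x \<in> degree_part m" "y \<in> degree_part n"
  shows "bmult x y \<in> degree_part (m + n)"
proof -
  have c: "coeffs x" "coeffs y" using assms coeffs_degree_part by auto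
  have "U \<subseteq> {..<2 * l} \<and> ghost_number l U = m + n" if nz: "bmult x y U \<noteq> 0" for U
  proof -
    obtain S where S: "S \<in> Pow {..<2 * l}" "(\<Sum>T\<in>Pow {..<2 * l}. sc (clifford_mult l (ext_basis S) (ext_basis T) U) (st (x S) (y T))) \<noteq> 0"
      using nz unfolding bmult_def by (rule sum.not_neutral_contains_not_neutral)
    obtain T where T: "T \<in> Pow {..<2 * l}" "sc (clifford_mult l (ext_basis S) (ext_basis T) U) (st (x S) (y T)) \<noteq> 0"
      using S(2) by (rule sum.not_neutral_contains_not_neutral)
    have "clifford_mult l (ext_basis S) (ext_basis T) U \<noteq> (0 :: 'k fls)" using T(2) by auto
    then have "U \<subseteq> {..<2 * l} \<and> ghost_number l U = ghost_number l S + ghost_number l T"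
      using clifford_coeff_support[where 'k = 'k] S(1) T(1) by blast
    moreover have "x S \<noteq> 0" "y T \<noteq> 0" using T(2) c by (auto simp: coeffs_def)
    ultimately show ?thesis using assms by (simp add: degree_part_def)
  qed
  then show ?thesis using coeffs_bmult[OF c] by (simp add: degree_part_def coeffs_def)
qed

lemma scale_degree: "x \<in> degree_part n ==> (\<lambda>S. sc c (x S)) \<in> degree_part n"
  by (rule degree_partI) (simp_all add: degree_part_C sc_C degree_part_zero)

lemma add_degree: "x \<in> degree_part n ==> y \<in> degree_part n ==> (\<lambda>S. x S + y S) \<in> degree_part n"
  by (rule degree_partI) (simp_all add: degree_part_C add_C degree_part_zero)

lemma diff_degree: "x \<in> degree_part n ==> y \<in> degree_part n ==> (\<lambda>S. x S - sc c (y S)) \<in> degree_part n"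
  using add_degree[OF _ scale_degree[of y n "- c"]] by (simp add: sc_uminus_left)

lemma gdiff_degree:
  assumes "\<theta> \<in> degree_part 1" "x \<in> degree_part n"
  shows "gdiff (brst \<theta>) n x \<in> degree_part (n + 1)"
  using bmult_degree[OF assms] bmult_degree[OF assms(2,1)]
  by (simp add: brst_def scale_degree diff_degree add.commute)

lemma act_hom:
  assumes x: "x \<in> degree_part n"
  shows "(\<lambda>k\<in>carrier (koszul p). \<lambda>V. sc c (act x k V)) \<in> left_hom R (koszul p) (koszul (p - n))"
proof -
  interpret K: left_module R "koszul p" by (rule koszul_module)
  note c = coeffs_degree_part[OF x] coeffs_koszul
  have actC: "act x k V \<in> C" if "k \<in> carrier (koszul p)" for k V
    using coeffs_act[OF c(1) c(2)[OF that]] by (simp add: coeffs_def)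
  show ?thesis
  proof (rule left_homI)
    fix k assume k: "k \<in> carrier (koszul p)"
    have "act x k \<in> carrier (koszul (p - n))" by (rule act_koszul[OF x k refl])
    then show "(\<lambda>k\<in>carrier (koszul p). \<lambda>V. sc c (act x k V)) k \<in> carrier (koszul (p - n))"
      using k koszul_scale by simp
    fix k' assume k': "k' \<in> carrier (koszul p)"
    have "k \<oplus>\<^bsub>koszul p\<^esub> k' \<in> carrier (koszul p)" using k k' by (rule K.M.a_closed)
    then show "(\<lambda>k\<in>carrier (koszul p). \<lambda>V. sc c (act x k V)) (k \<oplus>\<^bsub>koszul p\<^esub> k') =
        (\<lambda>k\<in>carrier (koszul p). \<lambda>V. sc c (act x k V)) k \<oplus>\<^bsub>koszul (p - n)\<^esub>
        (\<lambda>k\<in>carrier (koszul p). \<lambda>V. sc c (act x k V)) k'"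
      using k k' c by (simp add: act_add_right sc_add_right)
  next
    fix a k assume a: "a \<in> carrier R" and k: "k \<in> carrier (koszul p)"
    have "a \<odot>\<^bsub>koszul p\<^esub> k \<in> carrier (koszul p)" using a k by (rule K.lsmult_closed)
    then show "(\<lambda>k\<in>carrier (koszul p). \<lambda>V. sc c (act x k V)) (a \<odot>\<^bsub>koszul p\<^esub> k) =
        a \<odot>\<^bsub>koszul (p - n)\<^esub> (\<lambda>k\<in>carrier (koszul p). \<lambda>V. sc c (act x k V)) k"
      using a k c by (simp add: act_smult st_sc_right actC)
  qed simp
qed

lemma rep_hom: "x \<in> degree_part n ==> rep n x \<in> hom_deg R koszul koszul n"
  by (simp add: hom_deg_def rep_def act_hom)

lemma hom_expansion:
  assumes \<phi>: "\<phi> \<in> left_hom R (koszul p) (koszul q)"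
  shows "finite F ==> F \<subseteq> Pow {..<l} ==> k \<in> carrier (koszul p) ==> (\<And>T. T \<notin> F ==> k T = 0) ==>
    \<phi> k V = (\<Sum>T\<in>F. if int (card T) = p then st (k T) (\<phi> (ext_basis T) V) else 0)"
proof (induction F arbitrary: k rule: finite_induct)
  case empty
  then have "k = \<zero>\<^bsub>koszul p\<^esub>" by auto
  then have "\<phi> k = \<zero>\<^bsub>koszul q\<^esub>"
    using left_hom_zero[OF left_module_abelian_group[OF koszul_module] left_module_abelian_group[OF koszul_module] \<phi>]
    by simp
  then show ?case by simp
next
  case (insert T F)
  interpret K: left_module R "koszul p" by (rule koszul_module)
  define w where "w = k(T := 0)"
  have w: "w \<in> carrier (koszul p)" using insert.prems(2) zero_C by (auto simp: w_def mem_koszul)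
  have kT: "k T \<in> C" using insert.prems(2) by (simp add: mem_koszul)
  have w0: "w U = 0" if "U \<notin> F" for U using that insert.prems(3) by (auto simp: w_def)
  have IH: "\<phi> w V = (\<Sum>U\<in>F. if int (card U) = p then st (w U) (\<phi> (ext_basis U) V) else 0)"
    using insert.IH[OF _ w w0] insert.prems(1) by auto
  have eq: "(\<Sum>U\<in>F. if int (card U) = p then st (w U) (\<phi> (ext_basis U) V) else 0) =
      (\<Sum>U\<in>F. if int (card U) = p then st (k U) (\<phi> (ext_basis U) V) else 0)"
    using insert.hyps(2) by (intro sum.cong refl) (auto simp: w_def)
  show ?case
  proof (cases "int (card T) = p")
    case True
    have e: "ext_basis T \<in> carrier (koszul p)" using basis_koszul[of T] insert.prems(1) True by simp
    have s: "k T \<odot>\<^bsub>koszul p\<^esub> ext_basis T \<in> carrier (koszul p)" using K.lsmult_closed[OF _ e] kT by simp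
    have "k = w \<oplus>\<^bsub>koszul p\<^esub> k T \<odot>\<^bsub>koszul p\<^esub> ext_basis T"
      using kT by (auto simp: w_def ext_basis_def fun_eq_iff st_one)
    then have "\<phi> k = \<phi> w \<oplus>\<^bsub>koszul q\<^esub> k T \<odot>\<^bsub>koszul q\<^esub> \<phi> (ext_basis T)"
      using left_hom_add[OF \<phi> w s] left_hom_smult[OF \<phi> _ e, of "k T"] kT by simp
    then show ?thesis using insert.hyps True by (simp add: IH eq)
  next
    case False
    then have "k T = 0" using insert.prems(2) by (auto simp: mem_koszul)
    then have "w = k" by (auto simp: w_def)
    then show ?thesis using insert.hyps False IH eq by simp
  qed
qed

lemma sc_cancel: "c \<noteq> 0 ==> sc c x = sc c y ==> x = y"
  by (metis sc_sc sc_one left_inverse)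

text \<open>A homomorphism between free modules is its matrix, and every matrix of the right degree occurs by
  invertibility of the coefficients.\<close>

lemma rep_bij: "bij_betw (rep n) (degree_part n) (hom_deg R koszul koszul n)"
  unfolding bij_betw_def
proof
  show "inj_on (rep n) (degree_part n)"
  proof (rule inj_onI)
    fix x y assume x: "x \<in> degree_part n" and y: "y \<in> degree_part n" and eq: "rep n x = rep n y"
    show "x = y"
    proof (rule mat_inject)
      fix T V assume TV: "T \<subseteq> {..<l}" "V \<subseteq> {..<l}"
      have "rep n x (int (card T)) (ext_basis T) V = rep n y (int (card T)) (ext_basis T) V" by (simp only: eq)
      then have "sc (degree_sign n) (mat x T V) = sc (degree_sign n) (mat y T V)"
        using basis_koszul[OF TV(1)] act_basis[OF coeffs_degree_part TV] x y by (simp add: rep_def)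
      then show "mat x T V = mat y T V" by (rule sc_cancel[OF degree_sign_nonzero])
    qed (use x y in \<open>auto simp: degree_part_def\<close>)
  qed
  show "rep n ` degree_part n = hom_deg R koszul koszul n"
  proof
    show "rep n ` degree_part n \<subseteq> hom_deg R koszul koszul n" using rep_hom by blast
    show "hom_deg R koszul koszul n \<subseteq> rep n ` degree_part n"
    proof
      fix \<phi> assume \<phi>: "\<phi> \<in> hom_deg R koszul koszul n"
      have \<phi>T: "\<phi> (int (card T)) (ext_basis T) \<in> carrier (koszul (int (card T) - n))" if "T \<subseteq> {..<l}" for T
        by (rule hom_deg_closed[OF \<phi> basis_koszul[OF that] refl])
      define Y where "Y T V = (if T \<subseteq> {..<l} then sc (degree_sign n) (\<phi> (int (card T)) (ext_basis T) V) else 0)" for T V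
      have a: "Y T V \<in> C" for T V using \<phi>T[of T] by (auto simp: Y_def mem_koszul zero_C sc_C)
      have b: "int (card V) = int (card T) - n" if "T \<subseteq> {..<l}" "V \<subseteq> {..<l}" "Y T V \<noteq> 0" for T V
      proof -
        have "\<phi> (int (card T)) (ext_basis T) V \<noteq> 0" using that by (auto simp: Y_def)
        then show ?thesis using \<phi>T[OF that(1)] by (simp add: mem_koszul)
      qed
      have "\<exists>x\<in>degree_part n. \<forall>T\<subseteq>{..<l}. \<forall>V\<subseteq>{..<l}. mat x T V = Y T V"
        by (rule mat_surj) (rule a, rule b)
      then obtain x where x: "x \<in> degree_part n" and xY': "\<forall>T\<subseteq>{..<l}. \<forall>V\<subseteq>{..<l}. mat x T V = Y T V"
        by (elim bexE) (rule that)
      note xY = xY'[rule_format]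
      have "rep n x = \<phi>"
      proof (rule hom_deg_eqI[OF rep_hom[OF x] \<phi>], rule ext)
        fix p k V assume k: "k \<in> carrier (koszul p)"
        have fk: "\<phi> p k \<in> carrier (koszul (p - n))" by (rule hom_deg_closed[OF \<phi> k refl])
        have rk: "rep n x p k \<in> carrier (koszul (p - n))" by (rule hom_deg_closed[OF rep_hom[OF x] k refl])
        show "rep n x p k V = \<phi> p k V"
        proof (cases "V \<subseteq> {..<l}")
          case V: True
          have kC: "k T \<in> C" for T using k by (simp add: mem_koszul)
          have "rep n x p k V = (\<Sum>T\<in>Pow {..<l}. sc (degree_sign n) (st (k T) (mat x T V)))"
            using k V by (simp add: rep_def act_def sc_sum_right)
          also have "\<dots> = (\<Sum>T\<in>Pow {..<l}. if int (card T) = p then st (k T) (\<phi> p (ext_basis T) V) else 0)"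
          proof (rule sum.cong[OF refl])
            fix T assume "T \<in> Pow {..<l}"
            then have T: "T \<subseteq> {..<l}" by simp
            show "sc (degree_sign n) (st (k T) (mat x T V)) = (if int (card T) = p then st (k T) (\<phi> p (ext_basis T) V) else 0)"
            proof (cases "int (card T) = p")
              case True
              have pC: "\<phi> p (ext_basis T) V \<in> C" using \<phi>T[OF T] True by (simp add: mem_koszul)
              have "mat x T V = sc (degree_sign n) (\<phi> p (ext_basis T) V)" using xY[OF T V] T True by (simp add: Y_def)
              then show ?thesis using True kC pC by (simp add: st_sc_right sc_sc degree_sign_square sc_one)
            next
              case False
              then have "k T = 0" using k by (auto simp: mem_koszul)
              then show ?thesis using False mat_C[OF coeffs_degree_part[OF x]] by simp
            qed
          qed
          also have "\<dots> = \<phi> p k V"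
            by (rule hom_expansion[OF hom_degD[OF \<phi> refl], symmetric]) (use k koszul_zero[OF k] in simp_all)
          finally show ?thesis .
        next
          case False
          then show ?thesis using koszul_zero[OF fk] koszul_zero[OF rk] by simp
        qed
      qed
      then show "\<phi> \<in> rep n ` degree_part n" using x by blast
    qed
  qed
qed

lemma scalar_st: "x \<in> C ==> st (scalar c) x = sc c x" "x \<in> C ==> st x (scalar c) = sc c x"
  by (simp_all add: scalar_def st_sc_left st_sc_right one_C one_st st_one)

lemma kdiff_hom: "\<theta> \<in> degree_part 1 ==> kdiff \<theta> p \<in> left_hom R (koszul p) (koszul (p - 1))"
  unfolding kdiff_def by (rule act_hom)

lemma act_zero: "coeffs k ==> act (\<lambda>S. 0) k V = 0"
  by (simp add: act_def mat_def coeffs_def)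

text \<open>The operator \<open>\<theta>/\<nu>\<close> acting from the right squares to zero because \<open>\<theta> * \<theta> = 0\<close>.\<close>

lemma koszul_complex:
  assumes \<theta>: "\<theta> \<in> degree_part 1" and sq: "bmult \<theta> \<theta> = (\<lambda>S. 0)"
  shows "chain_complex R koszul (kdiff \<theta>)"
proof (rule chain_complex.intro)
  show "left_module R (koszul n)" for n by (rule koszul_module)
  show "kdiff \<theta> n \<in> left_hom R (koszul n) (koszul (n - 1))" for n by (rule kdiff_hom[OF \<theta>])
  fix n k assume k: "k \<in> carrier (koszul n)"
  note c = coeffs_degree_part[OF \<theta>] coeffs_koszul[OF k]
  have dk: "kdiff \<theta> n k \<in> carrier (koszul (n - 1))" by (rule left_hom_closed[OF kdiff_hom[OF \<theta>] k])
  show "kdiff \<theta> (n - 1) (kdiff \<theta> n k) = \<zero>\<^bsub>koszul (n - 2)\<^esub>"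
  proof
    fix V
    have "kdiff \<theta> (n - 1) (kdiff \<theta> n k) V = sc fls_X_inv (act \<theta> (\<lambda>V. sc fls_X_inv (act \<theta> k V)) V)"
      using k dk by (simp add: kdiff_def)
    also have "act \<theta> (\<lambda>V. sc fls_X_inv (act \<theta> k V)) V = sc fls_X_inv (act \<theta> (act \<theta> k) V)"
      by (rule act_scale_right[OF c(1) coeffs_act[OF c]])
    also have "act \<theta> (act \<theta> k) = act (bmult \<theta> \<theta>) k" by (rule act_bmult[OF c(1,1,2), symmetric])
    also have "act (bmult \<theta> \<theta>) k V = 0" unfolding sq by (rule act_zero[OF c(2)])
    finally show "kdiff \<theta> (n - 1) (kdiff \<theta> n k) V = \<zero>\<^bsub>koszul (n - 2)\<^esub> V" by simp
  qed
qed

text \<open>Right multiplication turns products around, and the sign \<open>degree_sign\<close> absorbs the sign in the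
  opposite product, since \<open>(m+n)(m+n+1)/2 = m(m+1)/2 + n(n+1)/2 + mn\<close>. It also corrects the
  sign with which the two differentials would otherwise differ.\<close>

theorem opposite_brst_isomorphic:
  assumes \<theta>: "\<theta> \<in> degree_part 1" and sq: "bmult \<theta> \<theta> = (\<lambda>S. 0)"
  shows "graded_alg_isomorphic (opposite_graded (cohomology (brst \<theta>))) (Ext_alg R scalar koszul (kdiff \<theta>))"
  unfolding Ext_alg_def
proof (rule opposite_cohomology_isomorphic[where \<Phi> = rep])
  interpret K: chain_complex R koszul "kdiff \<theta>" by (rule koszul_complex[OF \<theta> sq])
  interpret H: endomorphism_complex R koszul "kdiff \<theta>" scalar
    by (intro endomorphism_complex.intro K.chain_complex_axioms endomorphism_complex_axioms.intro)
      (auto simp: scalar_def sc_C one_C st_sc_left st_sc_right one_st st_one)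
  show "dga (hom_dga R scalar koszul (kdiff \<theta>))" by (rule H.H.dga_axioms)
  have \<theta>c: "coeffs \<theta>" by (rule coeffs_degree_part[OF \<theta>])
  show "gadd (brst \<theta>) n x y \<in> gcarrier (brst \<theta>) n" if "x \<in> gcarrier (brst \<theta>) n" "y \<in> gcarrier (brst \<theta>) n" for n x y
    using add_degree that by (simp add: brst_def plus_fun_def)
  show "gscale (brst \<theta>) n c x \<in> gcarrier (brst \<theta>) n" if "x \<in> gcarrier (brst \<theta>) n" for n c x
    using scale_degree that by (simp add: brst_def)
  show "gmult (brst \<theta>) m n x y \<in> gcarrier (brst \<theta>) (m + n)" if "x \<in> gcarrier (brst \<theta>) m" "y \<in> gcarrier (brst \<theta>) n" for m n x y
    using bmult_degree that by (simp add: brst_def)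
  show "gdiff (brst \<theta>) n x \<in> gcarrier (brst \<theta>) (n + 1)" if "x \<in> gcarrier (brst \<theta>) n" for n x
    using gdiff_degree[OF \<theta>, of x n] that by (simp add: brst_def)
  show "gzero (brst \<theta>) n \<in> gcarrier (brst \<theta>) n" for n
    by (simp add: brst_def degree_part_def zero_C)
  show "gone (brst \<theta>) \<in> gcarrier (brst \<theta>) 0"
    by (auto simp: brst_def degree_part_def ext_basis_def zero_C one_C)
  show "bij_betw (rep n) (gcarrier (brst \<theta>) n) (gcarrier (hom_dga R scalar koszul (kdiff \<theta>)) n)" for n
    unfolding H.hom_dga_simps(1) using rep_bij by (simp add: brst_def)
  show "rep n (gadd (brst \<theta>) n x y) = gadd (hom_dga R scalar koszul (kdiff \<theta>)) n (rep n x) (rep n y)"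
    if "x \<in> gcarrier (brst \<theta>) n" "y \<in> gcarrier (brst \<theta>) n" for n x y
  proof (intro ext)
    fix p k V
    have c: "coeffs x" "coeffs y" using that coeffs_degree_part by (auto simp: brst_def)
    show "rep n (gadd (brst \<theta>) n x y) p k V = gadd (hom_dga R scalar koszul (kdiff \<theta>)) n (rep n x) (rep n y) p k V"
      unfolding H.hom_dga_simps(2) using c act_add_left[OF c coeffs_koszul]
      by (auto simp: brst_def rep_def plus_fun_def sc_add_right restrict_def fun_eq_iff)
  qed
  show "rep n (gzero (brst \<theta>) n) = gzero (hom_dga R scalar koszul (kdiff \<theta>)) n" for n
    unfolding H.hom_dga_simps(3)
    by (auto simp: brst_def rep_def zero_fun_def restrict_def fun_eq_iff act_zero coeffs_koszul)
  show "rep n (gscale (brst \<theta>) n c x) = gscale (hom_dga R scalar koszul (kdiff \<theta>)) n c (rep n x)"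
    if "x \<in> gcarrier (brst \<theta>) n" for n c x
  proof (intro ext)
    fix p k V
    have c: "coeffs x" using that coeffs_degree_part by (auto simp: brst_def)
    have "act x k V \<in> C" if "k \<in> carrier (koszul p)"
      using coeffs_act[OF c coeffs_koszul[OF that]] by (simp add: coeffs_def)
    then show "rep n (gscale (brst \<theta>) n c x) p k V = gscale (hom_dga R scalar koszul (kdiff \<theta>)) n c (rep n x) p k V"
      unfolding H.hom_dga_simps(4) using c act_scale_left[OF c coeffs_koszul]
      by (auto simp: brst_def rep_def restrict_def scalar_st sc_C sc_sc mult.commute)
  qed
  show "rep 0 (gone (brst \<theta>)) = gone (hom_dga R scalar koszul (kdiff \<theta>))"
    unfolding H.hom_dga_simps(6) id_hom_def
  proof (intro ext)
    fix p k V
    have "act (ext_basis {}) k V = k V" if k: "k \<in> carrier (koszul p)"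
    proof -
      have kC: "k T \<in> C" for T using k by (simp add: mem_koszul)
      have m: "mat (ext_basis {}) T V = (if T = V then 1 else 0)" if T: "T \<subseteq> {..<l}" for T
      proof -
        have "mat (ext_basis {}) T V = (\<Sum>S\<in>Pow {..<2 * l}. if S = {} then sc (rep_coeff l T {} V) 1 else 0)"
          unfolding mat_def by (intro sum.cong refl) (auto simp: ext_basis_def)
        then show ?thesis using rep_coeff_one[where 'k = 'k, OF T] by (auto simp: sc_one)
      qed
      show ?thesis
      proof (cases "V \<subseteq> {..<l}")
        case True
        have "(\<Sum>T\<in>Pow {..<l}. st (k T) (mat (ext_basis {}) T V)) = (\<Sum>T\<in>Pow {..<l}. if T = V then k V else 0)"
          by (intro sum.cong refl) (auto simp: m kC st_one)
        then show ?thesis using True by (simp add: act_def)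
      next
        case False
        then show ?thesis using k by (auto simp: act_def mem_koszul)
      qed
    qed
    then show "rep 0 (gone (brst \<theta>)) p k V = (\<lambda>x\<in>carrier (koszul p). x) k V"
      by (auto simp: brst_def rep_def restrict_def degree_sign_def sc_one)
  qed
  show "gscale (hom_dga R scalar koszul (kdiff \<theta>)) (m + n) ((-1) powi (m * n)) (rep (m + n) (gmult (brst \<theta>) n m y x)) =
      gmult (hom_dga R scalar koszul (kdiff \<theta>)) m n (rep m x) (rep n y)"
    if "x \<in> gcarrier (brst \<theta>) m" "y \<in> gcarrier (brst \<theta>) n" for m n x y
  proof (intro ext)
    fix p k V
    have x: "x \<in> degree_part m" and y: "y \<in> degree_part n" using that by (auto simp: brst_def)
    note c = coeffs_degree_part[OF x] coeffs_degree_part[OF y]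
    show "gscale (hom_dga R scalar koszul (kdiff \<theta>)) (m + n) ((-1) powi (m * n)) (rep (m + n) (gmult (brst \<theta>) n m y x)) p k V =
        gmult (hom_dga R scalar koszul (kdiff \<theta>)) m n (rep m x) (rep n y) p k V"
    proof (cases "k \<in> carrier (koszul p)")
      case k: True
      note ck = coeffs_koszul[OF k]
      have yk: "coeffs (act y k)" by (rule coeffs_act[OF c(2) ck])
      have xyk: "act x (act y k) V \<in> C" using coeffs_act[OF c(1) yk] by (simp add: coeffs_def)
      have ryk: "rep n y p k \<in> carrier (koszul (p - n))" by (rule hom_deg_closed[OF rep_hom[OF y] k refl])
      have "gscale (hom_dga R scalar koszul (kdiff \<theta>)) (m + n) ((-1) powi (m * n)) (rep (m + n) (gmult (brst \<theta>) n m y x)) p k V =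
          st (scalar ((-1) powi (m * n))) (sc (degree_sign (m + n)) (act x (act y k) V))"
        unfolding H.hom_dga_simps(4) using k act_bmult[OF c(2,1) ck] by (simp add: rep_def brst_def)
      also have "\<dots> = sc (degree_sign m * degree_sign n) (act x (act y k) V)"
        by (simp only: scalar_st(1)[OF sc_C[OF xyk]] sc_sc degree_sign_add[symmetric] mult.commute)
      also have "\<dots> = sc (degree_sign m) (act x (\<lambda>V. sc (degree_sign n) (act y k V)) V)"
        by (simp only: act_scale_right[OF c(1) yk] sc_sc)
      also have "\<dots> = gmult (hom_dga R scalar koszul (kdiff \<theta>)) m n (rep m x) (rep n y) p k V"
        unfolding H.hom_dga_simps(5) hom_comp_def using k ryk by (simp add: rep_def)
      finally show ?thesis .
    next
      case False
      then show ?thesis unfolding H.hom_dga_simps(4,5) hom_comp_def by simp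
    qed
  qed
  show "rep (n + 1) (gdiff (brst \<theta>) n x) = gdiff (hom_dga R scalar koszul (kdiff \<theta>)) n (rep n x)"
    if "x \<in> gcarrier (brst \<theta>) n" for n x
  proof (intro ext)
    fix p k V
    have x: "x \<in> degree_part n" using that by (auto simp: brst_def)
    note c = coeffs_degree_part[OF x]
    show "rep (n + 1) (gdiff (brst \<theta>) n x) p k V = gdiff (hom_dga R scalar koszul (kdiff \<theta>)) n (rep n x) p k V"
    proof (cases "k \<in> carrier (koszul p)")
      case k: True
      note ck = coeffs_koszul[OF k]
      let ?i = "fls_X_inv :: 'k fls" and ?s = "degree_sign n" and ?t = "(-1) powi n :: 'k fls"
      have dk: "kdiff \<theta> p k \<in> carrier (koszul (p - 1))" by (rule left_hom_closed[OF kdiff_hom[OF \<theta>] k])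
      have xk: "rep n x p k \<in> carrier (koszul (p - n))" by (rule hom_deg_closed[OF rep_hom[OF x] k refl])
      define a where "a = act x (act \<theta> k) V"
      define b where "b = act \<theta> (act x k) V"
      have bm: "coeffs (bmult \<theta> x)" "coeffs (bmult x \<theta>)" using coeffs_bmult \<theta>c c by auto
      have sbm: "coeffs (\<lambda>S. sc (- ?t) (bmult x \<theta> S))" using bm(2) by (simp add: coeffs_def sc_C)
      have "rep (n + 1) (gdiff (brst \<theta>) n x) p k V =
          sc (degree_sign (n + 1)) (act (\<lambda>S. sc ?i (bmult \<theta> x S + sc (- ?t) (bmult x \<theta> S))) k V)"
        using k by (simp add: rep_def brst_def sc_uminus_left)
      also have "act (\<lambda>S. sc ?i (bmult \<theta> x S + sc (- ?t) (bmult x \<theta> S))) k V =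
          sc ?i (act (\<lambda>S. bmult \<theta> x S + sc (- ?t) (bmult x \<theta> S)) k V)"
        by (rule act_scale_left) (use bm sbm ck in \<open>auto simp: coeffs_def add_C\<close>)
      also have "act (\<lambda>S. bmult \<theta> x S + sc (- ?t) (bmult x \<theta> S)) k V = a + sc (- ?t) b"
        by (simp add: act_add_left[OF bm(1) sbm ck] act_scale_left[OF bm(2) ck] act_bmult[OF \<theta>c c ck] act_bmult[OF c \<theta>c ck]
            a_def b_def)
      finally have L: "rep (n + 1) (gdiff (brst \<theta>) n x) p k V = sc (degree_sign (n + 1)) (sc ?i (a + sc (- ?t) b))" .
      have A: "rep n x (p - 1) (kdiff \<theta> p k) V = sc ?s (sc ?i a)"
        using dk k act_scale_right[OF c coeffs_act[OF \<theta>c ck]] by (simp add: rep_def kdiff_def a_def)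
      have B: "kdiff \<theta> (p - n) (rep n x p k) V = sc ?i (sc ?s b)"
        using xk k act_scale_right[OF \<theta>c coeffs_act[OF c ck]] by (simp add: rep_def kdiff_def b_def)
      have neg: "(\<ominus>\<^bsub>koszul q\<^esub> f) V = - f V" if f: "f \<in> carrier (koszul q)" for f q
      proof -
        interpret Y: left_module R "koszul q" by (rule koszul_module)
        have "f \<oplus>\<^bsub>koszul q\<^esub> (\<ominus>\<^bsub>koszul q\<^esub> f) = \<zero>\<^bsub>koszul q\<^esub>" by (rule Y.M.r_neg[OF f])
        then have "f V + (\<ominus>\<^bsub>koszul q\<^esub> f) V = 0" by (simp add: fun_eq_iff)
        then show ?thesis by (metis add.inverse_unique)
      qed
      have rdk: "rep n x (p - 1) (kdiff \<theta> p k) \<in> carrier (koszul (p - (n + 1)))"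
        by (rule hom_deg_closed[OF rep_hom[OF x] dk]) simp
      have "gdiff (hom_dga R scalar koszul (kdiff \<theta>)) n (rep n x) p k V = sc ?i (sc ?s b) +
          msign (koszul (p - (n + 1))) (n + 1) (rep n x (p - 1) (kdiff \<theta> p k)) V"
        unfolding H.hom_dga_simps(7) using k B by simp
      also have "msign (koszul (p - (n + 1))) (n + 1) (rep n x (p - 1) (kdiff \<theta> p k)) V =
          (if odd n then sc ?s (sc ?i a) else - sc ?s (sc ?i a))"
        using neg[OF rdk] A by (simp add: msign_def)
      finally show ?thesis unfolding L degree_sign_Suc
        by (cases "even n") (simp_all add: sc_add_right sc_diff_right sc_one sc_sc sc_uminus_left sc_uminus_right mult.commute minus_one_powi)
    next
      case False
      then show ?thesis unfolding H.hom_dga_simps(7) by (simp add: rep_def)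
    qed
  qed
qed

lemma bmult_sums:
  assumes I: "finite I" "finite J" and r: "\<And>i. i \<in> I ==> r i \<in> C" "\<And>j. j \<in> J ==> t j \<in> C"
    and v: "\<And>i S. i \<in> I ==> v i S \<noteq> 0 ==> S \<subseteq> {..<2 * l}" and w: "\<And>j S. j \<in> J ==> w j S \<noteq> 0 ==> S \<subseteq> {..<2 * l}"
  shows "bmult (\<lambda>S. \<Sum>i\<in>I. sc (v i S) (r i)) (\<lambda>S. \<Sum>j\<in>J. sc (w j S) (t j)) U =
    (\<Sum>i\<in>I. \<Sum>j\<in>J. sc (clifford_mult l (v i) (w j) U) (st (r i) (t j)))"
proof -
  let ?P = "Pow {..<2 * l}"
  let ?c = "\<lambda>S T. clifford_mult l (ext_basis S) (ext_basis T) U :: 'k fls"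
  have cm: "clifford_mult l (v i) (w j) U = (\<Sum>S\<in>?P. \<Sum>T\<in>?P. v i S * (w j T * ?c S T))" if "i \<in> I" "j \<in> J" for i j
  proof -
    have "clifford_mult l (v i) (w j) U = (\<Sum>S\<in>?P. v i S * clifford_mult l (ext_basis S) (w j) U)"
      by (subst basis_expansion[of "v i" "2 * l"], erule v[OF that(1)], subst clifford_mult_sum_left) simp_all
    also have "\<dots> = (\<Sum>S\<in>?P. v i S * (\<Sum>T\<in>?P. w j T * ?c S T))"
      by (subst basis_expansion[of "w j" "2 * l"], erule w[OF that(2)], subst clifford_mult_sum_right) simp_all
    finally show ?thesis by (simp add: sum_distrib_left)
  qed
  have "bmult (\<lambda>S. \<Sum>i\<in>I. sc (v i S) (r i)) (\<lambda>S. \<Sum>j\<in>J. sc (w j S) (t j)) U =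
      (\<Sum>S\<in>?P. \<Sum>T\<in>?P. \<Sum>i\<in>I. \<Sum>j\<in>J. sc (v i S * (w j T * ?c S T)) (st (r i) (t j)))"
    unfolding bmult_def
  proof (intro sum.cong refl)
    fix S T
    have "st (\<Sum>i\<in>I. sc (v i S) (r i)) (\<Sum>j\<in>J. sc (w j T) (t j)) =
        (\<Sum>i\<in>I. st (sc (v i S) (r i)) (\<Sum>j\<in>J. sc (w j T) (t j)))"
      by (rule st_sum_left) (auto intro: sc_C r sum_C)
    also have "\<dots> = (\<Sum>i\<in>I. \<Sum>j\<in>J. st (sc (v i S) (r i)) (sc (w j T) (t j)))"
      by (intro sum.cong refl st_sum_right) (auto intro: sc_C r)
    also have "\<dots> = (\<Sum>i\<in>I. \<Sum>j\<in>J. sc (v i S * w j T) (st (r i) (t j)))"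
      by (intro sum.cong refl) (simp add: st_sc_left st_sc_right sc_sc sc_C r mult.commute)
    finally show "sc (?c S T) (st (\<Sum>i\<in>I. sc (v i S) (r i)) (\<Sum>j\<in>J. sc (w j T) (t j))) =
        (\<Sum>i\<in>I. \<Sum>j\<in>J. sc (v i S * (w j T * ?c S T)) (st (r i) (t j)))"
      by (simp add: sc_sum_right sc_sc mult_ac)
  qed
  also have "\<dots> = (\<Sum>S\<in>?P. \<Sum>i\<in>I. \<Sum>T\<in>?P. \<Sum>j\<in>J. sc (v i S * (w j T * ?c S T)) (st (r i) (t j)))"
    by (intro sum.cong refl sum.swap)
  also have "\<dots> = (\<Sum>i\<in>I. \<Sum>S\<in>?P. \<Sum>T\<in>?P. \<Sum>j\<in>J. sc (v i S * (w j T * ?c S T)) (st (r i) (t j)))" by (rule sum.swap)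
  also have "\<dots> = (\<Sum>i\<in>I. \<Sum>S\<in>?P. \<Sum>j\<in>J. \<Sum>T\<in>?P. sc (v i S * (w j T * ?c S T)) (st (r i) (t j)))"
    by (intro sum.cong refl sum.swap)
  also have "\<dots> = (\<Sum>i\<in>I. \<Sum>j\<in>J. \<Sum>S\<in>?P. \<Sum>T\<in>?P. sc (v i S * (w j T * ?c S T)) (st (r i) (t j)))"
    by (intro sum.cong refl sum.swap)
  also have "\<dots> = (\<Sum>i\<in>I. \<Sum>j\<in>J. sc (clifford_mult l (v i) (w j) U) (st (r i) (t j)))"
    by (intro sum.cong refl) (simp add: cm sc_sum_left)
  finally show ?thesis .
qed

definition charge :: "(nat => nat => nat => 'k fls) => (nat => 'r) => nat set => 'r" where
  "charge f J = (\<lambda>S. sc (cubic l (\<lambda>a b c. - f a b c * inverse 4) S) 1 + (\<Sum>a<l. sc (ext_basis {a} S) (J a)))"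

lemma charge_degree:
  assumes "\<And>a. a < l ==> J a \<in> C"
  shows "charge f J \<in> degree_part 1"
proof -
  have "S \<subseteq> {..<2 * l} \<and> ghost_number l S = 1" if nz: "charge f J S \<noteq> 0" for S
  proof (cases "cubic l (\<lambda>a b c. - f a b c * inverse 4) S = 0")
    case True
    have "\<exists>a<l. ext_basis {a} S \<noteq> (0 :: 'k fls)"
    proof (rule ccontr)
      assume "\<not> (\<exists>a<l. ext_basis {a} S \<noteq> (0 :: 'k fls))"
      then have "charge f J S = 0" using True by (simp add: charge_def)
      then show False using nz by simp
    qed
    then obtain a where "a < l" "ext_basis {a} S \<noteq> (0 :: 'k fls)" by blast
    then show ?thesis using ghost_number_insert[of a "{}" l] by (auto simp: ext_basis_def split: if_splits)
  next
    case False
    then obtain a b c where abc: "a < l" "b < l" "c < l" "a \<noteq> b" "S = {a, b} \<union> lift l {c}" using cubic_support by blast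
    then have S: "S = insert a (insert b {l + c})" by auto
    have "ghost_number l S = 1"
      unfolding S using abc ghost_number_insert[of a "insert b {l + c}" l] ghost_number_insert[of b "{l + c}" l]
        ghost_number_insert[of "l + c" "{}" l] by simp
    then show ?thesis using abc S by auto
  qed
  moreover have "charge f J S \<in> C" for S
    unfolding charge_def using assms by (auto intro!: add_C sc_C sum_C one_C)
  ultimately show ?thesis by (simp add: degree_part_def)
qed

text \<open>In the square of the charge, the anticommutator of the cubic and the linear term cancels
  the commutators of the \<open>J a\<close>.\<close>

lemma charge_square:
  assumes J: "\<And>a. a < l ==> J a \<in> C"
    and comm: "\<And>a b. a < l ==> b < l ==> st (J a) (J b) - st (J b) (J a) = (\<Sum>c<l. sc (fls_X * f a b c) (J c))"
    and anti: "\<And>a b c. [|a < l; b < l; c < l|] ==> f a b c = - f b a c"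
    and jacobi: "\<And>a b e g. [|a < l; b < l; e < l; g < l|] ==>
      (\<Sum>c<l. f a b c * f c e g) + (\<Sum>c<l. f b e c * f c a g) + (\<Sum>c<l. f e a c * f c b g) = 0"
  shows "bmult (charge f J) (charge f J) = (\<lambda>S. 0)"
proof
  fix U
  define \<phi> where "\<phi> a b c = - f a b c * inverse 4" for a b c
  define v where "v i = (if i = l then cubic l \<phi> else ext_basis {i})" for i
  define r where "r i = (if i = l then 1 else J i)" for i
  define \<omega> :: "nat => nat => 'k fls" where "\<omega> a b = lop l a (lop l b (ext_basis {})) U" for a b
  have \<phi>_eq: "\<phi> = (\<lambda>a b c. - f a b c * inverse 4)" by (simp add: fun_eq_iff \<phi>_def)
  have clifford_product: "clifford_mult l (ext_basis {a}) (ext_basis {b}) U = lop l a (ext_basis {b}) U" if "a < l" for a b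
    using that by (subst clifford_mult_generator) (simp_all add: finitary1_basis)
  have charge: "charge f J = (\<lambda>S. \<Sum>i\<in>insert l {..<l}. sc (v i S) (r i))"
    unfolding charge_def \<phi>_eq[symmetric] by (auto simp: v_def r_def intro!: ext sum.cong)
  have cub2: "clifford_mult l (cubic l \<phi>) (cubic l \<phi>) U = 0"
  proof (rule cubic_square)
    show "\<phi> a b c = - \<phi> b a c" if "a < l" "b < l" "c < l" for a b c using anti[OF that] by (simp add: \<phi>_def)
    fix a b e g assume "a < l" "b < l" "e < l" "g < l"
    note j = jacobi[OF this]
    have "(\<Sum>c<l. \<phi> a b c * \<phi> c e g) = inverse 4 * inverse 4 * (\<Sum>c<l. f a b c * f c e g)" for a b e g
      by (simp add: \<phi>_def sum_distrib_left mult_ac)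
    then show "(\<Sum>c<l. \<phi> a b c * \<phi> c e g) + (\<Sum>c<l. \<phi> b e c * \<phi> c a g) + (\<Sum>c<l. \<phi> e a c * \<phi> c b g) = 0"
      using j by (simp only: distrib_left[symmetric]) simp
  qed
  have "bmult (charge f J) (charge f J) U = (\<Sum>i\<in>insert l {..<l}. \<Sum>j\<in>insert l {..<l}.
      sc (clifford_mult l (v i) (v j) U) (st (r i) (r j)))"
    unfolding charge
  proof (rule bmult_sums)
    have "S \<subseteq> {..<2 * l}" if "i \<in> insert l {..<l}" "v i S \<noteq> 0" for i S
      using that cubic_support[of l \<phi> S] by (cases "i = l") (auto simp: v_def ext_basis_def split: if_splits)
    then show "\<And>i S. i \<in> insert l {..<l} ==> v i S \<noteq> 0 ==> S \<subseteq> {..<2 * l}"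
      "\<And>i S. i \<in> insert l {..<l} ==> v i S \<noteq> 0 ==> S \<subseteq> {..<2 * l}" by blast+
  qed (auto simp: r_def one_C J)
  also have "\<dots> = sc (clifford_mult l (cubic l \<phi>) (cubic l \<phi>) U) (st 1 1) +
      (\<Sum>a<l. sc (clifford_mult l (cubic l \<phi>) (ext_basis {a}) U) (J a) + sc (clifford_mult l (ext_basis {a}) (cubic l \<phi>) U) (J a)) +
      (\<Sum>a<l. \<Sum>b<l. sc (clifford_mult l (ext_basis {a}) (ext_basis {b}) U) (st (J a) (J b)))"
    by (simp add: v_def r_def sum.distrib one_st st_one J add.assoc)
  also have "(\<Sum>a<l. sc (clifford_mult l (cubic l \<phi>) (ext_basis {a}) U) (J a) + sc (clifford_mult l (ext_basis {a}) (cubic l \<phi>) U) (J a)) =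
      (\<Sum>c<l. \<Sum>a<l. \<Sum>b<l. sc (2 * fls_X * (\<phi> a b c * \<omega> a b)) (J c))"
    by (intro sum.cong refl)
      (simp add: sc_add_left[symmetric] cubic_ghost_anticommutator \<omega>_def sum_distrib_left sc_sum_left)
  also have "(\<Sum>a<l. \<Sum>b<l. sc (clifford_mult l (ext_basis {a}) (ext_basis {b}) U) (st (J a) (J b))) =
      (\<Sum>a<l. \<Sum>b<l. sc (\<omega> a b) (st (J a) (J b)))"
    by (intro sum.cong refl) (simp add: \<omega>_def ext_basis_generator[of _ l, symmetric] clifford_product)
  finally have total: "bmult (charge f J) (charge f J) U =
      (\<Sum>c<l. \<Sum>a<l. \<Sum>b<l. sc (2 * fls_X * (\<phi> a b c * \<omega> a b)) (J c)) + (\<Sum>a<l. \<Sum>b<l. sc (\<omega> a b) (st (J a) (J b)))"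
    by (simp add: cub2)
  define Q where "Q = (\<Sum>a<l. \<Sum>b<l. sc (\<omega> a b) (st (J a) (J b)))"
  have "Q = (\<Sum>a<l. \<Sum>b<l. sc (\<omega> b a) (st (J b) (J a)))" unfolding Q_def by (rule sum.swap)
  also have "\<dots> = (\<Sum>a<l. \<Sum>b<l. - sc (\<omega> a b) (st (J b) (J a)))"
  proof (intro sum.cong refl)
    fix a b assume "a \<in> {..<l}" "b \<in> {..<l}"
    then have "\<omega> b a = - \<omega> a b" unfolding \<omega>_def by (intro ghost_ghost) auto
    then show "sc (\<omega> b a) (st (J b) (J a)) = - sc (\<omega> a b) (st (J b) (J a))" by (simp add: sc_uminus_left)
  qed
  finally have Q': "Q = (\<Sum>a<l. \<Sum>b<l. - sc (\<omega> a b) (st (J b) (J a)))" .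
  have "Q + Q = (\<Sum>a<l. \<Sum>b<l. sc (\<omega> a b) (st (J a) (J b))) + (\<Sum>a<l. \<Sum>b<l. - sc (\<omega> a b) (st (J b) (J a)))"
    by (rule arg_cong2[where f = "(+)", OF Q_def Q'])
  also have "\<dots> = (\<Sum>a<l. \<Sum>b<l. sc (\<omega> a b) (st (J a) (J b)) + - sc (\<omega> a b) (st (J b) (J a)))"
    by (simp only: sum.distrib)
  also have "\<dots> = (\<Sum>a<l. \<Sum>b<l. \<Sum>c<l. sc (\<omega> a b * (fls_X * f a b c)) (J c))"
  proof (intro sum.cong refl)
    fix a b assume "a \<in> {..<l}" "b \<in> {..<l}"
    then have "st (J a) (J b) - st (J b) (J a) = (\<Sum>c<l. sc (fls_X * f a b c) (J c))" using comm by simp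
    then have "sc (\<omega> a b) (st (J a) (J b) - st (J b) (J a)) = (\<Sum>c<l. sc (\<omega> a b * (fls_X * f a b c)) (J c))"
      by (simp add: sc_sum_right sc_sc)
    then show "sc (\<omega> a b) (st (J a) (J b)) + - sc (\<omega> a b) (st (J b) (J a)) =
        (\<Sum>c<l. sc (\<omega> a b * (fls_X * f a b c)) (J c))" by (simp add: sc_diff_right)
  qed
  also have "\<dots> = (\<Sum>a<l. \<Sum>c<l. \<Sum>b<l. sc (\<omega> a b * (fls_X * f a b c)) (J c))" by (intro sum.cong refl sum.swap)
  also have "\<dots> = (\<Sum>c<l. \<Sum>a<l. \<Sum>b<l. sc (\<omega> a b * (fls_X * f a b c)) (J c))" by (rule sum.swap)
  finally have QQ: "Q + Q = (\<Sum>c<l. \<Sum>a<l. \<Sum>b<l. sc (\<omega> a b * (fls_X * f a b c)) (J c))" .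
  define P where "P = (\<Sum>c<l. \<Sum>a<l. \<Sum>b<l. sc (2 * fls_X * (\<phi> a b c * \<omega> a b)) (J c))"
  have four: "(4 :: 'k fls) \<noteq> 0" using fls_of_nat_nonzero[where 'k = 'k, of 3] by simp
  have "P + P = (\<Sum>c<l. \<Sum>a<l. \<Sum>b<l. - sc (\<omega> a b * (fls_X * f a b c)) (J c))"
    unfolding P_def sum.distrib[symmetric]
  proof (intro sum.cong refl)
    fix a b c
    have "2 * fls_X * (\<phi> a b c * \<omega> a b) + 2 * fls_X * (\<phi> a b c * \<omega> a b) = 4 * inverse 4 * (- (\<omega> a b * (fls_X * f a b c)))"
      by (simp add: \<phi>_def algebra_simps)
    also have "\<dots> = - (\<omega> a b * (fls_X * f a b c))" using four by simp
    finally show "sc (2 * fls_X * (\<phi> a b c * \<omega> a b)) (J c) + sc (2 * fls_X * (\<phi> a b c * \<omega> a b)) (J c) =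
        - sc (\<omega> a b * (fls_X * f a b c)) (J c)" by (simp only: sc_add_left[symmetric] sc_uminus_left)
  qed
  then have PP: "P + P = - (Q + Q)" unfolding QQ by (simp only: sum_negf)
  have "(P + Q) + (P + Q) = (P + P) + (Q + Q)" by (simp only: add_ac)
  then have "(P + Q) + (P + Q) = 0" unfolding PP by (simp only: left_minus)
  then have "sc 2 (P + Q) = 0" using sc_add_left[of 1 1 "P + Q"] by (simp add: sc_one)
  moreover have "(2 :: 'k fls) \<noteq> 0" using fls_of_nat_nonzero[where 'k = 'k, of 1] by simp
  ultimately have "P + Q = 0" using sc_cancel[of 2 "P + Q" 0] by simp
  then show "bmult (charge f J) (charge f J) U = 0" using total by (simp add: P_def Q_def)
qed

end

section \<open>Smooth functions and vector fields\<close>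

lemma sum_apply_fun: "(\<Sum>i\<in>I. F i) x = (\<Sum>i\<in>I. F i x)"
  by (induction I rule: infinite_finite_induct) auto

lemma frechet_derivative_cong:
  assumes "open S" "x \<in> S" "\<And>y. y \<in> S ==> f y = g y"
  shows "frechet_derivative f (at x) = frechet_derivative g (at x)"
proof -
  have "(f has_derivative D) (at x) \<longleftrightarrow> (g has_derivative D) (at x)" for D
  proof
    show "(g has_derivative D) (at x)" if "(f has_derivative D) (at x)"
      by (rule has_derivative_transform_within_open[OF that assms])
    show "(f has_derivative D) (at x)" if "(g has_derivative D) (at x)"
      by (rule has_derivative_transform_within_open[OF that assms(1,2) assms(3)[symmetric]])
  qed
  then show ?thesis by (simp add: frechet_derivative_def)
qed

lemma Ck_on_cong: "open S ==> Ck_on k S f ==> (\<And>y. y \<in> S ==> f y = g y) ==> Ck_on k S g"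
proof (induction k arbitrary: f g)
  case 0
  then show ?case using continuous_on_eq[of S f g] by simp
next
  case (Suc k)
  have "g differentiable (at x)" if xS: "x \<in> S" for x
  proof -
    obtain D where "(f has_derivative D) (at x)" using Suc.prems(2) xS by (auto simp: differentiable_def)
    then have "(g has_derivative D) (at x)"
      by (rule has_derivative_transform_within_open) (use Suc.prems xS in auto)
    then show ?thesis by (auto simp: differentiable_def)
  qed
  moreover have "Ck_on k S (\<lambda>x. frechet_derivative g (at x) v)" for v
  proof (rule Suc.IH[OF Suc.prems(1)])
    show "Ck_on k S (\<lambda>x. frechet_derivative f (at x) v)" using Suc.prems(2) by simp
    show "frechet_derivative f (at y) v = frechet_derivative g (at y) v" if "y \<in> S" for y
      using frechet_derivative_cong[OF Suc.prems(1) that Suc.prems(3)] by simp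
  qed
  ultimately show ?case by simp
qed

lemma Ck_on_linear:
  assumes h: "bounded_linear h" and h': "bounded_linear h'" and S: "open S"
  shows "Ck_on k S f ==> Ck_on k S g ==> Ck_on k S (\<lambda>x. h (f x) + h' (g x))"
proof (induction k arbitrary: f g)
  case 0
  then have "continuous_on S f" "continuous_on S g" by simp_all
  then show ?case unfolding Ck_on.simps
    by (intro continuous_on_add bounded_linear.continuous_on[OF h] bounded_linear.continuous_on[OF h'])
next
  case (Suc k)
  have D: "((\<lambda>x. h (f x) + h' (g x)) has_derivative
      (\<lambda>v. h (frechet_derivative f (at x) v) + h' (frechet_derivative g (at x) v))) (at x)" if "x \<in> S" for x
  proof (rule has_derivative_add)
    show "((\<lambda>x. h (f x)) has_derivative (\<lambda>v. h (frechet_derivative f (at x) v))) (at x)"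
      by (rule bounded_linear.has_derivative[OF h]) (use Suc.prems(1) that in \<open>simp add: frechet_derivative_works[symmetric]\<close>)
    show "((\<lambda>x. h' (g x)) has_derivative (\<lambda>v. h' (frechet_derivative g (at x) v))) (at x)"
      by (rule bounded_linear.has_derivative[OF h']) (use Suc.prems(2) that in \<open>simp add: frechet_derivative_works[symmetric]\<close>)
  qed
  have "Ck_on k S (\<lambda>x. frechet_derivative (\<lambda>x. h (f x) + h' (g x)) (at x) v)" for v
  proof (rule Ck_on_cong[OF S])
    show "Ck_on k S (\<lambda>x. h (frechet_derivative f (at x) v) + h' (frechet_derivative g (at x) v))"
      by (rule Suc.IH) (use Suc.prems in simp_all)
    show "h (frechet_derivative f (at y) v) + h' (frechet_derivative g (at y) v) =
        frechet_derivative (\<lambda>x. h (f x) + h' (g x)) (at y) v" if "y \<in> S" for y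
      using frechet_derivative_at[OF D[OF that]] by (rule fun_cong)
  qed
  moreover have "(\<lambda>x. h (f x) + h' (g x)) differentiable (at x)" if "x \<in> S" for x
    using D[OF that] unfolding differentiable_def by blast
  ultimately show ?case by simp
qed

lemma Cinf_linear:
  fixes f g :: "'m::{second_countable_topology,t2_space} => 'b::real_normed_field"
  assumes A: "smooth_manifold \<A>" and f: "f \<in> Cinf \<A>" and g: "g \<in> Cinf \<A>"
  shows "(\<lambda>x. r * f x + s * g x) \<in> Cinf \<A>"
proof -
  have "smooth_on (\<phi> ` U) ((\<lambda>x. r * f x + s * g x) \<circ> inv_into U \<phi>)" if U: "(U, \<phi>) \<in> \<A>" for U \<phi>
  proof -
    have o: "open (\<phi> ` U)" using A U unfolding smooth_manifold_def by fastforce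
    have "smooth_on (\<phi> ` U) (f \<circ> inv_into U \<phi>)" "smooth_on (\<phi> ` U) (g \<circ> inv_into U \<phi>)"
      using f g U by (auto simp: Cinf_def)
    then show ?thesis
      using Ck_on_linear[OF bounded_linear_mult_right[of r] bounded_linear_mult_right[of s] o]
      by (simp add: smooth_on_def o_def)
  qed
  then show ?thesis by (auto simp: Cinf_def)
qed

lemma vector_fieldD:
  assumes "X \<in> vector_fields \<A>"
  shows "f \<notin> Cinf \<A> ==> X f = 0" "f \<in> Cinf \<A> ==> X f \<in> Cinf \<A>"
    "[|f \<in> Cinf \<A>; g \<in> Cinf \<A>|] ==> X (\<lambda>x. r * f x + s * g x) = (\<lambda>x. r * X f x + s * X g x)"
    "[|f \<in> Cinf \<A>; g \<in> Cinf \<A>|] ==> X (f * g) = X f * g + f * X g"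
proof -
  note v = assms[unfolded vector_fields_def mem_Collect_eq]
  show "f \<notin> Cinf \<A> ==> X f = 0" by (rule v[THEN conjunct1, rule_format])
  show "f \<in> Cinf \<A> ==> X f \<in> Cinf \<A>" by (rule v[THEN conjunct2, THEN conjunct1, rule_format])
  show "[|f \<in> Cinf \<A>; g \<in> Cinf \<A>|] ==> X (\<lambda>x. r * f x + s * g x) = (\<lambda>x. r * X f x + s * X g x)"
    by (rule v[THEN conjunct2, THEN conjunct2, THEN conjunct1, rule_format])
  show "[|f \<in> Cinf \<A>; g \<in> Cinf \<A>|] ==> X (f * g) = X f * g + f * X g"
    by (rule v[THEN conjunct2, THEN conjunct2, THEN conjunct2, rule_format])
qed

lemma vf_combination_apply: "(vf_scale r X + vf_scale s Y) h = (\<lambda>x. r * X h x + s * Y h x)"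
  by (simp add: vf_scale_def fun_eq_iff)

lemma vector_fields_combination:
  assumes A: "smooth_manifold \<A>" and X: "X \<in> vector_fields \<A>" and Y: "Y \<in> vector_fields \<A>"
  shows "vf_scale r X + vf_scale s Y \<in> vector_fields \<A>"
  unfolding vector_fields_def mem_Collect_eq vf_combination_apply
proof (intro conjI ballI allI impI)
  show "(\<lambda>x. r * X f x + s * Y f x) = 0" if "f \<notin> Cinf \<A>" for f
    using that by (simp add: vector_fieldD(1)[OF X] vector_fieldD(1)[OF Y] fun_eq_iff)
  show "(\<lambda>x. r * X f x + s * Y f x) \<in> Cinf \<A>" if "f \<in> Cinf \<A>" for f
    by (rule Cinf_linear[OF A vector_fieldD(2)[OF X that] vector_fieldD(2)[OF Y that]])
  show "(\<lambda>x. r * X (\<lambda>x. r' * f x + s' * g x) x + s * Y (\<lambda>x. r' * f x + s' * g x) x) =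
      (\<lambda>x. r' * (r * X f x + s * Y f x) + s' * (r * X g x + s * Y g x))"
    if "f \<in> Cinf \<A>" "g \<in> Cinf \<A>" for f g r' s'
    by (simp add: vector_fieldD(3)[OF X that] vector_fieldD(3)[OF Y that] algebra_simps)
  show "(\<lambda>x. r * X (f * g) x + s * Y (f * g) x) =
      (\<lambda>x. r * X f x + s * Y f x) * g + f * (\<lambda>x. r * X g x + s * Y g x)"
    if "f \<in> Cinf \<A>" "g \<in> Cinf \<A>" for f g
    by (simp add: vector_fieldD(4)[OF X that] vector_fieldD(4)[OF Y that] fun_eq_iff algebra_simps)
qed

lemma lie_algebra_combination:
  fixes \<A> :: "('g::{second_countable_topology,t2_space}, 'e::real_normed_vector) atlas"
  assumes A: "smooth_manifold \<A>" and X: "X \<in> lie_algebra \<A> G" and Y: "Y \<in> lie_algebra \<A> G"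
  shows "vf_scale r X + vf_scale s Y \<in> lie_algebra \<A> G"
proof -
  have v: "X \<in> vector_fields \<A>" "Y \<in> vector_fields \<A>" using X Y by (auto simp: lie_algebra_def)
  have inv: "X (\<lambda>g. h (a \<otimes>\<^bsub>G\<^esub> g)) = (\<lambda>g. X h (a \<otimes>\<^bsub>G\<^esub> g))" "Y (\<lambda>g. h (a \<otimes>\<^bsub>G\<^esub> g)) = (\<lambda>g. Y h (a \<otimes>\<^bsub>G\<^esub> g))"
    if "h \<in> Cinf \<A>" for h a
    using X Y that unfolding lie_algebra_def mem_Collect_eq by auto
  show ?thesis unfolding lie_algebra_def mem_Collect_eq
  proof (intro conjI allI ballI)
    show "vf_scale r X + vf_scale s Y \<in> vector_fields \<A>" by (rule vector_fields_combination[OF A v])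
    fix a and h :: "'g => real" assume "h \<in> Cinf \<A>"
    then show "(vf_scale r X + vf_scale s Y) (\<lambda>g. h (a \<otimes>\<^bsub>G\<^esub> g)) = (\<lambda>g. (vf_scale r X + vf_scale s Y) h (a \<otimes>\<^bsub>G\<^esub> g))"
      unfolding vf_combination_apply by (simp only: inv)
  qed
qed

lemma vector_field_sum:
  fixes n :: nat and h :: "'m::{second_countable_topology,t2_space} => real"
  assumes A: "smooth_manifold \<A>" and X: "X \<in> vector_fields \<A>" and h: "h \<in> Cinf \<A>"
  shows "(\<And>c. c < n ==> u c \<in> Cinf \<A>) ==> (\<lambda>p. \<Sum>c<n. r c * u c p) \<in> Cinf \<A> \<and>
    X (\<lambda>p. \<Sum>c<n. r c * u c p) = (\<lambda>p. \<Sum>c<n. r c * X (u c) p)"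
proof (induction n)
  case 0
  then show ?case using Cinf_linear[OF A h h, of 0 0] vector_fieldD(3)[OF X h h, of 0 0] by simp
next
  case (Suc n)
  then have IH: "(\<lambda>p. \<Sum>c<n. r c * u c p) \<in> Cinf \<A>" "X (\<lambda>p. \<Sum>c<n. r c * u c p) = (\<lambda>p. \<Sum>c<n. r c * X (u c) p)"
    and un: "u n \<in> Cinf \<A>" by auto
  show ?case using Cinf_linear[OF A IH(1) un, of 1 "r n"] vector_fieldD(3)[OF X IH(1) un, of 1 "r n"] IH(2) by simp
qed

locale lie_structure =
  fixes \<G> :: "('g::{second_countable_topology,t2_space}, 'eg::real_normed_vector) atlas" and G :: "'g monoid"
    and l :: nat and e :: "nat => 'g vfield" and f :: "nat => nat => nat => real"
  assumes manifold_G: "smooth_manifold \<G>" and basis: "lie_basis \<G> G l e" and brackets: "structure_constants l e f"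
begin

lemma basis_lie: "a < l ==> e a \<in> lie_algebra \<G> G"
  using basis by (simp add: lie_basis_def)

lemma basis_field: "a < l ==> e a \<in> vector_fields \<G>"
  using basis_lie by (simp add: lie_algebra_def)

lemma combination_lie: "a < l ==> n \<le> l ==> (\<Sum>c<n. vf_scale (r c) (e c)) \<in> lie_algebra \<G> G"
proof (induction n)
  case 0
  have zero: "vf_scale 0 (e a) + vf_scale 0 (e a) = 0" by (simp add: fun_eq_iff vf_scale_def)
  show ?case using lie_algebra_combination[OF manifold_G basis_lie[OF 0(1)] basis_lie[OF 0(1)], of 0 0]
    by (simp only: zero lessThan_0 sum.empty)
next
  case (Suc n)
  have one: "vf_scale 1 X = X" for X :: "'g vfield" by (simp add: fun_eq_iff vf_scale_def)
  have n: "n < l" using Suc.prems by simp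
  show ?case
    using lie_algebra_combination[OF manifold_G Suc.IH[OF Suc.prems(1) less_imp_le[OF n]] basis_lie[OF n], of 1 "r n"]
    by (simp only: one sum.lessThan_Suc)
qed

text \<open>Uniqueness of coordinates is how the antisymmetry and the Jacobi identity of brackets of vector
  fields descend to the structure constants.\<close>

lemma combination_unique:
  assumes eq: "(\<Sum>c<l. vf_scale (r c) (e c)) = (\<Sum>c<l. vf_scale (s c) (e c))" and a: "a < l"
  shows "r a = s a"
proof -
  have ex1: "\<exists>!c. (\<forall>a\<ge>l. c a = 0) \<and> (\<Sum>c<l. vf_scale (r c) (e c)) = (\<Sum>a<l. vf_scale (c a) (e a))"
    using basis combination_lie[OF a order_refl, of r] unfolding lie_basis_def by blast
  let ?t = "\<lambda>r c. if c < l then r c else 0 :: real"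
  have "?t r = ?t s"
  proof (rule ex1E[OF ex1])
    fix c0 assume u: "\<forall>c. (\<forall>a\<ge>l. c a = 0) \<and> (\<Sum>c<l. vf_scale (r c) (e c)) = (\<Sum>a<l. vf_scale (c a) (e a)) \<longrightarrow> c = c0"
    have "?t r = c0" by (rule u[rule_format]) simp
    moreover have "?t s = c0" by (rule u[rule_format]) (simp add: eq)
    ultimately show ?thesis by simp
  qed
  then show ?thesis using fun_cong[of "?t r" "?t s" a] a by simp
qed

lemma bracket_apply:
  assumes "a < l" "b < l"
  shows "e a (e b h) p - e b (e a h) p = (\<Sum>c<l. f a b c * e c h p)"
proof -
  have "vf_bracket (e a) (e b) h p = (\<Sum>c<l. vf_scale (f a b c) (e c)) h p"
    using brackets assms by (simp add: structure_constants_def)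
  then show ?thesis by (simp add: vf_bracket_def sum_apply_fun vf_scale_def)
qed

lemma structure_antisymmetric:
  assumes "a < l" "b < l" "c < l"
  shows "f a b c = - f b a c"
proof (rule combination_unique[OF _ assms(3), of "f a b" "\<lambda>c. - f b a c"], intro ext)
  fix h p
  have "(\<Sum>c<l. f a b c * e c h p) = - (\<Sum>c<l. f b a c * e c h p)"
    using bracket_apply[OF assms(1,2), of h p] bracket_apply[OF assms(2,1), of h p] by simp
  then show "(\<Sum>c<l. vf_scale (f a b c) (e c)) h p = (\<Sum>c<l. vf_scale (- f b a c) (e c)) h p"
    by (simp add: sum_apply_fun vf_scale_def sum_negf)
qed

lemma structure_jacobi:
  assumes "a < l" "b < l" "d < l" "g < l"
  shows "(\<Sum>c<l. f a b c * f c d g) + (\<Sum>c<l. f b d c * f c a g) + (\<Sum>c<l. f d a c * f c b g) = 0"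
proof -
  let ?j = "\<lambda>g. (\<Sum>c<l. f a b c * f c d g) + (\<Sum>c<l. f b d c * f c a g) + (\<Sum>c<l. f d a c * f c b g)"
  have "(\<Sum>g<l. vf_scale (?j g) (e g)) = (\<Sum>g<l. vf_scale 0 (e g))"
  proof (intro ext)
    fix h p
    have "(\<Sum>g<l. ?j g * e g h p) = 0"
    proof (cases "h \<in> Cinf \<G>")
      case h: True
      have eC: "e x k \<in> Cinf \<G>" if "x < l" "k \<in> Cinf \<G>" for x k
        using vector_fieldD(2)[OF basis_field[OF that(1)] that(2)] .
      have K: "(\<Sum>g<l. (\<Sum>c<l. f x y c * f c z g) * e g h p) =
          e x (e y (e z h)) p - e y (e x (e z h)) p - e z (e x (e y h)) p + e z (e y (e x h)) p"
        if xyz: "x < l" "y < l" "z < l" for x y z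
      proof -
        have "(\<Sum>g<l. (\<Sum>c<l. f x y c * f c z g) * e g h p) = (\<Sum>g<l. \<Sum>c<l. f x y c * (f c z g * e g h p))"
          by (simp add: sum_distrib_right mult.assoc)
        also have "\<dots> = (\<Sum>c<l. \<Sum>g<l. f x y c * (f c z g * e g h p))" by (rule sum.swap)
        also have "\<dots> = (\<Sum>c<l. f x y c * (e c (e z h) p - e z (e c h) p))"
          by (intro sum.cong refl) (simp add: bracket_apply xyz(3) sum_distrib_left)
        also have "\<dots> = (\<Sum>c<l. f x y c * e c (e z h) p) - (\<Sum>c<l. f x y c * e z (e c h) p)"
          by (simp add: right_diff_distrib sum_subtractf)
        finally have 1: "(\<Sum>g<l. (\<Sum>c<l. f x y c * f c z g) * e g h p) =
            (\<Sum>c<l. f x y c * e c (e z h) p) - (\<Sum>c<l. f x y c * e z (e c h) p)" .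
        have 2: "(\<Sum>c<l. f x y c * e c (e z h) p) = e x (e y (e z h)) p - e y (e x (e z h)) p"
          by (rule bracket_apply[OF xyz(1,2), symmetric])
        have 3: "(\<Sum>c<l. f x y c * e z (e c h) p) = e z (\<lambda>p. \<Sum>c<l. f x y c * e c h p) p"
          using vector_field_sum[OF manifold_G basis_field[OF xyz(3)] h, of l "\<lambda>c. e c h" "f x y"] eC h by simp
        have 4: "(\<lambda>p. \<Sum>c<l. f x y c * e c h p) = (\<lambda>p. 1 * e x (e y h) p + (- 1) * e y (e x h) p)"
          by (simp add: bracket_apply[OF xyz(1,2), symmetric])
        have 5: "e z (\<lambda>p. 1 * e x (e y h) p + (- 1) * e y (e x h) p) p = 1 * e z (e x (e y h)) p + (- 1) * e z (e y (e x h)) p"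
          by (rule fun_cong[OF vector_fieldD(3)[OF basis_field[OF xyz(3)]]]) (intro eC xyz h)+
        show ?thesis unfolding 1 2 3 4 5 by simp
      qed
      show ?thesis using K[OF assms(1-3)] K[OF assms(2,3,1)] K[OF assms(3,1,2)]
        by (simp add: distrib_right sum.distrib)
    next
      case False
      then show ?thesis using vector_fieldD(1)[OF basis_field] by simp
    qed
    then show "(\<Sum>g<l. vf_scale (?j g) (e g)) h p = (\<Sum>g<l. vf_scale 0 (e g)) h p"
      by (simp add: sum_apply_fun vf_scale_def)
  qed
  then show ?thesis using combination_unique[OF _ assms(4), of ?j "\<lambda>_. 0"] by simp
qed

text \<open>The trace of the adjoint representation vanishes on commutators, so that the shift in the
  moment map does not change its commutation relations.\<close>

lemma trace_character:
  assumes "a < l" "b < l"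
  shows "(\<Sum>c<l. f a b c * (\<Sum>d<l. f c d d)) = 0"
proof -
  have "(\<Sum>d<l. (\<Sum>c<l. f a b c * f c d d) + (\<Sum>c<l. f b d c * f c a d) + (\<Sum>c<l. f d a c * f c b d)) = 0"
    using structure_jacobi assms by (intro sum.neutral) auto
  moreover have "(\<Sum>d<l. \<Sum>c<l. f d a c * f c b d) = (\<Sum>c<l. \<Sum>d<l. f d a c * f c b d)" by (rule sum.swap)
  moreover have "(\<Sum>c<l. \<Sum>d<l. f d a c * f c b d) = (\<Sum>c<l. \<Sum>d<l. - (f b c d * f d a c))"
  proof (intro sum.cong refl)
    fix c d assume "c \<in> {..<l}" "d \<in> {..<l}"
    then have "f c b d = - f b c d" using assms(2) by (intro structure_antisymmetric) simp_all
    then show "f d a c * f c b d = - (f b c d * f d a c)" by (simp only: mult_minus_right mult.commute)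
  qed
  moreover have "(\<Sum>c<l. f a b c * (\<Sum>d<l. f c d d)) = (\<Sum>d<l. \<Sum>c<l. f a b c * f c d d)"
    unfolding sum_distrib_left by (rule sum.swap)
  ultimately show ?thesis by (simp add: sum.distrib sum_negf)
qed

end

section \<open>Star products and the quantum moment map\<close>

lemma const_fls_nth [simp]: "fls_nth (const_fls c) n = (\<lambda>p. fls_nth c n)"
proof -
  have "\<exists>N. \<forall>n<N. (\<lambda>p. fls_nth c n) = 0" by (rule exI[of _ "fls_subdegree c"]) (auto simp: fun_eq_iff)
  then show ?thesis unfolding const_fls_def by (rule nth_Abs_fls_ex_lower_bound)
qed

lemma const_fls_zero [simp]: "const_fls 0 = 0" by (rule fls_eqI) (auto simp: fun_eq_iff)

lemma const_fls_add: "const_fls (c + d) = const_fls c + const_fls d"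
  by (rule fls_eqI) (auto simp: fun_eq_iff)

lemma const_fls_subdegree: "fls_subdegree (const_fls c) = fls_subdegree c"
proof (cases "c = 0")
  case False
  then have "fls_nth c (fls_subdegree c) \<noteq> 0" by simp
  then show ?thesis by (intro fls_subdegree_eqI) (auto simp: fun_eq_iff)
qed simp

lemma const_fls_mult: "const_fls (c * d) = const_fls c * const_fls d"
  by (rule fls_eqI) (auto simp: fun_eq_iff fls_times_nth(2) const_fls_subdegree sum_apply_fun)

lemma const_fls_one [simp]: "const_fls 1 = 1" by (rule fls_eqI) (auto simp: fun_eq_iff)

lemma const_fls_X: "const_fls fls_X = fls_X" "const_fls fls_X_inv = fls_X_inv"
  by (rule fls_eqI, auto simp: fun_eq_iff fls_X_inv_conv_shift_1)+

lemma const_fls_const: "const_fls (fls_const c) = fls_const (\<lambda>_. c)"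
  by (rule fls_eqI) (auto simp: fun_eq_iff)

lemma const_fls_sum: "const_fls (\<Sum>i\<in>I. c i) = (\<Sum>i\<in>I. const_fls (c i))"
  by (induction I rule: infinite_finite_induct) (simp_all add: const_fls_add)

text \<open>The star product algebra is assumed to be a ring here. In the theorem this is part of the
  existence of the given projective resolution.\<close>

locale quantum_moment = lie_structure \<G> G l e f
  for \<G> :: "('g::{second_countable_topology,t2_space}, 'eg::real_normed_vector) atlas" and G l e f +
  fixes \<A> :: "('m::{second_countable_topology,t2_space}, 'e::real_normed_vector) atlas"
    and \<omega> :: "'m => 'm tangent => 'm tangent => real" and J :: "'m => 'g vfield => real"
    and \<mu> :: "nat => ('m => 'k::{real_normed_field,euclidean_space}) => ('m => 'k) => ('m => 'k)"
    and \<J> :: "'g vfield => ('m => 'k) fps"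
  assumes manifold: "smooth_manifold \<A>" and star: "star_product \<A> \<omega> \<mu>"
    and moment: "quantum_moment_map \<G> G \<A> \<mu> J \<J>"
    and acyclic: "complete_intersection_hypothesis \<A> l (J_comp J e :: nat => 'm => 'k)"
    and ring: "ring (star_ring \<A> \<mu>)"
begin

abbreviation S :: "('m => 'k) fls set" where "S \<equiv> Cinf_fls \<A>"

lemma star_ring_simps: "carrier (star_ring \<A> \<mu>) = S" "x \<otimes>\<^bsub>star_ring \<A> \<mu>\<^esub> y = star \<mu> x y"
  "\<one>\<^bsub>star_ring \<A> \<mu>\<^esub> = 1" "\<zero>\<^bsub>star_ring \<A> \<mu>\<^esub> = 0" "x \<oplus>\<^bsub>star_ring \<A> \<mu>\<^esub> y = x + y"
  by (simp_all add: star_ring_def)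

interpretation SR: ring "star_ring \<A> \<mu>" by (rule ring)

lemma Cinf_zero: "(0 :: 'm => 'k) \<in> Cinf \<A>" and Cinf_one: "(1 :: 'm => 'k) \<in> Cinf \<A>"
proof -
  have "fls_nth (0 :: ('m => 'k) fls) 0 \<in> Cinf \<A>" "fls_nth (1 :: ('m => 'k) fls) 0 \<in> Cinf \<A>"
    using SR.zero_closed SR.one_closed unfolding star_ring_simps Cinf_fls_def by blast+
  then show "(0 :: 'm => 'k) \<in> Cinf \<A>" "(1 :: 'm => 'k) \<in> Cinf \<A>" by simp_all
qed

lemma Cinf_const: "(\<lambda>p. c :: 'k) \<in> Cinf \<A>"
  using Cinf_linear[OF manifold Cinf_one Cinf_one, of c 0] by simp

lemma Cinf_scale: "h \<in> Cinf \<A> ==> (\<lambda>p. c * h p :: 'k) \<in> Cinf \<A>"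
  using Cinf_linear[OF manifold, of h h c 0] by simp

lemma const_S: "const_fls c \<in> S"
  by (simp add: Cinf_fls_def Cinf_const)

lemma S_nth: "F \<in> S ==> fls_nth F n \<in> Cinf \<A>"
  by (simp add: Cinf_fls_def)

lemmas star_clauses = star[unfolded star_product_def]

lemma mu_zeroth: "[|h \<in> Cinf \<A>; k \<in> Cinf \<A>|] ==> \<mu> 0 h k = h * k"
  by (rule star_clauses[THEN conjunct1, rule_format])

lemma mu_scale: "[|h \<in> Cinf \<A>; k \<in> Cinf \<A>|] ==> \<mu> i (\<lambda>p. r * h p) k = (\<lambda>p. r * \<mu> i h k p)"
  "[|h \<in> Cinf \<A>; k \<in> Cinf \<A>|] ==> \<mu> i k (\<lambda>p. r * h p) = (\<lambda>p. r * \<mu> i k h p)"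
proof -
  assume h: "h \<in> Cinf \<A>" and k: "k \<in> Cinf \<A>"
  have "\<mu> i (\<lambda>p. r * h p + 0 * h p) k = (\<lambda>p. r * \<mu> i h k p + 0 * \<mu> i h k p)"
    by (rule star_clauses[THEN conjunct2, THEN conjunct2, THEN conjunct1, rule_format, THEN conjunct1, OF h h k])
  then show "\<mu> i (\<lambda>p. r * h p) k = (\<lambda>p. r * \<mu> i h k p)" by simp
  have "\<mu> i k (\<lambda>p. r * h p + 0 * h p) = (\<lambda>p. r * \<mu> i k h p + 0 * \<mu> i k h p)"
    by (rule star_clauses[THEN conjunct2, THEN conjunct2, THEN conjunct1, rule_format, THEN conjunct2, OF h h k])
  then show "\<mu> i k (\<lambda>p. r * h p) = (\<lambda>p. r * \<mu> i k h p)" by simp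
qed

lemma mu_zero: "k \<in> Cinf \<A> ==> \<mu> i 0 k = 0" "k \<in> Cinf \<A> ==> \<mu> i k 0 = 0"
  using mu_scale[OF Cinf_zero, of k i 0] by (simp_all add: zero_fun_def)

text \<open>The summation bounds may be replaced by any lower bounds on the orders, since the cochains vanish
  if one argument does.\<close>

lemma star_nth:
  assumes F: "F \<in> S" and H: "H \<in> S" and p: "\<And>j. j < p ==> fls_nth F j = 0" and q: "\<And>j. j < q ==> fls_nth H j = 0"
  shows "fls_nth (star \<mu> F H) n = (\<Sum>j=p..n-q. \<Sum>k=q..n-j. \<mu> (nat (n-j-k)) (fls_nth F j) (fls_nth H k))"
proof -
  define h where "h n = (\<Sum>j = fls_subdegree F..n - fls_subdegree H.
       \<Sum>k = fls_subdegree H..n - j. \<mu> (nat (n - j - k)) (fls_nth F j) (fls_nth H k))" for n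
  have "\<exists>N. \<forall>n<N. h n = 0"
  proof (intro exI allI impI)
    fix m assume "m < fls_subdegree F + fls_subdegree H"
    then have "{fls_subdegree F..m - fls_subdegree H} = {}" by auto
    then show "h m = 0" by (simp add: h_def)
  qed
  then have "fls_nth (Abs_fls h) n = h n" by (rule nth_Abs_fls_ex_lower_bound)
  moreover have "star \<mu> F H = Abs_fls h" by (simp only: star_def h_def[abs_def])
  moreover have "h n = (\<Sum>j=p..n-q. \<Sum>k=q..n-j. \<mu> (nat (n-j-k)) (fls_nth F j) (fls_nth H k))"
  proof -
    have z: "\<mu> i (fls_nth F j) (fls_nth H k) = 0" if "fls_nth F j = 0 \<or> fls_nth H k = 0" for i j k
      using that mu_zero S_nth[OF F] S_nth[OF H] by auto
    show ?thesis unfolding h_def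
    proof (rule sum.mono_neutral_cong)
      fix j assume j: "j \<in> {p..n-q} - {fls_subdegree F..n - fls_subdegree H}"
      show "(\<Sum>k=q..n-j. \<mu> (nat (n-j-k)) (fls_nth F j) (fls_nth H k)) = 0"
      proof (intro sum.neutral ballI z)
        fix k assume "k \<in> {q..n-j}"
        then have "j < fls_subdegree F \<or> k < fls_subdegree H" using j by auto
        then show "fls_nth F j = 0 \<or> fls_nth H k = 0" by auto
      qed
    next
      fix j assume j: "j \<in> {fls_subdegree F..n - fls_subdegree H} - {p..n-q}"
      show "(\<Sum>k=fls_subdegree H..n-j. \<mu> (nat (n-j-k)) (fls_nth F j) (fls_nth H k)) = 0"
      proof (intro sum.neutral ballI z)
        fix k assume "k \<in> {fls_subdegree H..n-j}"
        then have "j < p \<or> k < q" using j by auto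
        then show "fls_nth F j = 0 \<or> fls_nth H k = 0" using p q by auto
      qed
    next
      fix j
      show "(\<Sum>k=fls_subdegree H..n-j. \<mu> (nat (n-j-k)) (fls_nth F j) (fls_nth H k)) =
          (\<Sum>k=q..n-j. \<mu> (nat (n-j-k)) (fls_nth F j) (fls_nth H k))"
        by (rule sum.mono_neutral_cong) (use q in \<open>auto intro!: z\<close>)
    qed simp_all
  qed
  ultimately show ?thesis by simp
qed

lemma star_order:
  assumes "F \<in> S" "H \<in> S" "\<And>j. j < p ==> fls_nth F j = 0" "\<And>j. j < q ==> fls_nth H j = 0" "n < p + q"
  shows "fls_nth (star \<mu> F H) n = 0"
proof -
  have "{p..n-q} = {}" using assms(5) by auto
  moreover have "fls_nth (star \<mu> F H) n = (\<Sum>j=p..n-q. \<Sum>k=q..n-j. \<mu> (nat (n-j-k)) (fls_nth F j) (fls_nth H k))"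
    by (rule star_nth) (use assms in auto)
  ultimately show ?thesis by simp
qed

lemma star_leading:
  assumes "F \<in> S" "H \<in> S" "\<And>j. j < p ==> fls_nth F j = 0" "\<And>j. j < q ==> fls_nth H j = 0"
  shows "fls_nth (star \<mu> F H) (p + q) = fls_nth F p * fls_nth H q"
proof -
  have "fls_nth (star \<mu> F H) (p + q) =
      (\<Sum>j=p..p+q-q. \<Sum>k=q..p+q-j. \<mu> (nat (p+q-j-k)) (fls_nth F j) (fls_nth H k))"
    by (rule star_nth) (use assms in auto)
  then show ?thesis by (simp add: mu_zeroth S_nth assms(1,2))
qed

text \<open>The unit of the star product is the constant function 1, so the cochains of positive order vanish
  on constants. This makes the scalars central.\<close>

lemma mu_one:
  assumes i: "i \<ge> 1" and k: "k \<in> Cinf \<A>"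
  shows "\<mu> i 1 k = 0" "\<mu> i k 1 = 0"
proof -
  let ?K = "fls_const k"
  have K: "?K \<in> S" and one: "1 \<in> S" using k Cinf_zero Cinf_one by (auto simp: Cinf_fls_def)
  have "fps_const k \<in> Cinf_fps \<A>" using k Cinf_zero by (simp add: Cinf_fps_def)
  then have "star \<mu> 1 ?K = ?K \<and> star \<mu> ?K 1 = ?K"
    using star_clauses[THEN conjunct2, THEN conjunct2, THEN conjunct2, THEN conjunct2, THEN conjunct1, rule_format, of "fps_const k"]
    by simp
  then have nth: "fls_nth (star \<mu> 1 ?K) (int i) = 0" "fls_nth (star \<mu> ?K 1) (int i) = 0" using i by auto
  have red: "(\<Sum>j=0..int i-0. \<Sum>m=0..int i-j. \<mu> (nat (int i-j-m)) (fls_nth F j) (fls_nth H m)) = \<mu> i (fls_nth F 0) (fls_nth H 0)"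
    if F: "F \<in> S" "\<And>j. j \<noteq> 0 ==> fls_nth F j = 0" and H: "H \<in> S" "\<And>j. j \<noteq> 0 ==> fls_nth H j = 0" for F H
  proof -
    have "(\<Sum>m=0..int i-j. \<mu> (nat (int i-j-m)) (fls_nth F j) (fls_nth H m)) = (if j = 0 then \<mu> i (fls_nth F 0) (fls_nth H 0) else 0)"
      for j
    proof (cases "j = 0")
      case True
      have "(\<Sum>m=0..int i-j. \<mu> (nat (int i-j-m)) (fls_nth F j) (fls_nth H m)) =
          (\<Sum>m=0..int i. if m = 0 then \<mu> i (fls_nth F 0) (fls_nth H 0) else 0)"
        using True H(2) mu_zero(2)[OF S_nth[OF F(1)]] by (intro sum.cong) auto
      then show ?thesis using True by simp
    next
      case False
      then show ?thesis using F(2)[OF False] mu_zero(1)[OF S_nth[OF H(1)]] by simp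
    qed
    then show ?thesis by simp
  qed
  have "fls_nth (star \<mu> 1 ?K) (int i) = \<mu> i 1 k"
    using star_nth[OF one K, of 0 0 "int i"] red[OF one _ K] by simp
  then show "\<mu> i 1 k = 0" using nth by simp
  have "fls_nth (star \<mu> ?K 1) (int i) = \<mu> i k 1"
    using star_nth[OF K one, of 0 0 "int i"] red[OF K _ one] by simp
  then show "\<mu> i k 1 = 0" using nth by simp
qed

lemma star_const:
  assumes F: "F \<in> S"
  shows "star \<mu> (const_fls c) F = const_fls c * F" "star \<mu> F (const_fls c) = const_fls c * F"
proof -
  have mu_const: "\<mu> i (\<lambda>p. r) k = (if i = 0 then (\<lambda>p. r * k p) else 0)" "\<mu> i k (\<lambda>p. r) = (if i = 0 then (\<lambda>p. r * k p) else 0)"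
    if k: "k \<in> Cinf \<A>" for i r k
  proof -
    have "\<mu> i (\<lambda>p. r) k = (\<lambda>p. r * \<mu> i 1 k p)" "\<mu> i k (\<lambda>p. r) = (\<lambda>p. r * \<mu> i k 1 p)"
      using mu_scale[OF Cinf_one k, of i r] by simp_all
    then show "\<mu> i (\<lambda>p. r) k = (if i = 0 then (\<lambda>p. r * k p) else 0)" "\<mu> i k (\<lambda>p. r) = (if i = 0 then (\<lambda>p. r * k p) else 0)"
      using mu_one[OF _ k, of i] mu_zeroth[OF Cinf_one k] mu_zeroth[OF k Cinf_one] by (auto simp: fun_eq_iff)
  qed
  show "star \<mu> (const_fls c) F = const_fls c * F"
  proof (rule fls_eqI)
    fix n
    let ?p = "fls_subdegree (const_fls c :: ('m => 'k) fls)" and ?q = "fls_subdegree F"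
    have "fls_nth (star \<mu> (const_fls c) F) n =
        (\<Sum>j=?p..n-?q. \<Sum>k=?q..n-j. \<mu> (nat (n-j-k)) (fls_nth (const_fls c) j) (fls_nth F k))"
      by (rule star_nth[OF const_S F]) (rule fls_eq0_below_subdegree, assumption)+
    also have "\<dots> = (\<Sum>j=?p..n-?q. fls_nth (const_fls c) j * fls_nth F (n - j))"
    proof (rule sum.cong[OF refl])
      fix j assume j: "j \<in> {?p..n-?q}"
      have "(\<Sum>k=?q..n-j. \<mu> (nat (n-j-k)) (fls_nth (const_fls c) j) (fls_nth F k)) =
          (\<Sum>k=?q..n-j. if k = n - j then fls_nth (const_fls c) j * fls_nth F (n - j) else 0)"
        by (intro sum.cong refl) (auto simp: mu_const S_nth[OF F] fun_eq_iff)
      then show "(\<Sum>k=?q..n-j. \<mu> (nat (n-j-k)) (fls_nth (const_fls c) j) (fls_nth F k)) = fls_nth (const_fls c) j * fls_nth F (n - j)"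
        using j by simp
    qed
    also have "\<dots> = fls_nth (const_fls c * F) n" by (rule fls_times_nth(2)[symmetric])
    finally show "fls_nth (star \<mu> (const_fls c) F) n = fls_nth (const_fls c * F) n" .
  qed
  show "star \<mu> F (const_fls c) = const_fls c * F"
  proof (rule fls_eqI)
    fix n
    let ?p = "fls_subdegree F" and ?q = "fls_subdegree (const_fls c :: ('m => 'k) fls)"
    have "fls_nth (star \<mu> F (const_fls c)) n =
        (\<Sum>j=?p..n-?q. \<Sum>k=?q..n-j. \<mu> (nat (n-j-k)) (fls_nth F j) (fls_nth (const_fls c) k))"
      by (rule star_nth[OF F const_S]) (rule fls_eq0_below_subdegree, assumption)+
    also have "\<dots> = (\<Sum>j=?p..n-?q. fls_nth F j * fls_nth (const_fls c) (n - j))"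
    proof (rule sum.cong[OF refl])
      fix j assume j: "j \<in> {?p..n-?q}"
      have "(\<Sum>k=?q..n-j. \<mu> (nat (n-j-k)) (fls_nth F j) (fls_nth (const_fls c) k)) =
          (\<Sum>k=?q..n-j. if k = n - j then fls_nth F j * fls_nth (const_fls c) (n - j) else 0)"
        by (intro sum.cong refl) (auto simp: mu_const S_nth[OF F] fun_eq_iff)
      then show "(\<Sum>k=?q..n-j. \<mu> (nat (n-j-k)) (fls_nth F j) (fls_nth (const_fls c) k)) = fls_nth F j * fls_nth (const_fls c) (n - j)"
        using j by simp
    qed
    also have "\<dots> = fls_nth (F * const_fls c) n" by (rule fls_times_nth(2)[symmetric])
    finally show "fls_nth (star \<mu> F (const_fls c)) n = fls_nth (const_fls c * F) n" by (simp only: mult.commute)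
  qed
qed

lemma const_mult_S: "F \<in> S ==> const_fls c * F \<in> S"
  using SR.m_closed[of "const_fls c" F] star_const(1)[of F c] const_S[of c] by (simp add: star_ring_simps)

lemma uminus_S: "F \<in> S ==> - F \<in> S"
proof -
  have "const_fls (- 1) = (- 1 :: ('m => 'k) fls)" by (rule fls_eqI) (auto simp: fun_eq_iff)
  then show "F \<in> S ==> - F \<in> S" using const_mult_S[of F "- 1"] by simp
qed

sublocale star_algebra S "star \<mu>" "\<lambda>c x. const_fls c * x" l
proof unfold_locales
  note s = star_ring_simps
  show "0 \<in> S" "1 \<in> S" using SR.zero_closed SR.one_closed by (simp_all only: s)
  fix x y z
  {
  assume x: "x \<in> S"
  show "- x \<in> S" by (rule uminus_S[OF x])
  show "star \<mu> 1 x = x" "star \<mu> x 1 = x" using SR.l_one[of x] SR.r_one[of x] x by (simp_all only: s)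
  show "const_fls c * x \<in> S" for c by (rule const_mult_S[OF x])
  assume y: "y \<in> S"
  show "x + y \<in> S" "star \<mu> x y \<in> S" using SR.a_closed[of x y] SR.m_closed[of x y] x y by (simp_all only: s)
  have assoc: "star \<mu> (star \<mu> x y) z = star \<mu> x (star \<mu> y z)" if "x \<in> S" "y \<in> S" "z \<in> S" for x y z
    using SR.m_assoc[of x y z] that by (simp only: s)
  have C: "star \<mu> x y \<in> S" if "x \<in> S" "y \<in> S" for x y using SR.m_closed[of x y] that by (simp only: s)
  show "star \<mu> (const_fls c * x) y = const_fls c * star \<mu> x y" for c
    using assoc[OF const_S x y] by (simp only: star_const(1)[OF x] star_const(1)[OF C[OF x y]])
  show "star \<mu> x (const_fls c * y) = const_fls c * star \<mu> x y" for c
    using assoc[OF x y const_S] by (simp only: star_const(2)[OF y] star_const(2)[OF C[OF x y]])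
  assume z: "z \<in> S"
  show "star \<mu> (star \<mu> x y) z = star \<mu> x (star \<mu> y z)" by (rule assoc[OF x y z])
  show "star \<mu> (x + y) z = star \<mu> x z + star \<mu> y z" using SR.l_distr[of x y z] x y z by (simp only: s)
  show "star \<mu> x (y + z) = star \<mu> x y + star \<mu> x z" using SR.r_distr[of y z x] x y z by (simp only: s)
  }
  fix c d :: "'k fls" and u v :: "('m => 'k) fls"
  show "const_fls c * (u + v) = const_fls c * u + const_fls c * v" by (rule distrib_left)
  show "const_fls (c + d) * u = const_fls c * u + const_fls d * u" unfolding const_fls_add by (rule distrib_right)
  show "const_fls c * (const_fls d * u) = const_fls (c * d) * u" unfolding const_fls_mult by (rule mult.assoc[symmetric])
  show "const_fls 1 * u = u" by simp
qed

lemma R_eq: "R = star_ring \<A> \<mu>" by (simp add: R_def star_ring_def)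

lemma scalar_eq: "scalar c = const_fls c" by (simp add: scalar_def)

text \<open>The moment map: central shifts do not affect commutators.\<close>

lemma commutator_shift:
  assumes x: "x \<in> S" and y: "y \<in> S"
  shows "star \<mu> (x + const_fls c) (y + const_fls d) - star \<mu> (y + const_fls d) (x + const_fls c) = star \<mu> x y - star \<mu> y x"
  using x y const_S[of c] const_S[of d] add_C[OF x const_S] add_C[OF y const_S]
  by (simp add: st_add_left st_add_right star_const algebra_simps)

abbreviation J' :: "nat => ('m => 'k) fls" where "J' \<equiv> J_shifted l e f \<J>"

definition shift :: "nat => 'k fls" where "shift a = fls_X * fls_const (of_real ((\<Sum>b<l. f a b b) / 2))"

definition F :: "nat => nat => nat => 'k fls" where "F a b c = fls_const (of_real (f a b c))"

lemma J'_eq: "J' a = fps_to_fls (\<J> (e a)) + const_fls (shift a)"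
  by (simp add: J_shifted_def shift_def const_fls_mult const_fls_X const_fls_const real_const_def)

lemmas moment_clauses = moment[unfolded quantum_moment_map_def]

lemma moment_S: "a < l ==> fps_to_fls (\<J> (e a)) \<in> S"
  using moment_clauses[THEN conjunct1] basis_lie[of a] Cinf_zero by (auto simp: Cinf_fls_def Cinf_fps_def)

lemma J'_S: "a < l ==> J' a \<in> S"
  unfolding J'_eq by (intro add_C moment_S const_S)

lemma J'_order: "a < l ==> m < 0 ==> fls_nth (J' a) m = 0"
  by (simp add: J'_eq shift_def fls_X_times_conv_shift fun_eq_iff)

lemma J'_zeroth: "a < l ==> fls_nth (J' a) 0 = J_comp J e a"
  using moment_clauses[THEN conjunct2, THEN conjunct2, THEN conjunct1, rule_format, OF basis_lie, of a]
  by (simp add: J'_eq shift_def fls_X_times_conv_shift fun_eq_iff J_comp_def)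

lemma moment_sum:
  assumes a: "a < l"
  shows "n \<le> l ==> \<J> (\<Sum>c<n. vf_scale (r c) (e c)) = (\<Sum>c<n. fps_const (real_const (r c)) * \<J> (e c))"
proof (induction n)
  case 0
  have "vf_scale 0 (e a) + vf_scale 0 (e a) = 0" by (simp add: fun_eq_iff vf_scale_def)
  moreover have "real_const 0 = (0 :: 'm => 'k)" by (simp add: real_const_def fun_eq_iff)
  ultimately show ?case
    using moment_clauses[THEN conjunct2, THEN conjunct1, rule_format, OF basis_lie[OF a] basis_lie[OF a], of 0 0]
    by (simp only: lessThan_0 sum.empty fps_const_0_eq_0 mult_zero_left add_0_left)
next
  case (Suc n)
  have one: "vf_scale 1 X = X" for X :: "'g vfield" by (simp add: fun_eq_iff vf_scale_def)
  have c1: "real_const 1 = (1 :: 'm => 'k)" by (simp add: real_const_def fun_eq_iff)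
  have n: "n < l" and IH: "\<J> (\<Sum>c<n. vf_scale (r c) (e c)) = (\<Sum>c<n. fps_const (real_const (r c)) * \<J> (e c))"
    using Suc by (simp, intro Suc.IH, simp)
  have sum: "(\<Sum>c<n. vf_scale (r c) (e c)) \<in> lie_algebra \<G> G" by (rule combination_lie[OF a less_imp_le[OF n]])
  show ?case
    using moment_clauses[THEN conjunct2, THEN conjunct1, rule_format, OF sum basis_lie[OF n], of 1 "r n"]
    by (simp only: one c1 IH sum.lessThan_Suc fps_const_1_eq_1 mult_1_left)
qed

lemma F_simps: "fls_const (of_real (r + s)) = (fls_const (of_real r) + fls_const (of_real s) :: 'k fls)"
  "fls_const (of_real (r * s)) = (fls_const (of_real r) * fls_const (of_real s) :: 'k fls)"
  by (simp_all add: fls_plus_const)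

lemma F_sum: "fls_const (of_real (\<Sum>i\<in>I. r i)) = (\<Sum>i\<in>I. fls_const (of_real (r i)) :: 'k fls)"
  by (induction I rule: infinite_finite_induct) (simp_all add: fls_plus_const[symmetric])

lemma F_antisymmetric: "[|a < l; b < l; c < l|] ==> F a b c = - F b a c"
  using structure_antisymmetric[of a b c] by (simp add: F_def)

lemma F_jacobi:
  assumes "a < l" "b < l" "d < l" "g < l"
  shows "(\<Sum>c<l. F a b c * F c d g) + (\<Sum>c<l. F b d c * F c a g) + (\<Sum>c<l. F d a c * F c b g) = 0"
  unfolding F_def F_simps(2)[symmetric] F_sum[symmetric] F_simps(1)[symmetric] structure_jacobi[OF assms] by simp

lemma J'_commutator:
  assumes a: "a < l" and b: "b < l"
  shows "star \<mu> (J' a) (J' b) - star \<mu> (J' b) (J' a) = (\<Sum>c<l. const_fls (fls_X * F a b c) * J' c)"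
proof -
  have 1: "star \<mu> (J' a) (J' b) - star \<mu> (J' b) (J' a) = fls_X * fps_to_fls (\<J> (vf_bracket (e a) (e b)))"
    unfolding J'_eq commutator_shift[OF moment_S[OF a] moment_S[OF b]]
    by (rule moment_clauses[THEN conjunct2, THEN conjunct2, THEN conjunct2, rule_format, OF basis_lie[OF a] basis_lie[OF b]])
  have 2: "vf_bracket (e a) (e b) = (\<Sum>c<l. vf_scale (f a b c) (e c))"
    using brackets a b by (simp add: structure_constants_def)
  have 3: "\<J> (\<Sum>c<l. vf_scale (f a b c) (e c)) = (\<Sum>c<l. fps_const (real_const (f a b c)) * \<J> (e c))"
    by (rule moment_sum[OF a order_refl])
  have "fps_to_fls (\<Sum>c\<in>I. fps_const (real_const (f a b c)) * \<J> (e c)) =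
      (\<Sum>c\<in>I. const_fls (F a b c) * fps_to_fls (\<J> (e c)))" if "finite I" for I
    using that by induction (simp_all add: fls_times_fps_to_fls F_def const_fls_const real_const_def)
  then have L: "star \<mu> (J' a) (J' b) - star \<mu> (J' b) (J' a) =
      fls_X * (\<Sum>c<l. const_fls (F a b c) * fps_to_fls (\<J> (e c)))"
    unfolding 1 2 3 by simp
  have "(\<Sum>c<l. F a b c * shift c) = (\<Sum>c<l. fls_X * fls_const (of_real (f a b c * ((\<Sum>d<l. f c d d) / 2))))"
  proof (rule sum.cong[OF refl])
    fix c
    show "F a b c * shift c = fls_X * fls_const (of_real (f a b c * ((\<Sum>d<l. f c d d) / 2)))"
      unfolding F_def shift_def F_simps(2)[of "f a b c"] by (rule mult.left_commute)
  qed
  also have "\<dots> = fls_X * fls_const (of_real (\<Sum>c<l. f a b c * ((\<Sum>d<l. f c d d) / 2)))"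
    by (simp only: F_sum sum_distrib_left)
  also have "(\<Sum>c<l. f a b c * ((\<Sum>d<l. f c d d) / 2)) = 0"
  proof -
    have "(\<Sum>c<l. f a b c * ((\<Sum>d<l. f c d d) / 2)) = (\<Sum>c<l. f a b c * (\<Sum>d<l. f c d d)) * (1 / 2)"
      unfolding sum_distrib_right by (intro sum.cong refl) simp
    then show ?thesis unfolding trace_character[OF a b] by simp
  qed
  finally have "(\<Sum>c<l. F a b c * shift c) = 0" by simp
  then have "(\<Sum>c<l. const_fls (F a b c) * const_fls (shift c)) = (0 :: ('m => 'k) fls)"
    by (simp only: const_fls_mult[symmetric] const_fls_sum[symmetric] const_fls_zero)
  then have "fls_X * (\<Sum>c<l. const_fls (F a b c) * fps_to_fls (\<J> (e c))) = fls_X * (\<Sum>c<l. const_fls (F a b c) * J' c)"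
    by (simp add: J'_eq distrib_left sum.distrib)
  then show ?thesis unfolding L by (simp add: const_fls_mult const_fls_X sum_distrib_left mult.assoc)
qed

end

section \<open>The Koszul complex of the quantum moment map\<close>

lemma (in star_algebra) mat_charge:
  "mat (charge f J) T V =
    sc (\<Sum>S\<in>Pow {..<2 * l}. rep_coeff l T S V * cubic l (\<lambda>a b c. - f a b c * inverse 4) S) 1 +
    (\<Sum>a<l. sc (rep_coeff l T {a} V) (J a))"
proof -
  let ?P = "Pow {..<2 * l}" and ?q = "cubic l (\<lambda>a b c. - f a b c * inverse 4)"
  have "mat (charge f J) T V = (\<Sum>S\<in>?P. sc (rep_coeff l T S V * ?q S) 1) +
      (\<Sum>S\<in>?P. \<Sum>a<l. sc (rep_coeff l T S V * ext_basis {a} S) (J a))"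
    by (simp only: mat_def charge_def sc_add_right sc_sum_right sc_sc sum.distrib)
  also have "(\<Sum>S\<in>?P. \<Sum>a<l. sc (rep_coeff l T S V * ext_basis {a} S) (J a)) =
      (\<Sum>a<l. \<Sum>S\<in>?P. sc (rep_coeff l T S V * ext_basis {a} S) (J a))" by (rule sum.swap)
  also have "\<dots> = (\<Sum>a<l. sc (rep_coeff l T {a} V) (J a))"
  proof (rule sum.cong[OF refl])
    fix a assume a: "a \<in> {..<l}"
    have "(\<Sum>S\<in>?P. sc (rep_coeff l T S V * ext_basis {a} S) (J a)) =
        (\<Sum>S\<in>?P. if S = {a} then sc (rep_coeff l T {a} V) (J a) else 0)"
      by (intro sum.cong refl) (auto simp: ext_basis_def)
    then show "(\<Sum>S\<in>?P. sc (rep_coeff l T S V * ext_basis {a} S) (J a)) = sc (rep_coeff l T {a} V) (J a)"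
      using a by simp
  qed
  finally show ?thesis by (simp only: sc_sum_left)
qed

lemma minus_one_power_cases: "((-1) ^ n :: 'r::comm_ring_1) \<in> {1, - 1}"
  by (cases "even n") simp_all

lemma wedge_unit: "(\<And>U. v U \<in> {0, 1, - 1 :: 'r::comm_ring_1}) ==> wedge a v U \<in> {0, 1, - 1}"
proof -
  assume v: "\<And>U. v U \<in> {0, 1, - 1 :: 'r}"
  show "wedge a v U \<in> {0, 1, - 1}"
    using minus_one_power_cases[of "card {s\<in>U. s < a}", where 'r = 'r] v[of "U - {a}"]
    by (auto simp: wedge_def below_sign_def)
qed

lemma cubic_monomial_wedge:
  "[|a < l; b < l|] ==> lop l a (lop l b (lop l (l + c) (ext_basis {}))) = wedge a (wedge b (ext_basis {l + c} :: nat set => 'k::field_char_0 fls))"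
  unfolding ext_basis_generator[of "l + c" l] by (simp only: lop_ghost)

lemma cubic_nested: "cubic l \<phi> U = (\<Sum>a<l. \<Sum>b<l. \<Sum>c<l. \<phi> a b c * lop l a (lop l b (lop l (l + c) (ext_basis {}))) U)"
  by (simp add: cubic_def sum.cartesian_product split_def)

lemma cubic_order:
  assumes \<phi>: "\<And>a b c m. m < 0 ==> fls_nth (\<phi> a b c) m = 0" and m: "m < 0"
  shows "fls_nth (cubic l \<phi> U :: 'k::field_char_0 fls) m = 0"
  unfolding cubic_nested fls_nth_sum
proof (intro sum.neutral ballI)
  fix a b c assume "a \<in> {..<l}" "b \<in> {..<l}" "c \<in> {..<l}"
  then have "lop l a (lop l b (lop l (l + c) (ext_basis {}))) U = wedge a (wedge b (ext_basis {l + c} :: nat set => 'k fls)) U"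
    by (simp only: cubic_monomial_wedge lessThan_iff)
  moreover have "wedge a (wedge b (ext_basis {l + c} :: nat set => 'k fls)) U \<in> {0, 1, - 1}"
    by (intro wedge_unit) (simp add: ext_basis_def)
  ultimately have "lop l a (lop l b (lop l (l + c) (ext_basis {}))) U \<in> {0, 1, - 1 :: 'k fls}" by simp
  then show "fls_nth (\<phi> a b c * lop l a (lop l b (lop l (l + c) (ext_basis {}))) U) m = 0"
    using \<phi>[OF m] by auto
qed

lemma fls_mult_order:
  fixes x y :: "'r::comm_ring_1 fls"
  assumes "\<And>j. j < p ==> fls_nth x j = 0" "\<And>j. j < q ==> fls_nth y j = 0" "n < p + q"
  shows "fls_nth (x * y) n = 0"
proof (cases "x = 0 \<or> y = 0")
  case False
  then have "p \<le> fls_subdegree x" "q \<le> fls_subdegree y" using assms(1,2) fls_subdegree_geI by metis+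
  then show ?thesis using assms(3) by (intro fls_times_nth_eq0) simp
qed auto

context quantum_moment
begin

abbreviation \<theta> where "\<theta> \<equiv> charge F J'"
abbreviation Jc :: "nat => 'm => 'k" where "Jc \<equiv> J_comp J e"

lemma theta_degree: "\<theta> \<in> degree_part 1" by (rule charge_degree) (rule J'_S)

lemma theta_square: "bmult \<theta> \<theta> = (\<lambda>S. 0)"
  by (rule charge_square) (erule J'_S, erule (1) J'_commutator, erule (2) F_antisymmetric, erule (3) F_jacobi)

lemma cubic_coefficient: "- F a b c * inverse 4 = fls_const (of_real (- f a b c / 4))"
proof -
  have four: "inverse (fls_const 4 :: 'k fls) = fls_const (inverse 4)" by (rule fls_inverse_const)
  have inv: "inverse (4 :: 'k fls) = fls_const (inverse 4)" using four by (simp only: fls_const_numeral)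
  have "- F a b c * inverse 4 = fls_const (- of_real (f a b c)) * fls_const (inverse 4)"
    by (simp only: inv F_def fls_const_uminus)
  also have "\<dots> = fls_const (- of_real (f a b c) * inverse 4)" by (rule fls_const_mult_const)
  also have "- of_real (f a b c) * inverse 4 = (of_real (- f a b c / 4) :: 'k)" by (simp only: divide_inverse of_real_mult of_real_minus of_real_inverse of_real_numeral)
  finally show ?thesis .
qed

definition cubic_part :: "nat set => nat set => 'k fls" where
  "cubic_part T V = (\<Sum>S\<in>Pow {..<2 * l}. rep_coeff l T S V * cubic l (\<lambda>a b c. - F a b c * inverse 4) S)"

text \<open>The two ghosts of each cubic monomial are contracted, so that the cubic part of the charge acts with
  order at least 2, and still with positive order after the division by \<open>\<nu>\<close>.\<close>

lemma cubic_part_order: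
  assumes T: "T \<subseteq> {..<l}" and m: "m < 2"
  shows "fls_nth (cubic_part T V) m = 0"
  unfolding cubic_part_def fls_nth_sum
proof (intro sum.neutral ballI)
  fix U assume "U \<in> Pow {..<2 * l}"
  let ?q = "cubic l (\<lambda>a b c. - F a b c * inverse 4) U"
  show "fls_nth (rep_coeff l T U V * ?q) m = 0"
  proof (cases "?q = 0")
    case False
    then obtain a b c where abc: "a < l" "b < l" "a \<noteq> b" "U = {a, b} \<union> lift l {c}" using cubic_support by blast
    show ?thesis
    proof (rule fls_mult_order[of 2 _ 0])
      show "fls_nth (rep_coeff l T U V :: 'k fls) j = 0" if "j < 2" for j
        unfolding abc(4) by (rule rep_coeff_order[OF T]) (use abc that in auto)
      show "fls_nth ?q j = 0" if "j < 0" for j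
      proof (rule cubic_order[OF _ that])
        show "fls_nth (- F a b c * inverse 4) m = 0" if "m < 0" for a b c m
          unfolding cubic_coefficient using that by simp
      qed
    qed (use m in simp)
  qed simp
qed

text \<open>A single antighost cannot contract two different ghosts.\<close>

lemma cubic_part_generator: "a < l ==> cubic_part {a} {} = 0"
  unfolding cubic_part_def
proof (intro sum.neutral ballI)
  fix U assume a: "a < l" and "U \<in> Pow {..<2 * l}"
  let ?q = "cubic l (\<lambda>a b c. - F a b c * inverse 4) U"
  show "rep_coeff l {a} U {} * ?q = 0"
  proof (cases "?q = 0")
    case False
    then obtain b c d where abc: "b < l" "c < l" "b \<noteq> c" "U = {b, c} \<union> lift l {d}" using cubic_support by blast
    have "rep_coeff l {a} U {} = (0 :: 'k fls)"
    proof (rule ccontr)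
      assume "rep_coeff l {a} U {} \<noteq> (0 :: 'k fls)"
      then have "{b, c} \<subseteq> {a} \<union> lift l {}"
        using lift_mult_support[of "{a}" l "{b, c}" "{d}" "lift l {}", where 'k = 'k] a abc
        by (simp add: rep_coeff_def)
      then show False using abc(3) by simp
    qed
    then show ?thesis by simp
  qed simp
qed

definition entry :: "nat set => nat set => ('m => 'k) fls" where
  "entry T V = const_fls fls_X_inv * mat \<theta> T V"

lemma entry_S: "entry T V \<in> S"
  unfolding entry_def by (intro const_mult_S mat_C coeffs_degree_part[OF theta_degree])

lemma entry_nth:
  assumes T: "T \<subseteq> {..<l}" and m: "m \<le> 0"
  shows "fls_nth (entry T V) m = (\<Sum>a<l. if a \<in> T \<and> V = T - {a} then (\<lambda>p. 2 * (-1) ^ card {t\<in>T. a < t} * fls_nth (J' a) m p) else 0)"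
proof -
  have g: "fls_nth (const_fls (rep_coeff l T {a} V) * J' a) (m + 1) =
      (if a \<in> T \<and> V = T - {a} then (\<lambda>p. 2 * (-1) ^ card {t\<in>T. a < t} * fls_nth (J' a) m p) else 0)" if a: "a < l" for a
  proof (cases "a \<in> T \<and> V = T - {a}")
    case True
    let ?n = "card {t\<in>T. a < t}"
    have r: "(rep_coeff l T {a} V :: 'k fls) = 2 * fls_X * (-1) ^ ?n"
      unfolding rep_coeff_ghost[OF T a] if_P[OF True] by (rule refl)
    have c: "fls_const (2 * (-1) ^ ?n :: 'k) = 2 * (-1) ^ ?n" by (cases "even ?n") simp_all
    have "(rep_coeff l T {a} V :: 'k fls) = fls_X * fls_const (2 * (-1) ^ ?n)" unfolding r c by (simp only: mult_ac)
    then have "const_fls (rep_coeff l T {a} V) * J' a = fls_X * (fls_const (\<lambda>_. 2 * (-1) ^ ?n) * J' a)"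
      by (simp only: const_fls_mult const_fls_X const_fls_const mult.assoc)
    then show ?thesis using True by (simp add: fls_X_times_conv_shift fun_eq_iff)
  next
    case False
    then show ?thesis using rep_coeff_ghost[OF T a, of V, where 'k = 'k] by auto
  qed
  have "fls_nth (entry T V) m = fls_nth (mat \<theta> T V) (m + 1)"
    unfolding entry_def const_fls_X fls_X_inv_times_conv_shift by simp
  also have "\<dots> = fls_nth (const_fls (cubic_part T V)) (m + 1) + (\<Sum>a<l. fls_nth (const_fls (rep_coeff l T {a} V) * J' a) (m + 1))"
    unfolding mat_charge cubic_part_def[symmetric] fls_plus_nth fls_nth_sum mult_1_right ..
  also have "fls_nth (const_fls (cubic_part T V)) (m + 1) = (0 :: 'm => 'k)"
    using cubic_part_order[OF T, of "m + 1" V] m by (simp add: fun_eq_iff)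
  finally show ?thesis using g by simp
qed

lemma entry_order: "T \<subseteq> {..<l} ==> m < 0 ==> fls_nth (entry T V) m = 0"
proof -
  assume T: "T \<subseteq> {..<l}" and m: "m < 0"
  have "(if a \<in> T \<and> V = T - {a} then (\<lambda>p. 2 * (-1) ^ card {t\<in>T. a < t} * fls_nth (J' a) m p) else 0) = 0" if "a \<in> {..<l}" for a
    using that m by (simp add: J'_order fun_eq_iff)
  then show "fls_nth (entry T V) m = 0" unfolding entry_nth[OF T less_imp_le[OF m]] by (intro sum.neutral ballI)
qed

lemma kdiff_eq:
  assumes k: "k \<in> carrier (koszul n)" and V: "V \<subseteq> {..<l}"
  shows "kdiff \<theta> n k V = (\<Sum>T\<in>Pow {..<l}. star \<mu> (k T) (entry T V))"
proof -
  have kS: "k T \<in> S" for T using k by (simp add: mem_koszul)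
  have "kdiff \<theta> n k V = const_fls fls_X_inv * (\<Sum>T\<in>Pow {..<l}. star \<mu> (k T) (mat \<theta> T V))"
    using k V by (simp add: kdiff_def act_def)
  also have "\<dots> = (\<Sum>T\<in>Pow {..<l}. const_fls fls_X_inv * star \<mu> (k T) (mat \<theta> T V))" by (rule sum_distrib_left)
  also have "\<dots> = (\<Sum>T\<in>Pow {..<l}. star \<mu> (k T) (entry T V))"
    unfolding entry_def by (intro sum.cong refl st_sc_right[symmetric] kS mat_C coeffs_degree_part[OF theta_degree])
  finally show ?thesis .
qed

lemma kdiff_outside: "k \<in> carrier (koszul n) ==> \<not> V \<subseteq> {..<l} ==> kdiff \<theta> n k V = 0"
  by (simp add: kdiff_def act_def)

definition order_ge :: "int => (nat set => ('m => 'k) fls) => bool" where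
  "order_ge N k \<longleftrightarrow> (\<forall>T m. m < N \<longrightarrow> fls_nth (k T) m = 0)"

lemma order_geD: "order_ge N k ==> m < N ==> fls_nth (k T) m = 0"
  by (simp add: order_ge_def)

lemma kdiff_order:
  assumes k: "k \<in> carrier (koszul n)" and N: "order_ge N k"
  shows "order_ge N (kdiff \<theta> n k)"
  unfolding order_ge_def
proof (intro allI impI)
  fix V m assume m: "m < N"
  have kS: "k T \<in> S" for T using k by (simp add: mem_koszul)
  show "fls_nth (kdiff \<theta> n k V) m = 0"
  proof (cases "V \<subseteq> {..<l}")
    case True
    show ?thesis unfolding kdiff_eq[OF k True] fls_nth_sum
    proof (intro sum.neutral ballI)
      fix T assume "T \<in> Pow {..<l}"
      then have T: "T \<subseteq> {..<l}" by simp
      show "fls_nth (star \<mu> (k T) (entry T V)) m = 0"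
        by (rule star_order[OF kS entry_S, where p = N and q = 0]) (use order_geD[OF N] entry_order[OF T] m in auto)
    qed
  qed (simp add: kdiff_outside[OF k])
qed

text \<open>To lowest order in \<open>\<nu>\<close> the differential is, up to sign and a factor 2, the classical Koszul
  differential: the cubic term of the charge contributes only in positive order.\<close>

lemma kdiff_leading:
  assumes k: "k \<in> carrier (koszul n)" and N: "order_ge N k"
  shows "fls_nth (kdiff \<theta> n k V) N p = 2 * (-1) ^ card V * koszul_diff l Jc (\<lambda>T. fls_nth (k T) N) V p"
proof (cases "V \<subseteq> {..<l}")
  case V: True
  then have finV: "finite V" by (rule finite_subset) simp
  have kS: "k T \<in> S" for T using k by (simp add: mem_koszul)
  let ?c = "\<lambda>a T. 2 * (-1) ^ card {t\<in>T. a < t} * Jc a p"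
  have "fls_nth (kdiff \<theta> n k V) N p = (\<Sum>T\<in>Pow {..<l}. fls_nth (star \<mu> (k T) (entry T V)) (N + 0) p)"
    unfolding kdiff_eq[OF k V] fls_nth_sum sum_apply_fun by simp
  also have "\<dots> = (\<Sum>T\<in>Pow {..<l}. \<Sum>a<l. if a \<in> T \<and> V = T - {a} then fls_nth (k T) N p * ?c a T else 0)"
  proof (rule sum.cong[OF refl])
    fix T assume T: "T \<in> Pow {..<l}"
    then have T': "T \<subseteq> {..<l}" by simp
    have "fls_nth (star \<mu> (k T) (entry T V)) (N + 0) = fls_nth (k T) N * fls_nth (entry T V) 0"
      by (rule star_leading[OF kS entry_S]) (use N T' entry_order order_geD in auto)
    then have "fls_nth (star \<mu> (k T) (entry T V)) (N + 0) p = fls_nth (k T) N p * fls_nth (entry T V) 0 p" by simp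
    also have "fls_nth (entry T V) 0 p = (\<Sum>a<l. if a \<in> T \<and> V = T - {a} then ?c a T else 0)"
      unfolding entry_nth[OF T' order_refl] sum_apply_fun by (intro sum.cong refl) (simp add: J'_zeroth)
    finally show "fls_nth (star \<mu> (k T) (entry T V)) (N + 0) p =
        (\<Sum>a<l. if a \<in> T \<and> V = T - {a} then fls_nth (k T) N p * ?c a T else 0)"
      by (simp add: sum_distrib_left if_distrib cong: if_cong)
  qed
  also have "\<dots> = (\<Sum>a<l. \<Sum>T\<in>Pow {..<l}. if a \<in> T \<and> V = T - {a} then fls_nth (k T) N p * ?c a T else 0)" by (rule sum.swap)
  also have "\<dots> = (\<Sum>a<l. if a \<in> V then 0 else fls_nth (k (insert a V)) N p * ?c a V)"
  proof (rule sum.cong[OF refl])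
    fix a assume a: "a \<in> {..<l}"
    have e: "{t. (t = a \<or> t \<in> V) \<and> a < t} = {t \<in> V. a < t}" by auto
    have "(\<Sum>T\<in>Pow {..<l}. if a \<in> T \<and> V = T - {a} then fls_nth (k T) N p * ?c a T else 0) =
        (\<Sum>T\<in>Pow {..<l}. if T = insert a V then (if a \<in> V then 0 else fls_nth (k (insert a V)) N p * ?c a V) else 0)"
    proof (intro sum.cong refl)
      fix T
      have iff: "a \<in> T \<and> V = T - {a} \<longleftrightarrow> T = insert a V \<and> a \<notin> V" by blast
      show "(if a \<in> T \<and> V = T - {a} then fls_nth (k T) N p * ?c a T else 0) =
          (if T = insert a V then (if a \<in> V then 0 else fls_nth (k (insert a V)) N p * ?c a V) else 0)"
        unfolding iff by (cases "T = insert a V"; cases "a \<in> V"; simp add: e)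
    qed
    then show "(\<Sum>T\<in>Pow {..<l}. if a \<in> T \<and> V = T - {a} then fls_nth (k T) N p * ?c a T else 0) =
        (if a \<in> V then 0 else fls_nth (k (insert a V)) N p * ?c a V)"
      using a V by simp
  qed
  also have "\<dots> = 2 * (-1) ^ card V * (\<Sum>a<l. Jc a p * (ext_deriv a (\<lambda>T. fls_nth (k T) N) V) p)"
    unfolding sum_distrib_left
  proof (intro sum.cong refl)
    fix a
    let ?x = "card {s\<in>V. s < a}" and ?y = "card {s\<in>V. a < s}"
    have pw: "((-1) ^ i :: 'm => 'k) p = (-1) ^ i" for i by (cases "even i") simp_all
    show "(if a \<in> V then 0 else fls_nth (k (insert a V)) N p * ?c a V) =
        2 * (-1) ^ card V * (Jc a p * (ext_deriv a (\<lambda>T. fls_nth (k T) N) V) p)"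
    proof (cases "a \<in> V")
      case False
      have "V = {s\<in>V. s < a} \<union> {s\<in>V. a < s}"
      proof (intro equalityI subsetI)
        show "s \<in> {s\<in>V. s < a} \<union> {s\<in>V. a < s}" if "s \<in> V" for s
          using that False linorder_neq_iff[of s a] by (cases "s = a") auto
        show "s \<in> V" if "s \<in> {s\<in>V. s < a} \<union> {s\<in>V. a < s}" for s using that by blast
      qed
      then have "card V = card ({s\<in>V. s < a} \<union> {s\<in>V. a < s})" by (rule arg_cong)
      also have "\<dots> = ?x + ?y" using finV by (intro card_Un_disjoint) auto
      finally have sg: "((-1) ^ card V * (-1) ^ ?x :: 'k) = (-1) ^ ?y" by (simp add: minus_one_power_iff)
      show ?thesis using False by (simp add: ext_deriv_def pw sg[symmetric] mult_ac)
    qed (simp add: ext_deriv_def)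
  qed
  also have "(\<Sum>a<l. Jc a p * (ext_deriv a (\<lambda>T. fls_nth (k T) N) V) p) = koszul_diff l Jc (\<lambda>T. fls_nth (k T) N) V p"
    by (simp add: koszul_diff_def sum_apply_fun)
  finally show ?thesis .
next
  case False
  have "k (insert a V) = 0" for a using koszul_zero[OF k, of "insert a V"] False by blast
  then have "ext_deriv a (\<lambda>T. fls_nth (k T) N) V = 0" for a by (auto simp: ext_deriv_def)
  then show ?thesis using False by (simp add: kdiff_outside[OF k] koszul_diff_def sum_apply_fun)
qed

lemma koszul_add_closed: "[|x \<in> carrier (koszul n); y \<in> carrier (koszul n)|] ==> (\<lambda>T. x T + y T) \<in> carrier (koszul n)"
proof -
  interpret K: left_module R "koszul n" by (rule koszul_module)
  show "[|x \<in> carrier (koszul n); y \<in> carrier (koszul n)|] ==> (\<lambda>T. x T + y T) \<in> carrier (koszul n)"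
    using K.M.a_closed[of x y] by simp
qed

lemma koszul_diff_closed:
  assumes x: "x \<in> carrier (koszul n)" and y: "y \<in> carrier (koszul n)"
  shows "(\<lambda>T. x T - y T) \<in> carrier (koszul n)"
proof -
  have "const_fls (- 1) = (- 1 :: ('m => 'k) fls)" by (rule fls_eqI) (auto simp: fun_eq_iff)
  then show ?thesis using koszul_add_closed[OF x koszul_scale[OF y, of "- 1"]] by simp
qed

lemma kdiff_closed: "k \<in> carrier (koszul n) ==> kdiff \<theta> n k \<in> carrier (koszul (n - 1))"
  by (rule left_hom_closed[OF kdiff_hom[OF theta_degree]])

lemma kdiff_add:
  "[|x \<in> carrier (koszul n); y \<in> carrier (koszul n)|] ==> kdiff \<theta> n (\<lambda>T. x T + y T) V = kdiff \<theta> n x V + kdiff \<theta> n y V"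
  using left_hom_add[OF kdiff_hom[OF theta_degree], of x n y] by simp

lemma kdiff_diff:
  assumes x: "x \<in> carrier (koszul n)" and y: "y \<in> carrier (koszul n)"
  shows "kdiff \<theta> n (\<lambda>T. x T - y T) V = kdiff \<theta> n x V - kdiff \<theta> n y V"
  using kdiff_add[OF koszul_diff_closed[OF x y] y, of V] by simp

lemma kdiff_square: "k \<in> carrier (koszul n) ==> kdiff \<theta> (n - 1) (kdiff \<theta> n k) = (\<lambda>V. 0)"
proof -
  interpret K: chain_complex R koszul "kdiff \<theta>" by (rule koszul_complex[OF theta_degree theta_square])
  show "k \<in> carrier (koszul n) ==> kdiff \<theta> (n - 1) (kdiff \<theta> n k) = (\<lambda>V. 0)" using K.diff_diff[of k n] by simp
qed

lemma koszul_diff_scale: "koszul_diff l Jc (\<lambda>T p. c * w T p) V p = c * koszul_diff l Jc w V p"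
  unfolding koszul_diff_def sum_apply_fun sum_distrib_left
  by (intro sum.cong refl) (simp add: ext_deriv_def)

text \<open>A cycle is, modulo higher order, the boundary of any classical chain which the complete
  intersection hypothesis provides for its leading coefficient.\<close>

lemma koszul_step:
  assumes n: "n \<ge> 1" and k: "k \<in> carrier (koszul (int n))" and cyc: "kdiff \<theta> (int n) k = (\<lambda>V. 0)" and N: "order_ge N k"
  shows "\<exists>z\<in>carrier (koszul (int n + 1)). order_ge N z \<and> order_ge (N + 1) (\<lambda>T. k T - kdiff \<theta> (int n + 1) z T)"
proof -
  define x where "x T = fls_nth (k T) N" for T
  have "x T \<in> Cinf \<A>" for T using k by (simp add: x_def mem_koszul S_nth)
  moreover have "T \<subseteq> {..<l} \<and> card T = n" if "x T \<noteq> 0" for T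
  proof -
    have "k T \<noteq> 0" using that by (auto simp: x_def)
    then show ?thesis using k by (simp add: mem_koszul)
  qed
  ultimately have x: "x \<in> koszul_chains \<A> l n" unfolding koszul_chains_def by blast
  have x_eq: "x = (\<lambda>T. fls_nth (k T) N)" by (simp add: fun_eq_iff x_def)
  have "koszul_diff l Jc x V p = 0" for V p
    using kdiff_leading[OF k N, of V p] unfolding x_eq by (simp add: cyc)
  then have "koszul_diff l Jc x = 0" by (simp add: fun_eq_iff)
  then obtain w where w: "w \<in> koszul_chains \<A> l (n + 1)" and wx: "koszul_diff l Jc w = x"
    using acyclic x n unfolding complete_intersection_hypothesis_def by (metis less_le_trans zero_less_one)
  define c :: 'k where "c = (-1) ^ n / 2"
  define z where "z T = fls_shift (- N) (fls_const (\<lambda>p. c * w T p))" for T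
  have z_nth: "fls_nth (z T) m = (if m = N then (\<lambda>p. c * w T p) else 0)" for T m by (simp add: z_def)
  have wC: "w T \<in> Cinf \<A>" for T using w by (simp add: koszul_chains_def)
  have "z T \<in> S" for T using wC Cinf_zero by (simp add: Cinf_fls_def z_nth Cinf_scale)
  moreover have "T \<subseteq> {..<l} \<and> int (card T) = int n + 1" if "z T \<noteq> 0" for T
  proof -
    have "w T \<noteq> 0"
    proof
      assume "w T = 0"
      then have "z T = 0" by (intro fls_eqI) (simp add: z_nth fun_eq_iff)
      then show False using that by simp
    qed
    then show ?thesis using w by (auto simp: koszul_chains_def)
  qed
  ultimately have z: "z \<in> carrier (koszul (int n + 1))" unfolding mem_koszul by blast
  have zN: "order_ge N z" by (simp add: order_ge_def z_nth)
  have lead: "fls_nth (kdiff \<theta> (int n + 1) z V) N p = x V p" for V p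
  proof -
    have "fls_nth (kdiff \<theta> (int n + 1) z V) N p = 2 * (-1) ^ card V * (c * x V p)"
      using kdiff_leading[OF z zN, of V p] by (simp add: z_nth koszul_diff_scale wx)
    moreover have "x V p = 0" if "card V \<noteq> n"
    proof -
      have "x V = 0" by (rule ccontr) (use x that in \<open>simp add: koszul_chains_def\<close>)
      then show ?thesis by simp
    qed
    ultimately show ?thesis by (cases "card V = n") (simp_all add: c_def minus_one_power_iff)
  qed
  have "fls_nth (k T - kdiff \<theta> (int n + 1) z T) m = 0" if m: "m < N + 1" for T m
  proof (cases "m = N")
    case True
    then show ?thesis using lead by (simp add: fun_eq_iff x_def)
  next
    case False
    then show ?thesis using m order_geD[OF N, of m T] order_geD[OF kdiff_order[OF z zN], of m T] by simp
  qed
  then show ?thesis using z zN unfolding order_ge_def by blast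
qed

text \<open>Laurent series are complete for the \<open>\<nu>\<close>-adic topology, so the stepwise corrections add up.\<close>

lemma koszul_exact:
  assumes n: "n \<ge> 1" and k: "k \<in> carrier (koszul (int n))" and cyc: "kdiff \<theta> (int n) k = (\<lambda>V. 0)"
  shows "\<exists>y\<in>carrier (koszul (int n + 1)). kdiff \<theta> (int n + 1) y = k"
proof -
  let ?K = "carrier (koszul (int n + 1))" and ?d = "kdiff \<theta> (int n + 1)"
  define M where "M = Min (insert 0 ((\<lambda>T. fls_subdegree (k T)) ` Pow {..<l}))"
  have kM: "order_ge M k"
    unfolding order_ge_def
  proof (intro allI impI)
    fix T m assume m: "m < M"
    show "fls_nth (k T) m = 0"
    proof (cases "T \<subseteq> {..<l}")
      case True
      then have "M \<le> fls_subdegree (k T)" unfolding M_def by (intro Min_le) auto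
      then show ?thesis using m by simp
    next
      case False
      then show ?thesis using koszul_zero[OF k, of T] by simp
    qed
  qed
  define P where "P i Y \<longleftrightarrow> Y \<in> ?K \<and> order_ge M Y \<and> order_ge (M + int i) (\<lambda>T. k T - ?d Y T)" for i Y
  define Q where "Q i Y Y' \<longleftrightarrow> order_ge (M + int i) (\<lambda>T. Y' T - Y T)" for i and Y Y' :: "nat set => ('m => 'k) fls"
  have zero: "(\<lambda>T. 0) \<in> ?K" by (simp add: mem_koszul zero_C)
  have d0: "?d (\<lambda>T. 0) V = 0" for V using kdiff_diff[OF zero zero, of V] by simp
  have dK: "?d Y \<in> carrier (koszul (int n))" if "Y \<in> ?K" for Y using kdiff_closed[OF that] by simp
  have "\<exists>Y. \<forall>i. P i (Y i) \<and> Q i (Y i) (Y (Suc i))"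
  proof (rule dependent_nat_choice)
    show "\<exists>Y. P 0 Y" using zero kM by (intro exI[of _ "\<lambda>T. 0"]) (simp add: P_def d0 order_ge_def)
    fix Y i assume "P i Y"
    then have Y: "Y \<in> ?K" "order_ge M Y" "order_ge (M + int i) (\<lambda>T. k T - ?d Y T)" by (auto simp: P_def)
    have r: "(\<lambda>T. k T - ?d Y T) \<in> carrier (koszul (int n))" by (rule koszul_diff_closed[OF k dK[OF Y(1)]])
    have "kdiff \<theta> (int n) (?d Y) = (\<lambda>V. 0)" using kdiff_square[OF Y(1)] by simp
    then have "kdiff \<theta> (int n) (\<lambda>T. k T - ?d Y T) = (\<lambda>V. 0)"
      using kdiff_diff[OF k dK[OF Y(1)]] by (simp add: fun_eq_iff cyc)
    then obtain z where z: "z \<in> ?K" "order_ge (M + int i) z" "order_ge (M + int i + 1) (\<lambda>T. k T - ?d Y T - ?d z T)"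
      using koszul_step[OF n r _ Y(3)] by blast
    have "P (Suc i) (\<lambda>T. Y T + z T)"
      unfolding P_def
    proof (intro conjI)
      show "(\<lambda>T. Y T + z T) \<in> ?K" by (rule koszul_add_closed[OF Y(1) z(1)])
      show "order_ge M (\<lambda>T. Y T + z T)" using Y(2) z(2) by (simp add: order_ge_def)
      show "order_ge (M + int (Suc i)) (\<lambda>T. k T - ?d (\<lambda>T. Y T + z T) T)"
        using z(3) unfolding kdiff_add[OF Y(1) z(1)] by (simp only: diff_diff_eq of_nat_Suc add_ac)
    qed
    moreover have "Q i Y (\<lambda>T. Y T + z T)" using z(2) by (simp add: Q_def)
    ultimately show "\<exists>Y'. P (Suc i) Y' \<and> Q i Y Y'" by blast
  qed
  then obtain Y where Y': "\<forall>i. P i (Y i) \<and> Q i (Y i) (Y (Suc i))" ..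
  have Y: "Y i \<in> ?K" "order_ge M (Y i)" "order_ge (M + int i) (\<lambda>T. k T - ?d (Y i) T)"
    "order_ge (M + int i) (\<lambda>T. Y (Suc i) T - Y i T)" for i using Y'[rule_format, of i] by (auto simp: P_def Q_def)
  have stable: "fls_nth (Y j T) m = fls_nth (Y i T) m" if "i \<le> j" "m < M + int i" for i j T m
    using that(1)
  proof (induction j rule: dec_induct)
    case (step j)
    have "fls_nth (Y (Suc j) T - Y j T) m = 0" using order_geD[OF Y(4)[of j], of m T] that(2) step.hyps by simp
    then show ?case using step.IH by simp
  qed simp
  define y where "y T = Abs_fls (\<lambda>m. if m < M then 0 else fls_nth (Y (nat (m - M) + 1) T) m)" for T
  have y_nth: "fls_nth (y T) m = fls_nth (Y i T) m" if m: "m < M + int i" for T m i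
  proof -
    have "fls_nth (y T) m = (if m < M then 0 else fls_nth (Y (nat (m - M) + 1) T) m)"
      unfolding y_def by (rule nth_Abs_fls_ex_lower_bound) (rule exI[of _ M], simp)
    also have "\<dots> = fls_nth (Y i T) m"
    proof (cases "m < M")
      case True
      then show ?thesis using order_geD[OF Y(2)] by simp
    next
      case False
      then have "nat (m - M) + 1 \<le> i" "m < M + int (nat (m - M) + 1)" using m by auto
      then show ?thesis using stable[of "nat (m - M) + 1" i m T] False by simp
    qed
    finally show ?thesis .
  qed
  have ex: "\<exists>i. m < M + int i" for m :: int by (rule exI[of _ "nat (m - M) + 1"]) simp
  have y: "y \<in> ?K"
    unfolding mem_koszul
  proof (intro allI conjI impI)
    fix T
    have "fls_nth (y T) m \<in> Cinf \<A>" for m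
    proof -
      obtain i where "m < M + int i" using ex by blast
      moreover have "Y i T \<in> S" using Y(1)[of i] by (simp add: mem_koszul)
      ultimately show ?thesis by (simp add: y_nth S_nth)
    qed
    then show "y T \<in> S" by (simp add: Cinf_fls_def)
    assume nz: "y T \<noteq> 0"
    have "\<exists>m. fls_nth (y T) m \<noteq> 0"
    proof (rule ccontr)
      assume "\<not> (\<exists>m. fls_nth (y T) m \<noteq> 0)"
      then have "y T = 0" by (intro fls_eqI) simp
      then show False using nz by simp
    qed
    then obtain m i where "fls_nth (y T) m \<noteq> 0" "m < M + int i" using ex by blast
    then have "Y i T \<noteq> 0" using y_nth[of m i T] by auto
    then show "T \<subseteq> {..<l}" "int (card T) = int n + 1" using Y(1)[of i] by (auto simp: mem_koszul)
  qed
  have "?d y V = k V" for V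
  proof (rule fls_eqI)
    fix m
    obtain i where i: "m < M + int i" using ex by blast
    have "order_ge (M + int i) (\<lambda>T. y T - Y i T)" using y_nth by (simp add: order_ge_def)
    then have "fls_nth (?d (\<lambda>T. y T - Y i T) V) m = 0"
      using kdiff_order[OF koszul_diff_closed[OF y Y(1)]] order_geD i by blast
    moreover have "fls_nth (k V - ?d (Y i) V) m = 0" using order_geD[OF Y(3) i] .
    ultimately show "fls_nth (?d y V) m = fls_nth (k V) m" by (simp add: kdiff_diff[OF y Y(1)])
  qed
  then show ?thesis using y by (intro bexI[of _ y]) auto
qed

end

section \<open>Quotients by left ideals\<close>

lemma left_quotient_simps:
  "carrier (left_quotient R I) = a_rcosets\<^bsub>R\<^esub> I" "\<zero>\<^bsub>left_quotient R I\<^esub> = I"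
  "X \<oplus>\<^bsub>left_quotient R I\<^esub> Y = X <+>\<^bsub>R\<^esub> Y" "a \<odot>\<^bsub>left_quotient R I\<^esub> X = (\<Union>x\<in>X. I +>\<^bsub>R\<^esub> (a \<otimes>\<^bsub>R\<^esub> x))"
  by (simp_all add: left_quotient_def)

lemma left_quotient_module:
  fixes R :: "'a ring"
  assumes "ring R" and I: "left_ideal R I"
  shows "left_module R (left_quotient R I)"
    and "\<And>a x. [|a \<in> carrier R; x \<in> carrier R|] ==> a \<odot>\<^bsub>left_quotient R I\<^esub> (I +>\<^bsub>R\<^esub> x) = I +>\<^bsub>R\<^esub> (a \<otimes>\<^bsub>R\<^esub> x)"
    and "\<And>x y. [|x \<in> carrier R; y \<in> carrier R|] ==> (I +>\<^bsub>R\<^esub> x) \<oplus>\<^bsub>left_quotient R I\<^esub> (I +>\<^bsub>R\<^esub> y) = I +>\<^bsub>R\<^esub> (x \<oplus>\<^bsub>R\<^esub> y)"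
    and "carrier (left_quotient R I) = (\<lambda>x. I +>\<^bsub>R\<^esub> x) ` carrier R"
    and "\<And>x. x \<in> carrier R ==> I +>\<^bsub>R\<^esub> x = I \<longleftrightarrow> x \<in> I"
proof -
  interpret ring R by fact
  have "additive_subgroup I R" using I by (simp add: left_ideal_def additive_subgroup_def)
  then interpret I: abelian_subgroup I R by (rule abelian_subgroupI3) (rule abelian_group_axioms)
  have sub: "I \<subseteq> carrier R" by (rule I.a_subset)
  show sm: "a \<odot>\<^bsub>left_quotient R I\<^esub> (I +>\<^bsub>R\<^esub> x) = I +>\<^bsub>R\<^esub> (a \<otimes>\<^bsub>R\<^esub> x)" if ax: "a \<in> carrier R" "x \<in> carrier R" for a x
  proof -
    have eq: "I +>\<^bsub>R\<^esub> (a \<otimes>\<^bsub>R\<^esub> y) = I +>\<^bsub>R\<^esub> (a \<otimes>\<^bsub>R\<^esub> x)" if y: "y \<in> I +>\<^bsub>R\<^esub> x" for y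
    proof -
      obtain h where h: "h \<in> I" "y = h \<oplus>\<^bsub>R\<^esub> x" using y by (auto simp: a_r_coset_def')
      have "a \<otimes>\<^bsub>R\<^esub> y = a \<otimes>\<^bsub>R\<^esub> h \<oplus>\<^bsub>R\<^esub> a \<otimes>\<^bsub>R\<^esub> x" using h sub ax by (simp add: r_distr subsetD)
      moreover have "a \<otimes>\<^bsub>R\<^esub> h \<in> I" using I h ax by (simp add: left_ideal_def)
      ultimately have "a \<otimes>\<^bsub>R\<^esub> y \<in> I +>\<^bsub>R\<^esub> (a \<otimes>\<^bsub>R\<^esub> x)" by (auto simp: a_r_coset_def')
      then show ?thesis by (rule a_repr_independence[symmetric]) (use ax I.a_subgroup in auto)
    qed
    have "x \<in> I +>\<^bsub>R\<^esub> x" by (rule I.a_rcos_self[OF ax(2)])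
    then show ?thesis unfolding left_quotient_simps using eq by blast
  qed
  show ad: "(I +>\<^bsub>R\<^esub> x) \<oplus>\<^bsub>left_quotient R I\<^esub> (I +>\<^bsub>R\<^esub> y) = I +>\<^bsub>R\<^esub> (x \<oplus>\<^bsub>R\<^esub> y)"
    if "x \<in> carrier R" "y \<in> carrier R" for x y
    unfolding left_quotient_simps by (rule I.a_rcos_sum[OF that])
  show car: "carrier (left_quotient R I) = (\<lambda>x. I +>\<^bsub>R\<^esub> x) ` carrier R"
    by (auto simp: left_quotient_simps A_RCOSETS_def')
  have z: "I +>\<^bsub>R\<^esub> \<zero>\<^bsub>R\<^esub> = I" by (rule a_coset_add_zero[OF sub])
  show iz: "I +>\<^bsub>R\<^esub> x = I \<longleftrightarrow> x \<in> I" if x: "x \<in> carrier R" for x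
    using I.a_rcos_self[OF x] I.a_rcos_const[of x] by auto
  have zero: "\<zero>\<^bsub>left_quotient R I\<^esub> = I +>\<^bsub>R\<^esub> \<zero>\<^bsub>R\<^esub>" using z by (simp add: left_quotient_simps)
  show "left_module R (left_quotient R I)"
  proof (intro left_module.intro left_module_axioms.intro)
    show "ring R" by fact
    show "abelian_group (left_quotient R I)"
    proof (rule abelian_groupI)
      fix X assume "X \<in> carrier (left_quotient R I)"
      then obtain x where x: "x \<in> carrier R" "X = I +>\<^bsub>R\<^esub> x" by (auto simp: car)
      show "\<zero>\<^bsub>left_quotient R I\<^esub> \<oplus>\<^bsub>left_quotient R I\<^esub> X = X" by (simp add: zero x ad)
      show "\<exists>Y\<in>carrier (left_quotient R I). Y \<oplus>\<^bsub>left_quotient R I\<^esub> X = \<zero>\<^bsub>left_quotient R I\<^esub>"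
        by (rule bexI[of _ "I +>\<^bsub>R\<^esub> (\<ominus>\<^bsub>R\<^esub> x)"]) (use x in \<open>auto simp: zero ad car l_neg\<close>)
      fix Y assume "Y \<in> carrier (left_quotient R I)"
      then obtain y where y: "y \<in> carrier R" "Y = I +>\<^bsub>R\<^esub> y" by (auto simp: car)
      show "X \<oplus>\<^bsub>left_quotient R I\<^esub> Y \<in> carrier (left_quotient R I)" using x y by (auto simp: ad car)
      show "X \<oplus>\<^bsub>left_quotient R I\<^esub> Y = Y \<oplus>\<^bsub>left_quotient R I\<^esub> X" using x y by (simp add: ad a_comm)
      fix Z assume "Z \<in> carrier (left_quotient R I)"
      then obtain z where z: "z \<in> carrier R" "Z = I +>\<^bsub>R\<^esub> z" by (auto simp: car)
      show "X \<oplus>\<^bsub>left_quotient R I\<^esub> Y \<oplus>\<^bsub>left_quotient R I\<^esub> Z = X \<oplus>\<^bsub>left_quotient R I\<^esub> (Y \<oplus>\<^bsub>left_quotient R I\<^esub> Z)"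
        using x y z by (simp add: ad a_assoc)
    qed (auto simp: zero car)
  qed (auto simp: car ad sm l_distr r_distr m_assoc)
qed

section \<open>The Koszul resolution\<close>

text \<open>A free module on a finite set of subsets is a summand of a free module indexed by its own elements,
  the basis vectors serving as indices.\<close>

lemma (in star_algebra) koszul_projective: "projective_left_module R (koszul p)"
proof -
  let ?B = "{T. T \<subseteq> {..<l} \<and> int (card T) = p}" and ?e = "ext_basis :: nat set => nat set => 'r"
  let ?X = "?e ` ?B"
  let ?F = "free_left_module R ?X"
  have inj: "?e T = ?e U ==> T = U" for T U by (drule fun_cong[of _ _ T]) (simp add: ext_basis_def split: if_splits)
  have finB: "finite ?B" by (rule finite_subset[of _ "Pow {..<l}"]) auto
  define i where "i = (\<lambda>k\<in>carrier (koszul p). \<lambda>u. if u \<in> ?X then k (THE T. u = ?e T) else 0)"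
  define q where "q = (\<lambda>v\<in>carrier ?F. \<lambda>T. if T \<in> ?B then v (?e T) else 0)"
  have the: "(THE U. ?e T = ?e U) = T" for T by (rule the_equality) (rule refl, erule inj[symmetric])
  have memF: "v \<in> carrier ?F \<longleftrightarrow> (\<forall>u. v u \<in> C) \<and> (\<forall>u. u \<notin> ?X \<longrightarrow> v u = 0)" for v
  proof -
    have "finite {u. v u \<noteq> 0}" if "\<forall>u. u \<notin> ?X \<longrightarrow> v u = 0"
      by (rule finite_subset[of _ ?X]) (use that finB in auto)
    then show ?thesis by (auto simp: mem_free_left_module)
  qed
  interpret K: left_module R "koszul p" by (rule koszul_module)
  interpret F: left_module R ?F by (rule left_module_free[OF ring_R])
  have i: "i \<in> left_hom R (koszul p) ?F"
  proof (rule left_homI)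
    fix x assume x: "x \<in> carrier (koszul p)"
    then show "i x \<in> carrier ?F" unfolding memF by (auto simp: i_def mem_koszul zero_C)
    show "i (x \<oplus>\<^bsub>koszul p\<^esub> y) = i x \<oplus>\<^bsub>?F\<^esub> i y" if y: "y \<in> carrier (koszul p)" for y
      using x y K.M.a_closed[OF x y] by (auto simp: i_def fun_eq_iff)
    show "i (a \<odot>\<^bsub>koszul p\<^esub> x) = a \<odot>\<^bsub>?F\<^esub> i x" if a: "a \<in> carrier R" for a
      using x a K.lsmult_closed[OF a x] by (auto simp: i_def fun_eq_iff)
  qed (simp add: i_def)
  moreover have "q \<in> left_hom R ?F (koszul p)"
  proof (rule left_homI)
    fix x assume x: "x \<in> carrier ?F"
    then show "q x \<in> carrier (koszul p)" using x[unfolded memF] by (auto simp: q_def mem_koszul zero_C)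
    show "q (x \<oplus>\<^bsub>?F\<^esub> y) = q x \<oplus>\<^bsub>koszul p\<^esub> q y" if y: "y \<in> carrier ?F" for y
      using x y F.M.a_closed[OF x y] by (auto simp: q_def fun_eq_iff)
    show "q (a \<odot>\<^bsub>?F\<^esub> x) = a \<odot>\<^bsub>koszul p\<^esub> q x" if a: "a \<in> carrier R" for a
      using x a F.lsmult_closed[OF a x] by (auto simp: q_def fun_eq_iff)
  qed (simp add: q_def)
  moreover have "q (i x) = x" if x: "x \<in> carrier (koszul p)" for x
  proof
    fix T
    have "i x \<in> carrier ?F" by (rule left_hom_closed[OF i x])
    then show "q (i x) T = x T" using x koszul_zero[OF x, of T] by (auto simp: q_def i_def the)
  qed
  ultimately show ?thesis unfolding projective_left_module_def using koszul_module by blast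
qed

context quantum_moment
begin

definition moment_ideal :: "('m => 'k) fls set" where "moment_ideal = gen_left_ideal R (J' ` {..<l})"

lemma moment_combination_S: "(\<And>a. r a \<in> S) ==> (\<Sum>a<l. star \<mu> (r a) (J' a)) \<in> S"
  by (intro sum_C st_C J'_S) auto

lemma left_ideal_combinations:
  "left_ideal R {\<Sum>a<l. star \<mu> (r a) (J' a) |r. \<forall>a. r a \<in> S}" (is "left_ideal R ?I")
proof -
  interpret Rr: ring R by (rule ring_R)
  have inv: "\<ominus>\<^bsub>R\<^esub> x = - x" if "x \<in> S" for x by (rule Rr.minus_equality) (use that uminus_S in auto)
  have "subgroup ?I (add_monoid R)"
  proof (rule Rr.add.subgroupI)
    show "?I \<subseteq> carrier R" using moment_combination_S by auto
    have "(\<Sum>a<l. star \<mu> 0 (J' a)) \<in> ?I" using zero_C by (intro CollectI exI[of _ "\<lambda>a. 0"]) simp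
    then show "?I \<noteq> {}" by (metis empty_iff)
    fix x assume "x \<in> ?I"
    then obtain r where r: "\<And>a. r a \<in> S" "x = (\<Sum>a<l. star \<mu> (r a) (J' a))" by blast
    have "- x = (\<Sum>a<l. star \<mu> (- r a) (J' a))"
    proof -
      have "star \<mu> (- r a) (J' a) = - star \<mu> (r a) (J' a)" if "a < l" for a
        using st_add_left[OF r(1) uminus_S[OF r(1)] J'_S[OF that], of a a] J'_S[OF that]
        by (simp add: eq_neg_iff_add_eq_0 add.commute)
      then show ?thesis by (simp add: r(2) sum_negf)
    qed
    moreover have "x \<in> S" using r moment_combination_S by simp
    ultimately show "\<ominus>\<^bsub>R\<^esub> x \<in> ?I" using r(1) uminus_S by (auto simp: inv)
    fix y assume "y \<in> ?I"
    then obtain s where s: "\<And>a. s a \<in> S" "y = (\<Sum>a<l. star \<mu> (s a) (J' a))" by blast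
    have "x + y = (\<Sum>a<l. star \<mu> (r a + s a) (J' a))"
      unfolding r(2) s(2) sum.distrib[symmetric] by (intro sum.cong refl st_add_left[symmetric] r(1) s(1) J'_S) simp
    moreover have "r a + s a \<in> S" for a by (intro add_C r(1) s(1))
    ultimately have "x + y \<in> ?I" by (intro CollectI exI[of _ "\<lambda>a. r a + s a"]) simp
    then show "x \<oplus>\<^bsub>R\<^esub> y \<in> ?I" by simp
  qed
  moreover have "c \<otimes>\<^bsub>R\<^esub> x \<in> ?I" if c: "c \<in> carrier R" and x: "x \<in> ?I" for c x
  proof -
    have c': "c \<in> S" using c by simp
    obtain r where r: "\<And>a. r a \<in> S" "x = (\<Sum>a<l. star \<mu> (r a) (J' a))" using x by blast
    have "star \<mu> c x = (\<Sum>a<l. star \<mu> c (star \<mu> (r a) (J' a)))"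
      unfolding r(2) by (rule st_sum_right) (use c' r J'_S st_C in auto)
    also have "\<dots> = (\<Sum>a<l. star \<mu> (star \<mu> c (r a)) (J' a))"
      by (intro sum.cong refl st_assoc[symmetric] c' r(1) J'_S) simp
    finally show ?thesis using st_C[OF c' r(1)] by auto
  qed
  ultimately show ?thesis unfolding left_ideal_def by blast
qed

text \<open>The ideal is a left ideal, so its elements are the combinations with coefficients on the left;
  these are what the differential produces in degree zero.\<close>

lemma moment_ideal_eq: "moment_ideal = {\<Sum>a<l. star \<mu> (r a) (J' a) |r. \<forall>a. r a \<in> S}" (is "_ = ?I")
proof
  have "J' b \<in> ?I" if b: "b < l" for b
  proof -
    have "(\<Sum>a<l. star \<mu> (if a = b then 1 else 0) (J' a)) = (\<Sum>a<l. if a = b then J' b else 0)"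
      by (intro sum.cong refl) (auto simp: one_st J'_S)
    then have "J' b = (\<Sum>a<l. star \<mu> (if a = b then 1 else 0) (J' a))" using b by simp
    then show ?thesis using zero_C one_C by (intro CollectI exI[of _ "\<lambda>a. if a = b then 1 else 0"]) auto
  qed
  then have "J' ` {..<l} \<subseteq> ?I" by blast
  then show "moment_ideal \<subseteq> ?I" unfolding moment_ideal_def gen_left_ideal_def using left_ideal_combinations by blast
  show "?I \<subseteq> moment_ideal" unfolding moment_ideal_def gen_left_ideal_def
  proof (intro subsetI InterI)
    fix x I assume "x \<in> ?I" "I \<in> {I. left_ideal R I \<and> J' ` {..<l} \<subseteq> I}"
    then obtain r where r: "\<And>a. r a \<in> S" "x = (\<Sum>a<l. star \<mu> (r a) (J' a))" and I: "left_ideal R I" "J' ` {..<l} \<subseteq> I" by blast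
    have sg: "subgroup I (add_monoid R)" using I by (simp add: left_ideal_def)
    have t: "star \<mu> (r a) (J' a) \<in> I" if "a < l" for a
    proof -
      have "r a \<otimes>\<^bsub>R\<^esub> J' a \<in> I" using I r(1)[of a] that unfolding left_ideal_def by auto
      then show ?thesis by simp
    qed
    have "(\<Sum>a\<in>A. star \<mu> (r a) (J' a)) \<in> I" if "finite A" "A \<subseteq> {..<l}" for A
      using that
    proof (induction A)
      case empty
      then show ?case using subgroup.one_closed[OF sg] by simp
    next
      case (insert a A)
      then show ?case using subgroup.m_closed[OF sg t, of a "\<Sum>a\<in>A. star \<mu> (r a) (J' a)"] by simp
    qed
    then show "x \<in> I" using r(2) by simp
  qed
qed

lemma moment_ideal_left: "left_ideal R moment_ideal"
  unfolding moment_ideal_eq by (rule left_ideal_combinations)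

lemma kdiff_one:
  assumes k: "k \<in> carrier (koszul 1)"
  shows "kdiff \<theta> 1 k {} = (\<Sum>a<l. star \<mu> (const_fls 2 * k {a}) (J' a))"
proof -
  have kS: "k T \<in> S" for T using k by (simp add: mem_koszul)
  have e: "entry {a} {} = const_fls 2 * J' a" if a: "a < l" for a
  proof -
    have T: "{a} \<subseteq> {..<l}" using a by simp
    have "(\<Sum>b<l. const_fls (rep_coeff l {a} {b} {}) * J' b) = (\<Sum>b<l. if b = a then const_fls (2 * fls_X) * J' a else 0)"
    proof (rule sum.cong[OF refl])
      fix b assume b: "b \<in> {..<l}"
      have z: "{t. t = a \<and> a < t} = {}" by auto
      show "const_fls (rep_coeff l {a} {b} {}) * J' b = (if b = a then const_fls (2 * fls_X) * J' a else 0)"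
        using rep_coeff_ghost[OF T, of b "{}", where 'k = 'k] b by (auto simp: z)
    qed
    then have "mat \<theta> {a} {} = const_fls (2 * fls_X) * J' a"
      unfolding mat_charge cubic_part_def[symmetric] cubic_part_generator[OF a] using a by simp
    then have "entry {a} {} = const_fls (fls_X_inv * (2 * fls_X)) * J' a"
      by (simp only: entry_def const_fls_mult mult.assoc)
    also have "fls_X_inv * (2 * fls_X) = (2 :: 'k fls)" by (simp add: fls_X_inv_times_conv_shift fls_X_times_conv_shift)
    finally show ?thesis .
  qed
  have "kdiff \<theta> 1 k {} = (\<Sum>T\<in>Pow {..<l}. star \<mu> (k T) (entry T {}))" by (rule kdiff_eq[OF k]) simp
  also have "\<dots> = (\<Sum>T\<in>(\<lambda>a. {a}) ` {..<l}. star \<mu> (k T) (entry T {}))"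
  proof (rule sum.mono_neutral_right)
    show "\<forall>T\<in>Pow {..<l} - (\<lambda>a. {a}) ` {..<l}. star \<mu> (k T) (entry T {}) = 0"
    proof
      fix T assume T: "T \<in> Pow {..<l} - (\<lambda>a. {a}) ` {..<l}"
      have "k T = 0"
      proof (rule koszul_zero[OF k], rule notI)
        assume "T \<subseteq> {..<l} \<and> int (card T) = 1"
        then obtain a where "T = {a}" by (auto simp: card_1_singleton_iff)
        then show False using T by auto
      qed
      then show "star \<mu> (k T) (entry T {}) = 0" using entry_S by simp
    qed
  qed auto
  also have "\<dots> = (\<Sum>a<l. star \<mu> (k {a}) (entry {a} {}))" by (subst sum.reindex) (auto simp: inj_on_def)
  also have "\<dots> = (\<Sum>a<l. star \<mu> (const_fls 2 * k {a}) (J' a))"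
    by (intro sum.cong refl) (simp add: e st_sc_left st_sc_right kS J'_S)
  finally show ?thesis .
qed

definition augmentation :: "(nat set => ('m => 'k) fls) => ('m => 'k) fls set" where
  "augmentation = (\<lambda>k\<in>carrier (koszul 0). moment_ideal +>\<^bsub>R\<^esub> k {})"

lemma koszul_degree_zero: "k \<in> carrier (koszul 0) ==> T \<noteq> {} ==> k T = 0"
proof (erule koszul_zero, rule notI)
  assume "T \<noteq> {}" "T \<subseteq> {..<l} \<and> int (card T) = 0"
  then show False using finite_subset[of T "{..<l}"] by auto
qed

theorem koszul_resolution:
  "projective_resolution R (left_quotient R moment_ideal) koszul (kdiff \<theta>) augmentation"
proof -
  let ?B = "left_quotient R moment_ideal"
  note B = left_quotient_module[OF ring_R moment_ideal_left]
  interpret K: left_module R "koszul 0" by (rule koszul_module)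
  have k0: "k {} \<in> S" if "k \<in> carrier (koszul n)" for k n using that by (simp add: mem_koszul)
  show ?thesis unfolding projective_resolution_def
  proof (intro conjI allI impI)
    show "projective_left_module R (koszul n)" for n by (rule koszul_projective)
    show "carrier (koszul n) = {\<zero>\<^bsub>koszul n\<^esub>}" if "n < 0" for n
    proof -
      have "k = (\<lambda>T. 0)" if "k \<in> carrier (koszul n)" for k
        using koszul_zero[OF that] \<open>n < 0\<close> by (intro ext) auto
      then show ?thesis by (auto simp: mem_koszul zero_C)
    qed
    show "kdiff \<theta> n \<in> left_hom R (koszul n) (koszul (n - 1))" for n by (rule kdiff_hom[OF theta_degree])
    show "augmentation \<in> left_hom R (koszul 0) ?B"
    proof (rule left_homI)
      fix x assume x: "x \<in> carrier (koszul 0)"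
      show "augmentation x \<in> carrier ?B" using x k0[OF x] by (simp add: augmentation_def B(4))
      show "augmentation (x \<oplus>\<^bsub>koszul 0\<^esub> y) = augmentation x \<oplus>\<^bsub>?B\<^esub> augmentation y" if y: "y \<in> carrier (koszul 0)" for y
        using x y K.M.a_closed[OF x y] k0[OF x] k0[OF y] B(3)[of "x {}" "y {}"] by (simp add: augmentation_def)
      show "augmentation (a \<odot>\<^bsub>koszul 0\<^esub> x) = a \<odot>\<^bsub>?B\<^esub> augmentation x" if a: "a \<in> carrier R" for a
        using x a K.lsmult_closed[OF a x] k0[OF x] B(2)[of a "x {}"] by (simp add: augmentation_def)
    qed (simp add: augmentation_def)
    show "augmentation ` carrier (koszul 0) = carrier ?B"
    proof (intro equalityI subsetI)
      fix X assume "X \<in> carrier ?B"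
      then obtain x where x: "x \<in> S" "X = moment_ideal +>\<^bsub>R\<^esub> x" by (auto simp: B(4))
      let ?k = "\<lambda>T. if T = {} then x else 0"
      have k: "?k \<in> carrier (koszul 0)" using x zero_C by (simp add: mem_koszul)
      have "augmentation ?k = X" using k x by (simp add: augmentation_def)
      then show "X \<in> augmentation ` carrier (koszul 0)" using k by blast
    next
      fix X assume "X \<in> augmentation ` carrier (koszul 0)"
      then show "X \<in> carrier ?B" using k0 by (auto simp: augmentation_def B(4))
    qed
    show "{x \<in> carrier (koszul 0). augmentation x = \<zero>\<^bsub>?B\<^esub>} = kdiff \<theta> 1 ` carrier (koszul 1)"
    proof (intro equalityI subsetI)
      fix x assume "x \<in> {x \<in> carrier (koszul 0). augmentation x = \<zero>\<^bsub>?B\<^esub>}"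
      then have x: "x \<in> carrier (koszul 0)" and ax: "augmentation x = \<zero>\<^bsub>?B\<^esub>" by simp_all
      have "moment_ideal +>\<^bsub>R\<^esub> x {} = moment_ideal" using ax x by (simp add: augmentation_def left_quotient_simps)
      then have "x {} \<in> moment_ideal" using B(5)[of "x {}"] k0[OF x] by simp
      then obtain r where r: "\<And>a. r a \<in> S" "x {} = (\<Sum>a<l. star \<mu> (r a) (J' a))" unfolding moment_ideal_eq by blast
      define k where "k T = (\<Sum>a<l. if T = {a} then const_fls (inverse 2) * r a else 0)" for T
      have k_single: "k {a} = const_fls (inverse 2) * r a" if "a < l" for a
        using that by (simp add: k_def)
      have "k T \<in> S" for T unfolding k_def using r(1) zero_C const_mult_S by (auto intro!: sum_C)
      moreover have "T \<subseteq> {..<l} \<and> int (card T) = 1" if nz: "k T \<noteq> 0" for T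
      proof (rule ccontr)
        assume n: "\<not> (T \<subseteq> {..<l} \<and> int (card T) = 1)"
        have "k T = 0" unfolding k_def by (rule sum.neutral) (use n in auto)
        then show False using nz by simp
      qed
      ultimately have k: "k \<in> carrier (koszul 1)" unfolding mem_koszul by blast
      have two: "(2 :: 'k fls) \<noteq> 0" using fls_of_nat_nonzero[where 'k = 'k, of 1] by simp
      have h: "const_fls 2 * (const_fls (inverse 2) * r a) = r a" for a
        using two by (simp add: mult.assoc[symmetric] const_fls_mult[symmetric])
      have e: "kdiff \<theta> 1 k {} = x {}" unfolding kdiff_one[OF k] r(2)
        by (intro sum.cong refl) (simp only: k_single h lessThan_iff)
      have dk: "kdiff \<theta> 1 k \<in> carrier (koszul 0)" using kdiff_closed[OF k] by simp
      have "kdiff \<theta> 1 k = x"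
      proof
        fix T show "kdiff \<theta> 1 k T = x T"
          using e koszul_degree_zero[OF dk, of T] koszul_degree_zero[OF x, of T] by (cases "T = {}") auto
      qed
      then show "x \<in> kdiff \<theta> 1 ` carrier (koszul 1)" using k by blast
    next
      fix x assume "x \<in> kdiff \<theta> 1 ` carrier (koszul 1)"
      then obtain k where k: "k \<in> carrier (koszul 1)" "x = kdiff \<theta> 1 k" by blast
      have x: "x \<in> carrier (koszul 0)" using kdiff_closed[OF k(1)] k(2) by simp
      have "const_fls 2 * k {a} \<in> S" for a using k(1) by (simp add: mem_koszul const_mult_S)
      then have "x {} \<in> moment_ideal" unfolding k(2) kdiff_one[OF k(1)] moment_ideal_eq
        by (intro CollectI exI[of _ "\<lambda>a. const_fls 2 * k {a}"]) simp
      then show "x \<in> {x \<in> carrier (koszul 0). augmentation x = \<zero>\<^bsub>?B\<^esub>}"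
        using x k0[OF x] B(5)[of "x {}"] by (simp add: augmentation_def left_quotient_simps)
    qed
    show "{x \<in> carrier (koszul n). kdiff \<theta> n x = \<zero>\<^bsub>koszul (n - 1)\<^esub>} = kdiff \<theta> (n + 1) ` carrier (koszul (n + 1))"
      if n: "1 \<le> n" for n
    proof (intro equalityI subsetI)
      fix x assume "x \<in> {x \<in> carrier (koszul n). kdiff \<theta> n x = \<zero>\<^bsub>koszul (n - 1)\<^esub>}"
      then have x: "x \<in> carrier (koszul n)" "kdiff \<theta> n x = (\<lambda>V. 0)" by simp_all
      have nn: "nat n \<ge> 1" "int (nat n) = n" using n by auto
      obtain y where "y \<in> carrier (koszul (n + 1))" "kdiff \<theta> (n + 1) y = x"
        using koszul_exact[OF nn(1), unfolded nn(2), OF x] by (elim bexE) (rule that)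
      then show "x \<in> kdiff \<theta> (n + 1) ` carrier (koszul (n + 1))" by (intro image_eqI[of x _ y]) simp_all
    next
      fix x assume "x \<in> kdiff \<theta> (n + 1) ` carrier (koszul (n + 1))"
      then obtain k where k: "k \<in> carrier (koszul (n + 1))" "x = kdiff \<theta> (n + 1) k" by blast
      then show "x \<in> {x \<in> carrier (koszul n). kdiff \<theta> n x = \<zero>\<^bsub>koszul (n - 1)\<^esub>}"
        using kdiff_square[OF k(1)] kdiff_closed[OF k(1)] by simp
    qed
  qed
qed

end

section \<open>The BRST charge\<close>

lemma ext_mult_wedge: "ext_mult (wedge a v) w = wedge a (ext_mult v w)"
proof -
  have "(\<lambda>S T. wedge a v S * w T) = left_wedge a (\<lambda>S T. v S * w T)"
    by (simp add: left_wedge_def wedge_def fun_eq_iff)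
  then show ?thesis by (simp add: ext_mult_def ext_mu_left_wedge)
qed

lemma ext_mult_one: "finitary1 w ==> ext_mult (ext_basis {}) w = w"
proof
  fix U assume w: "finitary1 w"
  show "ext_mult (ext_basis {}) w U = w U"
  proof (cases "finite U")
    case True
    have "ext_mult (ext_basis {}) w U = (\<Sum>S\<in>Pow U. if S = {} then w U else 0)"
      unfolding ext_mult_def ext_mu_def by (intro sum.cong refl) (auto simp: ext_basis_def ext_sign_def)
    then show ?thesis using True by simp
  next
    case False
    then show ?thesis using w by (auto simp: ext_mult_def ext_mu_def finitary1_def)
  qed
qed

lemma ext_basis_wedge: "ext_basis {a} = wedge a (ext_basis {})"
proof
  fix U
  have z: "{s. s = a \<and> s < a} = {}" by auto
  show "ext_basis {a} U = wedge a (ext_basis {}) U"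
    by (cases "U = {a}") (auto simp: ext_basis_def wedge_def below_sign_def z)
qed

lemma const_fls_wedge:
  fixes v :: "nat set => 'k::comm_ring_1 fls"
  shows "(const_fls (wedge a v U) :: ('m => 'k) fls) = wedge a (\<lambda>U. const_fls (v U)) U"
proof -
  have m: "const_fls (- 1 :: 'k fls) = (- 1 :: ('m => 'k) fls)" by (rule fls_eqI) (auto simp: fun_eq_iff)
  have "const_fls ((-1) ^ n :: 'k fls) = ((-1) ^ n :: ('m => 'k) fls)" for n
    by (induction n) (simp_all only: power_0 power_Suc const_fls_one const_fls_mult m)
  then show ?thesis by (simp add: wedge_def below_sign_def const_fls_mult)
qed

lemma const_fls_basis: "const_fls (ext_basis S U) = ext_basis S U"
  by (simp add: ext_basis_def)

context quantum_moment
begin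

lemma cubic_ext_mult:
  assumes "a < l" "b < l"
  shows "ext_mult (ext_mult (ext_basis {a}) (ext_basis {b})) (ext_basis {l + c}) U =
    (const_fls (lop l a (lop l b (lop l (l + c) (ext_basis {}))) U) :: ('m => 'k) fls)"
proof -
  have w: "ext_mult (ext_basis {i}) v = wedge i v" if "finitary1 v" for i and v :: "nat set => ('m => 'k) fls"
    unfolding ext_basis_wedge ext_mult_wedge ext_mult_one[OF that] ..
  have f: "finitary1 (ext_basis {i} :: nat set => ('m => 'k) fls)" for i by (rule finitary1_basis) simp
  have "ext_mult (ext_mult (ext_basis {a}) (ext_basis {b})) (ext_basis {l + c}) =
      wedge a (wedge b (ext_basis {l + c} :: nat set => ('m => 'k) fls))"
    unfolding w[OF f] ext_mult_wedge ..
  then show ?thesis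
    unfolding cubic_monomial_wedge[OF assms] const_fls_wedge const_fls_basis by (simp only:)
qed

lemma theta_eq: "brst_theta l f J' = \<theta>"
proof
  fix U
  have "const_fls (cubic l (\<lambda>a b c. - F a b c * inverse 4) U) = (\<Sum>a<l. \<Sum>b<l. \<Sum>c<l. fls_const (real_const (- f a b c / 4)) *
        ext_mult (ext_mult (ext_basis {a}) (ext_basis {b})) (ext_basis {l + c}) U :: ('m => 'k) fls)"
    unfolding cubic_nested const_fls_sum
  proof (intro sum.cong refl)
    fix a b c assume "a \<in> {..<l}" "b \<in> {..<l}"
    then show "const_fls (- F a b c * inverse 4 * lop l a (lop l b (lop l (l + c) (ext_basis {}))) U) =
        fls_const (real_const (- f a b c / 4)) * (ext_mult (ext_mult (ext_basis {a}) (ext_basis {b})) (ext_basis {l + c}) U :: ('m => 'k) fls)"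
      by (simp only: cubic_coefficient const_fls_mult const_fls_const cubic_ext_mult lessThan_iff real_const_def)
  qed
  then show "brst_theta l f J' U = \<theta> U"
    unfolding brst_theta_def charge_def by (simp add: const_fls_basis mult.commute)
qed

lemma brst_alg_eq: "brst_alg \<A> \<mu> l f J' = brst \<theta>"
proof -
  have m: "brst_mult \<mu> l = bmult" by (intro ext) (simp add: brst_mult_def bmult_def)
  show ?thesis unfolding brst_alg_def brst_def theta_eq m degree_part_def const_fls_X ..
qed

end

lemma graded_alg_isomorphic_trans:
  assumes "graded_alg_isomorphic A B" "graded_alg_isomorphic B C"
  shows "graded_alg_isomorphic A C"
proof -
  obtain h g where h: "graded_alg_iso A B h" and g: "graded_alg_iso B C g"
    using assms by (auto simp: graded_alg_isomorphic_def)
  have hB: "h n x \<in> gcarrier B n" if "x \<in> gcarrier A n" for n x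
    using h that unfolding graded_alg_iso_def by (blast dest: bij_betwE)
  have b: "bij_betw (h n) (gcarrier A n) (gcarrier B n)" "bij_betw (g n) (gcarrier B n) (gcarrier C n)" for n
    using h g by (simp_all add: graded_alg_iso_def)
  have "bij_betw (g n \<circ> h n) (gcarrier A n) (gcarrier C n)" for n by (rule bij_betw_trans[OF b])
  then have "graded_alg_iso A C (\<lambda>n. g n \<circ> h n)"
    using h g hB unfolding graded_alg_iso_def by simp
  then show ?thesis by (auto simp: graded_alg_isomorphic_def)
qed

theorem corollary4p2p4:
  fixes \<A> :: "('m::{second_countable_topology,t2_space}, 'e::real_normed_vector) atlas"
    and \<omega> :: "'m \<Rightarrow> 'm tangent \<Rightarrow> 'm tangent \<Rightarrow> real"
    and \<G> :: "('g::{second_countable_topology,t2_space}, 'eg::real_normed_vector) atlas"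
    and G :: "'g monoid"
    and act :: "'g \<Rightarrow> 'm \<Rightarrow> 'm"
    and J :: "'m \<Rightarrow> 'g vfield \<Rightarrow> real"
    and l :: nat
    and e :: "nat \<Rightarrow> 'g vfield"
    and f :: "nat \<Rightarrow> nat \<Rightarrow> nat \<Rightarrow> real"
    and \<mu> :: "nat \<Rightarrow> ('m \<Rightarrow> 'k::{real_normed_field,euclidean_space}) \<Rightarrow> ('m \<Rightarrow> 'k) \<Rightarrow> ('m \<Rightarrow> 'k)"
    and \<J> :: "'g vfield \<Rightarrow> ('m \<Rightarrow> 'k) fps"
    and J' :: "nat \<Rightarrow> ('m \<Rightarrow> 'k) fls"
    and R :: "('m \<Rightarrow> 'k) fls ring"
    and B :: "(('m \<Rightarrow> 'k) fls, ('m \<Rightarrow> 'k) fls set) module"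
    and P :: "int \<Rightarrow> (('m \<Rightarrow> 'k) fls, 'p) module"
    and d :: "int \<Rightarrow> 'p \<Rightarrow> 'p"
    and \<epsilon> :: "'p \<Rightarrow> ('m \<Rightarrow> 'k) fls set"
  assumes "smooth_manifold \<A>" and "symplectic_form \<A> \<omega>"
    and "lie_group \<G> G" and "compact (UNIV :: 'g set)" and "connected (UNIV :: 'g set)"
    and "smooth_symplectic_action \<G> G \<A> \<omega> act"
    and "moment_map \<G> G \<A> \<omega> act J"
    and "lie_basis \<G> G l e" and "structure_constants l e f"
    and "star_product \<A> \<omega> \<mu>"
    and "quantum_moment_map \<G> G \<A> \<mu> J \<J>"
    and "generating_hypothesis \<A> l (J_comp J e :: nat \<Rightarrow> 'm \<Rightarrow> 'k) (zero_level \<G> G J)"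
    and "complete_intersection_hypothesis \<A> l (J_comp J e :: nat \<Rightarrow> 'm \<Rightarrow> 'k)"
    and "J' = J_shifted l e f \<J>"
    and "R = star_ring \<A> \<mu>"
    and "B = left_quotient R (gen_left_ideal R (J' ` {..<l}))"
    and "projective_resolution R B P d \<epsilon>"
  shows "graded_alg_isomorphic
           (opposite_graded (cohomology (brst_alg \<A> \<mu> l f J')))
           (Ext_alg R const_fls P d)"
proof -
  note res = assms(17)
  have "projective_left_module R (P 0)" using res by (simp add: projective_resolution_def)
  then have "left_module R (P 0)" by (rule projective_left_module_imp)
  then have ring: "ring (star_ring \<A> \<mu>)" unfolding left_module_def assms(15) by blast
  interpret Q: quantum_moment \<G> G l e f \<A> \<omega> J \<mu> \<J>
  proof (intro quantum_moment.intro quantum_moment_axioms.intro lie_structure.intro)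
    show "smooth_manifold \<G>" using assms(3) by (simp add: lie_group_def)
  qed (fact assms ring)+
  have R: "R = Q.R" using Q.R_eq assms(15) by simp
  have B: "B = left_quotient Q.R Q.moment_ideal" unfolding assms(16) R Q.moment_ideal_def assms(14) ..
  have 1: "graded_alg_isomorphic (opposite_graded (cohomology (brst_alg \<A> \<mu> l f J'))) (Ext_alg Q.R Q.scalar Q.koszul (Q.kdiff Q.\<theta>))"
    unfolding assms(14) Q.brst_alg_eq by (rule Q.opposite_brst_isomorphic[OF Q.theta_degree Q.theta_square])
  have 2: "graded_alg_isomorphic (Ext_alg Q.R Q.scalar Q.koszul (Q.kdiff Q.\<theta>)) (Ext_alg Q.R Q.scalar P d)"
  proof (rule Ext_alg_independent)
    show "projective_resolution Q.R B Q.koszul (Q.kdiff Q.\<theta>) Q.augmentation" unfolding B by (rule Q.koszul_resolution)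
    show "projective_resolution Q.R B P d \<epsilon>" using res unfolding R .
    show "left_module Q.R B" unfolding B by (rule left_quotient_module(1)[OF Q.ring_R Q.moment_ideal_left])
    show "Q.scalar c \<in> carrier Q.R" for c by (simp add: Q.scalar_eq Q.const_S)
    show "Q.scalar c \<otimes>\<^bsub>Q.R\<^esub> r = r \<otimes>\<^bsub>Q.R\<^esub> Q.scalar c" if "r \<in> carrier Q.R" for c r
      using that by (simp add: Q.scalar_eq Q.star_const)
  qed
  have "Q.scalar = const_fls" using Q.scalar_eq by (intro ext)
  then show ?thesis using graded_alg_isomorphic_trans[OF 1 2] unfolding R by simp
qed

end
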